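(* Let $d\in\{1,2,3\}$ and assume $\gamma(cx)=c^{-\alpha}\gamma(x)$ for all $x\in\mathbb{R}^d$, $c>0$, where either $0<\alpha<2\wedge d$ or $\alpha=d=1$. Let $u(t,x)=\sum_{n=0}^\infty S_n(g_n(\cdot,t,x))$ be the Stratonovich solution of $\partial_t^2u=\Delta u+\dot W(x)u$, $u(0,x)=1$, $\partial_tu(0,x)=0$. Then for any real number $p>1$, any $t>0$ and any $f\in\mathcal H$ with $f(\cdot)\ge0$, $$\|u(t,0)\|_p\ \ge\ \exp\Big\{-\frac1{2(p-1)}\|f\|_{\mathcal H}^2\Big\}\sum_{n=0}^\infty\big\langle f^{\otimes n},g_n(\cdot,t,0)\big\rangle_{\mathcal H^{\otimes n}},$$ where $\|X\|_p=(\mathbb{E}|X|^p)^{1/p}$.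
   Context: Noise. $\dot W$ is a mean-zero, possibly generalized, Gaussian field on $\mathbb{R}^d$ on $(\Omega,\mathcal F,\mathbb P)$ with covariance $\gamma(x-y)$, where $\gamma\ge0$ is nonnegative definite (possibly a generalized function) with spectral measure $\mu$: $\gamma(x)=\int e^{i\xi\cdot x}\mu(d\xi)$. $p_\varepsilon(x)=(2\pi\varepsilon)^{-d/2}e^{-|x|^2/(2\varepsilon)}$, $\dot W_\varepsilon(x)=\int\dot W(y)p_\varepsilon(y-x)dy$. $G(t,x)$ is the wave kernel: $\frac12 1_{\{|x|\le t\}}$ ($d=1$); $\frac1{2\pi}\frac{1_{\{|x|\le t\}}}{\sqrt{t^2-|x|^2}}$ ($d=2$); the measure $\frac1{4\pi t}\sigma_t(dx)$, $\sigma_t$ surface measure on $\{|x|=t\}$ ($d=3$). With $s_0=0$, $x_0=x$, $$g_n(x_1,\dots,x_n,t,x)=\int_{0<s_1<\dots<s_n<t}\prod_{k=1}^nG(s_k-s_{k-1},x_k-x_{k-1})ds_1\cdots ds_n$$ (for $d=3$, $g_n\,dx_1\cdots dx_n$ is the corresponding measure), and $S_n(g_n(\cdot,t,x))$ is the $L^2(\Omega,\mathcal F,\mathbb P)$-limit as $\varepsilon\to0^+$ of $\int_{(\mathbb{R}^d)^n}g_n(x_1,\dots,x_n,t,x)\prod_{k=1}^n\dot W_\varepsilon(x_k)dx_1\cdots dx_n$; $S_0(g_0)=1$. The series defining $u(t,x)$ converges in $L^2$ (indeed in every $L^p$) under the assumptions. $\mathcal H$ is the Hilbert space obtained as the closure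 of $\{f:\mathbb{R}^d\to\mathbb{R}:\int\int\gamma(x-y)f(x)f(y)dxdy<\infty\}$ under $\langle f,g\rangle_{\mathcal H}=\int_{\mathbb{R}^d\times\mathbb{R}^d}\gamma(x-y)f(x)g(y)dxdy$ (it may contain generalized functions). $\mathcal H^{\otimes n}$ is its $n$-th tensor power, with $$\langle f,g\rangle_{\mathcal H^{\otimes n}}=\int_{(\mathbb{R}^d)^{2n}}\Big(\prod_{k=1}^n\gamma(x_k-y_k)\Big)f(x_1,\dots,x_n)g(y_1,\dots,y_n)\,d\mathbf x\,d\mathbf y,$$ $f^{\otimes n}(x_1,\dots,x_n)=\prod_kf(x_k)$, and the $n=0$ term of the sum equals $1$. *)

theory Defs
  imports "HOL-Probability.Probability"
begin

text \<open>The space \<open>\<real>\<^sup>d\<close> is a type \<open>'a :: euclidean_space\<close> with \<open>d = DIM('a)\<close>.\<close>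


section \<open>Test functions and the covariance\<close>

fun partials :: "'a list \<Rightarrow> ('a::euclidean_space \<Rightarrow> real) \<Rightarrow> 'a \<Rightarrow> real" where
  "partials [] \<phi> = \<phi>"
| "partials (b # bs) \<phi> = (\<lambda>x. frechet_derivative (partials bs \<phi>) (at x) b)"

definition schwartz :: "('a::euclidean_space \<Rightarrow> real) \<Rightarrow> bool" where
  "schwartz \<phi> \<longleftrightarrow> (\<forall>bs. set bs \<subseteq> Basis \<longrightarrow>
      (\<forall>x. partials bs \<phi> differentiable (at x)) \<and>
      (\<forall>k::nat. bounded (range (\<lambda>x. norm x ^ k * partials bs \<phi> x))))"

definition fourier :: "('a::euclidean_space \<Rightarrow> real) \<Rightarrow> 'a \<Rightarrow> complex" where
  "fourier \<phi> \<xi> = (LINT x|lborel. cis (\<xi> \<bullet> x) * complex_of_real (\<phi> x))"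

definition tempered_measure :: "'a::euclidean_space measure \<Rightarrow> bool" where
  "tempered_measure N \<longleftrightarrow> sets N = sets borel \<and>
     (\<exists>k::nat. (\<integral>\<^sup>+x. ennreal (inverse ((1 + norm x) ^ k)) \<partial>N) < \<infinity>)"

text \<open>A non-negative generalized function is a measure, so \<open>\<gamma> \<ge> 0\<close> is represented by the
  measure \<open>\<Gamma>(dx) = \<gamma>(x) dx\<close>. Substituting \<open>x = y + z\<close>, the double integral
  \<open>\<integral>\<integral> \<gamma>(x - y) f(x) g(y) dx dy\<close> is the following integral over \<open>\<Gamma>(dz) dy\<close>.\<close>

definition cov_form :: "'a::euclidean_space measure \<Rightarrow> ('a \<Rightarrow> real) \<Rightarrow> ('a \<Rightarrow> real) \<Rightarrow> real" where
  "cov_form \<Gamma> f g = (LINT (z, y)|(\<Gamma> \<Otimes>\<^sub>M lborel). f (y + z) * g y)"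

text \<open>The last clause is \<open>\<gamma>(x) = \<integral> e\<^sup>i\<^sup>\<xi>\<^sup>x \<mu>(d\<xi>)\<close>, tested against \<open>\<phi>\<close>.\<close>

definition covariance_measure :: "'a::euclidean_space measure \<Rightarrow> 'a measure \<Rightarrow> bool" where
  "covariance_measure \<Gamma> \<mu> \<longleftrightarrow>
     tempered_measure \<Gamma> \<and> tempered_measure \<mu> \<and>
     (\<forall>\<phi>. schwartz \<phi> \<longrightarrow> 0 \<le> cov_form \<Gamma> \<phi> \<phi>) \<and>
     (\<forall>\<phi>. schwartz \<phi> \<longrightarrow>
        complex_of_real (LINT x|\<Gamma>. \<phi> x) = (LINT \<xi>|\<mu>. fourier \<phi> \<xi>))"

text \<open>If \<open>\<Gamma>(dx) = \<gamma>(x) dx\<close> then \<open>dilate c \<Gamma>\<close> is the measure \<open>\<gamma>(c x) dx\<close>.\<close>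

definition dilate :: "real \<Rightarrow> 'a::euclidean_space measure \<Rightarrow> 'a measure" where
  "dilate c \<Gamma> = scale_measure (ennreal (c powr (- real DIM('a))))
                  (distr \<Gamma> borel (\<lambda>x. x /\<^sub>R c))"

definition homogeneous_covariance :: "real \<Rightarrow> 'a::euclidean_space measure \<Rightarrow> bool" where
  "homogeneous_covariance \<alpha> \<Gamma> \<longleftrightarrow>
     (\<forall>c>0. dilate c \<Gamma> = scale_measure (ennreal (c powr (- \<alpha>))) \<Gamma>)"


section \<open>The Gaussian noise\<close>

definition heat :: "real \<Rightarrow> 'a::euclidean_space \<Rightarrow> real" where
  "heat \<epsilon> x = (2 * pi * \<epsilon>) powr (- real DIM('a) / 2) * exp (- (norm x)\<^sup>2 / (2 * \<epsilon>))"

definition mollified :: "(('a::euclidean_space \<Rightarrow> real) \<Rightarrow> 'w \<Rightarrow> real) \<Rightarrow> real \<Rightarrow> 'a \<Rightarrow> 'w \<Rightarrow> real" where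
  "mollified W \<epsilon> x = W (\<lambda>y. heat \<epsilon> (y - x))"

text \<open>Possibly degenerate.\<close>

definition centered_normal :: "'w measure \<Rightarrow> ('w \<Rightarrow> real) \<Rightarrow> bool" where
  "centered_normal M X \<longleftrightarrow>
     (AE \<omega> in M. X \<omega> = 0) \<or> (\<exists>\<sigma>>0. distributed M lborel X (normal_density 0 \<sigma>))"

text \<open>A generalized Gaussian field is a family \<open>W \<phi> = \<integral> W(y) \<phi>(y) dy\<close> indexed by Schwartz
  functions. The last clause says that a jointly measurable version of the mollified field is
  used: as each \<open>W \<phi>\<close> is determined only almost surely, pathwise integrals of the mollified
  field in the space variable would otherwise be meaningless.\<close>

definition gaussian_noise ::
  "'w measure \<Rightarrow> 'a::euclidean_space measure \<Rightarrow> (('a \<Rightarrow> real) \<Rightarrow> 'w \<Rightarrow> real) \<Rightarrow> bool" where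
  "gaussian_noise M \<Gamma> W \<longleftrightarrow>
     prob_space M \<and>
     (\<forall>\<phi>. schwartz \<phi> \<longrightarrow> W \<phi> \<in> borel_measurable M) \<and>
     (\<forall>I a. finite I \<and> (\<forall>\<phi>\<in>I. schwartz \<phi>) \<longrightarrow>
        centered_normal M (\<lambda>\<omega>. \<Sum>\<phi>\<in>I. a \<phi> * W \<phi> \<omega>)) \<and>
     (\<forall>\<phi> \<psi>. schwartz \<phi> \<and> schwartz \<psi> \<longrightarrow>
        (LINT \<omega>|M. W \<phi> \<omega> * W \<psi> \<omega>) = cov_form \<Gamma> \<phi> \<psi>) \<and>
     (\<forall>\<epsilon>>0. (\<lambda>(x, \<omega>). mollified W \<epsilon> x \<omega>) \<in> borel_measurable (borel \<Otimes>\<^sub>M M))"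


section \<open>The wave kernel\<close>

text \<open>Surface measure on the sphere of radius \<open>t\<close>, in polar coordinates:
  \<open>\<sigma>\<^sub>t(A) = (d / t) \<cdot> |{x. 0 < |x| \<le> t \<and> t x / |x| \<in> A}|\<close>.\<close>

definition sphere_measure :: "real \<Rightarrow> 'a::euclidean_space measure" where
  "sphere_measure t =
     distr (density lborel (\<lambda>x. ennreal (real DIM('a) / t * indicator (cball 0 t) x)))
       borel (\<lambda>x. (t / norm x) *\<^sub>R x)"

text \<open>The measure \<open>G(t, dx)\<close>; only meant for \<open>d \<le> 3\<close>.\<close>

definition wave_kernel :: "real \<Rightarrow> 'a::euclidean_space measure" where
  "wave_kernel t =
     (if DIM('a) = 1 then
        density lborel (\<lambda>x. ennreal (1 / 2 * indicator {x. norm x \<le> t} x))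
      else if DIM('a) = 2 then
        density lborel (\<lambda>x. ennreal
          (1 / (2 * pi) * (indicator {x. norm x \<le> t} x / sqrt (t\<^sup>2 - (norm x)\<^sup>2))))
      else scale_measure (ennreal (1 / (4 * pi * t))) (sphere_measure t))"

abbreviation tuples :: "nat \<Rightarrow> (nat \<Rightarrow> 'a::euclidean_space) measure" where
  "tuples n \<equiv> \<Pi>\<^sub>M k\<in>{1..n}. borel"

text \<open>\<open>s(0 := 0)\<close> implements the convention \<open>s\<^sub>0 = 0\<close>.\<close>

definition time_simplex :: "nat \<Rightarrow> real \<Rightarrow> (nat \<Rightarrow> real) set" where
  "time_simplex n t = {s. \<forall>k\<in>{1..n}. (s(0 := 0)) (k - 1) < s k \<and> s k < t}"

definition time_step :: "(nat \<Rightarrow> real) \<Rightarrow> nat \<Rightarrow> real" where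
  "time_step s k = (s(0 := 0)) k - (s(0 := 0)) (k - 1)"

definition path_from :: "'a::euclidean_space \<Rightarrow> nat \<Rightarrow> (nat \<Rightarrow> 'a) \<Rightarrow> nat \<Rightarrow> 'a" where
  "path_from x n z = (\<lambda>k\<in>{1..n}. x + (\<Sum>i=1..k. z i))"

text \<open>The measure \<open>g\<^sub>n(x\<^sub>1, \<dots>, x\<^sub>n, t, x) dx\<^sub>1 \<dots> dx\<^sub>n\<close> in all three dimensions. For fixed times the
  increments \<open>z\<^sub>k = x\<^sub>k - x\<^sub>k\<^sub>-\<^sub>1\<close> carry the product of the measures
  \<open>G(s\<^sub>k - s\<^sub>k\<^sub>-\<^sub>1, dz\<^sub>k)\<close>, and \<open>path_from\<close> recovers the points \<open>x\<^sub>k\<close> from them.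
  For \<open>n = 0\<close> this is the unit mass on the empty tuple.\<close>

definition wave_g :: "nat \<Rightarrow> real \<Rightarrow> 'a::euclidean_space \<Rightarrow> (nat \<Rightarrow> 'a) measure" where
  "wave_g n t x = measure_of (space (tuples n)) (sets (tuples n))
     (\<lambda>A. \<integral>\<^sup>+s. indicator (time_simplex n t) s *
        emeasure (distr (\<Pi>\<^sub>M k\<in>{1..n}. wave_kernel (time_step s k)) (tuples n) (path_from x n)) A
      \<partial>(\<Pi>\<^sub>M k\<in>{1..n}. lborel))"


section \<open>The Stratonovich solution\<close>

definition square_integrable :: "'w measure \<Rightarrow> ('w \<Rightarrow> real) \<Rightarrow> bool" where
  "square_integrable M X \<longleftrightarrow> X \<in> borel_measurable M \<and> integrable M (\<lambda>\<omega>. (X \<omega>)\<^sup>2)"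

definition L2_limit :: "'w measure \<Rightarrow> ('i \<Rightarrow> 'w \<Rightarrow> real) \<Rightarrow> ('w \<Rightarrow> real) \<Rightarrow> 'i filter \<Rightarrow> bool" where
  "L2_limit M X Y F \<longleftrightarrow>
     (\<forall>\<^sub>F i in F. square_integrable M (X i)) \<and> square_integrable M Y \<and>
     ((\<lambda>i. LINT \<omega>|M. (X i \<omega> - Y \<omega>)\<^sup>2) \<longlongrightarrow> 0) F"

definition strat_approx ::
  "(('a::euclidean_space \<Rightarrow> real) \<Rightarrow> 'w \<Rightarrow> real) \<Rightarrow> nat \<Rightarrow> real \<Rightarrow> 'a \<Rightarrow> real \<Rightarrow> 'w \<Rightarrow> real" where
  "strat_approx W n t x \<epsilon> \<omega> = (LINT y|wave_g n t x. (\<Prod>k\<in>{1..n}. mollified W \<epsilon> (y k) \<omega>))"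

text \<open>\<open>u(t, x) = \<Sum>n. S\<^sub>n(g\<^sub>n(\<cdot>, t, x))\<close>. Being \<open>L\<^sup>2\<close>-limits, \<open>S n t x\<close> and \<open>u t x\<close> are
  determined almost surely; \<open>S 0 t x = 1\<close> because \<open>strat_approx W 0 t x \<epsilon>\<close> is identically 1.\<close>

definition stratonovich_solution ::
  "'w measure \<Rightarrow> (('a::euclidean_space \<Rightarrow> real) \<Rightarrow> 'w \<Rightarrow> real) \<Rightarrow> (real \<Rightarrow> 'a \<Rightarrow> 'w \<Rightarrow> real) \<Rightarrow> bool" where
  "stratonovich_solution M W u \<longleftrightarrow>
     (\<exists>S. \<forall>t\<ge>0. \<forall>x.
        (\<forall>n. L2_limit M (\<lambda>\<epsilon>. strat_approx W n t x \<epsilon>) (S n t x) (at_right 0)) \<and>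
        L2_limit M (\<lambda>N \<omega>. \<Sum>n<N. S n t x \<omega>) (u t x) sequentially)"

text \<open>\<open>\<parallel>X\<parallel>\<^sub>p = (E |X|\<^sup>p)\<^sup>1\<^sup>/\<^sup>p\<close>, with value \<open>\<infinity>\<close> if \<open>E |X|\<^sup>p = \<infinity>\<close>.\<close>

definition Lp_norm :: "'w measure \<Rightarrow> real \<Rightarrow> ('w \<Rightarrow> real) \<Rightarrow> ennreal" where
  "Lp_norm M p X = (let E = (\<integral>\<^sup>+\<omega>. ennreal (\<bar>X \<omega>\<bar> powr p) \<partial>M)
     in if E = \<infinity> then \<infinity> else ennreal (enn2real E powr (1 / p)))"


section \<open>The Hilbert space of the noise and its tensor powers\<close>

definition pre_H :: "'a::euclidean_space measure \<Rightarrow> ('a \<Rightarrow> real) set" where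
  "pre_H \<Gamma> = {f \<in> borel_measurable borel.
     integrable (\<Gamma> \<Otimes>\<^sub>M lborel) (\<lambda>(z, y). f (y + z) * f y)}"

definition pre_H_norm :: "'a::euclidean_space measure \<Rightarrow> ('a \<Rightarrow> real) \<Rightarrow> real" where
  "pre_H_norm \<Gamma> f = sqrt (cov_form \<Gamma> f f)"

text \<open>The Hilbert space is the completion of \<open>pre_H \<Gamma>\<close>: Cauchy sequences modulo null sequences.\<close>

definition H_cauchy :: "'a::euclidean_space measure \<Rightarrow> (nat \<Rightarrow> 'a \<Rightarrow> real) set" where
  "H_cauchy \<Gamma> = {F. (\<forall>j. F j \<in> pre_H \<Gamma>) \<and>
     (\<forall>e>0. \<exists>N. \<forall>i\<ge>N. \<forall>j\<ge>N. pre_H_norm \<Gamma> (\<lambda>x. F i x - F j x) < e)}"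

definition H_rel :: "'a::euclidean_space measure \<Rightarrow> (nat \<Rightarrow> 'a \<Rightarrow> real) rel" where
  "H_rel \<Gamma> = {(F, F'). F \<in> H_cauchy \<Gamma> \<and> F' \<in> H_cauchy \<Gamma> \<and>
     (\<lambda>j. pre_H_norm \<Gamma> (\<lambda>x. F j x - F' j x)) \<longlonglongrightarrow> 0}"

definition H_space :: "'a::euclidean_space measure \<Rightarrow> (nat \<Rightarrow> 'a \<Rightarrow> real) set set" where
  "H_space \<Gamma> = H_cauchy \<Gamma> // H_rel \<Gamma>"

text \<open>The continuous extension to the completion of a quantity \<open>q\<close> defined on \<open>pre_H \<Gamma>\<close>.\<close>

definition H_extend :: "(('a \<Rightarrow> real) \<Rightarrow> real) \<Rightarrow> (nat \<Rightarrow> 'a \<Rightarrow> real) set \<Rightarrow> real" where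
  "H_extend q f = (THE r. \<forall>F\<in>f. (\<lambda>j. q (F j)) \<longlonglongrightarrow> r)"

definition H_norm :: "'a::euclidean_space measure \<Rightarrow> (nat \<Rightarrow> 'a \<Rightarrow> real) set \<Rightarrow> real" where
  "H_norm \<Gamma> = H_extend (pre_H_norm \<Gamma>)"

text \<open>Elements of the completion may be generalized functions. Such an \<open>f\<close> is non-negative if it
  is the limit of non-negative functions (for instance of its mollifications).\<close>

definition H_nonneg :: "(nat \<Rightarrow> 'a \<Rightarrow> real) set \<Rightarrow> bool" where
  "H_nonneg f \<longleftrightarrow> (\<exists>F\<in>f. \<forall>j x. 0 \<le> F j x)"

definition tensor_power :: "nat \<Rightarrow> ('a \<Rightarrow> real) \<Rightarrow> (nat \<Rightarrow> 'a) \<Rightarrow> real" where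
  "tensor_power n f x = (\<Prod>k\<in>{1..n}. f (x k))"

text \<open>The inner product
  \<open>\<integral> (\<Prod>k. \<gamma>(x\<^sub>k - y\<^sub>k)) h(x\<^sub>1, \<dots>, x\<^sub>n) g(y\<^sub>1, \<dots>, y\<^sub>n) dx dy\<close> of the \<open>n\<close>-th tensor power, with
  \<open>g\<close> given as the measure \<open>\<nu>(dy) = g(y) dy\<close> and \<open>x\<^sub>k = y\<^sub>k + z\<^sub>k\<close> as in \<open>cov_form\<close>.\<close>

definition tensor_form ::
  "'a::euclidean_space measure \<Rightarrow> nat \<Rightarrow> ((nat \<Rightarrow> 'a) \<Rightarrow> real) \<Rightarrow> (nat \<Rightarrow> 'a) measure \<Rightarrow> real" where
  "tensor_form \<Gamma> n h \<nu> =
     (LINT (z, y)|((\<Pi>\<^sub>M k\<in>{1..n}. \<Gamma>) \<Otimes>\<^sub>M \<nu>). h (\<lambda>k\<in>{1..n}. y k + z k))"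

text \<open>\<open>\<langle>f\<^sup>\<otimes>\<^sup>n, \<nu>\<rangle>\<close> for \<open>f\<close> in the completion.\<close>

definition H_tensor_inner ::
  "'a::euclidean_space measure \<Rightarrow> nat \<Rightarrow> (nat \<Rightarrow> 'a \<Rightarrow> real) set \<Rightarrow> (nat \<Rightarrow> 'a) measure \<Rightarrow> real" where
  "H_tensor_inner \<Gamma> n f \<nu> = H_extend (\<lambda>h. tensor_form \<Gamma> n (tensor_power n h) \<nu>) f"

end

theory Submission
  imports Defs "HOL-Probability.Probability"
begin

text \<open>Let \<open>Y\<close> be the Gaussian variable \<open>W(f)\<close>, of variance \<open>\<parallel>f\<parallel>\<^sup>2\<close>. Hoelder's inequality applied to
  \<open>E [exp Y \<cdot> u]\<close>, together with \<open>E [exp (q Y)] = exp (q\<^sup>2 \<parallel>f\<parallel>\<^sup>2 / 2)\<close> for the conjugate exponent \<open>q\<close>, gives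
  \<open>\<parallel>u\<parallel>\<^sub>p \<ge> exp (- \<parallel>f\<parallel>\<^sup>2 / (2 (p - 1))) \<cdot> exp (- \<parallel>f\<parallel>\<^sup>2 / 2) \<cdot> E [exp Y \<cdot> u]\<close>.
  Under the tilt by \<open>exp Y\<close> the noise \<open>W(x)\<close> acquires the mean \<open>E [Y W(x)] = (\<gamma> * f)(x) \<ge> 0\<close>. By Wick's
  formula, in which every covariance is non-negative, the tilted mean of \<open>W(x\<^sub>1) \<cdots> W(x\<^sub>n)\<close> is at least
  the product of these means, and integration against \<open>g\<^sub>n\<close> yields \<open>\<langle>f\<^sup>\<otimes>\<^sup>n, g\<^sub>n\<rangle>\<close>.

  The pairing \<open>\<langle>f\<^sup>\<otimes>\<^sup>n, g\<^sub>n\<rangle>\<close> is continuous in \<open>f\<close> because, again by Wick's formula, the energy of \<open>g\<^sub>n\<close> is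
  at most \<open>E [S\<^sub>n\<^sup>2]\<close>. This allows \<open>f\<close> to be replaced by heat-smoothed truncations, for which \<open>W(f)\<close>
  is a pathwise integral of the mollified noise.\<close>

section \<open>Gaussian spaces and Wick's formula\<close>

text \<open>No change of measure is constructed. The tilt stays a weight, and Gaussianity enters
  only through the Laplace transform E [exp X] = exp (E [X^2] / 2) on a linear space of variables:
  differentiating it in a direction Z gives Gaussian integration by parts, and the identity survives
  L^2-limits.

  The noise acts on Schwartz functions only, so Y is a pathwise integral of the mollified noise
  against some g, formally \<open>W (smooth \<delta> g)\<close>. That such an integral is Gaussian
  has to be proved. Pairing it with the mollified noise smooths g once more, and the smoothed
  functions converge only almost everywhere and along subsequences. Two facts about g_n are
  therefore essential: its marginals charge no Lebesgue null set, and its energy is finite. The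
  latter is read off from the L^2-convergence that defines S_n.

  As all pairings are non-negative, it suffices to bound partial sums, and smoothing, truncation and
  completion are removed for a fixed number of terms. Summability comes from the exponent 2, because
  u is in L^2.\<close>

definition all_moments :: "'w measure \<Rightarrow> ('w \<Rightarrow> real) \<Rightarrow> bool" where
  "all_moments M f \<longleftrightarrow> f \<in> borel_measurable M \<and> (\<forall>k::nat. integrable M (\<lambda>\<omega>. \<bar>f \<omega>\<bar> ^ k))"

lemma all_moments_measurable: "all_moments M f \<Longrightarrow> f \<in> borel_measurable M"
  by (simp add: all_moments_def)

lemma all_moments_power: "all_moments M f \<Longrightarrow> integrable M (\<lambda>\<omega>. \<bar>f \<omega>\<bar> ^ k)"
  by (simp add: all_moments_def)

lemma all_moments_integrable: "all_moments M f \<Longrightarrow> integrable M f"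
  using integrable_abs_cancel[of M f] all_moments_power[of M f 1] by (simp add: all_moments_def)

lemma all_moments_square: "all_moments M f \<Longrightarrow> integrable M (\<lambda>\<omega>. (f \<omega>)\<^sup>2)"
  using all_moments_power[of M f 2] by simp

text \<open>Closure under products makes the integrability of every tilted product of Gaussian
  variables automatic. The bound is a b \<le> a^2 + b^2, applied to the k-th powers.\<close>

lemma all_moments_mult:
  assumes f: "all_moments M f" and g: "all_moments M g"
  shows "all_moments M (\<lambda>\<omega>. f \<omega> * g \<omega>)"
  unfolding all_moments_def
proof (intro conjI allI)
  note [measurable] = all_moments_measurable[OF f] all_moments_measurable[OF g]
  show "(\<lambda>\<omega>. f \<omega> * g \<omega>) \<in> borel_measurable M" by measurable
  fix k :: nat
  show "integrable M (\<lambda>\<omega>. \<bar>f \<omega> * g \<omega>\<bar> ^ k)"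
  proof (rule Bochner_Integration.integrable_bound)
    show "integrable M (\<lambda>\<omega>. \<bar>f \<omega>\<bar> ^ (2 * k) + \<bar>g \<omega>\<bar> ^ (2 * k))"
      using f g by (intro Bochner_Integration.integrable_add all_moments_power)
    have *: "a * b \<le> a\<^sup>2 + b\<^sup>2" if "0 \<le> a" "0 \<le> b" for a b :: real
      using sum_squares_bound[of a b] mult_nonneg_nonneg[OF that] by linarith
    have "\<bar>f \<omega> * g \<omega>\<bar> ^ k \<le> \<bar>f \<omega>\<bar> ^ (2 * k) + \<bar>g \<omega>\<bar> ^ (2 * k)" for \<omega>
      unfolding power_even_eq abs_mult power_mult_distrib by (rule *) auto
    then show "AE \<omega> in M. norm (\<bar>f \<omega> * g \<omega>\<bar> ^ k) \<le> norm (\<bar>f \<omega>\<bar> ^ (2 * k) + \<bar>g \<omega>\<bar> ^ (2 * k))"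
      by (intro always_eventually allI) simp
  qed measurable
qed

lemma all_moments_abs: "all_moments M f \<Longrightarrow> all_moments M (\<lambda>\<omega>. \<bar>f \<omega>\<bar>)"
  by (auto simp: all_moments_def)

lemma (in prob_space) all_moments_const: "all_moments M (\<lambda>_. c)"
  by (simp add: all_moments_def)

lemma (in prob_space) all_moments_prod:
  "finite I \<Longrightarrow> (\<And>i. i \<in> I \<Longrightarrow> all_moments M (f i)) \<Longrightarrow> all_moments M (\<lambda>\<omega>. \<Prod>i\<in>I. f i \<omega>)"
proof (induction I rule: finite_induct)
  case (insert i I)
  then have "all_moments M (\<lambda>\<omega>. f i \<omega> * (\<Prod>i\<in>I. f i \<omega>))" by (intro all_moments_mult[of M "f i"]) auto
  then show ?case using insert.hyps by simp
qed (simp add: all_moments_const)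

section \<open>Inequalities for integrals and for the exponential\<close>

lemma abs_integral_le_integral:
  fixes f g :: "'w \<Rightarrow> real"
  assumes "integrable M f" "integrable M g" "\<And>x. x \<in> space M \<Longrightarrow> \<bar>f x\<bar> \<le> g x"
  shows "\<bar>LINT x|M. f x\<bar> \<le> (LINT x|M. g x)"
proof -
  have "\<bar>LINT x|M. f x\<bar> \<le> (LINT x|M. \<bar>f x\<bar>)" by (rule integral_abs_bound)
  also have "\<dots> \<le> (LINT x|M. g x)" using assms by (intro integral_mono) auto
  finally show ?thesis .
qed

lemma integrable_mult_square:
  fixes f g :: "'w \<Rightarrow> real"
  assumes [measurable]: "f \<in> borel_measurable M" "g \<in> borel_measurable M"
    and "integrable M (\<lambda>\<omega>. (f \<omega>)\<^sup>2)" "integrable M (\<lambda>\<omega>. (g \<omega>)\<^sup>2)"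
  shows "integrable M (\<lambda>\<omega>. f \<omega> * g \<omega>)"
proof (rule Bochner_Integration.integrable_bound)
  show "integrable M (\<lambda>\<omega>. (f \<omega>)\<^sup>2 + (g \<omega>)\<^sup>2)" using assms by simp
  have "\<bar>f \<omega> * g \<omega>\<bar> \<le> (f \<omega>)\<^sup>2 + (g \<omega>)\<^sup>2" for \<omega>
  proof -
    have "2 * \<bar>f \<omega> * g \<omega>\<bar> \<le> (f \<omega>)\<^sup>2 + (g \<omega>)\<^sup>2"
      using sum_squares_bound[of "\<bar>f \<omega>\<bar>" "\<bar>g \<omega>\<bar>"] by (simp add: abs_mult)
    then show ?thesis using abs_ge_zero[of "f \<omega> * g \<omega>"] by linarith
  qed
  then show "AE \<omega> in M. norm (f \<omega> * g \<omega>) \<le> norm ((f \<omega>)\<^sup>2 + (g \<omega>)\<^sup>2)"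
    by (intro always_eventually allI) simp
qed measurable

lemma Cauchy_Schwarz_integral:
  fixes f g :: "'w \<Rightarrow> real"
  assumes [measurable]: "f \<in> borel_measurable M" "g \<in> borel_measurable M"
    and f: "integrable M (\<lambda>\<omega>. (f \<omega>)\<^sup>2)" and g: "integrable M (\<lambda>\<omega>. (g \<omega>)\<^sup>2)"
  shows "\<bar>LINT \<omega>|M. f \<omega> * g \<omega>\<bar> \<le> sqrt (LINT \<omega>|M. (f \<omega>)\<^sup>2) * sqrt (LINT \<omega>|M. (g \<omega>)\<^sup>2)"
proof -
  note fg = integrable_mult_square[OF assms]
  define A B C where "A = (LINT \<omega>|M. (f \<omega>)\<^sup>2)" and "B = (LINT \<omega>|M. f \<omega> * g \<omega>)" and "C = (LINT \<omega>|M. (g \<omega>)\<^sup>2)"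
  \<comment> \<open>Two parameters, because normalising by A is impossible in the degenerate case A
    = 0.\<close>
  have q: "0 \<le> s\<^sup>2 * A + 2 * s * t * B + t\<^sup>2 * C" for s t
  proof -
    have "0 \<le> (LINT \<omega>|M. (s * f \<omega> + t * g \<omega>)\<^sup>2)" by simp
    also have "\<dots> = (LINT \<omega>|M. s\<^sup>2 * (f \<omega>)\<^sup>2 + 2 * s * t * (f \<omega> * g \<omega>) + t\<^sup>2 * (g \<omega>)\<^sup>2)"
      by (intro Bochner_Integration.integral_cong) (auto simp: power2_eq_square algebra_simps)
    also have "\<dots> = s\<^sup>2 * A + 2 * s * t * B + t\<^sup>2 * C"
      using f g fg by (simp add: A_def B_def C_def)
    finally show ?thesis .
  qed
  have A: "A \<ge> 0" and C: "C \<ge> 0" by (auto simp: A_def C_def)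
  have "B\<^sup>2 \<le> A * C"
  proof (cases "A = 0")
    case True
    have "B = 0"
    proof (rule ccontr)
      assume "B \<noteq> 0"
      \<comment> \<open>This choice of \<open>s\<close>, with t = 1, would give the form the value -
        (C + 1) + C = -1.\<close>
      moreover have "0 \<le> 2 * (- (C + 1) / (2 * B)) * B + C" using q[of "- (C + 1) / (2 * B)" 1] True by simp
      ultimately have "0 \<le> - (C + 1) + C" by (simp add: field_simps)
      then show False by simp
    qed
    then show ?thesis using True by simp
  next
    case False
    then have "A > 0" using A by simp
    \<comment> \<open>The minimising direction s = - B, t = A, at which the form equals A (A C -
      B^2).\<close>
    have "0 \<le> A * (A * C - B\<^sup>2)" using q[of "-B" A] by (simp add: power2_eq_square algebra_simps)
    then show ?thesis using \<open>A > 0\<close> by (simp add: zero_le_mult_iff)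
  qed
  then have "\<bar>B\<bar> \<le> sqrt (A * C)" by (rule real_le_rsqrt[of "\<bar>B\<bar>", simplified])
  then show ?thesis by (simp add: real_sqrt_mult A_def B_def C_def)
qed

lemma exp_minus_one_abs_le: "\<bar>exp x - 1\<bar> \<le> \<bar>x\<bar> * exp \<bar>x\<bar>" for x :: real
proof (cases "x \<ge> 0")
  case True
  have "1 - x \<le> exp (- x)" using exp_ge_add_one_self[of "-x"] by simp
  then have "(1 - x) * exp x \<le> exp (- x) * exp x" by (intro mult_right_mono) auto
  then show ?thesis using True by (simp add: exp_minus algebra_simps)
next
  case False
  have "1 - exp x \<le> - x" using exp_ge_add_one_self[of x] by linarith
  moreover have "- x * 1 \<le> - x * exp (- x)" using False by (intro mult_left_mono) auto
  ultimately have "1 - exp x \<le> - x * exp (- x)" by linarith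
  moreover have "\<bar>exp x - 1\<bar> = 1 - exp x" "\<bar>x\<bar> = - x" using False by auto
  ultimately show ?thesis by simp
qed

text \<open>A Taylor remainder whose factor \<open>exp \<bar>x\<bar>\<close> is integrable for
  Gaussian \<open>x\<close>; it justifies differentiation under the expectation.\<close>

lemma exp_second_order_le: "\<bar>exp x - 1 - x\<bar> \<le> x\<^sup>2 * exp \<bar>x\<bar>" for x :: real
proof -
  have "(1 - x) * exp x \<le> exp (- x) * exp x"
    using exp_ge_add_one_self[of "-x"] by (intro mult_right_mono) auto
  then have "exp x - 1 - x \<le> x * (exp x - 1)" by (simp add: exp_minus algebra_simps)
  also have "\<dots> \<le> \<bar>x\<bar> * \<bar>exp x - 1\<bar>" by (metis abs_ge_self abs_mult)
  also have "\<dots> \<le> \<bar>x\<bar> * (\<bar>x\<bar> * exp \<bar>x\<bar>)" by (intro mult_left_mono exp_minus_one_abs_le) auto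
  also have "\<dots> = x\<^sup>2 * exp \<bar>x\<bar>" by (simp add: power2_eq_square)
  finally have *: "exp x - 1 - x \<le> x\<^sup>2 * exp \<bar>x\<bar>" .
  have "0 \<le> exp x - 1 - x" using exp_ge_add_one_self[of x] by linarith
  then have "\<bar>exp x - 1 - x\<bar> = exp x - 1 - x" by simp
  then show ?thesis using * by simp
qed

text \<open>Applied to all multiples of X, the last axiom says that X is centred normal, possibly
  with variance zero. In contrast to a condition on densities, it has no separate degenerate case
  and is stable under L^2-limits.\<close>

locale gaussian_space = prob_space M for M :: "'w measure" +
  fixes V :: "('w \<Rightarrow> real) set"
  assumes measurable_V: "X \<in> V \<Longrightarrow> X \<in> borel_measurable M"
    and add_V: "X \<in> V \<Longrightarrow> Y \<in> V \<Longrightarrow> (\<lambda>\<omega>. X \<omega> + Y \<omega>) \<in> V"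
    and scale_V: "X \<in> V \<Longrightarrow> (\<lambda>\<omega>. c * X \<omega>) \<in> V"
    and integrable_square_V: "X \<in> V \<Longrightarrow> integrable M (\<lambda>\<omega>. (X \<omega>)\<^sup>2)"
    and integrable_exp_V: "X \<in> V \<Longrightarrow> integrable M (\<lambda>\<omega>. exp (X \<omega>))"
    and expectation_exp_V:
      "X \<in> V \<Longrightarrow> expectation (\<lambda>\<omega>. exp (X \<omega>)) = exp (expectation (\<lambda>\<omega>. (X \<omega>)\<^sup>2) / 2)"
begin

abbreviation cov :: "('w \<Rightarrow> real) \<Rightarrow> ('w \<Rightarrow> real) \<Rightarrow> real" where
  "cov X Y \<equiv> expectation (\<lambda>\<omega>. X \<omega> * Y \<omega>)"

text \<open>The k-th power is at most exp (k X) + exp (- k X), and both multiples of X lie in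
  \<open>V\<close>. As this variable dominates X and exp X, it supplies their moments as
  well.\<close>

lemma all_moments_exp_abs:
  assumes "X \<in> V" shows "all_moments M (\<lambda>\<omega>. exp \<bar>X \<omega>\<bar>)"
  unfolding all_moments_def
proof (intro conjI allI)
  note [measurable] = measurable_V[OF assms]
  show "(\<lambda>\<omega>. exp \<bar>X \<omega>\<bar>) \<in> borel_measurable M" by measurable
  fix k :: nat
  show "integrable M (\<lambda>\<omega>. \<bar>exp \<bar>X \<omega>\<bar>\<bar> ^ k)"
  proof (rule Bochner_Integration.integrable_bound)
    show "integrable M (\<lambda>\<omega>. exp (real k * X \<omega>) + exp (- real k * X \<omega>))"
      by (intro Bochner_Integration.integrable_add integrable_exp_V scale_V assms)
    show "AE \<omega> in M. norm (\<bar>exp \<bar>X \<omega>\<bar>\<bar> ^ k) \<le> norm (exp (real k * X \<omega>) + exp (- real k * X \<omega>))"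
    proof (intro always_eventually allI)
      fix \<omega>
      have "\<bar>exp \<bar>X \<omega>\<bar>\<bar> ^ k = exp (real k * \<bar>X \<omega>\<bar>)" by (simp add: exp_of_nat_mult)
      also have "\<dots> \<le> exp (real k * X \<omega>) + exp (- real k * X \<omega>)" by (cases "X \<omega> \<ge> 0") auto
      also have "\<dots> \<le> norm \<dots>" by simp
      finally show "norm (\<bar>exp \<bar>X \<omega>\<bar>\<bar> ^ k) \<le> norm (exp (real k * X \<omega>) + exp (- real k * X \<omega>))" by simp
    qed
  qed measurable
qed

lemma all_moments_bound:
  assumes "all_moments M g" "f \<in> borel_measurable M" "\<And>\<omega>. \<bar>f \<omega>\<bar> \<le> \<bar>g \<omega>\<bar>"
  shows "all_moments M f"
  unfolding all_moments_def
proof (intro conjI allI)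
  note [measurable] = assms(2)
  show "f \<in> borel_measurable M" by fact
  show "integrable M (\<lambda>\<omega>. \<bar>f \<omega>\<bar> ^ k)" for k
    by (rule Bochner_Integration.integrable_bound[OF all_moments_power[OF assms(1)]])
       (auto intro!: always_eventually power_mono assms(3))
qed

lemma all_moments_exp: "X \<in> V \<Longrightarrow> all_moments M (\<lambda>\<omega>. exp (X \<omega>))"
  by (rule all_moments_bound[OF all_moments_exp_abs[of X]]) (auto dest: measurable_V)

lemma all_moments_V: "X \<in> V \<Longrightarrow> all_moments M X"
proof (rule all_moments_bound[OF all_moments_exp_abs[of X]])
  show "\<bar>X \<omega>\<bar> \<le> \<bar>exp \<bar>X \<omega>\<bar>\<bar>" for \<omega> using exp_ge_add_one_self[of "\<bar>X \<omega>\<bar>"] by linarith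
qed (auto dest: measurable_V)

lemma all_moments_prod_V: "finite I \<Longrightarrow> (\<And>i. i \<in> I \<Longrightarrow> X i \<in> V) \<Longrightarrow> all_moments M (\<lambda>\<omega>. \<Prod>i\<in>I. X i \<omega>)"
  by (intro all_moments_prod all_moments_V)

text \<open>Moving the tilt in the direction Z and differentiating at 0 brings down a factor Z. This
  is how integration by parts passes from a product to one with an additional factor.\<close>

lemma has_derivative_exp_shift:
  assumes Y: "Y \<in> V" and Z: "Z \<in> V" and P: "all_moments M P"
  shows "((\<lambda>a. expectation (\<lambda>\<omega>. exp (Y \<omega> + a * Z \<omega>) * P \<omega>)) has_real_derivative
    expectation (\<lambda>\<omega>. exp (Y \<omega>) * (Z \<omega> * P \<omega>))) (at 0)"
proof -
  define F where "F a = expectation (\<lambda>\<omega>. exp (Y \<omega> + a * Z \<omega>) * P \<omega>)" for a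
  define D where "D = expectation (\<lambda>\<omega>. exp (Y \<omega>) * (Z \<omega> * P \<omega>))"
  define C where "C = expectation (\<lambda>\<omega>. \<bar>exp (Y \<omega>) * P \<omega>\<bar> * (Z \<omega> * Z \<omega> * exp \<bar>Z \<omega>\<bar>))"
  have iF: "integrable M (\<lambda>\<omega>. exp (Y \<omega> + a * Z \<omega>) * P \<omega>)" for a
    by (intro all_moments_integrable all_moments_mult all_moments_exp add_V scale_V Y Z P)
  have iD: "integrable M (\<lambda>\<omega>. exp (Y \<omega>) * (Z \<omega> * P \<omega>))"
    by (intro all_moments_integrable all_moments_mult all_moments_exp all_moments_V Y Z P)
  have iC: "integrable M (\<lambda>\<omega>. \<bar>exp (Y \<omega>) * P \<omega>\<bar> * (Z \<omega> * Z \<omega> * exp \<bar>Z \<omega>\<bar>))"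
    by (intro all_moments_integrable all_moments_mult all_moments_abs all_moments_exp all_moments_exp_abs all_moments_V Y Z P)
  \<comment> \<open>The restriction on \<open>a\<close> replaces exp \<bar>a Z\<bar> by exp
    \<bar>Z\<bar>, so that \<open>C\<close> does not depend on \<open>a\<close>.\<close>
  have bound: "\<bar>F a - F 0 - a * D\<bar> \<le> a\<^sup>2 * C" if "\<bar>a\<bar> \<le> 1" for a
  proof -
    have "F a - F 0 - a * D = expectation (\<lambda>\<omega>. exp (Y \<omega> + a * Z \<omega>) * P \<omega> - exp (Y \<omega> + 0 * Z \<omega>) * P \<omega> - a * (exp (Y \<omega>) * (Z \<omega> * P \<omega>)))"
      using iF[of a] iF[of 0] iD by (simp add: F_def D_def)
    also have "\<dots> = expectation (\<lambda>\<omega>. exp (Y \<omega>) * P \<omega> * (exp (a * Z \<omega>) - 1 - a * Z \<omega>))"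
      by (intro Bochner_Integration.integral_cong) (auto simp: exp_add algebra_simps)
    also have "\<bar>\<dots>\<bar> \<le> expectation (\<lambda>\<omega>. a\<^sup>2 * (\<bar>exp (Y \<omega>) * P \<omega>\<bar> * (Z \<omega> * Z \<omega> * exp \<bar>Z \<omega>\<bar>)))"
    proof (rule abs_integral_le_integral)
      have "integrable M (\<lambda>\<omega>. exp (Y \<omega> + a * Z \<omega>) * P \<omega> - exp (Y \<omega> + 0 * Z \<omega>) * P \<omega> - a * (exp (Y \<omega>) * (Z \<omega> * P \<omega>)))"
        using iF[of a] iF[of 0] iD by (intro Bochner_Integration.integrable_diff Bochner_Integration.integrable_mult_right) auto
      then show "integrable M (\<lambda>\<omega>. exp (Y \<omega>) * P \<omega> * (exp (a * Z \<omega>) - 1 - a * Z \<omega>))"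
        by (rule Bochner_Integration.integrable_cong[THEN iffD1, rotated -1]) (auto simp: exp_add algebra_simps)
      show "integrable M (\<lambda>\<omega>. a\<^sup>2 * (\<bar>exp (Y \<omega>) * P \<omega>\<bar> * (Z \<omega> * Z \<omega> * exp \<bar>Z \<omega>\<bar>)))"
        using iC by simp
      fix \<omega>
      have "\<bar>exp (a * Z \<omega>) - 1 - a * Z \<omega>\<bar> \<le> (a * Z \<omega>)\<^sup>2 * exp \<bar>a * Z \<omega>\<bar>" by (rule exp_second_order_le)
      also have "\<dots> \<le> (a * Z \<omega>)\<^sup>2 * exp \<bar>Z \<omega>\<bar>"
        using that by (intro mult_left_mono) (auto simp: abs_mult intro: mult_left_le_one_le)
      finally have "\<bar>exp (a * Z \<omega>) - 1 - a * Z \<omega>\<bar> \<le> a\<^sup>2 * (Z \<omega> * Z \<omega> * exp \<bar>Z \<omega>\<bar>)"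
        by (simp add: power2_eq_square mult_ac)
      then have "\<bar>exp (Y \<omega>) * P \<omega>\<bar> * \<bar>exp (a * Z \<omega>) - 1 - a * Z \<omega>\<bar> \<le> \<bar>exp (Y \<omega>) * P \<omega>\<bar> * (a\<^sup>2 * (Z \<omega> * Z \<omega> * exp \<bar>Z \<omega>\<bar>))"
        by (intro mult_left_mono) auto
      then show "\<bar>exp (Y \<omega>) * P \<omega> * (exp (a * Z \<omega>) - 1 - a * Z \<omega>)\<bar> \<le> a\<^sup>2 * (\<bar>exp (Y \<omega>) * P \<omega>\<bar> * (Z \<omega> * Z \<omega> * exp \<bar>Z \<omega>\<bar>))"
        by (simp add: abs_mult mult_ac)
    qed
    also have "\<dots> = a\<^sup>2 * C" using iC by (simp add: C_def)
    finally show ?thesis .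
  qed
  have "((\<lambda>a. (F a - F 0) / (a - 0)) \<longlongrightarrow> D) (at 0)"
  proof (rule Lim_transform_bound[where g = "\<lambda>a. C * a + 0" for F, THEN LIM_zero_cancel])
    have "\<forall>\<^sub>F a in at 0. a \<noteq> 0 \<and> \<bar>a\<bar> \<le> (1::real)"
      by (auto simp: eventually_at intro!: exI[of _ 1])
    then show "\<forall>\<^sub>F a in at 0. norm ((F a - F 0) / (a - 0) - D) \<le> norm (C * a + 0)"
    proof (rule eventually_mono)
      fix a :: real assume a: "a \<noteq> 0 \<and> \<bar>a\<bar> \<le> 1"
      have "\<bar>(F a - F 0) / a - D\<bar> = \<bar>F a - F 0 - a * D\<bar> / \<bar>a\<bar>"
      proof -
        have "F a - F 0 - a * D = a * ((F a - F 0) / a - D)" using a by (simp add: field_simps)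
        then show ?thesis using a by (simp only: abs_mult) simp
      qed
      also have "\<dots> \<le> (a\<^sup>2 * C) / \<bar>a\<bar>" using bound[of a] a by (intro divide_right_mono) auto
      also have "\<dots> = \<bar>a\<bar> * C" using a by (simp add: power2_eq_square abs_if)
      also have "\<dots> \<le> \<bar>C * a\<bar>" by (simp add: abs_mult mult.commute mult_right_mono)
      finally show "norm ((F a - F 0) / (a - 0) - D) \<le> norm (C * a + 0)" by simp
    qed
    have "((\<lambda>a. C * a + 0) \<longlongrightarrow> C * 0 + 0) (at 0)" by (intro tendsto_intros)
    then show "((\<lambda>a. C * a + 0) \<longlongrightarrow> 0) (at 0)" by simp
  qed
  then show ?thesis unfolding has_field_derivative_iff F_def D_def .
qed

lemma cov_add_left: "X \<in> V \<Longrightarrow> Y \<in> V \<Longrightarrow> Z \<in> V \<Longrightarrow> cov (\<lambda>\<omega>. X \<omega> + a * Y \<omega>) Z = cov X Z + a * cov Y Z"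
proof -
  assume "X \<in> V" "Y \<in> V" "Z \<in> V"
  then have "integrable M (\<lambda>\<omega>. X \<omega> * Z \<omega>)" "integrable M (\<lambda>\<omega>. Y \<omega> * Z \<omega>)"
    by (auto intro: all_moments_integrable[OF all_moments_mult[OF all_moments_V all_moments_V]])
  then show ?thesis by (simp add: algebra_simps)
qed

lemma cov_commute: "cov X Y = cov Y X"
  by (simp add: mult.commute)

text \<open>Wick's formula under the exponential tilt by \<open>Y\<close>: the induction differentiates
  the formula for fewer factors in the direction \<open>Z\<close>.\<close>

lemma gaussian_integration_by_parts:
  assumes "finite I" "\<And>i. i \<in> I \<Longrightarrow> X i \<in> V" "Y \<in> V" "Z \<in> V"
  shows "expectation (\<lambda>\<omega>. exp (Y \<omega>) * (Z \<omega> * (\<Prod>i\<in>I. X i \<omega>))) =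
    cov Y Z * expectation (\<lambda>\<omega>. exp (Y \<omega>) * (\<Prod>i\<in>I. X i \<omega>)) +
    (\<Sum>j\<in>I. cov Z (X j) * expectation (\<lambda>\<omega>. exp (Y \<omega>) * (\<Prod>i\<in>I-{j}. X i \<omega>)))"
  using assms
proof (induction "card I" arbitrary: I Y Z rule: less_induct)
  case less
  define E where "E I Y = expectation (\<lambda>\<omega>. exp (Y \<omega>) * (\<Prod>i\<in>I. X i \<omega>))" for I Y
  define EZ where "EZ Z I Y = expectation (\<lambda>\<omega>. exp (Y \<omega>) * (Z \<omega> * (\<Prod>i\<in>I. X i \<omega>)))" for I Y Z
  have IH: "EZ Z J Y = cov Y Z * E J Y + (\<Sum>j\<in>J. cov Z (X j) * E (J - {j}) Y)"
    if "J \<subset> I" "Y \<in> V" "Z \<in> V" for J Y Z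
    unfolding EZ_def E_def using that less.prems
    by (intro less.hyps psubset_card_mono) (auto intro: finite_subset)
  have deriv: "((\<lambda>a. E J (\<lambda>\<omega>. Y \<omega> + a * Z \<omega>)) has_real_derivative EZ Z J Y) (at 0)" if "J \<subseteq> I" for J
    unfolding E_def EZ_def using less.prems that
    by (intro has_derivative_exp_shift all_moments_prod_V) (auto intro: finite_subset)
  have "EZ Z I Y = cov Y Z * E I Y + (\<Sum>j\<in>I. cov Z (X j) * E (I - {j}) Y)"
  proof (cases "I = {}")
    case True
    \<comment> \<open>Without factors the expectation is the Laplace transform of Y + a Z, whose
      exponent is an explicit quadratic in \<open>a\<close>.\<close>
    have "((\<lambda>a. E {} (\<lambda>\<omega>. Y \<omega> + a * Z \<omega>)) has_real_derivative cov Y Z * E {} Y) (at 0)"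
    proof -
      have *: "E {} (\<lambda>\<omega>. Y \<omega> + a * Z \<omega>) = exp ((cov Y Y + 2 * a * cov Y Z + a * a * cov Z Z) / 2)" for a
      proof -
        have "E {} (\<lambda>\<omega>. Y \<omega> + a * Z \<omega>) = exp (expectation (\<lambda>\<omega>. (Y \<omega> + a * Z \<omega>)\<^sup>2) / 2)"
          unfolding E_def using expectation_exp_V[OF add_V[OF less.prems(3) scale_V[OF less.prems(4)]]] by simp
        also have "expectation (\<lambda>\<omega>. (Y \<omega> + a * Z \<omega>)\<^sup>2) = expectation (\<lambda>\<omega>. Y \<omega> * Y \<omega> + 2 * a * (Y \<omega> * Z \<omega>) + a * a * (Z \<omega> * Z \<omega>))"
          by (intro Bochner_Integration.integral_cong) (auto simp: power2_eq_square algebra_simps)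
        also have "\<dots> = cov Y Y + 2 * a * cov Y Z + a * a * cov Z Z"
          using less.prems
          by (subst Bochner_Integration.integral_add Bochner_Integration.integral_mult_right_zero |
              intro Bochner_Integration.integrable_add Bochner_Integration.integrable_mult_right all_moments_integrable all_moments_mult all_moments_V less.prems)+ auto
        finally show ?thesis .
      qed
      have "E {} Y = exp (cov Y Y / 2)" using *[of 0] by simp
      then show ?thesis unfolding * by (auto intro!: derivative_eq_intros)
    qed
    then have "EZ Z {} Y = cov Y Z * E {} Y" using deriv[of "{}"] by (intro DERIV_unique) auto
    then show ?thesis using True by simp
  next
    case False
    then obtain i where i: "i \<in> I" by blast
    define J where "J = I - {i}"
    have I: "I = insert i J" "i \<notin> J" "J \<subset> I" and J: "finite J" using i less.prems by (auto simp: J_def)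
    have X: "X i \<in> V" "\<And>j. j \<in> J \<Longrightarrow> X j \<in> V" using less.prems I by auto
    have Einsert: "E (insert i K) U = EZ (X i) K U" if "K \<subseteq> J" for K U
    proof -
      have "i \<notin> K" "finite K" using that I J finite_subset by auto
      then show ?thesis by (simp add: E_def EZ_def)
    qed
    \<comment> \<open>With X i singled out, the induction hypothesis for \<open>J\<close> expands E
      I at every tilt Y + a Z. Both sides can then be differentiated at a = 0, and the derivative of
      the left one is the expectation sought.\<close>
    have "E I (\<lambda>\<omega>. Y \<omega> + a * Z \<omega>) = (cov Y (X i) + a * cov Z (X i)) * E J (\<lambda>\<omega>. Y \<omega> + a * Z \<omega>)
        + (\<Sum>j\<in>J. cov (X i) (X j) * E (J - {j}) (\<lambda>\<omega>. Y \<omega> + a * Z \<omega>))" for a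
    proof -
      have "E I (\<lambda>\<omega>. Y \<omega> + a * Z \<omega>) = EZ (X i) J (\<lambda>\<omega>. Y \<omega> + a * Z \<omega>)" using Einsert[of J] I by simp
      also have "\<dots> = cov (\<lambda>\<omega>. Y \<omega> + a * Z \<omega>) (X i) * E J (\<lambda>\<omega>. Y \<omega> + a * Z \<omega>)
        + (\<Sum>j\<in>J. cov (X i) (X j) * E (J - {j}) (\<lambda>\<omega>. Y \<omega> + a * Z \<omega>))"
        using I X less.prems by (intro IH add_V scale_V) auto
      finally show ?thesis using X less.prems by (simp only: cov_add_left)
    qed
    then have "((\<lambda>a. E I (\<lambda>\<omega>. Y \<omega> + a * Z \<omega>)) has_real_derivative
       (cov Z (X i) * E J Y + cov Y (X i) * EZ Z J Y + (\<Sum>j\<in>J. cov (X i) (X j) * EZ Z (J - {j}) Y))) (at 0)"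
      using I by (auto intro!: derivative_eq_intros deriv sum.cong)
    then have "EZ Z I Y = cov Z (X i) * E J Y + cov Y (X i) * EZ Z J Y + (\<Sum>j\<in>J. cov (X i) (X j) * EZ Z (J - {j}) Y)"
      using deriv[of I] by (intro DERIV_unique) auto
    also have "EZ Z J Y = cov Y Z * E J Y + (\<Sum>l\<in>J. cov Z (X l) * E (J - {l}) Y)"
      using I less.prems by (intro IH) auto
    also have "(\<Sum>j\<in>J. cov (X i) (X j) * EZ Z (J - {j}) Y) =
       (\<Sum>j\<in>J. cov (X i) (X j) * (cov Y Z * E (J - {j}) Y + (\<Sum>l\<in>J-{j}. cov Z (X l) * E (J - {j} - {l}) Y)))"
      using I less.prems by (intro sum.cong refl arg_cong2[where f="(*)"] IH) auto
    also have "\<dots> = cov Y Z * (\<Sum>j\<in>J. cov (X i) (X j) * E (J - {j}) Y) +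
       (\<Sum>j\<in>J. \<Sum>l\<in>J-{j}. cov (X i) (X j) * cov Z (X l) * E (J - {j} - {l}) Y)"
      by (simp add: algebra_simps sum.distrib sum_distrib_left)
    \<comment> \<open>The ordered pairs of distinct indices are summed in the other order, so that
      the partner \<open>l\<close> of Z becomes the outer index.\<close>
    also have "(\<Sum>j\<in>J. \<Sum>l\<in>J-{j}. cov (X i) (X j) * cov Z (X l) * E (J - {j} - {l}) Y) =
       (\<Sum>l\<in>J. \<Sum>j\<in>J-{l}. cov (X i) (X j) * cov Z (X l) * E (J - {j} - {l}) Y)"
    proof -
      have "(\<Sum>j\<in>J. \<Sum>l | l \<in> J \<and> l \<noteq> j. cov (X i) (X j) * cov Z (X l) * E (J - {j} - {l}) Y) =
        (\<Sum>l\<in>J. \<Sum>j | j \<in> J \<and> l \<noteq> j. cov (X i) (X j) * cov Z (X l) * E (J - {j} - {l}) Y)"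
        using J by (intro sum.swap_restrict) auto
      moreover have "{l \<in> J. l \<noteq> j} = J - {j}" "{l \<in> J. j \<noteq> l} = J - {j}" for j by auto
      ultimately show ?thesis by simp
    qed
    \<comment> \<open>Grouped by the partner of Z: the factor X i, the tilt Y, or some X l. The
      inner brackets are the expansions \<open>2\<close> and \<open>3\<close> of E I and E (I -
      {l}).\<close>
    finally have 1: "EZ Z I Y = cov Z (X i) * E J Y
       + cov Y Z * (cov Y (X i) * E J Y + (\<Sum>j\<in>J. cov (X i) (X j) * E (J - {j}) Y))
       + (\<Sum>l\<in>J. cov Z (X l) * (cov Y (X i) * E (J - {l}) Y + (\<Sum>j\<in>J-{l}. cov (X i) (X j) * E (J - {j} - {l}) Y)))"
      by (simp add: algebra_simps sum.distrib sum_distrib_left)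
    have 2: "E I Y = cov Y (X i) * E J Y + (\<Sum>j\<in>J. cov (X i) (X j) * E (J - {j}) Y)"
      using IH[of J Y "X i"] X less.prems I Einsert[of J Y] by simp
    have 3: "E (I - {l}) Y = cov Y (X i) * E (J - {l}) Y + (\<Sum>j\<in>J-{l}. cov (X i) (X j) * E (J - {j} - {l}) Y)" if "l \<in> J" for l
    proof -
      have "I - {l} = insert i (J - {l})" using I that by auto
      then have "E (I - {l}) Y = EZ (X i) (J - {l}) Y" using Einsert[of "J - {l}" Y] by auto
      also have "\<dots> = cov Y (X i) * E (J - {l}) Y + (\<Sum>j\<in>J-{l}. cov (X i) (X j) * E (J - {l} - {j}) Y)"
        using X less.prems I by (intro IH) auto
      finally show ?thesis by (simp add: Diff_insert2[symmetric] insert_commute)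
    qed
    have "(\<Sum>j\<in>I. cov Z (X j) * E (I - {j}) Y) = cov Z (X i) * E J Y + (\<Sum>l\<in>J. cov Z (X l) * E (I - {l}) Y)"
      using I J by (simp add: J_def[symmetric])
    then show ?thesis using 1 2 3 by simp
  qed
  then show ?case unfolding EZ_def E_def .
qed

text \<open>Integration by parts on one factor leaves covariances times shorter products, so the
  sign propagates by induction on the number of factors.\<close>

lemma expectation_exp_prod_nonneg:
  assumes "finite I" "\<And>i. i \<in> I \<Longrightarrow> X i \<in> V" "Y \<in> V"
    and "\<And>i. i \<in> I \<Longrightarrow> 0 \<le> cov Y (X i)" "\<And>i j. i \<in> I \<Longrightarrow> j \<in> I \<Longrightarrow> 0 \<le> cov (X i) (X j)"
  shows "0 \<le> expectation (\<lambda>\<omega>. exp (Y \<omega>) * (\<Prod>i\<in>I. X i \<omega>))"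
  using assms
proof (induction "card I" arbitrary: I rule: less_induct)
  case less
  show ?case
  proof (cases "I = {}")
    case False
    then obtain i where i: "i \<in> I" by blast
    define J where "J = I - {i}"
    have I: "I = insert i J" "i \<notin> J" "J \<subset> I" and J: "finite J" using i less.prems by (auto simp: J_def)
    have IH: "0 \<le> expectation (\<lambda>\<omega>. exp (Y \<omega>) * (\<Prod>i\<in>K. X i \<omega>))" if "K \<subseteq> J" for K
    proof (intro less.hyps psubset_card_mono)
      show "finite K" using that J finite_subset by blast
      show "K \<subset> I" "finite I" using that I less.prems(1) by auto
      have K: "K \<subseteq> I" using that I by auto
      show "0 \<le> cov (X i) (X j)" if "i \<in> K" "j \<in> K" for i j by (rule less.prems(5)) (use that K in auto)
      show "0 \<le> cov Y (X i)" if "i \<in> K" for i by (rule less.prems(4)) (use that K in auto)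
      show "X i \<in> V" if "i \<in> K" for i by (rule less.prems(2)) (use that K in auto)
    qed (rule less.prems)
    have "expectation (\<lambda>\<omega>. exp (Y \<omega>) * (\<Prod>i\<in>I. X i \<omega>)) = expectation (\<lambda>\<omega>. exp (Y \<omega>) * (X i \<omega> * (\<Prod>i\<in>J. X i \<omega>)))"
      using I J by simp
    also have "\<dots> = cov Y (X i) * expectation (\<lambda>\<omega>. exp (Y \<omega>) * (\<Prod>i\<in>J. X i \<omega>)) +
      (\<Sum>j\<in>J. cov (X i) (X j) * expectation (\<lambda>\<omega>. exp (Y \<omega>) * (\<Prod>i\<in>J-{j}. X i \<omega>)))"
      using I J less.prems by (intro gaussian_integration_by_parts) auto
    finally show ?thesis using I J less.prems
      by (simp only:) (intro add_nonneg_nonneg sum_nonneg mult_nonneg_nonneg IH; auto)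
  qed simp
qed

text \<open>Of all pairings only the one joining every factor to the tilt Y is kept; the others
  contribute non-negative terms.\<close>

lemma expectation_exp_prod_ge:
  assumes "finite I" "\<And>i. i \<in> I \<Longrightarrow> X i \<in> V" "Y \<in> V"
    and "\<And>i. i \<in> I \<Longrightarrow> 0 \<le> cov Y (X i)" "\<And>i j. i \<in> I \<Longrightarrow> j \<in> I \<Longrightarrow> 0 \<le> cov (X i) (X j)"
  shows "exp (cov Y Y / 2) * (\<Prod>i\<in>I. cov Y (X i)) \<le> expectation (\<lambda>\<omega>. exp (Y \<omega>) * (\<Prod>i\<in>I. X i \<omega>))"
  using assms
proof (induction I rule: finite_induct)
  case empty
  then show ?case using expectation_exp_V[of Y] by (simp add: power2_eq_square)
next
  case (insert i J)
  have "exp (cov Y Y / 2) * (\<Prod>i\<in>insert i J. cov Y (X i)) = cov Y (X i) * (exp (cov Y Y / 2) * (\<Prod>i\<in>J. cov Y (X i)))"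
    using insert.hyps by simp
  also have "\<dots> \<le> cov Y (X i) * expectation (\<lambda>\<omega>. exp (Y \<omega>) * (\<Prod>i\<in>J. X i \<omega>))"
    by (intro mult_left_mono insert.IH insert.prems) (auto intro: insert.prems(1,2,4))
  also have "\<dots> \<le> cov Y (X i) * expectation (\<lambda>\<omega>. exp (Y \<omega>) * (\<Prod>i\<in>J. X i \<omega>)) +
      (\<Sum>j\<in>J. cov (X i) (X j) * expectation (\<lambda>\<omega>. exp (Y \<omega>) * (\<Prod>i\<in>J-{j}. X i \<omega>)))"
    unfolding le_add_same_cancel1 using insert.hyps
    by (intro sum_nonneg mult_nonneg_nonneg expectation_exp_prod_nonneg insert.prems) auto
  also have "\<dots> = expectation (\<lambda>\<omega>. exp (Y \<omega>) * (X i \<omega> * (\<Prod>i\<in>J. X i \<omega>)))"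
    using insert.hyps by (intro gaussian_integration_by_parts[symmetric] insert.prems) auto
  also have "\<dots> = expectation (\<lambda>\<omega>. exp (Y \<omega>) * (\<Prod>i\<in>insert i J. X i \<omega>))"
    using insert.hyps by simp
  finally show ?case .
qed

text \<open>Wick's formula with zero tilt, of which only the pairing of each X i with its own Y i is
  kept. It later compares the energy of a measure on tuples with a second moment.\<close>

lemma expectation_prod_pairs_ge:
  assumes "finite I" "\<And>i. i \<in> I \<Longrightarrow> X i \<in> V" "\<And>i. i \<in> I \<Longrightarrow> Y i \<in> V"
    and "\<And>i j. i \<in> I \<Longrightarrow> j \<in> I \<Longrightarrow> 0 \<le> cov (X i) (X j)" "\<And>i j. i \<in> I \<Longrightarrow> j \<in> I \<Longrightarrow> 0 \<le> cov (X i) (Y j)"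
     "\<And>i j. i \<in> I \<Longrightarrow> j \<in> I \<Longrightarrow> 0 \<le> cov (Y i) (Y j)"
  shows "(\<Prod>i\<in>I. cov (X i) (Y i)) \<le> expectation (\<lambda>\<omega>. (\<Prod>i\<in>I. X i \<omega>) * (\<Prod>i\<in>I. Y i \<omega>))"
  using assms
proof (induction I rule: finite_induct)
  case empty
  then show ?case by (simp add: prob_space)
next
  case (insert i J)
  \<comment> \<open>Both families become one, so that integration by parts applies to all variables
    together. The index (i, True) takes the role of Z and is absent from \<open>L\<close>.\<close>
  define U where "U = (\<lambda>(j, b). if b then X j else Y j)"
  define K where "K = J \<times> (UNIV :: bool set)"
  define L where "L = insert (i, False) K"
  have K: "finite K" "(i, False) \<notin> K" and L: "finite L" using insert.hyps by (auto simp: K_def L_def)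
  have UV: "U k \<in> V" if "k \<in> insert (i, True) L" for k
    using that insert.prems by (auto simp: U_def L_def K_def)
  have Uc: "0 \<le> cov (U k) (U l)" if "k \<in> insert (i, True) L" "l \<in> insert (i, True) L" for k l
    using that insert.prems(3-5) cov_commute[of "Y _" "X _"] by (auto simp: U_def L_def K_def)
  have 0: "(\<lambda>_. 0) \<in> V" using scale_V[of "X i" 0] insert.prems by simp
  have prodK: "(\<Prod>k\<in>K. U k \<omega>) = (\<Prod>j\<in>J. X j \<omega>) * (\<Prod>j\<in>J. Y j \<omega>)" for \<omega>
  proof -
    have "(\<Prod>k\<in>K. U k \<omega>) = (\<Prod>j\<in>J. \<Prod>b\<in>UNIV. U (j, b) \<omega>)"
      unfolding K_def by (subst prod.cartesian_product) (auto intro!: prod.cong)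
    then show ?thesis by (simp add: UNIV_bool U_def prod.distrib mult.commute)
  qed
  have "(\<Prod>i\<in>insert i J. cov (X i) (Y i)) = cov (X i) (Y i) * (\<Prod>i\<in>J. cov (X i) (Y i))"
    using insert.hyps by simp
  also have "\<dots> \<le> cov (X i) (Y i) * expectation (\<lambda>\<omega>. (\<Prod>i\<in>J. X i \<omega>) * (\<Prod>i\<in>J. Y i \<omega>))"
    by (intro mult_left_mono insert.IH insert.prems) auto
  also have "\<dots> = cov (U (i, True)) (U (i, False)) * expectation (\<lambda>\<omega>. exp 0 * (\<Prod>k\<in>L - {(i, False)}. U k \<omega>))"
    using K prodK by (simp add: L_def U_def)
  \<comment> \<open>The left side is the single summand j = (i, False).\<close>
  also have "\<dots> \<le> (\<Sum>j\<in>L. cov (U (i, True)) (U j) * expectation (\<lambda>\<omega>. exp 0 * (\<Prod>k\<in>L - {j}. U k \<omega>)))"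
    using L by (intro member_le_sum mult_nonneg_nonneg expectation_exp_prod_nonneg Uc UV 0 allI ballI)
      (auto simp: L_def)
  also have "\<dots> = expectation (\<lambda>\<omega>. exp 0 * (U (i, True) \<omega> * (\<Prod>k\<in>L. U k \<omega>)))"
    using L UV 0 by (subst gaussian_integration_by_parts[where Y = "\<lambda>_. 0"]) auto
  also have "\<dots> = expectation (\<lambda>\<omega>. (\<Prod>i\<in>insert i J. X i \<omega>) * (\<Prod>i\<in>insert i J. Y i \<omega>))"
    using K insert.hyps prodK by (simp add: L_def) (simp add: U_def mult_ac)
  finally show ?case .
qed

end

section \<open>Closure of Gaussian spaces and the exponential tilt\<close>

lemma abs_exp_diff_le: "\<bar>exp a - exp b\<bar> \<le> \<bar>a - b\<bar> * (exp a + exp b)" for a b :: real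
proof -
  have *: "exp x - exp y \<le> (x - y) * (exp x + exp y)" if "y \<le> x" for x y :: real
  proof -
    have "1 + (y - x) \<le> exp (y - x)" by (rule exp_ge_add_one_self)
    then have "(1 + (y - x)) * exp x \<le> exp (y - x) * exp x" by (intro mult_right_mono) auto
    then have "exp x - exp y \<le> (x - y) * exp x" by (simp add: exp_diff algebra_simps)
    also have "\<dots> \<le> (x - y) * (exp x + exp y)" using that by (intro mult_left_mono) auto
    finally show ?thesis .
  qed
  show ?thesis
  proof (cases "b \<le> a")
    case True
    then have "\<bar>exp a - exp b\<bar> = exp a - exp b" "\<bar>a - b\<bar> = a - b" by auto
    then show ?thesis using *[OF True] by simp
  next
    case False
    then have "\<bar>exp a - exp b\<bar> = exp b - exp a" "\<bar>a - b\<bar> = b - a" by auto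
    then show ?thesis using *[of a b] False by (simp add: add.commute)
  qed
qed

definition L2_closure :: "'w measure \<Rightarrow> ('w \<Rightarrow> real) set \<Rightarrow> ('w \<Rightarrow> real) set" where
  "L2_closure M V = {X. square_integrable M X \<and> (\<forall>e>0. \<exists>Y\<in>V. (LINT \<omega>|M. (X \<omega> - Y \<omega>)\<^sup>2) < e)}"

lemma square_integrable_add:
  assumes "square_integrable M X" "square_integrable M Y"
  shows "square_integrable M (\<lambda>\<omega>. X \<omega> + Y \<omega>)"
proof -
  have [measurable]: "X \<in> borel_measurable M" "Y \<in> borel_measurable M"
    using assms by (auto simp: square_integrable_def)
  have "integrable M (\<lambda>\<omega>. (X \<omega>)\<^sup>2 + 2 * (X \<omega> * Y \<omega>) + (Y \<omega>)\<^sup>2)"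
    using assms by (intro Bochner_Integration.integrable_add Bochner_Integration.integrable_mult_right integrable_mult_square)
      (auto simp: square_integrable_def)
  moreover have "(\<lambda>\<omega>. (X \<omega>)\<^sup>2 + 2 * (X \<omega> * Y \<omega>) + (Y \<omega>)\<^sup>2) = (\<lambda>\<omega>. (X \<omega> + Y \<omega>)\<^sup>2)"
    by (auto simp: power2_eq_square algebra_simps)
  ultimately show ?thesis by (simp add: square_integrable_def)
qed

lemma square_integrable_scale:
  "square_integrable M X \<Longrightarrow> square_integrable M (\<lambda>\<omega>. c * X \<omega>)"
  by (auto simp: square_integrable_def power_mult_distrib)

lemma square_integrable_diff:
  "square_integrable M X \<Longrightarrow> square_integrable M Y \<Longrightarrow> square_integrable M (\<lambda>\<omega>. X \<omega> - Y \<omega>)"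
  using square_integrable_add[of M X "\<lambda>\<omega>. (-1) * Y \<omega>"] square_integrable_scale[of M Y "-1"] by simp

lemma square_integrable_mult:
  "square_integrable M X \<Longrightarrow> square_integrable M Y \<Longrightarrow> integrable M (\<lambda>\<omega>. X \<omega> * Y \<omega>)"
  by (simp add: square_integrable_def integrable_mult_square)

lemma Cauchy_Schwarz_square_integrable:
  "square_integrable M X \<Longrightarrow> square_integrable M Y \<Longrightarrow>
    \<bar>LINT \<omega>|M. X \<omega> * Y \<omega>\<bar> \<le> sqrt (LINT \<omega>|M. (X \<omega>)\<^sup>2) * sqrt (LINT \<omega>|M. (Y \<omega>)\<^sup>2)"
  by (simp add: square_integrable_def Cauchy_Schwarz_integral)

lemma integral_square_add_le:
  assumes "square_integrable M X" "square_integrable M Y"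
  shows "(LINT \<omega>|M. (X \<omega> + Y \<omega>)\<^sup>2) \<le> 2 * (LINT \<omega>|M. (X \<omega>)\<^sup>2) + 2 * (LINT \<omega>|M. (Y \<omega>)\<^sup>2)"
proof -
  have "(LINT \<omega>|M. (X \<omega> + Y \<omega>)\<^sup>2) \<le> (LINT \<omega>|M. 2 * (X \<omega>)\<^sup>2 + 2 * (Y \<omega>)\<^sup>2)"
  proof (rule integral_mono)
    show "(X \<omega> + Y \<omega>)\<^sup>2 \<le> 2 * (X \<omega>)\<^sup>2 + 2 * (Y \<omega>)\<^sup>2" for \<omega>
      using sum_squares_bound[of "X \<omega>" "Y \<omega>"] by (simp add: power2_sum)
  qed (use assms square_integrable_add[OF assms] in \<open>auto simp: square_integrable_def\<close>)
  also have "\<dots> = 2 * (LINT \<omega>|M. (X \<omega>)\<^sup>2) + 2 * (LINT \<omega>|M. (Y \<omega>)\<^sup>2)"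
    using assms by (simp add: square_integrable_def)
  finally show ?thesis .
qed

lemma expectation_mult_tendsto:
  assumes Z: "square_integrable M Z" and X: "L2_limit M X Y F"
  shows "((\<lambda>i. LINT \<omega>|M. Z \<omega> * X i \<omega>) \<longlongrightarrow> (LINT \<omega>|M. Z \<omega> * Y \<omega>)) F"
proof (rule LIM_zero_cancel, rule Lim_null_comparison)
  have "((\<lambda>i. LINT \<omega>|M. (X i \<omega> - Y \<omega>)\<^sup>2) \<longlongrightarrow> 0) F" using X by (simp add: L2_limit_def)
  from tendsto_mult[OF tendsto_const[of "sqrt (LINT \<omega>|M. (Z \<omega>)\<^sup>2)"] tendsto_real_sqrt[OF this]]
  show "((\<lambda>i. sqrt (LINT \<omega>|M. (Z \<omega>)\<^sup>2) * sqrt (LINT \<omega>|M. (X i \<omega> - Y \<omega>)\<^sup>2)) \<longlongrightarrow> 0) F" by simp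
  have Y: "square_integrable M Y" and "\<forall>\<^sub>F i in F. square_integrable M (X i)" using X by (auto simp: L2_limit_def)
  from this(2) show "\<forall>\<^sub>F i in F. norm ((LINT \<omega>|M. Z \<omega> * X i \<omega>) - (LINT \<omega>|M. Z \<omega> * Y \<omega>)) \<le>
    sqrt (LINT \<omega>|M. (Z \<omega>)\<^sup>2) * sqrt (LINT \<omega>|M. (X i \<omega> - Y \<omega>)\<^sup>2)"
  proof eventually_elim
    case (elim i)
    have "(LINT \<omega>|M. Z \<omega> * X i \<omega>) - (LINT \<omega>|M. Z \<omega> * Y \<omega>) = (LINT \<omega>|M. Z \<omega> * (X i \<omega> - Y \<omega>))"
      using square_integrable_mult[OF Z elim] square_integrable_mult[OF Z Y] by (simp add: right_diff_distrib)
    then show ?case using Cauchy_Schwarz_square_integrable[OF Z square_integrable_diff[OF elim Y]] by simp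
  qed
qed

lemma integral_square_tendsto:
  assumes X: "square_integrable M X" and Y: "\<And>n. square_integrable M (Y n)"
    and lim: "(\<lambda>n::nat. LINT \<omega>|M. (X \<omega> - Y n \<omega>)\<^sup>2) \<longlonglongrightarrow> 0"
  shows "(\<lambda>n. LINT \<omega>|M. (Y n \<omega>)\<^sup>2) \<longlonglongrightarrow> (LINT \<omega>|M. (X \<omega>)\<^sup>2)"
proof -
  define d where "d n = (LINT \<omega>|M. (X \<omega> - Y n \<omega>)\<^sup>2)" for n
  define c where "c n = (LINT \<omega>|M. X \<omega> * (X \<omega> - Y n \<omega>))" for n
  have "(LINT \<omega>|M. (Y n \<omega>)\<^sup>2) = (LINT \<omega>|M. (X \<omega>)\<^sup>2) - 2 * c n + d n" for n
  proof -
    note D = square_integrable_diff[OF X Y[of n]]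
    have "(LINT \<omega>|M. (Y n \<omega>)\<^sup>2) = (LINT \<omega>|M. (X \<omega>)\<^sup>2 - 2 * (X \<omega> * (X \<omega> - Y n \<omega>)) + (X \<omega> - Y n \<omega>)\<^sup>2)"
      by (intro Bochner_Integration.integral_cong) (auto simp: power2_eq_square algebra_simps)
    also have "\<dots> = (LINT \<omega>|M. (X \<omega>)\<^sup>2) - 2 * c n + d n"
      using X D square_integrable_mult[OF X D] unfolding c_def d_def square_integrable_def
      by (subst Bochner_Integration.integral_add Bochner_Integration.integral_diff; (intro Bochner_Integration.integrable_diff Bochner_Integration.integrable_mult_right)?; simp)+
    finally show ?thesis .
  qed
  moreover have "c \<longlonglongrightarrow> 0"
  proof (rule Lim_null_comparison)
    show "\<forall>\<^sub>F n in sequentially. norm (c n) \<le> sqrt (LINT \<omega>|M. (X \<omega>)\<^sup>2) * sqrt (d n)"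
      using Cauchy_Schwarz_square_integrable[OF X square_integrable_diff[OF X Y]] by (simp add: c_def d_def)
    have "(\<lambda>n. sqrt (LINT \<omega>|M. (X \<omega>)\<^sup>2) * sqrt (d n)) \<longlonglongrightarrow> sqrt (LINT \<omega>|M. (X \<omega>)\<^sup>2) * sqrt 0"
      using lim unfolding d_def by (intro tendsto_intros)
    then show "(\<lambda>n. sqrt (LINT \<omega>|M. (X \<omega>)\<^sup>2) * sqrt (d n)) \<longlonglongrightarrow> 0" by simp
  qed
  ultimately show ?thesis
    using lim tendsto_add[OF tendsto_diff[OF tendsto_const[of "LINT \<omega>|M. (X \<omega>)\<^sup>2"] tendsto_mult[OF tendsto_const[of 2] \<open>c \<longlonglongrightarrow> 0\<close>]], of d 0]
    unfolding d_def[abs_def] by simp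
qed

lemma (in gaussian_space) square_integrable_V: "X \<in> V \<Longrightarrow> square_integrable M X"
  by (simp add: square_integrable_def measurable_V integrable_square_V)

lemma (in gaussian_space) square_integrable_exp_V:
  assumes "X \<in> V" shows "square_integrable M (\<lambda>\<omega>. exp (X \<omega>))"
  unfolding square_integrable_def
  using all_moments_exp[OF assms] all_moments_measurable all_moments_square by blast

lemma (in gaussian_space) expectation_exp_scale:
  assumes "X \<in> V" shows "expectation (\<lambda>\<omega>. exp (c * X \<omega>)) = exp (c\<^sup>2 * expectation (\<lambda>\<omega>. (X \<omega>)\<^sup>2) / 2)"
  using expectation_exp_V[OF scale_V[OF assms, of c]] by (simp add: power_mult_distrib)

text \<open>The variances of Y n converge, hence E [exp (2 Y n)] is bounded, and Fatou's lemma along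
  an almost surely convergent subsequence puts exp X into L^2. Then \<open>abs_exp_diff_le\<close>
  and Cauchy-Schwarz turn the L^2-convergence of Y n into convergence of the Laplace
  transforms.\<close>

lemma (in gaussian_space) exp_L2_limit:
  assumes X: "square_integrable M X" and Y: "\<And>n. Y n \<in> V"
    and lim: "(\<lambda>n::nat. expectation (\<lambda>\<omega>. (X \<omega> - Y n \<omega>)\<^sup>2)) \<longlonglongrightarrow> 0"
  shows "integrable M (\<lambda>\<omega>. exp (X \<omega>)) \<and> expectation (\<lambda>\<omega>. exp (X \<omega>)) = exp (expectation (\<lambda>\<omega>. (X \<omega>)\<^sup>2) / 2)"
proof -
  have [measurable]: "X \<in> borel_measurable M" "\<And>n. Y n \<in> borel_measurable M"
    using X Y measurable_V by (auto simp: square_integrable_def)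
  have Ysq: "square_integrable M (Y n)" for n by (rule square_integrable_V[OF Y])
  have lim2: "(\<lambda>n. expectation (\<lambda>\<omega>. (Y n \<omega>)\<^sup>2)) \<longlonglongrightarrow> expectation (\<lambda>\<omega>. (X \<omega>)\<^sup>2)"
    by (rule integral_square_tendsto[OF X Ysq lim])
  then obtain K where K: "\<And>n. expectation (\<lambda>\<omega>. (Y n \<omega>)\<^sup>2) \<le> K"
    using convergent_imp_Bseq[OF convergentI[OF lim2]] unfolding Bseq_def by (metis abs_le_D1 real_norm_def)
  obtain r where r: "strict_mono r" and AE: "AE \<omega> in M. (\<lambda>n. (X \<omega> - Y (r n) \<omega>)\<^sup>2) \<longlonglongrightarrow> 0"
  proof -
    have "(\<lambda>n. expectation (\<lambda>\<omega>. norm ((X \<omega> - Y n \<omega>)\<^sup>2))) \<longlonglongrightarrow> 0" using lim by simp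
    then show ?thesis
      using tendsto_L1_AE_subseq[of M "\<lambda>n \<omega>. (X \<omega> - Y n \<omega>)\<^sup>2"] that square_integrable_diff[OF X Ysq]
      by (auto simp: square_integrable_def)
  qed
  have AE': "AE \<omega> in M. (\<lambda>n. ennreal (exp (2 * Y (r n) \<omega>))) \<longlonglongrightarrow> ennreal (exp (2 * X \<omega>))"
    using AE
  proof eventually_elim
    case (elim \<omega>)
    have "(\<lambda>n. X \<omega> - Y (r n) \<omega>) \<longlonglongrightarrow> 0"
      using elim by simp
    then have "(\<lambda>n. X \<omega> - (X \<omega> - Y (r n) \<omega>)) \<longlonglongrightarrow> X \<omega> - 0" by (intro tendsto_intros)
    then show ?case by (intro tendsto_intros) simp
  qed
  have "AE \<omega> in M. ennreal (exp (2 * X \<omega>)) = liminf (\<lambda>n. ennreal (exp (2 * Y (r n) \<omega>)))"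
    using AE' by eventually_elim (rule lim_imp_Liminf[symmetric], simp_all)
  then have "(\<integral>\<^sup>+\<omega>. ennreal (exp (2 * X \<omega>)) \<partial>M) = (\<integral>\<^sup>+\<omega>. liminf (\<lambda>n. ennreal (exp (2 * Y (r n) \<omega>))) \<partial>M)"
    by (rule nn_integral_cong_AE)
  also have "\<dots> \<le> liminf (\<lambda>n. \<integral>\<^sup>+\<omega>. ennreal (exp (2 * Y (r n) \<omega>)) \<partial>M)"
    by (intro nn_integral_liminf) auto
  also have "\<dots> \<le> ennreal (exp (2 * K))"
  proof (rule Liminf_le)
    have "(\<integral>\<^sup>+\<omega>. ennreal (exp (2 * Y n \<omega>)) \<partial>M) \<le> ennreal (exp (2 * K))" for n
    proof -
      have "(\<integral>\<^sup>+\<omega>. ennreal (exp (2 * Y n \<omega>)) \<partial>M) = ennreal (expectation (\<lambda>\<omega>. exp (2 * Y n \<omega>)))"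
        by (intro nn_integral_eq_integral integrable_exp_V scale_V Y) auto
      then show ?thesis using K[of n] by (simp add: expectation_exp_scale[OF Y])
    qed
    then show "\<forall>\<^sub>F n in sequentially. (\<integral>\<^sup>+\<omega>. ennreal (exp (2 * Y (r n) \<omega>)) \<partial>M) \<le> ennreal (exp (2 * K))"
      by simp
  qed simp
  finally have fin: "(\<integral>\<^sup>+\<omega>. ennreal (exp (2 * X \<omega>)) \<partial>M) \<le> ennreal (exp (2 * K))" .
  have sqX: "square_integrable M (\<lambda>\<omega>. exp (X \<omega>))"
  proof -
    have "integrable M (\<lambda>\<omega>. exp (2 * X \<omega>))"
      using fin by (intro integrableI_nonneg) (auto simp: less_top[symmetric] top_unique)
    then show ?thesis by (simp add: square_integrable_def exp_double)
  qed
  have int: "integrable M (\<lambda>\<omega>. exp (X \<omega>))" using sqX by (auto simp: square_integrable_def intro: square_integrable_imp_integrable)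
  have "(\<lambda>n. expectation (\<lambda>\<omega>. exp (Y n \<omega>)) - expectation (\<lambda>\<omega>. exp (X \<omega>))) \<longlonglongrightarrow> 0"
  proof (rule Lim_null_comparison)
    define B where "B = 2 * exp (2 * K) + 2 * expectation (\<lambda>\<omega>. (exp (X \<omega>))\<^sup>2)"
    show "\<forall>\<^sub>F n in sequentially. norm (expectation (\<lambda>\<omega>. exp (Y n \<omega>)) - expectation (\<lambda>\<omega>. exp (X \<omega>)))
       \<le> sqrt (expectation (\<lambda>\<omega>. (X \<omega> - Y n \<omega>)\<^sup>2)) * sqrt B"
    proof (intro always_eventually allI)
      fix n
      note sqY = square_integrable_exp_V[OF Y[of n]]
      note D = square_integrable_diff[OF X Ysq[of n]] and S = square_integrable_add[OF sqY sqX]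
      have D': "square_integrable M (\<lambda>\<omega>. \<bar>X \<omega> - Y n \<omega>\<bar>)" using D by (simp add: square_integrable_def)
      have "\<bar>expectation (\<lambda>\<omega>. exp (Y n \<omega>)) - expectation (\<lambda>\<omega>. exp (X \<omega>))\<bar> = \<bar>expectation (\<lambda>\<omega>. exp (Y n \<omega>) - exp (X \<omega>))\<bar>"
        using int integrable_exp_V[OF Y[of n]] by simp
      also have "\<dots> \<le> expectation (\<lambda>\<omega>. \<bar>X \<omega> - Y n \<omega>\<bar> * (exp (Y n \<omega>) + exp (X \<omega>)))"
      proof (rule abs_integral_le_integral)
        show "integrable M (\<lambda>\<omega>. \<bar>X \<omega> - Y n \<omega>\<bar> * (exp (Y n \<omega>) + exp (X \<omega>)))"
          by (rule square_integrable_mult[OF D' S])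
        show "\<bar>exp (Y n \<omega>) - exp (X \<omega>)\<bar> \<le> \<bar>X \<omega> - Y n \<omega>\<bar> * (exp (Y n \<omega>) + exp (X \<omega>))" for \<omega>
          using abs_exp_diff_le[of "Y n \<omega>" "X \<omega>"] by (simp add: abs_minus_commute)
      qed (use int integrable_exp_V[OF Y[of n]] in auto)
      also have "\<dots> \<le> sqrt (expectation (\<lambda>\<omega>. \<bar>X \<omega> - Y n \<omega>\<bar>\<^sup>2)) * sqrt (expectation (\<lambda>\<omega>. (exp (Y n \<omega>) + exp (X \<omega>))\<^sup>2))"
        using Cauchy_Schwarz_square_integrable[OF D' S] by linarith
      also have "\<dots> \<le> sqrt (expectation (\<lambda>\<omega>. (X \<omega> - Y n \<omega>)\<^sup>2)) * sqrt B"
      proof -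
        have "expectation (\<lambda>\<omega>. (exp (Y n \<omega>) + exp (X \<omega>))\<^sup>2) \<le> B"
        proof -
          have "expectation (\<lambda>\<omega>. (exp (Y n \<omega>))\<^sup>2) = exp (2 * expectation (\<lambda>\<omega>. (Y n \<omega>)\<^sup>2))"
            using expectation_exp_scale[OF Y[of n], of 2] by (simp add: exp_double)
          also have "\<dots> \<le> exp (2 * K)" using K[of n] by simp
          finally show ?thesis using integral_square_add_le[OF sqY sqX] by (simp add: B_def)
        qed
        then show ?thesis by (intro mult_mono) auto
      qed
      finally show "norm (expectation (\<lambda>\<omega>. exp (Y n \<omega>)) - expectation (\<lambda>\<omega>. exp (X \<omega>)))
       \<le> sqrt (expectation (\<lambda>\<omega>. (X \<omega> - Y n \<omega>)\<^sup>2)) * sqrt B" by simp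
    qed
    have "(\<lambda>n. sqrt (expectation (\<lambda>\<omega>. (X \<omega> - Y n \<omega>)\<^sup>2)) * sqrt B) \<longlonglongrightarrow> sqrt 0 * sqrt B"
      using lim by (intro tendsto_intros)
    then show "(\<lambda>n. sqrt (expectation (\<lambda>\<omega>. (X \<omega> - Y n \<omega>)\<^sup>2)) * sqrt B) \<longlonglongrightarrow> 0" by simp
  qed
  then have "(\<lambda>n. expectation (\<lambda>\<omega>. exp (Y n \<omega>))) \<longlonglongrightarrow> expectation (\<lambda>\<omega>. exp (X \<omega>))"
    by (rule LIM_zero_cancel)
  moreover have "(\<lambda>n. expectation (\<lambda>\<omega>. exp (Y n \<omega>))) \<longlonglongrightarrow> exp (expectation (\<lambda>\<omega>. (X \<omega>)\<^sup>2) / 2)"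
    unfolding expectation_exp_V[OF Y] using lim2 by (intro tendsto_intros) auto
  ultimately show ?thesis using int LIMSEQ_unique by blast
qed

text \<open>Needed because pathwise integrals of the noise are not finite linear combinations of the
  \<open>W \<phi>\<close>, only L^2-limits of such.\<close>

lemma (in gaussian_space) gaussian_space_L2_closure: "gaussian_space M (L2_closure M V)"
proof (unfold_locales)
  fix X assume X: "X \<in> L2_closure M V"
  then show "X \<in> borel_measurable M" and "integrable M (\<lambda>\<omega>. (X \<omega>)\<^sup>2)"
    by (auto simp: L2_closure_def square_integrable_def)
  have sq: "square_integrable M X" using X by (simp add: L2_closure_def)
  have "\<forall>n. \<exists>Y\<in>V. expectation (\<lambda>\<omega>. (X \<omega> - Y \<omega>)\<^sup>2) < 1 / real (Suc n)"
    using X unfolding L2_closure_def by auto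
  then obtain Y where Y: "\<And>n. Y n \<in> V" "\<And>n. expectation (\<lambda>\<omega>. (X \<omega> - Y n \<omega>)\<^sup>2) < 1 / real (Suc n)"
    by metis
  have "(\<lambda>n. expectation (\<lambda>\<omega>. (X \<omega> - Y n \<omega>)\<^sup>2)) \<longlonglongrightarrow> 0"
  proof (rule tendsto_sandwich[OF _ _ tendsto_const])
    show "(\<lambda>n. 1 / real (Suc n)) \<longlonglongrightarrow> 0" using LIMSEQ_inverse_real_of_nat by (simp add: inverse_eq_divide)
    show "\<forall>\<^sub>F n in sequentially. expectation (\<lambda>\<omega>. (X \<omega> - Y n \<omega>)\<^sup>2) \<le> 1 / real (Suc n)"
      by (intro always_eventually allI less_imp_le Y(2))
  qed simp
  from exp_L2_limit[OF sq Y(1) this]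
  show "integrable M (\<lambda>\<omega>. exp (X \<omega>))" "expectation (\<lambda>\<omega>. exp (X \<omega>)) = exp (expectation (\<lambda>\<omega>. (X \<omega>)\<^sup>2) / 2)"
    by auto
  show "(\<lambda>\<omega>. c * X \<omega>) \<in> L2_closure M V" for c
    unfolding L2_closure_def
  proof (intro CollectI conjI allI impI square_integrable_scale sq)
    fix e :: real assume "e > 0"
    \<comment> \<open>The summand 1 keeps the denominator positive when c = 0.\<close>
    then obtain Y where Y: "Y \<in> V" "expectation (\<lambda>\<omega>. (X \<omega> - Y \<omega>)\<^sup>2) < e / (c\<^sup>2 + 1)"
      using X unfolding L2_closure_def by (auto simp: add_nonneg_pos dest!: spec[of _ "e / (c\<^sup>2 + 1)"])
    have "expectation (\<lambda>\<omega>. (c * X \<omega> - c * Y \<omega>)\<^sup>2) = c\<^sup>2 * expectation (\<lambda>\<omega>. (X \<omega> - Y \<omega>)\<^sup>2)"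
      by (simp add: right_diff_distrib[symmetric] power_mult_distrib)
    also have "\<dots> \<le> (c\<^sup>2 + 1) * expectation (\<lambda>\<omega>. (X \<omega> - Y \<omega>)\<^sup>2)"
      by (intro mult_right_mono) auto
    also have "\<dots> < e"
    proof -
      have "0 < c\<^sup>2 + 1" by (simp add: add_nonneg_pos)
      then show ?thesis using Y(2) by (simp add: pos_less_divide_eq mult.commute)
    qed
    finally show "\<exists>Y\<in>V. expectation (\<lambda>\<omega>. (c * X \<omega> - Y \<omega>)\<^sup>2) < e" by (intro bexI[OF _ scale_V[OF Y(1), of c]])
  qed
  fix X' assume X': "X' \<in> L2_closure M V"
  then have sq': "square_integrable M X'" by (simp add: L2_closure_def)
  show "(\<lambda>\<omega>. X \<omega> + X' \<omega>) \<in> L2_closure M V"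
    unfolding L2_closure_def
  proof (intro CollectI conjI allI impI square_integrable_add sq sq')
    fix e :: real assume "e > 0"
    then obtain Y Y' where Y: "Y \<in> V" "expectation (\<lambda>\<omega>. (X \<omega> - Y \<omega>)\<^sup>2) < e / 4"
      and Y': "Y' \<in> V" "expectation (\<lambda>\<omega>. (X' \<omega> - Y' \<omega>)\<^sup>2) < e / 4"
      using X X' unfolding L2_closure_def by (auto dest!: spec[of _ "e / 4"])
    have "expectation (\<lambda>\<omega>. ((X \<omega> + X' \<omega>) - (Y \<omega> + Y' \<omega>))\<^sup>2) = expectation (\<lambda>\<omega>. ((X \<omega> - Y \<omega>) + (X' \<omega> - Y' \<omega>))\<^sup>2)"
      by (simp add: algebra_simps)
    also have "\<dots> \<le> 2 * expectation (\<lambda>\<omega>. (X \<omega> - Y \<omega>)\<^sup>2) + 2 * expectation (\<lambda>\<omega>. (X' \<omega> - Y' \<omega>)\<^sup>2)"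
      by (intro integral_square_add_le square_integrable_diff sq sq' square_integrable_V Y Y')
    also have "\<dots> < e" using Y(2) Y'(2) by simp
    finally show "\<exists>Z\<in>V. expectation (\<lambda>\<omega>. (X \<omega> + X' \<omega> - Z \<omega>)\<^sup>2) < e" by (intro bexI[OF _ add_V[OF Y(1) Y'(1)]])
  qed
qed

text \<open>Completing the square: weighting the centred normal density by exp x moves its mean to
  \<sigma>^2 and multiplies its mass by exp (\<sigma>^2 / 2).\<close>

lemma (in prob_space) normal_exponential_moment:
  assumes X: "distributed M lborel X (normal_density 0 \<sigma>)" and \<sigma>: "\<sigma> > 0"
  shows "integrable M (\<lambda>\<omega>. exp (X \<omega>)) \<and> expectation (\<lambda>\<omega>. exp (X \<omega>)) = exp (\<sigma>\<^sup>2 / 2)"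
proof -
  have *: "normal_density 0 \<sigma> x * exp x = exp (\<sigma>\<^sup>2 / 2) * normal_density (\<sigma>\<^sup>2) \<sigma> x" for x
  proof -
    have "- (x - 0)\<^sup>2 / (2 * \<sigma>\<^sup>2) + x = \<sigma>\<^sup>2 / 2 + - (x - \<sigma>\<^sup>2)\<^sup>2 / (2 * \<sigma>\<^sup>2)"
      using \<sigma> by (simp add: field_simps power2_eq_square)
    then show ?thesis by (simp add: normal_density_def mult_exp_exp)
  qed
  have "integrable lborel (\<lambda>x. normal_density 0 \<sigma> x * exp x)"
    unfolding * using \<sigma> by simp
  moreover have "(LINT x|lborel. normal_density 0 \<sigma> x * exp x) = exp (\<sigma>\<^sup>2 / 2)"
    unfolding * using \<sigma> by simp
  ultimately show ?thesis
    using distributed_integrable[OF X, of exp] distributed_integral[OF X, of exp] by simp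
qed

lemma gaussian_spaceI:
  assumes M: "prob_space M"
    and meas: "\<And>X. X \<in> V \<Longrightarrow> X \<in> borel_measurable M"
    and add: "\<And>X Y. X \<in> V \<Longrightarrow> Y \<in> V \<Longrightarrow> (\<lambda>\<omega>. X \<omega> + Y \<omega>) \<in> V"
    and scale: "\<And>X c. X \<in> V \<Longrightarrow> (\<lambda>\<omega>. c * X \<omega>) \<in> V"
    and normal: "\<And>X. X \<in> V \<Longrightarrow> centered_normal M X"
  shows "gaussian_space M V"
proof -
  interpret prob_space M by fact
  have "integrable M (\<lambda>\<omega>. (X \<omega>)\<^sup>2) \<and> integrable M (\<lambda>\<omega>. exp (X \<omega>)) \<and>
     expectation (\<lambda>\<omega>. exp (X \<omega>)) = exp (expectation (\<lambda>\<omega>. (X \<omega>)\<^sup>2) / 2)" if "X \<in> V" for X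
  proof -
    note [measurable] = meas[OF that]
    show ?thesis
      using normal[OF that] unfolding centered_normal_def
    proof (elim disjE exE conjE)
      assume 0: "AE \<omega> in M. X \<omega> = 0"
      have "integrable M (\<lambda>\<omega>. (X \<omega>)\<^sup>2) \<longleftrightarrow> integrable M (\<lambda>\<omega>. 0::real)"
        "integrable M (\<lambda>\<omega>. exp (X \<omega>)) \<longleftrightarrow> integrable M (\<lambda>\<omega>. 1::real)"
        using 0 by (intro integrable_cong_AE; auto)+
      moreover have "expectation (\<lambda>\<omega>. (X \<omega>)\<^sup>2) = expectation (\<lambda>\<omega>. 0::real)"
        "expectation (\<lambda>\<omega>. exp (X \<omega>)) = expectation (\<lambda>\<omega>. 1::real)"
        using 0 by (intro integral_cong_AE; auto)+
      ultimately show ?thesis by (simp add: prob_space)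
    next
      fix \<sigma> :: real assume \<sigma>: "\<sigma> > 0" and d: "distributed M lborel X (normal_density 0 \<sigma>)"
      have "expectation (\<lambda>\<omega>. (X \<omega>)\<^sup>2) = \<sigma>\<^sup>2"
        using normal_distributed_variance[OF \<sigma> d] normal_distributed_expectation[OF \<sigma> d] by simp
      moreover have "integrable M (\<lambda>\<omega>. (X \<omega>)\<^sup>2)"
        using distributed_integrable[OF d, of "\<lambda>x. x\<^sup>2"] integrable_normal_moment[OF \<sigma>, of 0 2] by simp
      ultimately show ?thesis using normal_exponential_moment[OF d \<sigma>] by simp
    qed
  qed
  then show ?thesis
    using assms by (intro gaussian_space.intro gaussian_space_axioms.intro) auto
qed

section \<open>Hoelder's inequality and the tilt\<close>

lemma Hoelder_inequality_powr:
  fixes f g :: "'w \<Rightarrow> real"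
  assumes pq: "1 < p" "1 < q" "1 / p + 1 / q = 1"
    and nonneg: "\<And>x. 0 \<le> f x" "\<And>x. 0 \<le> g x"
    and [measurable]: "f \<in> borel_measurable M" "g \<in> borel_measurable M"
    and f: "integrable M (\<lambda>x. f x powr p)" and g: "integrable M (\<lambda>x. g x powr q)"
    and fg: "integrable M (\<lambda>x. f x * g x)"
  shows "(LINT x|M. f x * g x) \<le> (LINT x|M. f x powr p) powr (1 / p) * (LINT x|M. g x powr q) powr (1 / q)"
proof -
  define A B where "A = (LINT x|M. f x powr p)" and "B = (LINT x|M. g x powr q)"
  have A: "A \<ge> 0" and B: "B \<ge> 0" by (auto simp: A_def B_def)
  show ?thesis
  proof (cases "A = 0 \<or> B = 0")
    case True
    have "AE x in M. f x * g x = 0"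
      using True
    proof
      assume "A = 0"
      then have "AE x in M. f x powr p = 0"
        using f unfolding A_def by (subst (asm) integral_nonneg_eq_0_iff_AE) auto
      then show ?thesis by eventually_elim auto
    next
      assume "B = 0"
      then have "AE x in M. g x powr q = 0"
        using g unfolding B_def by (subst (asm) integral_nonneg_eq_0_iff_AE) auto
      then show ?thesis by eventually_elim auto
    qed
    then have "(LINT x|M. f x * g x) = (LINT x|M. 0)" by (intro integral_cong_AE) auto
    then show ?thesis by simp
  next
    case False
    then have AB: "A > 0" "B > 0" using A B by auto
    \<comment> \<open>Dividing by the norms reduces to factors of norm 1, for which Young's
      inequality integrates to 1 / p + 1 / q = 1.\<close>
    define a b where "a = A powr (1 / p)" and "b = B powr (1 / q)"
    have ab: "a > 0" "b > 0" and pw: "a powr p = A" "b powr q = B"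
      using AB pq by (auto simp: a_def b_def powr_powr)
    have "(LINT x|M. f x * g x) = (LINT x|M. a * b * ((f x / a) * (g x / b)))"
      using ab by (intro Bochner_Integration.integral_cong) auto
    also have "\<dots> \<le> (LINT x|M. a * b * (f x powr p / A / p + g x powr q / B / q))"
    proof (intro integral_mono)
      show "integrable M (\<lambda>x. a * b * ((f x / a) * (g x / b)))"
        using fg ab by simp
      show "integrable M (\<lambda>x. a * b * (f x powr p / A / p + g x powr q / B / q))"
        using f g by simp
      fix x
      have "(f x / a) * (g x / b) \<le> (f x / a) powr p / p + (g x / b) powr q / q"
        using nonneg[of x] ab pq by (intro Youngs_inequality) auto
      also have "\<dots> = f x powr p / A / p + g x powr q / B / q"
        using nonneg[of x] ab pw by (simp add: powr_divide)
      finally show "a * b * ((f x / a) * (g x / b)) \<le> a * b * (f x powr p / A / p + g x powr q / B / q)"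
        using ab by (intro mult_left_mono) auto
    qed
    also have "\<dots> = a * b * (A / A / p + B / B / q)"
      using f g by (simp add: A_def B_def)
    also have "\<dots> = a * b" using AB pq by simp
    finally show ?thesis by (simp add: a_def b_def A_def B_def)
  qed
qed

text \<open>The conjugate exponent \<open>q = p / (p - 1)\<close> satisfies \<open>q - 1 = 1 / (p - 1)\<close>, which is where the
  constant in the exponent comes from.\<close>

lemma (in gaussian_space) expectation_tilt_le_Lp_norm:
  assumes Y: "Y \<in> V" and u: "square_integrable M u" and p: "p > 1"
  shows "ennreal (exp (- expectation (\<lambda>\<omega>. (Y \<omega>)\<^sup>2) / 2) * expectation (\<lambda>\<omega>. exp (Y \<omega>) * u \<omega>)) \<le>
    ennreal (exp (expectation (\<lambda>\<omega>. (Y \<omega>)\<^sup>2) / (2 * (p - 1)))) * Lp_norm M p u"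
proof (cases "(\<integral>\<^sup>+\<omega>. ennreal (\<bar>u \<omega>\<bar> powr p) \<partial>M) = \<infinity>")
  case True
  then show ?thesis by (simp add: Lp_norm_def ennreal_mult_top)
next
  case False
  have [measurable]: "u \<in> borel_measurable M" using u by (simp add: square_integrable_def)
  define s where "s = expectation (\<lambda>\<omega>. (Y \<omega>)\<^sup>2)"
  define q where "q = p / (p - 1)"
  have q: "q > 1" "1 / p + 1 / q = 1" using p by (auto simp: q_def field_simps)
  have int_u: "integrable M (\<lambda>\<omega>. \<bar>u \<omega>\<bar> powr p)"
    using False by (intro integrableI_nonneg) (auto simp: less_top)
  have expq: "exp (Y \<omega>) powr q = exp (q * Y \<omega>)" for \<omega> by (simp add: powr_def)
  have u': "square_integrable M (\<lambda>\<omega>. \<bar>u \<omega>\<bar>)" using u by (simp add: square_integrable_def)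
  note sqe = square_integrable_exp_V[OF Y]
  have "expectation (\<lambda>\<omega>. exp (Y \<omega>) * u \<omega>) \<le> expectation (\<lambda>\<omega>. \<bar>u \<omega>\<bar> * exp (Y \<omega>))"
    by (intro integral_mono square_integrable_mult sqe u u') (simp add: mult.commute)
  also have "\<dots> \<le> expectation (\<lambda>\<omega>. \<bar>u \<omega>\<bar> powr p) powr (1 / p) * expectation (\<lambda>\<omega>. exp (Y \<omega>) powr q) powr (1 / q)"
    using p q int_u square_integrable_mult[OF u' sqe] measurable_V[OF Y]
    by (intro Hoelder_inequality_powr) (auto simp: expq intro: integrable_exp_V[OF scale_V[OF Y]])
  \<comment> \<open>The q-th root of exp (q^2 s / 2).\<close>
  also have "expectation (\<lambda>\<omega>. exp (Y \<omega>) powr q) powr (1 / q) = exp (q * s / 2)"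
    unfolding expq expectation_exp_scale[OF Y] s_def using q by (simp add: powr_def power2_eq_square)
  finally have "exp (- s / 2) * expectation (\<lambda>\<omega>. exp (Y \<omega>) * u \<omega>) \<le>
     exp (- s / 2) * (expectation (\<lambda>\<omega>. \<bar>u \<omega>\<bar> powr p) powr (1 / p) * exp (q * s / 2))"
    by (intro mult_left_mono) auto
  also have "\<dots> = exp (s / (2 * (p - 1))) * expectation (\<lambda>\<omega>. \<bar>u \<omega>\<bar> powr p) powr (1 / p)"
  proof -
    have "- s / 2 + q * s / 2 = s / (2 * (p - 1))" using p by (simp add: q_def field_simps)
    then have "exp (- s / 2) * exp (q * s / 2) = exp (s / (2 * (p - 1)))" by (simp only: mult_exp_exp)
    then show ?thesis by (simp only: mult_ac) (simp only: mult.assoc[symmetric])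
  qed
  finally have "ennreal (exp (- s / 2) * expectation (\<lambda>\<omega>. exp (Y \<omega>) * u \<omega>)) \<le>
     ennreal (exp (s / (2 * (p - 1)))) * ennreal (expectation (\<lambda>\<omega>. \<bar>u \<omega>\<bar> powr p) powr (1 / p))"
    by (simp add: ennreal_mult[symmetric] ennreal_leI)
  moreover have "Lp_norm M p u = ennreal (expectation (\<lambda>\<omega>. \<bar>u \<omega>\<bar> powr p) powr (1 / p))"
    using False nn_integral_eq_integral[OF int_u] by (simp add: Lp_norm_def)
  ultimately show ?thesis unfolding s_def by simp
qed

section \<open>Heat smoothing\<close>

lemma distr_lborel_add: "distr lborel borel (\<lambda>x. x + c) = (lborel :: 'a::euclidean_space measure)"
proof -
  have "(\<lambda>x. x + c) = (+) c" by (auto simp: add.commute)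
  then show ?thesis by (simp add: lborel_distr_plus)
qed

lemma nn_integral_lborel_shift:
  fixes c :: "'a::euclidean_space"
  assumes [measurable]: "f \<in> borel_measurable borel"
  shows "(\<integral>\<^sup>+x. f (x + c) \<partial>lborel) = (\<integral>\<^sup>+x. f x \<partial>lborel)"
  by (subst (2) distr_lborel_add[of c, symmetric], subst nn_integral_distr) auto

lemma integral_lborel_shift:
  fixes c :: "'a::euclidean_space" and f :: "'a \<Rightarrow> real"
  assumes [measurable]: "f \<in> borel_measurable borel"
  shows "(LINT x|lborel. f (x + c)) = (LINT x|lborel. f x)"
  by (subst (2) distr_lborel_add[of c, symmetric], subst integral_distr) auto

lemma integrable_lborel_shift:
  fixes c :: "'a::euclidean_space" and f :: "'a \<Rightarrow> real"
  assumes "integrable lborel f"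
  shows "integrable lborel (\<lambda>x. f (x + c))"
proof -
  have [measurable]: "f \<in> borel_measurable borel" using assms by auto
  have "integrable (distr lborel borel (\<lambda>x. x + c)) f" using assms by (simp add: distr_lborel_add)
  then show ?thesis by (subst (asm) integrable_distr_eq) auto
qed

definition L1_continuous :: "('a::euclidean_space \<Rightarrow> real) \<Rightarrow> bool" where
  "L1_continuous h \<longleftrightarrow> (\<forall>v. v \<longlonglongrightarrow> 0 \<longrightarrow> (\<lambda>n. LINT x|lborel. \<bar>h (x + v n) - h x\<bar>) \<longlonglongrightarrow> 0)"

text \<open>Translation is an isometry of L^1, so continuity at 0 passes to L^1-limits.\<close>

lemma L1_continuous_approx:
  assumes h: "integrable lborel h"
    and approx: "\<And>e. e > 0 \<Longrightarrow> \<exists>g. integrable lborel g \<and> L1_continuous g \<and> (LINT x|lborel. \<bar>h x - g x\<bar>) \<le> e"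
  shows "L1_continuous h"
  unfolding L1_continuous_def
proof (intro allI impI)
  fix v :: "nat \<Rightarrow> 'a" assume v: "v \<longlonglongrightarrow> 0"
  show "(\<lambda>n. LINT x|lborel. \<bar>h (x + v n) - h x\<bar>) \<longlonglongrightarrow> 0"
  proof (rule LIMSEQ_I)
    fix e :: real assume "e > 0"
    then obtain g where g: "integrable lborel g" "L1_continuous g" "(LINT x|lborel. \<bar>h x - g x\<bar>) \<le> e / 4"
      using approx[of "e / 4"] by auto
    obtain N where N: "\<And>n. n \<ge> N \<Longrightarrow> (LINT x|lborel. \<bar>g (x + v n) - g x\<bar>) < e / 2"
      using LIMSEQ_D[OF g(2)[unfolded L1_continuous_def, rule_format, OF v], of "e / 2"] \<open>e > 0\<close> by auto
    show "\<exists>N. \<forall>n\<ge>N. norm ((LINT x|lborel. \<bar>h (x + v n) - h x\<bar>) - 0) < e"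
    proof (intro exI allI impI)
      fix n assume "n \<ge> N"
      note i = h g(1) integrable_lborel_shift[OF h, of "v n"] integrable_lborel_shift[OF g(1), of "v n"]
      have "(LINT x|lborel. \<bar>h (x + v n) - h x\<bar>) \<le>
        (LINT x|lborel. \<bar>h (x + v n) - g (x + v n)\<bar> + \<bar>g (x + v n) - g x\<bar> + \<bar>h x - g x\<bar>)"
        using i by (intro integral_mono) auto
      also have "\<dots> = (LINT x|lborel. \<bar>h (x + v n) - g (x + v n)\<bar>) + (LINT x|lborel. \<bar>g (x + v n) - g x\<bar>) + (LINT x|lborel. \<bar>h x - g x\<bar>)"
        using i by simp
      also have "(LINT x|lborel. \<bar>h (x + v n) - g (x + v n)\<bar>) = (LINT x|lborel. \<bar>h x - g x\<bar>)"
        using h g(1) by (intro integral_lborel_shift[where f = "\<lambda>x. \<bar>h x - g x\<bar>"]) auto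
      also have "\<dots> + (LINT x|lborel. \<bar>g (x + v n) - g x\<bar>) + (LINT x|lborel. \<bar>h x - g x\<bar>) < e"
        using g(3) N[OF \<open>n \<ge> N\<close>] by simp
      finally show "norm ((LINT x|lborel. \<bar>h (x + v n) - h x\<bar>) - 0) < e" by simp
    qed
  qed
qed

text \<open>The distance is 2 \<bar>U\<bar> minus twice the measure of the overlap of U with its
  translate. The overlap converges to \<bar>U\<bar> by dominated convergence, because a point of an
  open set stays inside under small shifts; nothing has to be known at the boundary.\<close>

lemma L1_continuous_open:
  fixes U :: "'a::euclidean_space set"
  assumes U: "open U" and fin: "emeasure lborel U < \<infinity>"
  shows "L1_continuous (indicator U :: 'a \<Rightarrow> real)"
  unfolding L1_continuous_def
proof (intro allI impI)
  fix v :: "nat \<Rightarrow> 'a" assume v: "v \<longlonglongrightarrow> 0"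
  have [measurable]: "U \<in> sets borel" using U by simp
  have iU: "integrable lborel (indicator U :: 'a \<Rightarrow> real)" using fin by simp
  have iUn: "integrable lborel (\<lambda>x. indicator U x * indicator U (x + v n) :: real)" for n
    by (rule Bochner_Integration.integrable_bound[OF iU]) (auto simp: indicator_def)
  have "(\<lambda>n. LINT x|lborel. indicator U x * indicator U (x + v n) :: real) \<longlonglongrightarrow> (LINT x|lborel. indicator U x)"
  proof (rule integral_dominated_convergence[where w = "indicator U"])
    show "AE x in lborel. (\<lambda>n. indicator U x * indicator U (x + v n) :: real) \<longlonglongrightarrow> indicator U x"
    proof (intro always_eventually allI)
      fix x
      show "(\<lambda>n. indicator U x * indicator U (x + v n) :: real) \<longlonglongrightarrow> indicator U x"
      proof (cases "x \<in> U")
        case True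
        have "(\<lambda>n. x + v n) \<longlonglongrightarrow> x + 0" using v by (intro tendsto_intros)
        then have "\<forall>\<^sub>F n in sequentially. x + v n \<in> U" using U True by (auto intro: topological_tendstoD)
        then have "\<forall>\<^sub>F n in sequentially. indicator U x * indicator U (x + v n) = (1 :: real)"
          by eventually_elim (use True in simp)
        then show ?thesis using True by (simp add: tendsto_eventually)
      qed simp
    qed
  qed (use iU in \<open>auto simp: indicator_def\<close>)
  then have "(\<lambda>n. 2 * (LINT x|lborel. indicator U x :: real) - 2 * (LINT x|lborel. indicator U x * indicator U (x + v n))) \<longlonglongrightarrow>
     2 * (LINT x|lborel. indicator U x :: real) - 2 * (LINT x|lborel. indicator U x)"
    by (intro tendsto_intros)
  moreover have "(LINT x|lborel. \<bar>indicator U (x + v n) - indicator U x :: real\<bar>) =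
      2 * (LINT x|lborel. indicator U x) - 2 * (LINT x|lborel. indicator U x * indicator U (x + v n))" for n
  proof -
    have "(LINT x|lborel. \<bar>indicator U (x + v n) - indicator U x :: real\<bar>) =
      (LINT x|lborel. indicator U (x + v n) + indicator U x - 2 * (indicator U x * indicator U (x + v n)))"
      by (intro Bochner_Integration.integral_cong) (auto simp: indicator_def)
    also have "\<dots> = (LINT x|lborel. indicator U (x + v n)) + (LINT x|lborel. indicator U x) - 2 * (LINT x|lborel. indicator U x * indicator U (x + v n))"
      using iU iUn[of n] integrable_lborel_shift[OF iU, of "v n"] by simp
    also have "(LINT x|lborel. indicator U (x + v n)) = (LINT x|lborel. indicator U x :: real)"
      by (rule integral_lborel_shift) simp
    finally show ?thesis by simp
  qed
  ultimately show "(\<lambda>n. LINT x|lborel. \<bar>indicator U (x + v n) - indicator U x :: real\<bar>) \<longlonglongrightarrow> 0" by simp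
qed

lemma L1_continuous_scale: "L1_continuous h \<Longrightarrow> L1_continuous (\<lambda>x. h x * c)"
proof -
  assume h: "L1_continuous h"
  have "(LINT x|lborel. \<bar>h (x + w) * c - h x * c\<bar>) = (LINT x|lborel. \<bar>h (x + w) - h x\<bar>) * \<bar>c\<bar>" for w
    by (simp add: left_diff_distrib[symmetric] abs_mult)
  then show ?thesis using h tendsto_mult_left_zero unfolding L1_continuous_def by simp blast
qed

lemma L1_continuous_add:
  assumes "integrable lborel f" "integrable lborel g" "L1_continuous f" "L1_continuous g"
  shows "L1_continuous (\<lambda>x. f x + g x)"
  unfolding L1_continuous_def
proof (intro allI impI)
  fix v :: "nat \<Rightarrow> 'a" assume v: "v \<longlonglongrightarrow> 0"
  show "(\<lambda>n. LINT x|lborel. \<bar>f (x + v n) + g (x + v n) - (f x + g x)\<bar>) \<longlonglongrightarrow> 0"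
  proof (rule Lim_null_comparison)
    show "\<forall>\<^sub>F n in sequentially. norm (LINT x|lborel. \<bar>f (x + v n) + g (x + v n) - (f x + g x)\<bar>) \<le>
      (LINT x|lborel. \<bar>f (x + v n) - f x\<bar>) + (LINT x|lborel. \<bar>g (x + v n) - g x\<bar>)"
    proof (intro always_eventually allI)
      fix n
      note i = assms(1,2) integrable_lborel_shift[OF assms(1), of "v n"] integrable_lborel_shift[OF assms(2), of "v n"]
      have "(LINT x|lborel. \<bar>f (x + v n) + g (x + v n) - (f x + g x)\<bar>) \<le>
        (LINT x|lborel. \<bar>f (x + v n) - f x\<bar> + \<bar>g (x + v n) - g x\<bar>)"
        using i by (intro integral_mono) auto
      then show "norm (LINT x|lborel. \<bar>f (x + v n) + g (x + v n) - (f x + g x)\<bar>) \<le>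
        (LINT x|lborel. \<bar>f (x + v n) - f x\<bar>) + (LINT x|lborel. \<bar>g (x + v n) - g x\<bar>)"
        using i by simp
    qed
    show "(\<lambda>n. (LINT x|lborel. \<bar>f (x + v n) - f x\<bar>) + (LINT x|lborel. \<bar>g (x + v n) - g x\<bar>)) \<longlonglongrightarrow> 0"
      using tendsto_add[OF assms(3)[unfolded L1_continuous_def, rule_format, OF v] assms(4)[unfolded L1_continuous_def, rule_format, OF v]]
      by simp
  qed
qed

text \<open>Outer regularity approximates a set of finite measure by an open one, which settles
  indicators; linearity and L^1-density do the rest.\<close>

lemma L1_continuous_integrable:
  fixes h :: "'a::euclidean_space \<Rightarrow> real"
  assumes "integrable lborel h"
  shows "L1_continuous h"
  using assms
proof (induction rule: integrable_induct)
  case (base A c)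
  then have A: "A \<in> sets borel" "emeasure lborel A < \<infinity>" by auto
  have "L1_continuous (indicator A :: 'a \<Rightarrow> real)"
  proof (rule L1_continuous_approx)
    fix e :: real assume "e > 0"
    from outer_regular_lborel[OF A(1) this]
    obtain U where U: "open U" "A \<subseteq> U" "emeasure lborel (U - A) < ennreal e" by blast
    have [measurable]: "U \<in> sets borel" using U by simp
    have "emeasure lborel U = emeasure lborel A + emeasure lborel (U - A)"
      using A U by (subst plus_emeasure) (auto intro!: arg_cong[where f = "emeasure lborel"])
    then have fin: "emeasure lborel U < \<infinity>" using A U(3) by (auto simp: ennreal_add_less_top dest: order.strict_trans[OF _ ennreal_less_top])
    have "(LINT x|lborel. \<bar>indicator A x - indicator U x :: real\<bar>) = (LINT x|lborel. indicator (U - A) x)"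
      using U(2) by (intro Bochner_Integration.integral_cong) (auto simp: indicator_def)
    also have "\<dots> = measure lborel (U - A)" by simp
    also have "\<dots> \<le> e" using U(3) \<open>e > 0\<close> unfolding measure_def by (intro enn2real_leI) auto
    finally have "(LINT x|lborel. \<bar>indicator A x - indicator U x :: real\<bar>) \<le> e" .
    then show "\<exists>g. integrable lborel g \<and> L1_continuous g \<and> (LINT x|lborel. \<bar>indicator A x - g x\<bar>) \<le> e"
      using L1_continuous_open[OF U(1) fin] fin by (intro exI[of _ "indicator U"]) auto
  qed (use A in auto)
  then show ?case using L1_continuous_scale[of "indicator A" c] by simp
next
  case (add f g)
  then show ?case by (intro L1_continuous_add) auto
next
  case (lim f s)
  show ?case
  proof (rule L1_continuous_approx)
    fix e :: real assume "e > 0"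
    have [measurable]: "f \<in> borel_measurable borel" "\<And>i. s i \<in> borel_measurable borel"
      using lim by (auto dest: borel_measurable_integrable)
    have "(\<lambda>i. LINT x|lborel. \<bar>f x - s i x\<bar>) \<longlonglongrightarrow> (LINT x|(lborel :: 'a measure). (0::real))"
    proof (rule integral_dominated_convergence[where w = "\<lambda>x. 3 * \<bar>f x\<bar>"])
      show "AE x in lborel. (\<lambda>i. \<bar>f x - s i x\<bar>) \<longlonglongrightarrow> 0"
      proof (intro always_eventually allI)
        fix x
        have "(\<lambda>i. \<bar>f x - s i x\<bar>) \<longlonglongrightarrow> \<bar>f x - f x\<bar>" using lim.hyps(2)[of x] by (intro tendsto_intros) auto
        then show "(\<lambda>i. \<bar>f x - s i x\<bar>) \<longlonglongrightarrow> 0" by simp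
      qed
      show "AE x in lborel. norm \<bar>f x - s i x\<bar> \<le> 3 * \<bar>f x\<bar>" for i
      proof (intro always_eventually allI)
        fix x
        have "\<bar>s i x\<bar> \<le> 2 * \<bar>f x\<bar>" using lim.hyps(3)[of x i] by simp
        then show "norm \<bar>f x - s i x\<bar> \<le> 3 * \<bar>f x\<bar>" by simp
      qed
    qed (use lim in auto)
    then have "\<forall>\<^sub>F i in sequentially. (LINT x|lborel. \<bar>f x - s i x\<bar>) < e"
      by (rule order_tendstoD(2)) (simp add: \<open>e > 0\<close>)
    then obtain i where "(LINT x|lborel. \<bar>f x - s i x\<bar>) < e"
      by (auto dest!: eventually_happens'[OF sequentially_bot])
    then show "\<exists>g. integrable lborel g \<and> L1_continuous g \<and> (LINT x|lborel. \<bar>f x - g x\<bar>) \<le> e"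
      using lim.hyps(1) lim.IH by (intro exI[of _ "s i"]) auto
  qed (use lim in auto)
qed

section \<open>Exponential and Gaussian integrals in d dimensions\<close>

lemma nn_integral_exp_abs_finite:
  fixes c :: real assumes "c > 0"
  shows "(\<integral>\<^sup>+x. ennreal (exp (- c * \<bar>x\<bar>)) \<partial>lborel) < \<infinity>"
proof -
  have 1: "(\<integral>\<^sup>+x. ennreal (exponential_density c x) \<partial>lborel) = 1"
    using prob_space.emeasure_space_1[OF prob_space_exponential_density[OF assms]] by (simp add: emeasure_density)
  have 2: "(\<integral>\<^sup>+x. ennreal (exponential_density c (- x)) \<partial>lborel) = 1"
    using nn_integral_real_affine[of "\<lambda>x. ennreal (exponential_density c x)" "-1" 0] 1 by simp
  have "(\<integral>\<^sup>+x. ennreal (exp (- c * \<bar>x\<bar>)) \<partial>lborel) \<le>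
     (\<integral>\<^sup>+x. ennreal (1 / c) * (ennreal (exponential_density c x) + ennreal (exponential_density c (- x))) \<partial>lborel)"
  proof (rule nn_integral_mono)
    fix x :: real
    have "exp (- c * \<bar>x\<bar>) \<le> 1 / c * (exponential_density c x + exponential_density c (- x))"
      using assms by (cases "x < 0"; cases "x = 0") (simp_all add: exponential_density_def mult.commute)
    then have "ennreal (exp (- c * \<bar>x\<bar>)) \<le> ennreal (1 / c * (exponential_density c x + exponential_density c (- x)))"
      by (rule ennreal_leI)
    also have "\<dots> = ennreal (1 / c) * (ennreal (exponential_density c x) + ennreal (exponential_density c (- x)))"
    proof -
      have "0 \<le> exponential_density c x" "0 \<le> exponential_density c (- x)" "0 \<le> 1 / c"
        using assms by (auto intro: exponential_density_nonneg)
      then show ?thesis by (simp only: ennreal_mult ennreal_plus add_nonneg_nonneg)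
    qed
    finally show "ennreal (exp (- c * \<bar>x\<bar>)) \<le> ennreal (1 / c) * (ennreal (exponential_density c x) + ennreal (exponential_density c (- x)))" .
  qed
  also have "\<dots> = ennreal (1 / c) * 2"
    using 1 2 by (subst nn_integral_cmult) (auto simp: nn_integral_add exponential_density_def)
  also have "\<dots> < \<infinity>" by (simp add: ennreal_mult_less_top)
  finally show ?thesis .
qed

lemma sum_abs_inner_Basis_le: "(\<Sum>b\<in>Basis. \<bar>x \<bullet> b\<bar>) \<le> real DIM('a) * norm x" for x :: "'a::euclidean_space"
  using sum_bounded_above[of Basis "\<lambda>b. \<bar>x \<bullet> b\<bar>" "norm x"] Basis_le_norm[of _ x] by auto

text \<open>As the l^1-norm is at most d times the Euclidean norm, the integrand is dominated by a
  product over the coordinates.\<close>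

lemma integrable_exp_norm:
  fixes c :: real assumes "c > 0"
  shows "integrable lborel (\<lambda>x::'a::euclidean_space. exp (- c * norm x))"
proof (rule integrableI_nonneg)
  define k where "k = c / real DIM('a)"
  have k: "k > 0" using assms by (simp add: k_def)
  have "(\<integral>\<^sup>+x. ennreal (exp (- c * norm (x::'a))) \<partial>lborel) \<le> (\<integral>\<^sup>+x. (\<Prod>b\<in>Basis. ennreal (exp (- k * \<bar>(x::'a) \<bullet> b\<bar>))) \<partial>lborel)"
  proof (intro nn_integral_mono)
    fix x :: 'a
    have "k * (\<Sum>b\<in>Basis. \<bar>x \<bullet> b\<bar>) \<le> k * (real DIM('a) * norm x)"
      using k by (intro mult_left_mono sum_abs_inner_Basis_le) auto
    then have "k * (\<Sum>b\<in>Basis. \<bar>x \<bullet> b\<bar>) \<le> c * norm x" by (simp add: k_def)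
    then have "exp (- c * norm x) \<le> (\<Prod>b\<in>Basis. exp (- k * \<bar>x \<bullet> b\<bar>))"
      by (simp add: exp_sum[symmetric] sum_negf sum_distrib_left[symmetric])
    then show "ennreal (exp (- c * norm x)) \<le> (\<Prod>b\<in>Basis. ennreal (exp (- k * \<bar>x \<bullet> b\<bar>)))"
      by (simp add: prod_ennreal ennreal_leI)
  qed
  also have "\<dots> = (\<Prod>b\<in>(Basis::'a set). (\<integral>\<^sup>+x. ennreal (exp (- k * \<bar>x\<bar>)) \<partial>lborel))"
    by (rule nn_integral_lborel_prod) auto
  also have "\<dots> < \<infinity>"
    using nn_integral_exp_abs_finite[OF k] by (simp add: power_less_top_ennreal)
  finally show "(\<integral>\<^sup>+x. ennreal (exp (- c * norm (x::'a))) \<partial>lborel) < \<infinity>" .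
qed auto

lemma heat_nonneg: "0 \<le> heat \<epsilon> x"
  by (simp add: heat_def)

lemma heat_minus: "heat \<epsilon> (- x) = heat \<epsilon> x"
  by (simp add: heat_def)

lemma borel_measurable_heat [measurable]: "heat \<epsilon> \<in> borel_measurable borel"
  unfolding heat_def[abs_def] by measurable

lemma heat_eq_prod:
  assumes "\<epsilon> > 0"
  shows "heat \<epsilon> (x::'a::euclidean_space) = (\<Prod>b\<in>Basis. normal_density 0 (sqrt \<epsilon>) (x \<bullet> b))"
proof -
  have "(2 * pi * \<epsilon>) powr (- real DIM('a) / 2) = (1 / sqrt (2 * pi * \<epsilon>)) ^ DIM('a)"
  proof -
    have "(2 * pi * \<epsilon>) powr (- real DIM('a) / 2) = ((2 * pi * \<epsilon>) powr (- (1 / 2))) powr real DIM('a)"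
      by (simp add: powr_powr)
    also have "(2 * pi * \<epsilon>) powr (- (1 / 2)) = 1 / sqrt (2 * pi * \<epsilon>)"
      using assms by (simp only: powr_minus_divide) (simp add: powr_half_sqrt)
    also have "(1 / sqrt (2 * pi * \<epsilon>)) powr real DIM('a) = (1 / sqrt (2 * pi * \<epsilon>)) ^ DIM('a)"
      using assms by (intro powr_realpow) simp
    finally show ?thesis .
  qed
  moreover have "exp (- (norm x)\<^sup>2 / (2 * \<epsilon>)) = (\<Prod>b\<in>Basis. exp (- (x \<bullet> b)\<^sup>2 / (2 * \<epsilon>)))"
  proof -
    have "(norm x)\<^sup>2 = (\<Sum>b\<in>Basis. (x \<bullet> b)\<^sup>2)"
      unfolding power2_norm_eq_inner by (subst euclidean_inner) (simp add: power2_eq_square)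
    then show ?thesis by (simp add: exp_sum[symmetric] sum_negf sum_divide_distrib)
  qed
  ultimately show ?thesis using assms
    by (simp add: heat_def normal_density_def prod.distrib power_one_over prod_dividef)
qed

lemma nn_integral_heat: "\<epsilon> > 0 \<Longrightarrow> (\<integral>\<^sup>+x. ennreal (heat \<epsilon> x) \<partial>lborel) = 1"
  for \<epsilon> :: real
proof -
  assume \<epsilon>: "\<epsilon> > 0"
  have "(\<integral>\<^sup>+x. ennreal (heat \<epsilon> (x::'a)) \<partial>lborel) = (\<integral>\<^sup>+x. (\<Prod>b\<in>Basis. ennreal (normal_density 0 (sqrt \<epsilon>) ((x::'a) \<bullet> b))) \<partial>lborel)"
    using \<epsilon> by (simp add: heat_eq_prod prod_ennreal)
  also have "\<dots> = (\<Prod>b\<in>(Basis::'a set). (\<integral>\<^sup>+x. ennreal (normal_density 0 (sqrt \<epsilon>) x) \<partial>lborel))"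
    by (rule nn_integral_lborel_prod) auto
  also have "(\<integral>\<^sup>+x. ennreal (normal_density 0 (sqrt \<epsilon>) x) \<partial>lborel) = 1"
    using prob_space.emeasure_space_1[OF prob_space_normal_density[of "sqrt \<epsilon>" 0]] \<epsilon> by (simp add: emeasure_density)
  finally show ?thesis by simp
qed

lemma integrable_heat: "\<epsilon> > 0 \<Longrightarrow> integrable lborel (heat \<epsilon>)"
  by (rule integrableI_nonneg) (auto simp: nn_integral_heat heat_nonneg)

lemma integral_heat: "\<epsilon> > 0 \<Longrightarrow> (LINT x|lborel. heat \<epsilon> x) = 1"
  by (subst integral_eq_nn_integral) (auto simp: nn_integral_heat heat_nonneg)

lemma normal_density_times_exp:
  assumes "\<sigma> > 0"
  shows "normal_density 0 \<sigma> x * exp (c * x) = exp (c\<^sup>2 * \<sigma>\<^sup>2 / 2) * normal_density (c * \<sigma>\<^sup>2) \<sigma> x"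
proof -
  have "- (x - 0)\<^sup>2 / (2 * \<sigma>\<^sup>2) + c * x = c\<^sup>2 * \<sigma>\<^sup>2 / 2 + - (x - c * \<sigma>\<^sup>2)\<^sup>2 / (2 * \<sigma>\<^sup>2)"
    using assms by (simp add: field_simps power2_eq_square)
  then show ?thesis by (simp add: normal_density_def mult_exp_exp)
qed

lemma nn_integral_normal_density: "\<sigma> > 0 \<Longrightarrow> (\<integral>\<^sup>+x. ennreal (normal_density m \<sigma> x) \<partial>lborel) = 1"
  using prob_space.emeasure_space_1[OF prob_space_normal_density[of \<sigma> m]] by (simp add: emeasure_density)

text \<open>Each coordinate contributes 2 exp (\<epsilon> / 2), and 2 e \<le> 6 for \<epsilon> \<le>
  1. What matters is that the constant does not depend on \<epsilon>: it makes decay bounds uniform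
  along the smoothing.\<close>

lemma nn_integral_heat_exp_norm_le:
  assumes \<epsilon>: "0 < \<epsilon>" "\<epsilon> \<le> 1"
  shows "(\<integral>\<^sup>+x. ennreal (heat \<epsilon> (x::'a::euclidean_space) * exp (norm x)) \<partial>lborel) \<le> ennreal (6 ^ DIM('a))"
proof -
  have "(\<integral>\<^sup>+x. ennreal (heat \<epsilon> (x::'a) * exp (norm x)) \<partial>lborel) \<le>
     (\<integral>\<^sup>+x. (\<Prod>b\<in>Basis. ennreal (normal_density 0 (sqrt \<epsilon>) ((x::'a) \<bullet> b) * (exp (1 * (x \<bullet> b)) + exp ((-1) * (x \<bullet> b))))) \<partial>lborel)"
  proof (intro nn_integral_mono)
    fix x :: 'a
    have "exp (norm x) \<le> (\<Prod>b\<in>Basis. exp \<bar>x \<bullet> b\<bar>)"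
      by (simp add: exp_sum[symmetric] norm_le_l1)
    also have "\<dots> \<le> (\<Prod>b\<in>Basis. exp (1 * (x \<bullet> b)) + exp ((-1) * (x \<bullet> b)))"
      by (intro prod_mono) (auto simp: abs_if add_increasing add_increasing2)
    finally have "heat \<epsilon> x * exp (norm x) \<le> (\<Prod>b\<in>Basis. normal_density 0 (sqrt \<epsilon>) (x \<bullet> b) * (exp (1 * (x \<bullet> b)) + exp ((-1) * (x \<bullet> b))))"
      using \<epsilon> by (simp add: heat_eq_prod prod.distrib mult_left_mono prod_nonneg)
    then show "ennreal (heat \<epsilon> x * exp (norm x)) \<le> (\<Prod>b\<in>Basis. ennreal (normal_density 0 (sqrt \<epsilon>) (x \<bullet> b) * (exp (1 * (x \<bullet> b)) + exp ((-1) * (x \<bullet> b)))))"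
      by (subst prod_ennreal) (auto intro!: ennreal_leI mult_nonneg_nonneg add_nonneg_nonneg)
  qed
  also have "\<dots> = (\<Prod>b\<in>(Basis::'a set). (\<integral>\<^sup>+x. ennreal (normal_density 0 (sqrt \<epsilon>) x * (exp (1 * x) + exp ((-1) * x))) \<partial>lborel))"
    by (rule nn_integral_lborel_prod) (auto intro!: mult_nonneg_nonneg add_nonneg_nonneg)
  also have "\<dots> \<le> ennreal 6 ^ DIM('a)"
    unfolding prod_constant
  proof (intro power_mono)
    have "normal_density 0 (sqrt \<epsilon>) x * (exp (1 * x) + exp ((-1) * x)) =
       exp (\<epsilon> / 2) * normal_density \<epsilon> (sqrt \<epsilon>) x + exp (\<epsilon> / 2) * normal_density (- \<epsilon>) (sqrt \<epsilon>) x" for x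
      using \<epsilon> normal_density_times_exp[of "sqrt \<epsilon>" x 1] normal_density_times_exp[of "sqrt \<epsilon>" x "-1"]
      by (simp add: distrib_left)
    then have "(\<integral>\<^sup>+x. ennreal (normal_density 0 (sqrt \<epsilon>) x * (exp (1 * x) + exp ((-1) * x))) \<partial>lborel) =
       (\<integral>\<^sup>+x. ennreal (exp (\<epsilon> / 2)) * ennreal (normal_density \<epsilon> (sqrt \<epsilon>) x) + ennreal (exp (\<epsilon> / 2)) * ennreal (normal_density (- \<epsilon>) (sqrt \<epsilon>) x) \<partial>lborel)"
      by (simp add: ennreal_mult)
    also have "\<dots> = ennreal (exp (\<epsilon> / 2)) * 1 + ennreal (exp (\<epsilon> / 2)) * 1"
      using \<epsilon> by (simp add: nn_integral_add nn_integral_cmult nn_integral_normal_density)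
    also have "\<dots> = ennreal (2 * exp (\<epsilon> / 2))" by (simp add: ennreal_plus[symmetric] del: ennreal_plus)
    also have "\<dots> \<le> ennreal 6"
    proof (rule ennreal_leI)
      have "exp (\<epsilon> / 2) \<le> exp 1" using \<epsilon> by simp
      then show "2 * exp (\<epsilon> / 2) \<le> 6" using exp_le by linarith
    qed
    finally show "(\<integral>\<^sup>+x. ennreal (normal_density 0 (sqrt \<epsilon>) x * (exp (1 * x) + exp ((-1) * x))) \<partial>lborel) \<le> ennreal 6" .
  qed auto
  also have "\<dots> = ennreal (6 ^ DIM('a))" by (subst ennreal_power) auto
  finally show ?thesis .
qed

lemma heat_le_exp_norm:
  assumes "\<epsilon> > 0"
  shows "heat \<epsilon> (y - x) \<le> (2 * pi * \<epsilon>) powr (- real DIM('a) / 2) * exp (\<epsilon> / 2 + norm x) * exp (- norm (y::'a::euclidean_space))"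
proof -
  \<comment> \<open>This is (r - \<epsilon>)^2 \<ge> 0 for r = norm (y - x), divided by 2
    \<epsilon>.\<close>
  have "norm (y - x) - \<epsilon> / 2 \<le> (norm (y - x))\<^sup>2 / (2 * \<epsilon>)"
    using assms zero_le_power2[of "norm (y - x) - \<epsilon>"] by (simp add: field_simps power2_eq_square)
  then have "- (norm (y - x))\<^sup>2 / (2 * \<epsilon>) \<le> \<epsilon> / 2 + norm x - norm y"
    using norm_triangle_ineq2[of y x] by simp
  then have "exp (- (norm (y - x))\<^sup>2 / (2 * \<epsilon>)) \<le> exp (\<epsilon> / 2 + norm x) * exp (- norm y)"
    by (simp add: mult_exp_exp)
  then show ?thesis unfolding heat_def by (simp add: mult.assoc mult_left_mono)
qed

section \<open>Heat smoothing of integrable functions\<close>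

definition smooth :: "real \<Rightarrow> ('a::euclidean_space \<Rightarrow> real) \<Rightarrow> 'a \<Rightarrow> real" where
  "smooth \<epsilon> h x = (LINT y|lborel. heat \<epsilon> y * h (x + y))"

lemma borel_measurable_smooth [measurable]:
  assumes [measurable]: "h \<in> borel_measurable borel"
  shows "smooth \<epsilon> h \<in> borel_measurable borel"
  unfolding smooth_def[abs_def] by measurable

lemma heat_bound: "heat \<epsilon> (x::'a::euclidean_space) \<le> (2 * pi * \<epsilon>) powr (- real DIM('a) / 2)" if "\<epsilon> > 0"
  unfolding heat_def using that by (intro mult_left_le) auto

lemma integrable_heat_mult:
  fixes h :: "'a::euclidean_space \<Rightarrow> real"
  assumes "\<epsilon> > 0" "integrable lborel h"
  shows "integrable lborel (\<lambda>y. heat \<epsilon> y * h (x + y))"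
proof (rule Bochner_Integration.integrable_bound)
  have [measurable]: "h \<in> borel_measurable borel" using assms by auto
  show "integrable lborel (\<lambda>y. (2 * pi * \<epsilon>) powr (- real DIM('a) / 2) * h (y + x))"
    using integrable_lborel_shift[OF assms(2), of x] by simp
  show "AE y in lborel. norm (heat \<epsilon> y * h (x + y)) \<le> norm ((2 * pi * \<epsilon>) powr (- real DIM('a) / 2) * h (y + x))"
    using heat_bound[OF assms(1), where 'a = 'a] heat_nonneg[of \<epsilon>, where 'a = 'a]
    by (intro always_eventually allI) (auto simp: abs_mult add.commute intro!: mult_right_mono)
  show "(\<lambda>y. heat \<epsilon> y * h (x + y)) \<in> borel_measurable lborel" by measurable
qed

lemma nn_integral_smooth_le:
  fixes h :: "'a::euclidean_space \<Rightarrow> real"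
  assumes \<epsilon>: "\<epsilon> > 0" and h: "integrable lborel h"
  shows "(\<integral>\<^sup>+x. ennreal \<bar>smooth \<epsilon> h x\<bar> \<partial>lborel) \<le> (\<integral>\<^sup>+x. ennreal \<bar>h x\<bar> \<partial>lborel)"
proof -
  have [measurable]: "h \<in> borel_measurable borel" using assms by auto
  have "(\<integral>\<^sup>+x. ennreal \<bar>smooth \<epsilon> h x\<bar> \<partial>lborel) \<le> (\<integral>\<^sup>+x. \<integral>\<^sup>+y. ennreal (heat \<epsilon> y) * ennreal \<bar>h (x + y)\<bar> \<partial>lborel \<partial>lborel)"
  proof (intro nn_integral_mono)
    fix x
    have "ennreal \<bar>smooth \<epsilon> h x\<bar> \<le> (\<integral>\<^sup>+y. ennreal (norm (heat \<epsilon> y * h (x + y))) \<partial>lborel)"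
      unfolding smooth_def using integral_norm_bound_ennreal[OF integrable_heat_mult[OF assms, of x]] by simp
    then show "ennreal \<bar>smooth \<epsilon> h x\<bar> \<le> (\<integral>\<^sup>+y. ennreal (heat \<epsilon> y) * ennreal \<bar>h (x + y)\<bar> \<partial>lborel)"
      by (simp add: abs_mult heat_nonneg ennreal_mult)
  qed
  also have "\<dots> = (\<integral>\<^sup>+y. \<integral>\<^sup>+x. ennreal (heat \<epsilon> y) * ennreal \<bar>h (x + y)\<bar> \<partial>lborel \<partial>lborel)"
    by (rule lborel_pair.Fubini'[symmetric]) measurable
  also have "\<dots> = (\<integral>\<^sup>+y. ennreal (heat \<epsilon> y) * (\<integral>\<^sup>+x. ennreal \<bar>h x\<bar> \<partial>lborel) \<partial>(lborel :: 'a measure))"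
    by (intro nn_integral_cong) (simp add: nn_integral_cmult nn_integral_lborel_shift[of "\<lambda>x. ennreal \<bar>h x\<bar>"])
  also have "\<dots> = (\<integral>\<^sup>+x. ennreal \<bar>h x\<bar> \<partial>lborel)"
    using \<epsilon> by (simp add: nn_integral_multc nn_integral_heat)
  finally show ?thesis .
qed

lemma integrable_smooth:
  assumes "\<epsilon> > 0" "integrable lborel h"
  shows "integrable lborel (smooth \<epsilon> h)"
proof -
  have [measurable]: "h \<in> borel_measurable borel" using assms by auto
  have "(\<integral>\<^sup>+x. ennreal (norm (smooth \<epsilon> h x)) \<partial>lborel) < \<infinity>"
    using order.strict_trans1[OF nn_integral_smooth_le[OF assms]] assms(2) by (simp add: integrable_iff_bounded)
  then show ?thesis by (simp add: integrable_iff_bounded)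
qed

lemma integral_smooth_le:
  assumes "\<epsilon> > 0" "integrable lborel h"
  shows "(LINT x|lborel. \<bar>smooth \<epsilon> h x\<bar>) \<le> (LINT x|lborel. \<bar>h x\<bar>)"
  using nn_integral_smooth_le[OF assms] integrable_smooth[OF assms] assms(2)
  by (simp add: nn_integral_eq_integral)

lemma heat_scale:
  assumes "\<epsilon> > 0"
  shows "sqrt \<epsilon> ^ DIM('a) * heat \<epsilon> (sqrt \<epsilon> *\<^sub>R v) = heat 1 (v :: 'a::euclidean_space)"
proof -
  have "sqrt \<epsilon> ^ DIM('a) = \<epsilon> powr (real DIM('a) / 2)"
    using assms by (simp add: powr_half_sqrt[symmetric] powr_realpow[symmetric] powr_powr)
  moreover have "(2 * pi * \<epsilon>) powr (- real DIM('a) / 2) = (2 * pi) powr (- real DIM('a) / 2) * \<epsilon> powr (- real DIM('a) / 2)"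
    using assms by (simp add: powr_mult)
  moreover have "\<epsilon> powr (real DIM('a) / 2) * \<epsilon> powr (- real DIM('a) / 2) = 1"
    using assms by (simp add: powr_add[symmetric])
  ultimately have "sqrt \<epsilon> ^ DIM('a) * (2 * pi * \<epsilon>) powr (- real DIM('a) / 2) = (2 * pi) powr (- real DIM('a) / 2)"
    by (simp only: mult.left_commute[of "\<epsilon> powr (real DIM('a) / 2)"] mult_1_right)
  moreover have "(norm (sqrt \<epsilon> *\<^sub>R v))\<^sup>2 / (2 * \<epsilon>) = (norm v)\<^sup>2 / (2 * 1)"
    using assms by (simp add: power_mult_distrib)
  ultimately show ?thesis unfolding heat_def by (simp add: mult.assoc[symmetric])
qed

text \<open>Moves \<epsilon> from the kernel into the argument of F, so that dominated convergence
  can work with the fixed weight \<open>heat 1\<close>.\<close>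

lemma nn_integral_heat_scale:
  fixes F :: "'a::euclidean_space \<Rightarrow> ennreal"
  assumes \<epsilon>: "\<epsilon> > 0" and [measurable]: "F \<in> borel_measurable borel"
  shows "(\<integral>\<^sup>+y. ennreal (heat \<epsilon> y) * F y \<partial>lborel) = (\<integral>\<^sup>+v. ennreal (heat 1 v) * F (sqrt \<epsilon> *\<^sub>R v) \<partial>lborel)"
proof -
  have "sqrt \<epsilon> \<noteq> 0" using \<epsilon> by simp
  from lborel_affine[OF this, of "0::'a"]
  have "(\<integral>\<^sup>+y. ennreal (heat \<epsilon> y) * F y \<partial>lborel) =
     (\<integral>\<^sup>+y. ennreal (heat \<epsilon> y) * F y \<partial>(density (distr lborel borel (\<lambda>x. sqrt \<epsilon> *\<^sub>R x)) (\<lambda>_. ennreal (sqrt \<epsilon> ^ DIM('a)))))"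
    using \<epsilon> by simp
  also have "\<dots> = (\<integral>\<^sup>+v. ennreal (sqrt \<epsilon> ^ DIM('a)) * (ennreal (heat \<epsilon> (sqrt \<epsilon> *\<^sub>R v)) * F (sqrt \<epsilon> *\<^sub>R v)) \<partial>lborel)"
    by (simp add: nn_integral_density nn_integral_distr)
  also have "\<dots> = (\<integral>\<^sup>+v. ennreal (heat 1 v) * F (sqrt \<epsilon> *\<^sub>R v) \<partial>lborel)"
    using \<epsilon> by (simp add: mult.assoc[symmetric] ennreal_mult[symmetric] heat_nonneg heat_scale)
  finally show ?thesis .
qed

text \<open>By Minkowski's inequality the L^1-error is at most the average, against the heat kernel,
  of the modulus w of continuity of translations. After rescaling, w is evaluated at points tending
  to 0 and stays below twice the norm of h.\<close>

lemma smooth_L1_tendsto: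
  fixes h :: "'a::euclidean_space \<Rightarrow> real"
  assumes h: "integrable lborel h" and e: "\<And>n. e n > 0" "e \<longlonglongrightarrow> 0"
  shows "(\<lambda>n. LINT x|lborel. \<bar>smooth (e n) h x - h x\<bar>) \<longlonglongrightarrow> 0"
proof -
  have [measurable]: "h \<in> borel_measurable borel" using h by auto
  define w where "w y = (LINT x|lborel. \<bar>h (x + y) - h x\<bar>)" for y
  have [measurable]: "w \<in> borel_measurable borel" unfolding w_def[abs_def] by measurable
  have w0: "0 \<le> w y" for y by (simp add: w_def)
  have wn: "(\<integral>\<^sup>+x. ennreal \<bar>h (x + y) - h x\<bar> \<partial>lborel) = ennreal (w y)" for y
    unfolding w_def using h integrable_lborel_shift[OF h, of y] by (intro nn_integral_eq_integral) auto
  define K where "K = 2 * (LINT x|lborel. \<bar>h x\<bar>)"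
  have wK: "w y \<le> K" for y
  proof -
    have "w y \<le> (LINT x|lborel. \<bar>h (x + y)\<bar> + \<bar>h x\<bar>)"
      unfolding w_def using h integrable_lborel_shift[OF h, of y] by (intro integral_mono) auto
    also have "\<dots> = (LINT x|lborel. \<bar>h (x + y)\<bar>) + (LINT x|lborel. \<bar>h x\<bar>)"
      using h integrable_lborel_shift[OF h, of y] by simp
    also have "(LINT x|lborel. \<bar>h (x + y)\<bar>) = (LINT x|lborel. \<bar>h x\<bar>)"
      by (rule integral_lborel_shift) simp
    finally show ?thesis by (simp add: K_def)
  qed
  have le: "ennreal (LINT x|lborel. \<bar>smooth (e n) h x - h x\<bar>) \<le> (\<integral>\<^sup>+v. ennreal (heat 1 v) * ennreal (w (sqrt (e n) *\<^sub>R v)) \<partial>lborel)" for n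
  proof -
    have "ennreal (LINT x|lborel. \<bar>smooth (e n) h x - h x\<bar>) = (\<integral>\<^sup>+x. ennreal \<bar>smooth (e n) h x - h x\<bar> \<partial>lborel)"
      using h integrable_smooth[OF e(1) h] by (intro nn_integral_eq_integral[symmetric]) auto
    also have "\<dots> \<le> (\<integral>\<^sup>+x. \<integral>\<^sup>+y. ennreal (heat (e n) y) * ennreal \<bar>h (x + y) - h x\<bar> \<partial>lborel \<partial>lborel)"
    proof (intro nn_integral_mono)
      fix x
      have i: "integrable lborel (\<lambda>y. heat (e n) y * h (x + y))" "integrable lborel (\<lambda>y. heat (e n) y * h x)"
        using integrable_heat_mult[OF e(1) h] integrable_heat[OF e(1)] by auto
      have "smooth (e n) h x - h x = (LINT y|lborel. heat (e n) y * h (x + y) - heat (e n) y * h x)"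
        using integral_heat[OF e(1)[of n], where 'a = 'a]
        by (subst Bochner_Integration.integral_diff[OF i]) (simp add: smooth_def)
      also have "\<dots> = (LINT y|lborel. heat (e n) y * (h (x + y) - h x))"
        by (simp add: right_diff_distrib)
      finally have "ennreal \<bar>smooth (e n) h x - h x\<bar> = ennreal (norm (LINT y|lborel. heat (e n) y * (h (x + y) - h x)))"
        by simp
      also have "\<dots> \<le> (\<integral>\<^sup>+y. ennreal (norm (heat (e n) y * (h (x + y) - h x))) \<partial>lborel)"
        using Bochner_Integration.integrable_diff[OF i]
        by (intro integral_norm_bound_ennreal) (simp add: right_diff_distrib)
      finally show "ennreal \<bar>smooth (e n) h x - h x\<bar> \<le> (\<integral>\<^sup>+y. ennreal (heat (e n) y) * ennreal \<bar>h (x + y) - h x\<bar> \<partial>lborel)"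
        by (simp add: abs_mult heat_nonneg ennreal_mult)
    qed
    also have "\<dots> = (\<integral>\<^sup>+y. \<integral>\<^sup>+x. ennreal (heat (e n) y) * ennreal \<bar>h (x + y) - h x\<bar> \<partial>lborel \<partial>lborel)"
      by (rule lborel_pair.Fubini'[symmetric]) measurable
    also have "\<dots> = (\<integral>\<^sup>+y. ennreal (heat (e n) y) * ennreal (w y) \<partial>lborel)"
      by (intro nn_integral_cong) (simp add: nn_integral_cmult wn)
    also have "\<dots> = (\<integral>\<^sup>+v. ennreal (heat 1 v) * ennreal (w (sqrt (e n) *\<^sub>R v)) \<partial>lborel)"
      by (rule nn_integral_heat_scale[OF e(1)]) measurable
    finally show ?thesis .
  qed
  have "(\<lambda>n. \<integral>\<^sup>+v. ennreal (heat 1 (v::'a)) * ennreal (w (sqrt (e n) *\<^sub>R v)) \<partial>lborel) \<longlonglongrightarrow> (\<integral>\<^sup>+v. 0 \<partial>(lborel :: 'a measure))"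
  proof (rule nn_integral_dominated_convergence[where w = "\<lambda>v. ennreal (heat 1 v) * ennreal K"])
    show "(\<integral>\<^sup>+v. ennreal (heat 1 (v::'a)) * ennreal K \<partial>lborel) < \<infinity>"
      by (simp add: nn_integral_multc nn_integral_heat)
    show "AE v in lborel. ennreal (heat 1 v) * ennreal (w (sqrt (e j) *\<^sub>R v)) \<le> ennreal (heat 1 v) * ennreal K" for j
      by (intro always_eventually allI mult_left_mono ennreal_leI wK) auto
    show "AE v in lborel. (\<lambda>n. ennreal (heat 1 v) * ennreal (w (sqrt (e n) *\<^sub>R v))) \<longlonglongrightarrow> 0"
    proof (intro always_eventually allI)
      fix v :: 'a
      have "(\<lambda>n. sqrt (e n) *\<^sub>R v) \<longlonglongrightarrow> sqrt 0 *\<^sub>R v" using e by (intro tendsto_intros)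
      then have "(\<lambda>n. w (sqrt (e n) *\<^sub>R v)) \<longlonglongrightarrow> 0"
        using L1_continuous_integrable[OF h] unfolding L1_continuous_def w_def by simp
      then have "(\<lambda>n. ennreal (heat 1 v * w (sqrt (e n) *\<^sub>R v))) \<longlonglongrightarrow> ennreal (heat 1 v * 0)"
        by (intro tendsto_intros)
      then show "(\<lambda>n. ennreal (heat 1 v) * ennreal (w (sqrt (e n) *\<^sub>R v))) \<longlonglongrightarrow> 0"
        by (simp add: ennreal_mult heat_nonneg w0)
    qed
  qed (auto simp: w0)
  then have "(\<lambda>n. \<integral>\<^sup>+v. ennreal (heat 1 (v::'a)) * ennreal (w (sqrt (e n) *\<^sub>R v)) \<partial>lborel) \<longlonglongrightarrow> 0" by simp
  then have "(\<lambda>n. ennreal (LINT x|lborel. \<bar>smooth (e n) h x - h x\<bar>)) \<longlonglongrightarrow> 0"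
    by (rule tendsto_sandwich[OF _ _ tendsto_const, rotated 2]) (auto simp: le)
  then have "(\<lambda>n. ennreal (LINT x|lborel. \<bar>smooth (e n) h x - h x\<bar>)) \<longlonglongrightarrow> ennreal 0" by simp
  then show ?thesis by (subst (asm) tendsto_ennreal_iff) auto
qed

lemma smooth_diff:
  assumes "\<epsilon> > 0" "integrable lborel g" "integrable lborel h"
  shows "smooth \<epsilon> (\<lambda>x. g x - h x) x = smooth \<epsilon> g x - smooth \<epsilon> h x"
  unfolding smooth_def using integrable_heat_mult[OF assms(1,2), of x] integrable_heat_mult[OF assms(1,3), of x]
  by (simp add: right_diff_distrib)

lemma smooth_nonneg: "(\<And>x. 0 \<le> h x) \<Longrightarrow> 0 \<le> smooth \<epsilon> h x"
  unfolding smooth_def by (intro Bochner_Integration.integral_nonneg mult_nonneg_nonneg heat_nonneg)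

lemma smooth_AE_subseq:
  fixes h :: "'a::euclidean_space \<Rightarrow> real"
  assumes h: "integrable lborel h" and e: "\<And>n. e n > 0" "e \<longlonglongrightarrow> 0"
  obtains r where "strict_mono r" "AE x in lborel. (\<lambda>n. smooth (e (r n)) h x) \<longlonglongrightarrow> h x"
proof -
  have "\<exists>r. strict_mono r \<and> (AE x in lborel. (\<lambda>n. smooth (e (r n)) h x - h x) \<longlonglongrightarrow> 0)"
    using smooth_L1_tendsto[OF assms] integrable_smooth[OF e(1) h] h
    by (intro tendsto_L1_AE_subseq) auto
  then show ?thesis using that by (auto simp: LIM_zero_iff)
qed

text \<open>Two smoothings occur because a field built from the mollified noise is tested against
  the mollified noise again. Writing the error as the smoothed error of one smoothing plus that
  error itself, contractivity in L^1 gives the factor 2.\<close>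

lemma smooth_smooth_AE_subseq:
  fixes h :: "'a::euclidean_space \<Rightarrow> real"
  assumes h: "integrable lborel h" and e: "\<And>n. e n > 0" "e \<longlonglongrightarrow> 0"
  obtains r where "strict_mono r" "AE x in lborel. (\<lambda>n. smooth (e (r n)) (smooth (e (r n)) h) x) \<longlonglongrightarrow> h x"
proof -
  note S = integrable_smooth[OF e(1) h]
  have "(\<lambda>n. LINT x|lborel. norm (smooth (e n) (smooth (e n) h) x - h x)) \<longlonglongrightarrow> 0"
  proof (rule tendsto_sandwich[OF _ _ tendsto_const])
    show "(\<lambda>n. 2 * (LINT x|lborel. \<bar>smooth (e n) h x - h x\<bar>)) \<longlonglongrightarrow> 0"
      using tendsto_mult[OF tendsto_const[of 2] smooth_L1_tendsto[OF assms]] by simp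
    show "\<forall>\<^sub>F n in sequentially. (LINT x|lborel. norm (smooth (e n) (smooth (e n) h) x - h x)) \<le> 2 * (LINT x|lborel. \<bar>smooth (e n) h x - h x\<bar>)"
    proof (intro always_eventually allI)
      fix n
      have D: "integrable lborel (\<lambda>x. smooth (e n) h x - h x)" using S[of n] h by simp
      have "(LINT x|lborel. norm (smooth (e n) (smooth (e n) h) x - h x)) \<le>
        (LINT x|lborel. \<bar>smooth (e n) (\<lambda>x. smooth (e n) h x - h x) x\<bar> + \<bar>smooth (e n) h x - h x\<bar>)"
        using integrable_smooth[OF e(1)[of n] D] integrable_smooth[OF e(1)[of n] S[of n]] S[of n] D h
        by (intro integral_mono Bochner_Integration.integrable_add integrable_abs integrable_norm Bochner_Integration.integrable_diff)
          (auto simp: smooth_diff[OF e(1) S h])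
      also have "\<dots> = (LINT x|lborel. \<bar>smooth (e n) (\<lambda>x. smooth (e n) h x - h x) x\<bar>) + (LINT x|lborel. \<bar>smooth (e n) h x - h x\<bar>)"
        using integrable_smooth[OF e(1) D] D by (intro Bochner_Integration.integral_add) auto
      also have "\<dots> \<le> 2 * (LINT x|lborel. \<bar>smooth (e n) h x - h x\<bar>)"
        using integral_smooth_le[OF e(1) D] by simp
      finally show "(LINT x|lborel. norm (smooth (e n) (smooth (e n) h) x - h x)) \<le> 2 * (LINT x|lborel. \<bar>smooth (e n) h x - h x\<bar>)" .
    qed
  qed simp
  moreover have "integrable lborel (\<lambda>x. smooth (e n) (smooth (e n) h) x - h x)" for n
    using integrable_smooth[OF e(1) S[of n]] h by simp
  ultimately have "\<exists>r. strict_mono r \<and> (AE x in lborel. (\<lambda>n. smooth (e (r n)) (smooth (e (r n)) h) x - h x) \<longlonglongrightarrow> 0)"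
    by (intro tendsto_L1_AE_subseq)
  then show ?thesis using that by (auto simp: LIM_zero_iff)
qed

text \<open>Products of several smoothed functions converge almost everywhere only along a
  subsequence common to all factors.\<close>

lemma smooth_AE_subseq_finite:
  fixes h :: "'i \<Rightarrow> 'a::euclidean_space \<Rightarrow> real"
  assumes I: "finite I" and h: "\<And>i. i \<in> I \<Longrightarrow> integrable lborel (h i)" and e: "\<And>n. e n > 0" "e \<longlonglongrightarrow> 0"
  shows "\<exists>r. strict_mono r \<and> (\<forall>i\<in>I. (AE x in lborel. (\<lambda>n. smooth (e (r n)) (h i) x) \<longlonglongrightarrow> h i x) \<and>
     (AE x in lborel. (\<lambda>n. smooth (e (r n)) (smooth (e (r n)) (h i)) x) \<longlonglongrightarrow> h i x))"
  using I h
proof (induction I rule: finite_induct)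
  case empty
  show ?case by (intro exI[of _ id]) (auto simp: strict_mono_id)
next
  case (insert j I)
  then obtain r where r: "strict_mono r"
    "\<And>i. i \<in> I \<Longrightarrow> AE x in lborel. (\<lambda>n. smooth (e (r n)) (h i) x) \<longlonglongrightarrow> h i x"
    "\<And>i. i \<in> I \<Longrightarrow> AE x in lborel. (\<lambda>n. smooth (e (r n)) (smooth (e (r n)) (h i)) x) \<longlonglongrightarrow> h i x"
    by auto
  have j: "integrable lborel (h j)" using insert.prems by auto
  have er: "(\<lambda>n. e (r n)) \<longlonglongrightarrow> 0" using LIMSEQ_subseq_LIMSEQ[OF e(2) r(1)] by (simp add: o_def)
  obtain r' where r': "strict_mono r'" "AE x in lborel. (\<lambda>n. smooth (e (r (r' n))) (h j) x) \<longlonglongrightarrow> h j x"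
    using smooth_AE_subseq[of "h j" "\<lambda>n. e (r n)"] j e(1) er by blast
  have er': "(\<lambda>n. e (r (r' n))) \<longlonglongrightarrow> 0" using LIMSEQ_subseq_LIMSEQ[OF er r'(1)] by (simp add: o_def)
  obtain q where q: "strict_mono q"
    "AE x in lborel. (\<lambda>n. smooth (e (r (r' (q n)))) (smooth (e (r (r' (q n)))) (h j)) x) \<longlonglongrightarrow> h j x"
    using smooth_smooth_AE_subseq[of "h j" "\<lambda>n. e (r (r' n))"] j e(1) er' by blast
  have sub: "AE x in lborel. (\<lambda>n. F (p (q' n)) x) \<longlonglongrightarrow> L x" if "AE x in lborel. (\<lambda>n. F (p n) x) \<longlonglongrightarrow> L x" "strict_mono q'"
    for F :: "nat \<Rightarrow> 'a \<Rightarrow> real" and p q' :: "nat \<Rightarrow> nat" and L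
    using that(1) by eventually_elim (use LIMSEQ_subseq_LIMSEQ[OF _ that(2)] in \<open>auto simp: o_def\<close>)
  have rq: "strict_mono (\<lambda>n. r' (q n))" using r'(1) q(1) by (simp add: strict_mono_def)
  show ?case
  proof (intro exI[of _ "\<lambda>n. r (r' (q n))"] conjI ballI)
    show "strict_mono (\<lambda>n. r (r' (q n)))" using r(1) rq by (simp add: strict_mono_def)
    fix i assume i: "i \<in> insert j I"
    show "AE x in lborel. (\<lambda>n. smooth (e (r (r' (q n)))) (h i) x) \<longlonglongrightarrow> h i x"
      using sub[of "\<lambda>m. smooth (e m) (h j)" "\<lambda>n. r (r' n)" "h j" q] r'(2) q(1)
        sub[of "\<lambda>m. smooth (e m) (h i)" r "h i" "\<lambda>n. r' (q n)"] r(2)[of i] rq i by auto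
    show "AE x in lborel. (\<lambda>n. smooth (e (r (r' (q n)))) (smooth (e (r (r' (q n)))) (h i)) x) \<longlonglongrightarrow> h i x"
      using q(2) sub[of "\<lambda>m. smooth (e m) (smooth (e m) (h i))" r "h i" "\<lambda>n. r' (q n)"] r(3)[of i] rq i by auto
  qed
qed

text \<open>The working class of test functions: it contains truncations and heat kernels, is
  preserved by smoothing with uniform constants, and is integrable against every tempered
  measure.\<close>

definition exp_decay :: "('a::euclidean_space \<Rightarrow> real) \<Rightarrow> bool" where
  "exp_decay h \<longleftrightarrow> h \<in> borel_measurable borel \<and> (\<exists>C. \<forall>x. \<bar>h x\<bar> \<le> C * exp (- norm x))"

lemma exp_decay_measurable: "exp_decay h \<Longrightarrow> h \<in> borel_measurable borel"
  by (simp add: exp_decay_def)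

lemma exp_decay_bound:
  assumes "exp_decay h"
  obtains C where "C \<ge> 0" "\<And>x. \<bar>h x\<bar> \<le> C * exp (- norm x)"
proof -
  obtain C where C: "\<And>x. \<bar>h x\<bar> \<le> C * exp (- norm x)" using assms by (auto simp: exp_decay_def)
  have "0 \<le> C" using order.trans[OF abs_ge_zero C[of 0]] by simp
  then show ?thesis using C that by blast
qed

lemma exp_decay_integrable:
  fixes h :: "'a::euclidean_space \<Rightarrow> real"
  assumes "exp_decay h" shows "integrable lborel h"
proof -
  obtain C where C: "\<And>x. \<bar>h x\<bar> \<le> C * exp (- norm x)" using exp_decay_bound[OF assms] by blast
  show ?thesis
  proof (rule Bochner_Integration.integrable_bound)
    show "integrable lborel (\<lambda>x::'a. C * exp (- norm x))"
      using integrable_exp_norm[of 1, where 'a = 'a] by simp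
    show "AE x in lborel. norm (h x) \<le> norm (C * exp (- norm x))"
      using C by (intro always_eventually allI) (auto intro: order.trans[OF _ abs_ge_self])
  qed (use exp_decay_measurable[OF assms] in simp)
qed

text \<open>From exp (- norm (x + y)) \<le> exp (- norm x) exp (norm y), averaged against the heat
  kernel; hence the constant of \<open>nn_integral_heat_exp_norm_le\<close>.\<close>

lemma smooth_le_exp_norm:
  fixes h :: "'a::euclidean_space \<Rightarrow> real"
  assumes \<epsilon>: "0 < \<epsilon>" "\<epsilon> \<le> 1" and [measurable]: "h \<in> borel_measurable borel"
    and C: "\<And>x. \<bar>h x\<bar> \<le> C * exp (- norm x)"
  shows "\<bar>smooth \<epsilon> h x\<bar> \<le> (C * 6 ^ DIM('a)) * exp (- norm x)"
proof -
  have C0: "0 \<le> C" using order.trans[OF abs_ge_zero C[of 0]] by simp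
  have "exp_decay h" unfolding exp_decay_def using C by auto
  note i = integrable_heat_mult[OF \<epsilon>(1) exp_decay_integrable[OF this], of x]
  have "ennreal \<bar>smooth \<epsilon> h x\<bar> \<le> (\<integral>\<^sup>+y. ennreal (norm (heat \<epsilon> y * h (x + y))) \<partial>lborel)"
    unfolding smooth_def using integral_norm_bound_ennreal[OF i] by simp
  also have "\<dots> \<le> (\<integral>\<^sup>+y. ennreal (C * exp (- norm x)) * ennreal (heat \<epsilon> y * exp (norm (y::'a))) \<partial>lborel)"
  proof (intro nn_integral_mono)
    fix y :: 'a
    have "\<bar>h (x + y)\<bar> \<le> C * exp (- norm (x + y))" by (rule C)
    also have "\<dots> \<le> C * exp (- norm x + norm y)"
      using norm_triangle_ineq4[of "x + y" y] C0 by (intro mult_left_mono) auto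
    finally have "heat \<epsilon> y * \<bar>h (x + y)\<bar> \<le> heat \<epsilon> y * (C * exp (- norm x + norm y))"
      by (intro mult_left_mono heat_nonneg)
    also have "\<dots> = (C * exp (- norm x)) * (heat \<epsilon> y * exp (norm y))"
      by (simp only: exp_add mult_ac)
    finally have "norm (heat \<epsilon> y * h (x + y)) \<le> (C * exp (- norm x)) * (heat \<epsilon> y * exp (norm y))"
      by (simp add: abs_mult heat_nonneg)
    then show "ennreal (norm (heat \<epsilon> y * h (x + y))) \<le> ennreal (C * exp (- norm x)) * ennreal (heat \<epsilon> y * exp (norm y))"
      using C0 by (subst ennreal_mult[symmetric]) (auto simp: heat_nonneg intro!: ennreal_leI)
  qed
  also have "\<dots> = ennreal (C * exp (- norm x)) * (\<integral>\<^sup>+y. ennreal (heat \<epsilon> y * exp (norm (y::'a))) \<partial>lborel)"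
    by (rule nn_integral_cmult) measurable
  also have "\<dots> \<le> ennreal (C * exp (- norm x)) * ennreal (6 ^ DIM('a))"
    by (intro mult_left_mono nn_integral_heat_exp_norm_le \<epsilon>) auto
  also have "\<dots> = ennreal (C * exp (- norm x) * 6 ^ DIM('a))"
    using C0 by (simp add: ennreal_mult)
  finally have "\<bar>smooth \<epsilon> h x\<bar> \<le> C * exp (- norm x) * 6 ^ DIM('a)"
    using C0 by (subst (asm) ennreal_le_iff) auto
  then show ?thesis by (simp add: mult_ac)
qed

lemma exp_decay_smooth: "exp_decay h \<Longrightarrow> 0 < \<epsilon> \<Longrightarrow> \<epsilon> \<le> 1 \<Longrightarrow> exp_decay (smooth \<epsilon> h)"
  using smooth_le_exp_norm[of \<epsilon> h] unfolding exp_decay_def by (metis borel_measurable_smooth)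

lemma exp_decay_heat: "\<epsilon> > 0 \<Longrightarrow> exp_decay (\<lambda>y. heat \<epsilon> (y - (x::'a::euclidean_space)))"
  unfolding exp_decay_def using heat_le_exp_norm[of \<epsilon> _ x]
  by (auto simp: heat_nonneg intro!: exI[of _ "(2 * pi * \<epsilon>) powr (- real DIM('a) / 2) * exp (\<epsilon> / 2 + norm x)"])

lemma smooth_eq_convolution:
  fixes g :: "'a::euclidean_space \<Rightarrow> real"
  assumes \<epsilon>: "\<epsilon> > 0" and g: "integrable lborel g"
  shows "integrable lborel (\<lambda>w. g w * heat \<epsilon> (u - w))" "(LINT w|lborel. g w * heat \<epsilon> (u - w)) = smooth \<epsilon> g u"
proof -
  have [measurable]: "g \<in> borel_measurable borel" using g by auto
  have eq: "g w * heat \<epsilon> (u - w) = heat \<epsilon> (w + - u) * g (u + (w + - u))" for w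
    using heat_minus[of \<epsilon> "w - u"] by simp
  show "integrable lborel (\<lambda>w. g w * heat \<epsilon> (u - w))"
    unfolding eq by (rule integrable_lborel_shift[OF integrable_heat_mult[OF \<epsilon> g, of u]])
  show "(LINT w|lborel. g w * heat \<epsilon> (u - w)) = smooth \<epsilon> g u"
    unfolding eq smooth_def by (rule integral_lborel_shift[of "\<lambda>y. heat \<epsilon> y * g (u + y)" "- u"]) measurable
qed

section \<open>The heat kernel is a Schwartz function\<close>

lemma real_polynomial_function_derivative:
  fixes P :: "'a::real_normed_vector \<Rightarrow> real"
  assumes "real_polynomial_function P"
  shows "\<exists>Q. real_polynomial_function Q \<and> (\<forall>x. \<exists>D. (P has_derivative D) (at x) \<and> D b = Q x)"
  using assms
proof (induction P rule: real_polynomial_function.induct)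
  case (linear f)
  then show ?case
    by (intro exI[of _ "\<lambda>_. f b"] conjI real_polynomial_function.intros(2) allI exI[of _ f])
      (auto intro: bounded_linear_imp_has_derivative)
next
  case (const c)
  then show ?case
    by (intro exI[of _ "\<lambda>_. 0"] conjI real_polynomial_function.intros(2) allI exI[of _ "\<lambda>_. 0"]) auto
next
  case (add f g)
  then obtain F G where FG: "real_polynomial_function F" "real_polynomial_function G"
    "\<And>x. \<exists>D. (f has_derivative D) (at x) \<and> D b = F x" "\<And>x. \<exists>D. (g has_derivative D) (at x) \<and> D b = G x"
    by blast
  show ?case
  proof (rule exI[of _ "\<lambda>x. F x + G x"], rule conjI, rule_tac [2] allI)
    show "real_polynomial_function (\<lambda>x. F x + G x)" by (intro real_polynomial_function.intros(3) FG)
    fix x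
    obtain D E where "(f has_derivative D) (at x)" "D b = F x" "(g has_derivative E) (at x)" "E b = G x"
      using FG(3,4)[of x] by blast
    then show "\<exists>D. ((\<lambda>x. f x + g x) has_derivative D) (at x) \<and> D b = F x + G x"
      by (intro exI[of _ "\<lambda>h. D h + E h"]) (auto intro: derivative_intros)
  qed
next
  case (mult f g)
  then obtain F G where FG: "real_polynomial_function F" "real_polynomial_function G"
    "\<And>x. \<exists>D. (f has_derivative D) (at x) \<and> D b = F x" "\<And>x. \<exists>D. (g has_derivative D) (at x) \<and> D b = G x"
    by blast
  show ?case
  proof (rule exI[of _ "\<lambda>x. f x * G x + F x * g x"], rule conjI, rule_tac [2] allI)
    show "real_polynomial_function (\<lambda>x. f x * G x + F x * g x)"
      by (intro real_polynomial_function.intros(3,4) FG mult.hyps)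
    fix x
    obtain D E where "(f has_derivative D) (at x)" "D b = F x" "(g has_derivative E) (at x)" "E b = G x"
      using FG(3,4)[of x] by blast
    then show "\<exists>D. ((\<lambda>x. f x * g x) has_derivative D) (at x) \<and> D b = f x * G x + F x * g x"
      by (intro exI[of _ "\<lambda>h. f x * E h + D h * g x"]) (auto intro: derivative_intros)
  qed
qed

lemma real_polynomial_function_growth:
  fixes P :: "'a::real_normed_vector \<Rightarrow> real"
  assumes "real_polynomial_function P"
  shows "\<exists>C m. C \<ge> 0 \<and> (\<forall>x. \<bar>P x\<bar> \<le> C * (1 + norm x) ^ m)"
  using assms
proof (induction P rule: real_polynomial_function.induct)
  case (linear f)
  then obtain K where K: "K \<ge> 0" "\<And>x. norm (f x) \<le> norm x * K" using bounded_linear.nonneg_bounded by blast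
  have "\<bar>f x\<bar> \<le> K * (1 + norm x) ^ 1" for x
  proof -
    have "\<bar>f x\<bar> \<le> K * norm x" using K(2)[of x] by (simp add: mult.commute)
    also have "\<dots> \<le> K * (1 + norm x)" using K(1) by (intro mult_left_mono) auto
    finally show ?thesis by simp
  qed
  then show ?case using K(1) by blast
next
  case (const c)
  show ?case by (intro exI[of _ "\<bar>c\<bar>"] exI[of _ 0]) auto
next
  case (add f g)
  then obtain A m B n where *: "A \<ge> 0" "\<And>x. \<bar>f x\<bar> \<le> A * (1 + norm x) ^ m" "B \<ge> 0" "\<And>x. \<bar>g x\<bar> \<le> B * (1 + norm x) ^ n"
    by blast
  have "\<bar>f x + g x\<bar> \<le> (A + B) * (1 + norm x) ^ (m + n)" for x
  proof -
    have "A * (1 + norm x) ^ m \<le> A * (1 + norm x) ^ (m + n)" "B * (1 + norm x) ^ n \<le> B * (1 + norm x) ^ (m + n)"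
      using * by (intro mult_left_mono power_increasing; simp)+
    then show ?thesis using *(2,4)[of x] by (simp add: distrib_right)
  qed
  then show ?case using * by (intro exI[of _ "A + B"] exI[of _ "m + n"]) auto
next
  case (mult f g)
  then obtain A m B n where *: "A \<ge> 0" "\<And>x. \<bar>f x\<bar> \<le> A * (1 + norm x) ^ m" "B \<ge> 0" "\<And>x. \<bar>g x\<bar> \<le> B * (1 + norm x) ^ n"
    by blast
  have "\<bar>f x * g x\<bar> \<le> (A * B) * (1 + norm x) ^ (m + n)" for x
  proof -
    have "\<bar>f x\<bar> * \<bar>g x\<bar> \<le> (A * (1 + norm x) ^ m) * (B * (1 + norm x) ^ n)"
      using * by (intro mult_mono) auto
    then show ?thesis by (simp add: abs_mult power_add mult_ac)
  qed
  then show ?case using * by (intro exI[of _ "A * B"] exI[of _ "m + n"]) auto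
qed

lemma power_le_exp: "0 \<le> r \<Longrightarrow> r ^ n \<le> real n ^ n * exp r" for r :: real
proof (cases "n = 0")
  case False
  assume r: "0 \<le> r"
  have "r / n \<le> exp (r / n)" using exp_ge_add_one_self[of "r / n"] by linarith
  then have "(r / n) ^ n \<le> exp (r / n) ^ n" using r by (intro power_mono) auto
  also have "\<dots> = exp r" using False by (simp add: exp_of_nat_mult[symmetric])
  finally show ?thesis using False by (simp add: power_divide field_simps)
qed simp

lemma has_derivative_heat:
  assumes "\<epsilon> > 0"
  shows "((\<lambda>y. heat \<epsilon> (y - x)) has_derivative (\<lambda>h. heat \<epsilon> (y - x) * (- ((y - x) \<bullet> h) / \<epsilon>))) (at y)"
proof -
  have "((\<lambda>y. (2 * pi * \<epsilon>) powr (- real DIM('a) / 2) * exp (- ((y - x) \<bullet> (y - x)) / (2 * \<epsilon>))) has_derivative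
    (\<lambda>h. (2 * pi * \<epsilon>) powr (- real DIM('a) / 2) * (exp (- ((y - x) \<bullet> (y - x)) / (2 * \<epsilon>)) * (- ((y - x) \<bullet> h) / \<epsilon>)))) (at y)"
    using assms by (auto intro!: derivative_eq_intros simp: inner_commute field_simps)
  then show ?thesis by (simp add: heat_def[abs_def] power2_norm_eq_inner mult.assoc)
qed

text \<open>Polynomials times the heat kernel form a class closed under differentiation, and every
  member decays faster than any power.\<close>

lemma partials_heat:
  fixes x :: "'a::euclidean_space"
  assumes \<epsilon>: "\<epsilon> > 0"
  shows "\<exists>P. real_polynomial_function P \<and> partials bs (\<lambda>y. heat \<epsilon> (y - x)) = (\<lambda>y. P y * heat \<epsilon> (y - x))"
proof (induction bs)
  case Nil
  show ?case by (intro exI[of _ "\<lambda>_. 1"] conjI real_polynomial_function.intros(2)) auto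
next
  case (Cons b bs)
  then obtain P where P: "real_polynomial_function P" "partials bs (\<lambda>y. heat \<epsilon> (y - x)) = (\<lambda>y. P y * heat \<epsilon> (y - x))"
    by blast
  obtain Q where Q: "real_polynomial_function Q" "\<And>y. \<exists>D. (P has_derivative D) (at y) \<and> D b = Q y"
    using real_polynomial_function_derivative[OF P(1)] by blast
  \<comment> \<open>The product rule: the heat kernel contributes its logarithmic derivative, the
    inner product of - (y - x) / \<epsilon> with \<open>b\<close>.\<close>
  define R where "R y = Q y + P y * ((- 1 / \<epsilon>) * (y \<bullet> b + - (x \<bullet> b)))" for y
  have "real_polynomial_function R"
    unfolding R_def[abs_def]
    by (intro real_polynomial_function.intros(3) real_polynomial_function.intros(4) real_polynomial_function.intros(2) P Q
      real_polynomial_function.intros(1) bounded_linear_inner_left)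
  moreover have "partials (b # bs) (\<lambda>y. heat \<epsilon> (y - x)) = (\<lambda>y. R y * heat \<epsilon> (y - x))"
  proof
    fix y
    obtain D where D: "(P has_derivative D) (at y)" "D b = Q y" using Q(2) by blast
    have "((\<lambda>y. P y * heat \<epsilon> (y - x)) has_derivative (\<lambda>h. P y * (heat \<epsilon> (y - x) * (- ((y - x) \<bullet> h) / \<epsilon>)) + D h * heat \<epsilon> (y - x))) (at y)"
      by (intro has_derivative_mult D has_derivative_heat \<epsilon>)
    then have "frechet_derivative (\<lambda>y. P y * heat \<epsilon> (y - x)) (at y) = (\<lambda>h. P y * (heat \<epsilon> (y - x) * (- ((y - x) \<bullet> h) / \<epsilon>)) + D h * heat \<epsilon> (y - x))"
      by (rule frechet_derivative_at[symmetric])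
    then show "partials (b # bs) (\<lambda>y. heat \<epsilon> (y - x)) y = R y * heat \<epsilon> (y - x)"
      using \<epsilon> by (simp add: P(2) D(2) R_def inner_diff_left field_simps)
  qed
  ultimately show ?case by blast
qed

lemma schwartz_heat:
  fixes x :: "'a::euclidean_space"
  assumes \<epsilon>: "\<epsilon> > 0"
  shows "schwartz (\<lambda>y. heat \<epsilon> (y - x))"
  unfolding schwartz_def
proof (intro allI impI conjI)
  fix bs :: "'a list"
  obtain P where P: "real_polynomial_function P" "partials bs (\<lambda>y. heat \<epsilon> (y - x)) = (\<lambda>y. P y * heat \<epsilon> (y - x))"
    using partials_heat[OF \<epsilon>] by blast
  show "partials bs (\<lambda>y. heat \<epsilon> (y - x)) differentiable at y" for y
  proof -
    obtain D where D: "(P has_derivative D) (at y)" using real_polynomial_function_derivative[OF P(1)] by blast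
    show ?thesis unfolding P(2) using has_derivative_mult[OF D has_derivative_heat[OF \<epsilon>, of x y]]
      by (rule differentiableI)
  qed
  fix k :: nat
  obtain C m where C: "C \<ge> 0" "\<And>y. \<bar>P y\<bar> \<le> C * (1 + norm y) ^ m"
    using real_polynomial_function_growth[OF P(1)] by blast
  define H where "H = (2 * pi * \<epsilon>) powr (- real DIM('a) / 2) * exp (\<epsilon> / 2 + norm x)"
  have H: "H \<ge> 0" "\<And>y. heat \<epsilon> (y - x) \<le> H * exp (- norm y)" using heat_le_exp_norm[OF \<epsilon>, of _ x] by (auto simp: H_def)
  have "\<bar>norm y ^ k * (P y * heat \<epsilon> (y - x))\<bar> \<le> C * H * (real (k + m) ^ (k + m) * exp 1)" for y
  proof -
    have "\<bar>norm y ^ k * (P y * heat \<epsilon> (y - x))\<bar> = norm y ^ k * (\<bar>P y\<bar> * heat \<epsilon> (y - x))"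
      by (simp add: abs_mult heat_nonneg)
    also have "\<dots> \<le> (1 + norm y) ^ k * ((C * (1 + norm y) ^ m) * (H * exp (- norm y)))"
      using C H heat_nonneg by (intro mult_mono power_mono) auto
    also have "\<dots> = C * H * ((1 + norm y) ^ (k + m) * exp (- norm y))"
      by (simp add: power_add mult_ac)
    also have "\<dots> \<le> C * H * ((real (k + m) ^ (k + m) * exp (1 + norm y)) * exp (- norm y))"
      using C H by (intro mult_left_mono mult_right_mono power_le_exp) auto
    also have "\<dots> = C * H * (real (k + m) ^ (k + m) * exp 1)"
      by (simp only: mult.assoc mult_exp_exp) simp
    finally show ?thesis .
  qed
  then show "bounded (range (\<lambda>y. norm y ^ k * partials bs (\<lambda>y. heat \<epsilon> (y - x)) y))"
    unfolding P(2) bounded_iff by auto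
qed

section \<open>Fields of the noise\<close>

lemma (in pair_sigma_finite) integrable_pair_bound:
  fixes f :: "'a \<times> 'b \<Rightarrow> real"
  assumes [measurable]: "f \<in> borel_measurable (M1 \<Otimes>\<^sub>M M2)"
    and b: "integrable M1 b" and le: "\<And>x. x \<in> space M1 \<Longrightarrow> (\<integral>\<^sup>+y. ennreal \<bar>f (x, y)\<bar> \<partial>M2) \<le> ennreal (b x)"
  shows "integrable (M1 \<Otimes>\<^sub>M M2) f"
proof (rule integrableI_bounded)
  have "(\<integral>\<^sup>+p. ennreal (norm (f p)) \<partial>(M1 \<Otimes>\<^sub>M M2)) = (\<integral>\<^sup>+x. \<integral>\<^sup>+y. ennreal \<bar>f (x, y)\<bar> \<partial>M2 \<partial>M1)"
    by (subst M2.nn_integral_fst[symmetric]) auto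
  also have "\<dots> \<le> (\<integral>\<^sup>+x. ennreal (norm (b x)) \<partial>M1)"
    by (intro nn_integral_mono order.trans[OF le] ennreal_leI) auto
  also have "\<dots> < \<infinity>" using b by (simp add: integrable_iff_bounded)
  finally show "(\<integral>\<^sup>+p. ennreal (norm (f p)) \<partial>(M1 \<Otimes>\<^sub>M M2)) < \<infinity>" .
qed fact

lemma (in pair_sigma_finite) integrable_mult_pair:
  fixes f :: "'a \<Rightarrow> real" and g :: "'b \<Rightarrow> real"
  assumes f: "integrable M1 f" and g: "integrable M2 g"
  shows "integrable (M1 \<Otimes>\<^sub>M M2) (\<lambda>(x, y). f x * g y)"
proof (rule integrable_pair_bound)
  have [measurable]: "f \<in> borel_measurable M1" "g \<in> borel_measurable M2" using f g by auto
  show "(\<lambda>(x, y). f x * g y) \<in> borel_measurable (M1 \<Otimes>\<^sub>M M2)" by measurable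
  show "integrable M1 (\<lambda>x. \<bar>f x\<bar> * (LINT y|M2. \<bar>g y\<bar>))" using f by simp
  show "(\<integral>\<^sup>+y. ennreal \<bar>case (x, y) of (x, y) \<Rightarrow> f x * g y\<bar> \<partial>M2) \<le> ennreal (\<bar>f x\<bar> * (LINT y|M2. \<bar>g y\<bar>))" for x
  proof -
    have "(\<integral>\<^sup>+y. ennreal \<bar>f x * g y\<bar> \<partial>M2) = ennreal (LINT y|M2. \<bar>f x * g y\<bar>)"
      using g by (intro nn_integral_eq_integral) auto
    then show ?thesis by (simp add: abs_mult)
  qed
qed

lemma tempered_measure_exp_integrable:
  fixes \<Gamma> :: "'a::euclidean_space measure"
  assumes "tempered_measure \<Gamma>" "c > 0"
  shows "integrable \<Gamma> (\<lambda>z. exp (- c * norm z))"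
proof -
  obtain k where k: "(\<integral>\<^sup>+x. ennreal (inverse ((1 + norm x) ^ k)) \<partial>\<Gamma>) < \<infinity>" and [measurable_cong]: "sets \<Gamma> = sets borel"
    using assms(1) by (auto simp: tempered_measure_def)
  \<comment> \<open>From r^k \<le> k^k exp r at r = c (1 + norm z); the extra 1 in r costs the
    factor exp c.\<close>
  define K where "K = real k ^ k * exp c / c ^ k"
  have K: "K \<ge> 0" using assms(2) by (simp add: K_def)
  have le: "exp (- c * norm z) \<le> K * inverse ((1 + norm z) ^ k)" for z :: 'a
  proof -
    have "(c * (1 + norm z)) ^ k \<le> real k ^ k * exp (c * (1 + norm z))"
      using assms(2) by (intro power_le_exp) auto
    then have "(c * (1 + norm z)) ^ k * exp (- c * norm z) \<le> real k ^ k * exp (c * (1 + norm z)) * exp (- c * norm z)"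
      by (intro mult_right_mono) auto
    also have "\<dots> = real k ^ k * exp c"
      by (simp only: mult.assoc mult_exp_exp) (simp add: algebra_simps)
    finally have *: "c ^ k * ((1 + norm z) ^ k * exp (- c * norm z)) \<le> real k ^ k * exp c"
      by (simp add: power_mult_distrib mult.assoc)
    have p: "0 < c ^ k" "0 < (1 + norm z) ^ k" using assms(2) by (auto intro!: zero_less_power add_pos_nonneg)
    have "(1 + norm z) ^ k * exp (- c * norm z) \<le> K"
      using * p(1) by (simp add: K_def pos_le_divide_eq mult.commute)
    then show ?thesis using p(2) by (simp add: divide_inverse[symmetric] pos_le_divide_eq mult.commute)
  qed
  have "integrable \<Gamma> (\<lambda>x. inverse ((1 + norm x) ^ k))"
    using k by (intro integrableI_nonneg) (auto intro!: zero_le_power add_nonneg_nonneg)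
  then have "integrable \<Gamma> (\<lambda>x. K * inverse ((1 + norm x) ^ k))" by simp
  then show ?thesis
    by (rule Bochner_Integration.integrable_bound)
      (use le in \<open>auto intro: order.trans[OF _ abs_ge_self]\<close>)
qed

lemma tempered_measure_sigma_finite:
  fixes \<Gamma> :: "'a::euclidean_space measure"
  assumes "tempered_measure \<Gamma>"
  shows "sigma_finite_measure \<Gamma>"
proof
  have sets [measurable_cong]: "sets \<Gamma> = sets borel" using assms by (simp add: tempered_measure_def)
  have space: "space \<Gamma> = UNIV" using sets_eq_imp_space_eq[OF sets] by simp
  have "emeasure \<Gamma> (ball 0 (real n)) < \<infinity>" for n
  proof -
    have "emeasure \<Gamma> (ball 0 (real n)) = (\<integral>\<^sup>+x. indicator (ball 0 (real n)) x \<partial>\<Gamma>)" by simp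
    also have "\<dots> \<le> (\<integral>\<^sup>+x. ennreal (exp (real n)) * ennreal (exp (- 1 * norm x)) \<partial>\<Gamma>)"
      by (intro nn_integral_mono) (auto simp: indicator_def ennreal_mult[symmetric] mult_exp_exp ennreal_1[symmetric] simp del: ennreal_1 intro!: ennreal_leI)
    also have "\<dots> = ennreal (exp (real n)) * (\<integral>\<^sup>+x. ennreal (exp (- 1 * norm x)) \<partial>\<Gamma>)"
      by (rule nn_integral_cmult) measurable
    also have "\<dots> < \<infinity>"
      using tempered_measure_exp_integrable[OF assms, of 1]
      by (auto simp: integrable_iff_bounded ennreal_mult_less_top)
    finally show ?thesis .
  qed
  moreover have "(\<Union>n. ball (0::'a) (real n)) = UNIV"
    using reals_Archimedean2 by (auto simp: dist_norm)
  ultimately show "\<exists>A. countable A \<and> A \<subseteq> sets \<Gamma> \<and> \<Union> A = space \<Gamma> \<and> (\<forall>a\<in>A. emeasure \<Gamma> a \<noteq> \<infinity>)"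
    by (intro exI[of _ "range (\<lambda>n. ball 0 (real n))"]) (auto simp: space less_top sets)
qed

locale noise =
  fixes M :: "'w measure" and \<Gamma> :: "'a::euclidean_space measure" and W :: "('a \<Rightarrow> real) \<Rightarrow> 'w \<Rightarrow> real"
  assumes gaussian: "gaussian_noise M \<Gamma> W" and tempered: "tempered_measure \<Gamma>"
begin

sublocale prob_space M using gaussian by (simp add: gaussian_noise_def)

sublocale G: sigma_finite_measure \<Gamma> by (rule tempered_measure_sigma_finite[OF tempered])

sublocale GL: pair_sigma_finite \<Gamma> lborel ..

sublocale LM: pair_sigma_finite "lborel :: 'a measure" M ..

lemma sets_G [measurable_cong, simp]: "sets \<Gamma> = sets borel"
  using tempered by (simp add: tempered_measure_def)

lemma integrable_dominating_pair:
  "integrable (\<Gamma> \<Otimes>\<^sub>M lborel) (\<lambda>(z, y). exp (- (1 / 2) * norm z) * exp (- (1 / 2) * norm (y::'a)))"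
  by (intro GL.integrable_mult_pair tempered_measure_exp_integrable[OF tempered] integrable_exp_norm) auto

text \<open>Decay in y + z and in y is converted into decay in z and in y. Both norm z and norm y
  are at most norm (y + z) + norm y, and the average of the two bounds produces the halves.\<close>

lemma decay_pair_bound:
  fixes f g :: "'a \<Rightarrow> real"
  assumes "\<And>x. \<bar>f x\<bar> \<le> C * exp (- norm x)" "\<And>x. \<bar>g x\<bar> \<le> D * exp (- norm x)"
  shows "\<bar>f (y + z) * g y\<bar> \<le> C * D * (exp (- (1 / 2) * norm z) * exp (- (1 / 2) * norm y))"
proof -
  have CD: "C \<ge> 0" "D \<ge> 0" using order.trans[OF abs_ge_zero assms(1)[of 0]] order.trans[OF abs_ge_zero assms(2)[of 0]] by auto
  have "\<bar>f (y + z)\<bar> * \<bar>g y\<bar> \<le> (C * exp (- norm (y + z))) * (D * exp (- norm y))"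
    using assms CD by (intro mult_mono) auto
  also have "\<dots> = C * D * exp (- norm (y + z) - norm y)"
    by (simp only: mult_ac exp_diff exp_minus divide_inverse)
  also have "\<dots> \<le> C * D * exp (- (1 / 2) * norm z - (1 / 2) * norm y)"
  proof -
    have "norm z \<le> norm (y + z) + norm y" using norm_triangle_ineq4[of "y + z" y] by simp
    moreover have "norm y \<le> norm (y + z) + norm y" by simp
    ultimately have "- norm (y + z) - norm y \<le> - (1 / 2) * norm z - (1 / 2) * norm y" by linarith
    then show ?thesis using CD by (intro mult_left_mono) auto
  qed
  finally show ?thesis by (simp only: abs_mult mult_exp_exp) simp
qed

lemma form_integrable:
  assumes "exp_decay f" "exp_decay g"
  shows "integrable (\<Gamma> \<Otimes>\<^sub>M lborel) (\<lambda>(z, y). f (y + z) * g y)"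
proof -
  obtain C where C: "\<And>x. \<bar>f x\<bar> \<le> C * exp (- norm x)" using exp_decay_bound[OF assms(1)] by blast
  obtain D where D: "\<And>x. \<bar>g x\<bar> \<le> D * exp (- norm x)" using exp_decay_bound[OF assms(2)] by blast
  have [measurable]: "f \<in> borel_measurable borel" "g \<in> borel_measurable borel"
    using assms by (auto simp: exp_decay_def)
  show ?thesis
  proof (rule Bochner_Integration.integrable_bound)
    show "integrable (\<Gamma> \<Otimes>\<^sub>M lborel) (\<lambda>p. C * D * (case p of (z, y) \<Rightarrow> exp (- (1 / 2) * norm z) * exp (- (1 / 2) * norm (y::'a))))"
      using integrable_dominating_pair by (rule integrable_mult_right)
    show "AE p in \<Gamma> \<Otimes>\<^sub>M lborel. norm (case p of (z, y) \<Rightarrow> f (y + z) * g y) \<le> norm (C * D * (case p of (z, y) \<Rightarrow> exp (- (1 / 2) * norm z) * exp (- (1 / 2) * norm (y::'a))))"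
      using decay_pair_bound[of f C g D, OF C D]
      by (intro always_eventually allI) (auto intro: order.trans[OF _ abs_ge_self] split: prod.split)
  qed measurable
qed

text \<open>For fixed z the Lebesgue measure in y is invariant under the shift. Hence almost
  everywhere convergence of functions suffices inside \<open>cov_form\<close>, even when
  \<open>\<Gamma>\<close> is singular.\<close>

lemma AE_pair_shift:
  assumes "AE x in (lborel :: 'a measure). P x"
  shows "AE p in \<Gamma> \<Otimes>\<^sub>M lborel. P (snd p + fst p) \<and> P (snd p)"
proof -
  obtain N where N: "{x \<in> space lborel. \<not> P x} \<subseteq> N" "emeasure lborel N = 0" "N \<in> sets (lborel :: 'a measure)"
    using AE_E[OF assms] by blast
  have [measurable]: "N \<in> sets borel" using N(3) by simp
  have "AE p in \<Gamma> \<Otimes>\<^sub>M lborel. snd p + fst p \<notin> N \<and> snd p \<notin> N"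
  proof (rule GL.AE_pair_measure)
    show "{p \<in> space (\<Gamma> \<Otimes>\<^sub>M lborel). snd p + fst p \<notin> N \<and> snd p \<notin> N} \<in> sets (\<Gamma> \<Otimes>\<^sub>M lborel)" by measurable
    have "AE y in lborel. y + z \<notin> N \<and> y \<notin> N" for z
    proof -
      have "(\<integral>\<^sup>+y. indicator N (y + z) \<partial>lborel) = (\<integral>\<^sup>+y. indicator N y \<partial>lborel)"
        by (rule nn_integral_lborel_shift) measurable
      also have "\<dots> = 0" using N(2,3) by simp
      finally have "AE y in lborel. indicator N (y + z) = (0 :: ennreal)"
        by (subst (asm) nn_integral_0_iff_AE) auto
      moreover have "AE y in lborel. y \<notin> N" using N(2,3) by (intro AE_not_in) auto
      ultimately show ?thesis by eventually_elim (auto simp: indicator_def split: if_splits)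
    qed
    then show "AE z in \<Gamma>. AE y in lborel. snd (z, y) + fst (z, y) \<notin> N \<and> snd (z, y) \<notin> N" by simp
  qed
  then show ?thesis by eventually_elim (use N(1) in auto)
qed

lemma cov_form_tendsto:
  fixes f g :: "nat \<Rightarrow> 'a \<Rightarrow> real"
  assumes [measurable]: "\<And>n. f n \<in> borel_measurable borel" "\<And>n. g n \<in> borel_measurable borel"
    "f' \<in> borel_measurable borel" "g' \<in> borel_measurable borel"
    and C: "\<And>n x. \<bar>f n x\<bar> \<le> C * exp (- norm x)" and D: "\<And>n x. \<bar>g n x\<bar> \<le> D * exp (- norm x)"
    and f: "AE x in lborel. (\<lambda>n. f n x) \<longlonglongrightarrow> f' x" and g: "AE x in lborel. (\<lambda>n. g n x) \<longlonglongrightarrow> g' x"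
  shows "(\<lambda>n. cov_form \<Gamma> (f n) (g n)) \<longlonglongrightarrow> cov_form \<Gamma> f' g'"
  unfolding cov_form_def
proof (rule integral_dominated_convergence)
  show "integrable (\<Gamma> \<Otimes>\<^sub>M lborel) (\<lambda>p. C * D * (case p of (z, y) \<Rightarrow> exp (- (1 / 2) * norm z) * exp (- (1 / 2) * norm (y::'a))))"
    using integrable_dominating_pair by (rule integrable_mult_right)
  show "AE p in \<Gamma> \<Otimes>\<^sub>M lborel. norm (case p of (z, y) \<Rightarrow> f n (y + z) * g n y) \<le> C * D * (case p of (z, y) \<Rightarrow> exp (- (1 / 2) * norm z) * exp (- (1 / 2) * norm (y::'a)))" for n
    using decay_pair_bound[of "f n" C "g n" D, OF C D]
    by (intro always_eventually allI) (auto split: prod.split)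
  show "AE p in \<Gamma> \<Otimes>\<^sub>M lborel. (\<lambda>n. case p of (z, y) \<Rightarrow> f n (y + z) * g n y) \<longlonglongrightarrow> (case p of (z, y) \<Rightarrow> f' (y + z) * g' y)"
    using AE_pair_shift[OF f] AE_pair_shift[OF g]
    by eventually_elim (auto intro!: tendsto_intros split: prod.split)
qed measurable

section \<open>The mollified noise and its pathwise integrals\<close>

abbreviation mol :: "real \<Rightarrow> 'a \<Rightarrow> 'w \<Rightarrow> real" where "mol \<equiv> mollified W"

text \<open>Formally \<open>W (smooth \<delta> g)\<close>. As W is not assumed to be linear or
  continuous path by path, this integral of the jointly measurable mollified field is what stands
  for W applied to a function.\<close>

definition fld :: "real \<Rightarrow> ('a \<Rightarrow> real) \<Rightarrow> 'w \<Rightarrow> real" where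
  "fld \<delta> g \<omega> = (LINT w|lborel. g w * mol \<delta> w \<omega>)"

lemma measurable_mol [measurable (raw)]:
  assumes "\<delta> > 0" "X \<in> measurable N borel" "Z \<in> measurable N M"
  shows "(\<lambda>n. mol \<delta> (X n) (Z n)) \<in> borel_measurable N"
proof -
  have "(\<lambda>(x, \<omega>). mol \<delta> x \<omega>) \<in> borel_measurable (borel \<Otimes>\<^sub>M M)"
    using gaussian assms(1) by (simp add: gaussian_noise_def)
  from measurable_compose[OF measurable_Pair[OF assms(2,3)] this] show ?thesis by simp
qed

definition gspan :: "('w \<Rightarrow> real) set" where
  "gspan = {\<lambda>\<omega>. \<Sum>\<phi>\<in>I. a \<phi> * W \<phi> \<omega> | I a. finite I \<and> (\<forall>\<phi>\<in>I. schwartz \<phi>)}"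

lemma gaussian_space_gspan: "gaussian_space M gspan"
proof (rule gaussian_spaceI)
  show "prob_space M" by unfold_locales
  have meas: "\<And>\<phi>. schwartz \<phi> \<Longrightarrow> W \<phi> \<in> borel_measurable M" using gaussian by (simp add: gaussian_noise_def)
  fix X assume "X \<in> gspan"
  then obtain I a where X: "X = (\<lambda>\<omega>. \<Sum>\<phi>\<in>I. a \<phi> * W \<phi> \<omega>)" and I: "finite I" "\<forall>\<phi>\<in>I. schwartz \<phi>"
    by (auto simp: gspan_def)
  show "X \<in> borel_measurable M" unfolding X using I(2) meas by (intro borel_measurable_sum) auto
  show "centered_normal M X" unfolding X using gaussian I unfolding gaussian_noise_def by blast
  show "(\<lambda>\<omega>. c * X \<omega>) \<in> gspan" for c
    unfolding gspan_def X using I by (auto simp: sum_distrib_left mult.assoc intro!: exI[of _ I] exI[of _ "\<lambda>\<phi>. c * a \<phi>"])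
  fix Y assume "Y \<in> gspan"
  then obtain J b where Y: "Y = (\<lambda>\<omega>. \<Sum>\<phi>\<in>J. b \<phi> * W \<phi> \<omega>)" and J: "finite J" "\<forall>\<phi>\<in>J. schwartz \<phi>"
    by (auto simp: gspan_def)
  define c where "c \<phi> = (if \<phi> \<in> I then a \<phi> else 0) + (if \<phi> \<in> J then b \<phi> else 0)" for \<phi>
  have "X \<omega> + Y \<omega> = (\<Sum>\<phi>\<in>I \<union> J. c \<phi> * W \<phi> \<omega>)" for \<omega>
  proof -
    have "X \<omega> = (\<Sum>\<phi>\<in>I \<union> J. (if \<phi> \<in> I then a \<phi> else 0) * W \<phi> \<omega>)"
      unfolding X using I J by (intro sum.mono_neutral_cong_left) auto
    moreover have "Y \<omega> = (\<Sum>\<phi>\<in>I \<union> J. (if \<phi> \<in> J then b \<phi> else 0) * W \<phi> \<omega>)"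
      unfolding Y using I J by (intro sum.mono_neutral_cong_left) auto
    ultimately show ?thesis by (simp add: c_def distrib_right sum.distrib)
  qed
  then show "(\<lambda>\<omega>. X \<omega> + Y \<omega>) \<in> gspan"
    unfolding gspan_def using I J by (auto intro!: exI[of _ "I \<union> J"] exI[of _ c])
qed

lemma mol_in_gspan: "\<delta> > 0 \<Longrightarrow> mol \<delta> x \<in> gspan"
  unfolding gspan_def mollified_def
  by (intro CollectI exI[of _ "{\<lambda>y. heat \<delta> (y - x)}"] exI[of _ "\<lambda>_. 1"]) (auto simp: schwartz_heat)

lemma square_integrable_mol: "\<delta> > 0 \<Longrightarrow> square_integrable M (mol \<delta> x)"
  using gaussian_space.square_integrable_V[OF gaussian_space_gspan mol_in_gspan] .

lemma expectation_mol_mol: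
  assumes "\<delta> > 0" "\<delta>' > 0"
  shows "expectation (\<lambda>\<omega>. mol \<delta> w \<omega> * mol \<delta>' x \<omega>) = cov_form \<Gamma> (\<lambda>y. heat \<delta> (y - w)) (\<lambda>y. heat \<delta>' (y - x))"
proof -
  have "\<And>\<phi> \<psi>. schwartz \<phi> \<Longrightarrow> schwartz \<psi> \<Longrightarrow> expectation (\<lambda>\<omega>. W \<phi> \<omega> * W \<psi> \<omega>) = cov_form \<Gamma> \<phi> \<psi>"
    using gaussian unfolding gaussian_noise_def by blast
  then show ?thesis unfolding mollified_def using schwartz_heat assms by blast
qed

lemma expectation_mol_mol_nonneg: "\<delta> > 0 \<Longrightarrow> \<delta>' > 0 \<Longrightarrow> 0 \<le> expectation (\<lambda>\<omega>. mol \<delta> w \<omega> * mol \<delta>' x \<omega>)"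
  unfolding expectation_mol_mol cov_form_def
  by (intro Bochner_Integration.integral_nonneg) (auto simp: heat_nonneg)

definition molvar :: "real \<Rightarrow> real" where
  "molvar \<delta> = expectation (\<lambda>\<omega>. (mol \<delta> 0 \<omega>)\<^sup>2)"

text \<open>Stationarity: for fixed z, a translation of the Lebesgue variable y removes the centre x
  from the form.\<close>

lemma expectation_mol_square:
  assumes \<delta>: "\<delta> > 0"
  shows "expectation (\<lambda>\<omega>. (mol \<delta> x \<omega>)\<^sup>2) = molvar \<delta>"
proof -
  have "cov_form \<Gamma> (\<lambda>y. heat \<delta> (y - x)) (\<lambda>y. heat \<delta> (y - x)) = cov_form \<Gamma> (heat \<delta>) (heat \<delta>)" for x
  proof -
    have i: "integrable (\<Gamma> \<Otimes>\<^sub>M lborel) (\<lambda>(z, y). heat \<delta> (y + z - v) * heat \<delta> (y - v))" for v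
      using form_integrable[OF exp_decay_heat[OF \<delta>] exp_decay_heat[OF \<delta>]] by simp
    have "cov_form \<Gamma> (\<lambda>y. heat \<delta> (y - x)) (\<lambda>y. heat \<delta> (y - x)) = (LINT z|\<Gamma>. LINT y|lborel. heat \<delta> (y + z - x) * heat \<delta> (y - x))"
      unfolding cov_form_def by (subst GL.integral_fst'[symmetric, OF i]) simp
    also have "\<dots> = (LINT z|\<Gamma>. LINT y|lborel. heat \<delta> ((y + - x) + z) * heat \<delta> (y + - x))"
      by (simp add: algebra_simps)
    also have "\<dots> = (LINT z|\<Gamma>. LINT y|lborel. heat \<delta> (y + z) * heat \<delta> y)"
      by (subst integral_lborel_shift[of "\<lambda>y. heat \<delta> (y + _) * heat \<delta> y" "- x"]) auto
    also have "\<dots> = cov_form \<Gamma> (heat \<delta>) (heat \<delta>)"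
      unfolding cov_form_def using GL.integral_fst'[OF i[of 0]] by simp
    finally show ?thesis .
  qed
  then show ?thesis
    using expectation_mol_mol[OF \<delta> \<delta>, of x x] expectation_mol_mol[OF \<delta> \<delta>, of 0 0]
    by (simp add: molvar_def power2_eq_square)
qed

lemma molvar_nonneg: "0 \<le> molvar \<delta>"
  by (simp add: molvar_def)

lemma expectation_abs_mol_mult:
  assumes \<delta>: "\<delta> > 0" and X: "square_integrable M X"
  shows "expectation (\<lambda>\<omega>. \<bar>mol \<delta> x \<omega> * X \<omega>\<bar>) \<le> sqrt (molvar \<delta>) * sqrt (expectation (\<lambda>\<omega>. (X \<omega>)\<^sup>2))"
proof -
  have "square_integrable M (\<lambda>\<omega>. \<bar>mol \<delta> x \<omega>\<bar>)" "square_integrable M (\<lambda>\<omega>. \<bar>X \<omega>\<bar>)"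
    using X square_integrable_mol[OF \<delta>, of x] by (auto simp: square_integrable_def)
  from Cauchy_Schwarz_square_integrable[OF this] show ?thesis
    by (simp add: abs_mult expectation_mol_square[OF \<delta>])
qed

lemma integrable_fld_mult:
  assumes \<delta>: "\<delta> > 0" and g: "integrable lborel g" and X: "square_integrable M X"
  shows "integrable (lborel \<Otimes>\<^sub>M M) (\<lambda>(w, \<omega>). g w * (mol \<delta> w \<omega> * X \<omega>))"
proof (rule LM.integrable_pair_bound)
  note \<delta>[measurable]
  have [measurable]: "g \<in> borel_measurable borel" "X \<in> borel_measurable M"
    using g X by (auto simp: square_integrable_def)
  show "(\<lambda>(w, \<omega>). g w * (mol \<delta> w \<omega> * X \<omega>)) \<in> borel_measurable (lborel \<Otimes>\<^sub>M M)" by measurable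
  define K where "K = sqrt (molvar \<delta>) * sqrt (expectation (\<lambda>\<omega>. (X \<omega>)\<^sup>2))"
  show "integrable lborel (\<lambda>w. \<bar>g w\<bar> * K)" using g by simp
  fix w :: 'a
  have "(\<integral>\<^sup>+\<omega>. ennreal \<bar>g w * (mol \<delta> w \<omega> * X \<omega>)\<bar> \<partial>M) = ennreal (expectation (\<lambda>\<omega>. \<bar>g w * (mol \<delta> w \<omega> * X \<omega>)\<bar>))"
    using square_integrable_mult[OF square_integrable_mol[OF \<delta>] X] by (intro nn_integral_eq_integral) auto
  also have "\<dots> \<le> ennreal (\<bar>g w\<bar> * K)"
    using expectation_abs_mol_mult[OF \<delta> X, of w] by (intro ennreal_leI) (simp add: abs_mult K_def mult_left_mono mult.assoc)
  finally show "(\<integral>\<^sup>+\<omega>. ennreal \<bar>case (w, \<omega>) of (w, \<omega>) \<Rightarrow> g w * (mol \<delta> w \<omega> * X \<omega>)\<bar> \<partial>M) \<le> ennreal (\<bar>g w\<bar> * K)"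
    by simp
qed

lemma expectation_fld_mult:
  assumes \<delta>: "\<delta> > 0" and g: "integrable lborel g" and X: "square_integrable M X"
  shows "expectation (\<lambda>\<omega>. fld \<delta> g \<omega> * X \<omega>) = (LINT w|lborel. g w * expectation (\<lambda>\<omega>. mol \<delta> w \<omega> * X \<omega>))"
proof -
  have "expectation (\<lambda>\<omega>. fld \<delta> g \<omega> * X \<omega>) = expectation (\<lambda>\<omega>. LINT w|lborel. g w * (mol \<delta> w \<omega> * X \<omega>))"
    unfolding fld_def by (simp add: mult.assoc flip: integral_mult_left_zero)
  also have "\<dots> = (LINT w|lborel. expectation (\<lambda>\<omega>. g w * (mol \<delta> w \<omega> * X \<omega>)))"
    by (rule LM.Fubini_integral[OF integrable_fld_mult[OF assms]])
  finally show ?thesis by simp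
qed

text \<open>Cauchy-Schwarz path by path, with weight \<bar>g\<bar>: the square of the integral is at
  most the mass of \<bar>g\<bar> times the integral of \<bar>g\<bar> against the squared noise,
  whose expectation is finite by stationarity.\<close>

lemma square_integrable_fld:
  assumes \<delta>: "\<delta> > 0" and g: "integrable lborel g"
  shows "square_integrable M (fld \<delta> g)"
proof -
  note \<delta>[measurable]
  have [measurable]: "g \<in> borel_measurable borel" using g by auto
  have [measurable]: "fld \<delta> g \<in> borel_measurable M" unfolding fld_def[abs_def] by measurable
  define c where "c = (LINT w|lborel. \<bar>g w\<bar>)"
  have i: "integrable (lborel \<Otimes>\<^sub>M M) (\<lambda>(w, \<omega>). \<bar>g w\<bar> * (mol \<delta> w \<omega> * mol \<delta> w \<omega>))"
  proof (rule LM.integrable_pair_bound)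
    show "(\<lambda>(w, \<omega>). \<bar>g w\<bar> * (mol \<delta> w \<omega> * mol \<delta> w \<omega>)) \<in> borel_measurable (lborel \<Otimes>\<^sub>M M)" by measurable
    show "integrable lborel (\<lambda>w. \<bar>g w\<bar> * molvar \<delta>)" using g by simp
    fix w :: 'a
    have "(\<integral>\<^sup>+\<omega>. ennreal \<bar>\<bar>g w\<bar> * (mol \<delta> w \<omega> * mol \<delta> w \<omega>)\<bar> \<partial>M) = ennreal (expectation (\<lambda>\<omega>. \<bar>\<bar>g w\<bar> * (mol \<delta> w \<omega> * mol \<delta> w \<omega>)\<bar>))"
      using square_integrable_mult[OF square_integrable_mol[OF \<delta>] square_integrable_mol[OF \<delta>]] by (intro nn_integral_eq_integral) auto
    also have "\<dots> = ennreal (\<bar>g w\<bar> * molvar \<delta>)"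
      using expectation_mol_square[OF \<delta>, of w] by (simp add: abs_mult power2_eq_square)
    finally show "(\<integral>\<^sup>+\<omega>. ennreal \<bar>case (w, \<omega>) of (w, \<omega>) \<Rightarrow> \<bar>g w\<bar> * (mol \<delta> w \<omega> * mol \<delta> w \<omega>)\<bar> \<partial>M) \<le> ennreal (\<bar>g w\<bar> * molvar \<delta>)"
      by simp
  qed
  interpret PS: pair_sigma_finite M "lborel :: 'a measure" ..
  have i': "integrable (M \<Otimes>\<^sub>M lborel) (\<lambda>(\<omega>, w). \<bar>g w\<bar> * (mol \<delta> w \<omega> * mol \<delta> w \<omega>))"
    using LM.integrable_product_swap[OF i] by simp
  have bound: "AE \<omega> in M. (fld \<delta> g \<omega>)\<^sup>2 \<le> c * (LINT w|lborel. \<bar>g w\<bar> * (mol \<delta> w \<omega> * mol \<delta> w \<omega>))"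
    using PS.AE_integrable_fst'[OF i'] AE_space
  proof eventually_elim
    fix \<omega> assume \<omega>: "\<omega> \<in> space M" and "integrable lborel (\<lambda>w. case (\<omega>, w) of (\<omega>, w) \<Rightarrow> \<bar>g w\<bar> * (mol \<delta> w \<omega> * mol \<delta> w \<omega>))"
    then have i\<omega>: "integrable lborel (\<lambda>w. \<bar>g w\<bar> * (mol \<delta> w \<omega> * mol \<delta> w \<omega>))" by simp
    note \<omega>[measurable]
    \<comment> \<open>The splitting of g into sqrt \<bar>g\<bar> and sgn g sqrt \<bar>g\<bar>
      realises the weighted inequality.\<close>
    have sq1: "(sqrt \<bar>g w\<bar>)\<^sup>2 = \<bar>g w\<bar>" and sq2: "(sgn (g w) * sqrt \<bar>g w\<bar> * mol \<delta> w \<omega>)\<^sup>2 = \<bar>g w\<bar> * (mol \<delta> w \<omega> * mol \<delta> w \<omega>)" for w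
      by (auto simp: power_mult_distrib power2_eq_square sgn_if)
    have "\<bar>LINT w|lborel. sqrt \<bar>g w\<bar> * (sgn (g w) * sqrt \<bar>g w\<bar> * mol \<delta> w \<omega>)\<bar> \<le>
      sqrt (LINT w|lborel. (sqrt \<bar>g w\<bar>)\<^sup>2) * sqrt (LINT w|lborel. (sgn (g w) * sqrt \<bar>g w\<bar> * mol \<delta> w \<omega>)\<^sup>2)"
      by (rule Cauchy_Schwarz_integral) (use g i\<omega> in \<open>simp_all add: sq1 sq2\<close>)
    moreover have "sqrt \<bar>g w\<bar> * (sgn (g w) * sqrt \<bar>g w\<bar> * mol \<delta> w \<omega>) = g w * mol \<delta> w \<omega>" for w
      by (auto simp: sgn_if)
    ultimately have "\<bar>fld \<delta> g \<omega>\<bar> \<le> sqrt (c * (LINT w|lborel. \<bar>g w\<bar> * (mol \<delta> w \<omega> * mol \<delta> w \<omega>)))"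
      by (simp add: fld_def c_def sq1 sq2 real_sqrt_mult)
    then have "\<bar>fld \<delta> g \<omega>\<bar>\<^sup>2 \<le> (sqrt (c * (LINT w|lborel. \<bar>g w\<bar> * (mol \<delta> w \<omega> * mol \<delta> w \<omega>))))\<^sup>2"
      by (intro power_mono) auto
    also have "\<dots> = c * (LINT w|lborel. \<bar>g w\<bar> * (mol \<delta> w \<omega> * mol \<delta> w \<omega>))"
      by (intro real_sqrt_pow2) (auto simp: c_def intro!: mult_nonneg_nonneg Bochner_Integration.integral_nonneg)
    finally show "(fld \<delta> g \<omega>)\<^sup>2 \<le> c * (LINT w|lborel. \<bar>g w\<bar> * (mol \<delta> w \<omega> * mol \<delta> w \<omega>))" by simp
  qed
  have "integrable M (\<lambda>\<omega>. (fld \<delta> g \<omega>)\<^sup>2)"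
  proof (rule Bochner_Integration.integrable_bound)
    show "integrable M (\<lambda>\<omega>. c * (LINT w|lborel. \<bar>g w\<bar> * (mol \<delta> w \<omega> * mol \<delta> w \<omega>)))"
      using PS.integrable_fst'[OF i'] by simp
    show "AE \<omega> in M. norm ((fld \<delta> g \<omega>)\<^sup>2) \<le> norm (c * (LINT w|lborel. \<bar>g w\<bar> * (mol \<delta> w \<omega> * mol \<delta> w \<omega>)))"
      using bound by eventually_elim (auto intro: order.trans[OF _ abs_ge_self])
  qed measurable
  then show ?thesis by (simp add: square_integrable_def)
qed

section \<open>Covariances of pathwise fields\<close>

lemma cov_form_smooth_left:
  assumes \<delta>: "0 < \<delta>" "\<delta> \<le> 1" and g: "exp_decay g" and k: "exp_decay k"
  shows "cov_form \<Gamma> (smooth \<delta> g) k = (LINT w|lborel. g w * cov_form \<Gamma> (\<lambda>y. heat \<delta> (y - w)) k)"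
proof -
  have [measurable]: "g \<in> borel_measurable borel" "k \<in> borel_measurable borel" using g k by (auto simp: exp_decay_def)
  have ga: "exp_decay (\<lambda>x. \<bar>g x\<bar>)" "exp_decay (\<lambda>x. \<bar>k x\<bar>)" using g k by (auto simp: exp_decay_def)
  interpret P: pair_sigma_finite "\<Gamma> \<Otimes>\<^sub>M (lborel :: 'a measure)" "lborel :: 'a measure"
    by (intro pair_sigma_finite.intro sigma_finite_pair_measure G.sigma_finite_measure_axioms lborel.sigma_finite_measure_axioms)
  have i: "integrable ((\<Gamma> \<Otimes>\<^sub>M lborel) \<Otimes>\<^sub>M lborel) (\<lambda>(p, w). g w * heat \<delta> (snd p + fst p - w) * k (snd p))"
  proof (rule P.integrable_pair_bound)
    show "(\<lambda>(p, w). g w * heat \<delta> (snd p + fst p - w) * k (snd p)) \<in> borel_measurable ((\<Gamma> \<Otimes>\<^sub>M lborel) \<Otimes>\<^sub>M lborel)" by measurable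
    \<comment> \<open>Integrating \<open>w\<close> out of the absolute value leaves the smoothing of
      \<bar>g\<bar>, which again has exponential decay.\<close>
    show "integrable (\<Gamma> \<Otimes>\<^sub>M lborel) (\<lambda>p. case p of (z, y) \<Rightarrow> smooth \<delta> (\<lambda>x. \<bar>g x\<bar>) (y + z) * \<bar>k y\<bar>)"
      by (intro form_integrable exp_decay_smooth ga \<delta>)
    fix p :: "'a \<times> 'a"
    have "(\<integral>\<^sup>+w. ennreal \<bar>g w * heat \<delta> (snd p + fst p - w) * k (snd p)\<bar> \<partial>lborel) = ennreal (LINT w|lborel. \<bar>g w\<bar> * heat \<delta> (snd p + fst p - w) * \<bar>k (snd p)\<bar>)"
      using smooth_eq_convolution(1)[OF \<delta>(1) exp_decay_integrable[OF ga(1)], of "snd p + fst p"]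
      by (subst nn_integral_eq_integral[symmetric]) (auto simp: abs_mult heat_nonneg)
    also have "\<dots> = ennreal (smooth \<delta> (\<lambda>x. \<bar>g x\<bar>) (snd p + fst p) * \<bar>k (snd p)\<bar>)"
      using smooth_eq_convolution(2)[OF \<delta>(1) exp_decay_integrable[OF ga(1)], of "snd p + fst p"] by simp
    finally show "(\<integral>\<^sup>+w. ennreal \<bar>case (p, w) of (p, w) \<Rightarrow> g w * heat \<delta> (snd p + fst p - w) * k (snd p)\<bar> \<partial>lborel) \<le> ennreal (case p of (z, y) \<Rightarrow> smooth \<delta> (\<lambda>x. \<bar>g x\<bar>) (y + z) * \<bar>k y\<bar>)"
      by (simp add: case_prod_beta)
  qed
  have "cov_form \<Gamma> (smooth \<delta> g) k = (LINT p|(\<Gamma> \<Otimes>\<^sub>M lborel). LINT w|lborel. g w * heat \<delta> (snd p + fst p - w) * k (snd p))"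
    unfolding cov_form_def case_prod_beta
    using smooth_eq_convolution(2)[OF \<delta>(1) exp_decay_integrable[OF g]] by simp
  also have "\<dots> = (LINT w|lborel. LINT p|(\<Gamma> \<Otimes>\<^sub>M lborel). g w * heat \<delta> (snd p + fst p - w) * k (snd p))"
    by (rule P.Fubini_integral[symmetric, OF i])
  also have "\<dots> = (LINT w|lborel. g w * cov_form \<Gamma> (\<lambda>y. heat \<delta> (y - w)) k)"
    unfolding cov_form_def case_prod_beta by (simp add: mult.assoc)
  finally show ?thesis .
qed

lemma cov_form_smooth_right:
  assumes \<delta>: "0 < \<delta>" "\<delta> \<le> 1" and g: "exp_decay g" and k: "exp_decay k"
  shows "cov_form \<Gamma> k (smooth \<delta> g) = (LINT w|lborel. g w * cov_form \<Gamma> k (\<lambda>y. heat \<delta> (y - w)))"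
proof -
  have [measurable]: "g \<in> borel_measurable borel" "k \<in> borel_measurable borel" using g k by (auto simp: exp_decay_def)
  have ga: "exp_decay (\<lambda>x. \<bar>g x\<bar>)" "exp_decay (\<lambda>x. \<bar>k x\<bar>)" using g k by (auto simp: exp_decay_def)
  have minus: "heat \<delta> (y - w) = heat \<delta> (w - y)" for y w :: 'a using heat_minus[of \<delta> "y - w"] by simp
  interpret P: pair_sigma_finite "\<Gamma> \<Otimes>\<^sub>M (lborel :: 'a measure)" "lborel :: 'a measure"
    by (intro pair_sigma_finite.intro sigma_finite_pair_measure G.sigma_finite_measure_axioms lborel.sigma_finite_measure_axioms)
  have i: "integrable ((\<Gamma> \<Otimes>\<^sub>M lborel) \<Otimes>\<^sub>M lborel) (\<lambda>(p, w). g w * heat \<delta> (snd p - w) * k (snd p + fst p))"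
  proof (rule P.integrable_pair_bound)
    show "(\<lambda>(p, w). g w * heat \<delta> (snd p - w) * k (snd p + fst p)) \<in> borel_measurable ((\<Gamma> \<Otimes>\<^sub>M lborel) \<Otimes>\<^sub>M lborel)" by measurable
    show "integrable (\<Gamma> \<Otimes>\<^sub>M lborel) (\<lambda>p. case p of (z, y) \<Rightarrow> \<bar>k (y + z)\<bar> * smooth \<delta> (\<lambda>x. \<bar>g x\<bar>) y)"
      by (intro form_integrable exp_decay_smooth ga \<delta>)
    fix p :: "'a \<times> 'a"
    have "(\<integral>\<^sup>+w. ennreal \<bar>g w * heat \<delta> (snd p - w) * k (snd p + fst p)\<bar> \<partial>lborel) = ennreal (LINT w|lborel. \<bar>g w\<bar> * heat \<delta> (snd p - w) * \<bar>k (snd p + fst p)\<bar>)"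
      using smooth_eq_convolution(1)[OF \<delta>(1) exp_decay_integrable[OF ga(1)], of "snd p"]
      by (subst nn_integral_eq_integral[symmetric]) (auto simp: abs_mult heat_nonneg)
    also have "\<dots> = ennreal (smooth \<delta> (\<lambda>x. \<bar>g x\<bar>) (snd p) * \<bar>k (snd p + fst p)\<bar>)"
      using smooth_eq_convolution(2)[OF \<delta>(1) exp_decay_integrable[OF ga(1)], of "snd p"] by simp
    finally show "(\<integral>\<^sup>+w. ennreal \<bar>case (p, w) of (p, w) \<Rightarrow> g w * heat \<delta> (snd p - w) * k (snd p + fst p)\<bar> \<partial>lborel) \<le> ennreal (case p of (z, y) \<Rightarrow> \<bar>k (y + z)\<bar> * smooth \<delta> (\<lambda>x. \<bar>g x\<bar>) y)"
      by (simp add: case_prod_beta mult.commute)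
  qed
  have "cov_form \<Gamma> k (smooth \<delta> g) = (LINT p|(\<Gamma> \<Otimes>\<^sub>M lborel). LINT w|lborel. g w * heat \<delta> (snd p - w) * k (snd p + fst p))"
    unfolding cov_form_def case_prod_beta
    using smooth_eq_convolution(2)[OF \<delta>(1) exp_decay_integrable[OF g]] by (simp add: mult.commute)
  also have "\<dots> = (LINT w|lborel. LINT p|(\<Gamma> \<Otimes>\<^sub>M lborel). g w * heat \<delta> (snd p - w) * k (snd p + fst p))"
    by (rule P.Fubini_integral[symmetric, OF i])
  also have "\<dots> = (LINT w|lborel. g w * cov_form \<Gamma> k (\<lambda>y. heat \<delta> (y - w)))"
    unfolding cov_form_def case_prod_beta by (simp add: mult.assoc mult.commute[of "heat _ _"])
  finally show ?thesis .
qed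

lemma cov_form_heat_right:
  assumes \<delta>: "0 < \<delta>" "\<delta> \<le> 1" and g: "exp_decay g"
  shows "cov_form \<Gamma> g (\<lambda>y. heat \<delta> (y - x)) = (LINT z|\<Gamma>. smooth \<delta> g (x + z))"
proof -
  have [measurable]: "g \<in> borel_measurable borel" using g by (simp add: exp_decay_def)
  have "cov_form \<Gamma> g (\<lambda>y. heat \<delta> (y - x)) = (LINT z|\<Gamma>. LINT y|lborel. g (y + z) * heat \<delta> (y - x))"
    unfolding cov_form_def
    by (subst GL.integral_fst'[symmetric, OF form_integrable[OF g exp_decay_heat[OF \<delta>(1)]]]) simp
  also have "\<dots> = (LINT z|\<Gamma>. smooth \<delta> g (x + z))"
  proof (intro Bochner_Integration.integral_cong refl)
    fix z
    have "(LINT y|lborel. g (y + z) * heat \<delta> (y - x)) = (LINT y|lborel. heat \<delta> (y + - x) * g (x + z + (y + - x)))"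
      by (intro Bochner_Integration.integral_cong) (auto simp: algebra_simps)
    also have "\<dots> = smooth \<delta> g (x + z)"
      unfolding smooth_def by (rule integral_lborel_shift[of "\<lambda>y. heat \<delta> y * g (x + z + y)" "- x"]) measurable
    finally show "(LINT y|lborel. g (y + z) * heat \<delta> (y - x)) = smooth \<delta> g (x + z)" .
  qed
  finally show ?thesis .
qed

text \<open>The mean acquired at x by the mollified noise under the tilt: \<open>\<Gamma>\<close>
  applied to \<open>smooth \<delta> g\<close>, which the mollifier of the noise smooths a second
  time. It is non-negative if g is.\<close>

lemma expectation_fld_mol:
  assumes \<delta>: "0 < \<delta>" "\<delta> \<le> 1" and \<epsilon>: "0 < \<epsilon>" "\<epsilon> \<le> 1" and g: "exp_decay g"
  shows "expectation (\<lambda>\<omega>. fld \<delta> g \<omega> * mol \<epsilon> x \<omega>) = (LINT z|\<Gamma>. smooth \<epsilon> (smooth \<delta> g) (x + z))"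
proof -
  have "expectation (\<lambda>\<omega>. fld \<delta> g \<omega> * mol \<epsilon> x \<omega>) = (LINT w|lborel. g w * cov_form \<Gamma> (\<lambda>y. heat \<delta> (y - w)) (\<lambda>y. heat \<epsilon> (y - x)))"
    using \<delta> \<epsilon> by (simp add: expectation_fld_mult exp_decay_integrable g square_integrable_mol expectation_mol_mol)
  also have "\<dots> = cov_form \<Gamma> (smooth \<delta> g) (\<lambda>y. heat \<epsilon> (y - x))"
    by (rule cov_form_smooth_left[OF \<delta> g exp_decay_heat[OF \<epsilon>(1)], symmetric])
  also have "\<dots> = (LINT z|\<Gamma>. smooth \<epsilon> (smooth \<delta> g) (x + z))"
    by (rule cov_form_heat_right[OF \<epsilon> exp_decay_smooth[OF g \<delta>]])
  finally show ?thesis .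
qed

lemma expectation_fld_fld:
  assumes \<delta>: "0 < \<delta>" "\<delta> \<le> 1" and \<epsilon>: "0 < \<epsilon>" "\<epsilon> \<le> 1" and g: "exp_decay g" and h: "exp_decay h"
  shows "expectation (\<lambda>\<omega>. fld \<delta> g \<omega> * fld \<epsilon> h \<omega>) = cov_form \<Gamma> (smooth \<delta> g) (smooth \<epsilon> h)"
proof -
  have 1: "expectation (\<lambda>\<omega>. mol \<epsilon> x \<omega> * fld \<delta> g \<omega>) = cov_form \<Gamma> (smooth \<delta> g) (\<lambda>y. heat \<epsilon> (y - x))" for x
    using expectation_fld_mol[OF \<delta> \<epsilon> g, of x] cov_form_heat_right[OF \<epsilon> exp_decay_smooth[OF g \<delta>], of x] by (simp add: mult.commute)
  have "expectation (\<lambda>\<omega>. fld \<delta> g \<omega> * fld \<epsilon> h \<omega>) = expectation (\<lambda>\<omega>. fld \<epsilon> h \<omega> * fld \<delta> g \<omega>)"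
    by (simp add: mult.commute)
  also have "\<dots> = (LINT x|lborel. h x * cov_form \<Gamma> (smooth \<delta> g) (\<lambda>y. heat \<epsilon> (y - x)))"
    using expectation_fld_mult[OF \<epsilon>(1) exp_decay_integrable[OF h] square_integrable_fld[OF \<delta>(1) exp_decay_integrable[OF g]]]
    by (simp add: 1)
  also have "\<dots> = cov_form \<Gamma> (smooth \<delta> g) (smooth \<epsilon> h)"
    by (rule cov_form_smooth_right[OF \<epsilon> h exp_decay_smooth[OF g \<delta>], symmetric])
  finally show ?thesis .
qed

end

section \<open>The covariance form\<close>

text \<open>Cutting both the values and the domain turns every measurable function into one of
  exponential decay.\<close>

definition trunc :: "nat \<Rightarrow> ('a::euclidean_space \<Rightarrow> real) \<Rightarrow> 'a \<Rightarrow> real" where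
  "trunc n h x = (if \<bar>h x\<bar> \<le> real n \<and> norm x \<le> real n then h x else 0)"

lemma borel_measurable_trunc [measurable]:
  assumes [measurable]: "h \<in> borel_measurable borel"
  shows "trunc n h \<in> borel_measurable borel"
  unfolding trunc_def[abs_def] by measurable

lemma trunc_abs_le: "\<bar>trunc n h x\<bar> \<le> \<bar>h x\<bar>"
  by (simp add: trunc_def)

lemma trunc_nonneg: "(\<And>x. 0 \<le> h x) \<Longrightarrow> 0 \<le> trunc n h x"
  by (simp add: trunc_def)

lemma exp_decay_trunc: "h \<in> borel_measurable borel \<Longrightarrow> exp_decay (trunc n h)"
  unfolding exp_decay_def
proof (intro conjI exI[of _ "real n * exp (real n)"] allI)
  fix x :: 'a
  have "real n * exp (real n) * exp (- norm x) = real n * exp (real n - norm x)"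
    by (simp add: mult_exp_exp)
  moreover have "real n * 1 \<le> real n * exp (real n - norm x)" if "norm x \<le> real n"
    using that by (intro mult_left_mono) auto
  ultimately have "\<bar>h x\<bar> \<le> real n * exp (real n) * exp (- norm x)" if "\<bar>h x\<bar> \<le> real n" "norm x \<le> real n"
    using that by linarith
  then show "\<bar>trunc n h x\<bar> \<le> real n * exp (real n) * exp (- norm x)"
    by (simp add: trunc_def)
qed measurable

lemma trunc_tendsto: "(\<lambda>n. trunc n h x) \<longlonglongrightarrow> h x"
proof -
  obtain N :: nat where N: "\<bar>h x\<bar> + norm x \<le> real N" using real_arch_simple by blast
  have "\<forall>\<^sub>F n in sequentially. trunc n h x = h x"
    using eventually_ge_at_top[of N]
  proof eventually_elim
    fix n assume "N \<le> n"
    then have "\<bar>h x\<bar> + norm x \<le> real n" using N by linarith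
    then have "\<bar>h x\<bar> \<le> real n" "norm x \<le> real n" using abs_ge_zero[of "h x"] norm_ge_zero[of x] by linarith+
    then show "trunc n h x = h x" by (simp add: trunc_def)
  qed
  then show ?thesis by (rule tendsto_eventually)
qed

text \<open>A sequence within the range (0, 1], on which the smoothing bounds have constants
  independent of the parameter.\<close>

definition eps :: "nat \<Rightarrow> real" where "eps n = 1 / real (Suc n)"

lemma eps: "0 < eps n" "eps n \<le> 1" "eps \<longlonglongrightarrow> 0"
  using LIMSEQ_inverse_real_of_nat by (auto simp: eps_def[abs_def] inverse_eq_divide)

lemma filterlim_eps: "filterlim eps (at_right 0) sequentially"
  using eps by (intro tendsto_imp_filterlim_at_right) auto

context noise
begin

text \<open>Represents the form as a limit of covariances of random variables, from which symmetry,
  positivity and Cauchy-Schwarz are inherited. The double smoothings along the same subsequence are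
  recorded for the tensor pairing.\<close>

lemma cov_form_smooth_limits:
  fixes h :: "'i \<Rightarrow> 'a \<Rightarrow> real"
  assumes I: "finite I" and h: "\<And>i. i \<in> I \<Longrightarrow> exp_decay (h i)"
  shows "\<exists>r. strict_mono r \<and>
    (\<forall>i\<in>I. \<forall>j\<in>I. (\<lambda>n. expectation (\<lambda>\<omega>. fld (eps (r n)) (h i) \<omega> * fld (eps (r n)) (h j) \<omega>)) \<longlonglongrightarrow> cov_form \<Gamma> (h i) (h j)) \<and>
    (\<forall>i\<in>I. AE x in lborel. (\<lambda>n. smooth (eps (r n)) (smooth (eps (r n)) (h i)) x) \<longlonglongrightarrow> h i x)"
proof -
  obtain r where r: "strict_mono r"
    "\<And>i. i \<in> I \<Longrightarrow> AE x in lborel. (\<lambda>n. smooth (eps (r n)) (h i) x) \<longlonglongrightarrow> h i x"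
    "\<And>i. i \<in> I \<Longrightarrow> AE x in lborel. (\<lambda>n. smooth (eps (r n)) (smooth (eps (r n)) (h i)) x) \<longlonglongrightarrow> h i x"
    using smooth_AE_subseq_finite[OF I, of h eps] h eps exp_decay_integrable by blast
  have "(\<lambda>n. expectation (\<lambda>\<omega>. fld (eps (r n)) (h i) \<omega> * fld (eps (r n)) (h j) \<omega>)) \<longlonglongrightarrow> cov_form \<Gamma> (h i) (h j)"
    if ij: "i \<in> I" "j \<in> I" for i j
  proof -
    note [measurable] = exp_decay_measurable[OF h[OF ij(1)]] exp_decay_measurable[OF h[OF ij(2)]]
    obtain C D where C: "\<And>x. \<bar>h i x\<bar> \<le> C * exp (- norm x)" and D: "\<And>x. \<bar>h j x\<bar> \<le> D * exp (- norm x)"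
      using h[OF ij(1)] h[OF ij(2)] exp_decay_bound by metis
    have "(\<lambda>n. cov_form \<Gamma> (smooth (eps (r n)) (h i)) (smooth (eps (r n)) (h j))) \<longlonglongrightarrow> cov_form \<Gamma> (h i) (h j)"
      by (rule cov_form_tendsto[where C = "C * 6 ^ DIM('a)" and D = "D * 6 ^ DIM('a)"])
        (use r ij C D eps in \<open>auto intro!: smooth_le_exp_norm\<close>)
    then show ?thesis using expectation_fld_fld[OF eps(1,2) eps(1,2) h[OF ij(1)] h[OF ij(2)]] by simp
  qed
  then show ?thesis using r by blast
qed

lemma cov_form_exp_decay:
  assumes f: "exp_decay f" and g: "exp_decay g"
  shows "cov_form \<Gamma> f g = cov_form \<Gamma> g f" "0 \<le> cov_form \<Gamma> f f"
    "\<bar>cov_form \<Gamma> f g\<bar> \<le> sqrt (cov_form \<Gamma> f f) * sqrt (cov_form \<Gamma> g g)"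
proof -
  define h where "h b = (if b then f else g)" for b
  have h: "exp_decay (h b)" for b using f g by (simp add: h_def)
  obtain r where r: "\<And>i j. (\<lambda>n. expectation (\<lambda>\<omega>. fld (eps (r n)) (h i) \<omega> * fld (eps (r n)) (h j) \<omega>)) \<longlonglongrightarrow> cov_form \<Gamma> (h i) (h j)"
    using cov_form_smooth_limits[of "UNIV :: bool set" h] h by auto
  have fg: "(\<lambda>n. expectation (\<lambda>\<omega>. fld (eps (r n)) f \<omega> * fld (eps (r n)) g \<omega>)) \<longlonglongrightarrow> cov_form \<Gamma> f g"
    and gf: "(\<lambda>n. expectation (\<lambda>\<omega>. fld (eps (r n)) g \<omega> * fld (eps (r n)) f \<omega>)) \<longlonglongrightarrow> cov_form \<Gamma> g f"
    and ff: "(\<lambda>n. expectation (\<lambda>\<omega>. fld (eps (r n)) f \<omega> * fld (eps (r n)) f \<omega>)) \<longlonglongrightarrow> cov_form \<Gamma> f f"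
    and gg: "(\<lambda>n. expectation (\<lambda>\<omega>. fld (eps (r n)) g \<omega> * fld (eps (r n)) g \<omega>)) \<longlonglongrightarrow> cov_form \<Gamma> g g"
    using r[of True False] r[of False True] r[of True True] r[of False False] by (simp_all add: h_def)
  show "cov_form \<Gamma> f g = cov_form \<Gamma> g f"
    using LIMSEQ_unique[OF fg] gf by (simp add: mult.commute)
  show "0 \<le> cov_form \<Gamma> f f"
    by (rule LIMSEQ_le_const[OF ff]) auto
  have sq: "square_integrable M (fld (eps n) f)" "square_integrable M (fld (eps n) g)" for n
    by (intro square_integrable_fld eps exp_decay_integrable f g)+
  show "\<bar>cov_form \<Gamma> f g\<bar> \<le> sqrt (cov_form \<Gamma> f f) * sqrt (cov_form \<Gamma> g g)"
  proof (rule LIMSEQ_le)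
    show "(\<lambda>n. \<bar>expectation (\<lambda>\<omega>. fld (eps (r n)) f \<omega> * fld (eps (r n)) g \<omega>)\<bar>) \<longlonglongrightarrow> \<bar>cov_form \<Gamma> f g\<bar>"
      by (intro tendsto_intros fg)
    show "(\<lambda>n. sqrt (expectation (\<lambda>\<omega>. fld (eps (r n)) f \<omega> * fld (eps (r n)) f \<omega>)) * sqrt (expectation (\<lambda>\<omega>. fld (eps (r n)) g \<omega> * fld (eps (r n)) g \<omega>)))
      \<longlonglongrightarrow> sqrt (cov_form \<Gamma> f f) * sqrt (cov_form \<Gamma> g g)"
      by (intro tendsto_intros ff gg)
    show "\<exists>N. \<forall>n\<ge>N. \<bar>expectation (\<lambda>\<omega>. fld (eps (r n)) f \<omega> * fld (eps (r n)) g \<omega>)\<bar> \<le>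
      sqrt (expectation (\<lambda>\<omega>. fld (eps (r n)) f \<omega> * fld (eps (r n)) f \<omega>)) * sqrt (expectation (\<lambda>\<omega>. fld (eps (r n)) g \<omega> * fld (eps (r n)) g \<omega>))"
      using Cauchy_Schwarz_square_integrable[OF sq] by (simp add: power2_eq_square)
  qed
qed

section \<open>The semi-inner product on \<open>pre_H\<close>\<close>

lemma pre_H_measurable: "f \<in> pre_H \<Gamma> \<Longrightarrow> f \<in> borel_measurable borel"
  by (simp add: pre_H_def)

lemma exp_decay_pre_H: "exp_decay f \<Longrightarrow> f \<in> pre_H \<Gamma>"
  by (simp add: pre_H_def form_integrable exp_decay_measurable)

lemma pre_H_abs:
  assumes "f \<in> pre_H \<Gamma>" shows "(\<lambda>x. \<bar>f x\<bar>) \<in> pre_H \<Gamma>"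
proof -
  have [measurable]: "f \<in> borel_measurable borel" using assms by (rule pre_H_measurable)
  have "integrable (\<Gamma> \<Otimes>\<^sub>M lborel) (\<lambda>p. \<bar>case p of (z, y) \<Rightarrow> f (y + z) * f y\<bar>)"
    using assms by (intro integrable_abs) (simp add: pre_H_def)
  then show ?thesis by (simp add: pre_H_def case_prod_unfold abs_mult)
qed

lemma cov_form_mono_trunc:
  assumes f: "f \<in> pre_H \<Gamma>" and nn: "\<And>x. 0 \<le> f x"
  shows "cov_form \<Gamma> (trunc n f) (trunc n f) \<le> cov_form \<Gamma> f f"
  unfolding cov_form_def
proof (rule integral_mono)
  have [measurable]: "f \<in> borel_measurable borel" using f by (rule pre_H_measurable)
  show "integrable (\<Gamma> \<Otimes>\<^sub>M lborel) (\<lambda>(z, y). trunc n f (y + z) * trunc n f y)"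
    by (intro form_integrable exp_decay_trunc) measurable
  show "integrable (\<Gamma> \<Otimes>\<^sub>M lborel) (\<lambda>(z, y). f (y + z) * f y)" using f by (simp add: pre_H_def)
  show "(case p of (z, y) \<Rightarrow> trunc n f (y + z) * trunc n f y) \<le> (case p of (z, y) \<Rightarrow> f (y + z) * f y)" for p
    using nn trunc_nonneg[of f n, OF nn] by (auto simp: trunc_def split: prod.split)
qed

text \<open>The definition of \<open>pre_H\<close> gives integrability only on the diagonal. Off the
  diagonal, Cauchy-Schwarz bounds the form for truncations of \<bar>f\<bar> and \<bar>g\<bar>
  uniformly, and Fatou's lemma removes the truncation.\<close>

lemma pre_H_pair_integrable:
  assumes f: "f \<in> pre_H \<Gamma>" and g: "g \<in> pre_H \<Gamma>"
  shows "integrable (\<Gamma> \<Otimes>\<^sub>M lborel) (\<lambda>(z, y). f (y + z) * g y)"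
proof (rule integrableI_bounded)
  have [measurable]: "f \<in> borel_measurable borel" "g \<in> borel_measurable borel" using f g by (auto intro: pre_H_measurable)
  show "(\<lambda>(z, y). f (y + z) * g y) \<in> borel_measurable (\<Gamma> \<Otimes>\<^sub>M lborel)" by measurable
  define F G where "F n = trunc n (\<lambda>x. \<bar>f x\<bar>)" and "G n = trunc n (\<lambda>x. \<bar>g x\<bar>)" for n
  have [measurable]: "F n \<in> borel_measurable borel" "G n \<in> borel_measurable borel" for n by (auto simp: F_def G_def)
  have FG: "exp_decay (F n)" "exp_decay (G n)" "0 \<le> F n x" "0 \<le> G n x" for n x
    by (auto simp: F_def G_def trunc_nonneg intro!: exp_decay_trunc)
  define K where "K = sqrt (cov_form \<Gamma> (\<lambda>x. \<bar>f x\<bar>) (\<lambda>x. \<bar>f x\<bar>)) * sqrt (cov_form \<Gamma> (\<lambda>x. \<bar>g x\<bar>) (\<lambda>x. \<bar>g x\<bar>))"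
  have lim: "(\<lambda>n. ennreal (F n (y + z) * G n y)) \<longlonglongrightarrow> ennreal (\<bar>f (y + z)\<bar> * \<bar>g y\<bar>)" for y z
    unfolding F_def G_def by (intro tendsto_intros trunc_tendsto)
  have "(\<integral>\<^sup>+p. ennreal (norm (case p of (z, y) \<Rightarrow> f (y + z) * g y)) \<partial>(\<Gamma> \<Otimes>\<^sub>M lborel)) =
     (\<integral>\<^sup>+p. liminf (\<lambda>n. ennreal (F n (snd p + fst p) * G n (snd p))) \<partial>(\<Gamma> \<Otimes>\<^sub>M lborel))"
    by (intro nn_integral_cong) (simp add: case_prod_beta abs_mult lim_imp_Liminf[OF _ lim])
  also have "\<dots> \<le> liminf (\<lambda>n. \<integral>\<^sup>+p. ennreal (F n (snd p + fst p) * G n (snd p)) \<partial>(\<Gamma> \<Otimes>\<^sub>M lborel))"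
    by (intro nn_integral_liminf) measurable
  also have "\<dots> \<le> ennreal K"
  proof (rule Liminf_le)
    have "(\<integral>\<^sup>+p. ennreal (F n (snd p + fst p) * G n (snd p)) \<partial>(\<Gamma> \<Otimes>\<^sub>M lborel)) \<le> ennreal K" for n
    proof -
      have "(\<integral>\<^sup>+p. ennreal (F n (snd p + fst p) * G n (snd p)) \<partial>(\<Gamma> \<Otimes>\<^sub>M lborel)) = ennreal (cov_form \<Gamma> (F n) (G n))"
        unfolding cov_form_def case_prod_unfold
        using form_integrable[OF FG(1,2), of n n] FG(3,4) by (intro nn_integral_eq_integral) (auto simp: case_prod_unfold)
      also have "cov_form \<Gamma> (F n) (G n) \<le> sqrt (cov_form \<Gamma> (F n) (F n)) * sqrt (cov_form \<Gamma> (G n) (G n))"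
        using cov_form_exp_decay(3)[OF FG(1,2), of n n] by linarith
      also have "\<dots> \<le> K"
      proof -
        have "cov_form \<Gamma> (F n) (F n) \<le> cov_form \<Gamma> (\<lambda>x. \<bar>f x\<bar>) (\<lambda>x. \<bar>f x\<bar>)" "cov_form \<Gamma> (G n) (G n) \<le> cov_form \<Gamma> (\<lambda>x. \<bar>g x\<bar>) (\<lambda>x. \<bar>g x\<bar>)"
          unfolding F_def G_def by (intro cov_form_mono_trunc pre_H_abs f g; simp)+
        moreover have "0 \<le> cov_form \<Gamma> (F n) (F n)" "0 \<le> cov_form \<Gamma> (G n) (G n)"
          using cov_form_exp_decay(2)[OF FG(1) FG(1)] cov_form_exp_decay(2)[OF FG(2) FG(2)] by auto
        ultimately show ?thesis unfolding K_def by (intro mult_mono) auto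
      qed
      finally show ?thesis by (simp add: ennreal_leI)
    qed
    then show "\<forall>\<^sub>F n in sequentially. (\<integral>\<^sup>+p. ennreal (F n (snd p + fst p) * G n (snd p)) \<partial>(\<Gamma> \<Otimes>\<^sub>M lborel)) \<le> ennreal K" by simp
  qed simp
  also have "\<dots> < \<infinity>" by simp
  finally show "(\<integral>\<^sup>+p. ennreal (norm (case p of (z, y) \<Rightarrow> f (y + z) * g y)) \<partial>(\<Gamma> \<Otimes>\<^sub>M lborel)) < \<infinity>" .
qed

lemma cov_form_trunc_tendsto:
  assumes f: "f \<in> pre_H \<Gamma>" and g: "g \<in> pre_H \<Gamma>"
  shows "(\<lambda>n. cov_form \<Gamma> (trunc n f) (trunc n g)) \<longlonglongrightarrow> cov_form \<Gamma> f g"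
  unfolding cov_form_def
proof (rule integral_dominated_convergence)
  have [measurable]: "f \<in> borel_measurable borel" "g \<in> borel_measurable borel" using f g by (auto intro: pre_H_measurable)
  show "integrable (\<Gamma> \<Otimes>\<^sub>M lborel) (\<lambda>p. \<bar>case p of (z, y) \<Rightarrow> f (y + z) * g y\<bar>)"
    by (intro integrable_abs pre_H_pair_integrable f g)
  show "AE p in \<Gamma> \<Otimes>\<^sub>M lborel. norm (case p of (z, y) \<Rightarrow> trunc n f (y + z) * trunc n g y) \<le> \<bar>case p of (z, y) \<Rightarrow> f (y + z) * g y\<bar>" for n
    by (intro always_eventually allI) (auto simp: abs_mult intro!: mult_mono trunc_abs_le split: prod.split)
  show "AE p in \<Gamma> \<Otimes>\<^sub>M lborel. (\<lambda>n. case p of (z, y) \<Rightarrow> trunc n f (y + z) * trunc n g y) \<longlonglongrightarrow> (case p of (z, y) \<Rightarrow> f (y + z) * g y)"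
    by (intro always_eventually allI) (auto intro!: tendsto_intros trunc_tendsto split: prod.split)
  show "(\<lambda>(z, y). f (y + z) * g y) \<in> borel_measurable (\<Gamma> \<Otimes>\<^sub>M lborel)"
    "(\<lambda>(z, y). trunc n f (y + z) * trunc n g y) \<in> borel_measurable (\<Gamma> \<Otimes>\<^sub>M lborel)" for n by measurable
qed

lemma cov_form_commute: "f \<in> pre_H \<Gamma> \<Longrightarrow> g \<in> pre_H \<Gamma> \<Longrightarrow> cov_form \<Gamma> f g = cov_form \<Gamma> g f"
proof -
  assume f: "f \<in> pre_H \<Gamma>" and g: "g \<in> pre_H \<Gamma>"
  have "cov_form \<Gamma> (trunc n f) (trunc n g) = cov_form \<Gamma> (trunc n g) (trunc n f)" for n
    by (intro cov_form_exp_decay(1) exp_decay_trunc pre_H_measurable f g)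
  then show ?thesis using LIMSEQ_unique[OF cov_form_trunc_tendsto[OF f g]] cov_form_trunc_tendsto[OF g f] by simp
qed

lemma cov_form_nonneg:
  assumes f: "f \<in> pre_H \<Gamma>" shows "0 \<le> cov_form \<Gamma> f f"
proof (rule LIMSEQ_le_const[OF cov_form_trunc_tendsto[OF f f]])
  note t = exp_decay_trunc[OF pre_H_measurable[OF f]]
  show "\<exists>N. \<forall>n\<ge>N. 0 \<le> cov_form \<Gamma> (trunc n f) (trunc n f)"
    using cov_form_exp_decay(2)[OF t t] by blast
qed

lemma pre_H_norm_nonneg: "f \<in> pre_H \<Gamma> \<Longrightarrow> 0 \<le> pre_H_norm \<Gamma> f"
  by (simp add: pre_H_norm_def cov_form_nonneg)

lemma pre_H_norm_square: "f \<in> pre_H \<Gamma> \<Longrightarrow> (pre_H_norm \<Gamma> f)\<^sup>2 = cov_form \<Gamma> f f"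
  by (simp add: pre_H_norm_def cov_form_nonneg)

lemma pre_H_norm_trunc_tendsto: "f \<in> pre_H \<Gamma> \<Longrightarrow> (\<lambda>n. pre_H_norm \<Gamma> (trunc n f)) \<longlonglongrightarrow> pre_H_norm \<Gamma> f"
  unfolding pre_H_norm_def by (intro tendsto_real_sqrt cov_form_trunc_tendsto)

lemma cov_form_abs_le:
  assumes f: "f \<in> pre_H \<Gamma>" and g: "g \<in> pre_H \<Gamma>"
  shows "\<bar>cov_form \<Gamma> f g\<bar> \<le> pre_H_norm \<Gamma> f * pre_H_norm \<Gamma> g"
proof (rule LIMSEQ_le)
  show "(\<lambda>n. \<bar>cov_form \<Gamma> (trunc n f) (trunc n g)\<bar>) \<longlonglongrightarrow> \<bar>cov_form \<Gamma> f g\<bar>"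
    by (intro tendsto_intros cov_form_trunc_tendsto f g)
  show "(\<lambda>n. pre_H_norm \<Gamma> (trunc n f) * pre_H_norm \<Gamma> (trunc n g)) \<longlonglongrightarrow> pre_H_norm \<Gamma> f * pre_H_norm \<Gamma> g"
    by (intro tendsto_intros pre_H_norm_trunc_tendsto f g)
  show "\<exists>N. \<forall>n\<ge>N. \<bar>cov_form \<Gamma> (trunc n f) (trunc n g)\<bar> \<le> pre_H_norm \<Gamma> (trunc n f) * pre_H_norm \<Gamma> (trunc n g)"
    using cov_form_exp_decay(3)[OF exp_decay_trunc[OF pre_H_measurable[OF f]] exp_decay_trunc[OF pre_H_measurable[OF g]]]
    by (simp add: pre_H_norm_def)
qed

lemma pre_H_lincomb:
  assumes f: "f \<in> pre_H \<Gamma>" and g: "g \<in> pre_H \<Gamma>"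
  shows "(\<lambda>x. f x + c * g x) \<in> pre_H \<Gamma>"
    "cov_form \<Gamma> (\<lambda>x. f x + c * g x) (\<lambda>x. f x + c * g x) = cov_form \<Gamma> f f + 2 * c * cov_form \<Gamma> f g + c\<^sup>2 * cov_form \<Gamma> g g"
proof -
  have [measurable]: "f \<in> borel_measurable borel" "g \<in> borel_measurable borel" using f g by (auto intro: pre_H_measurable)
  note i = pre_H_pair_integrable[OF f f] pre_H_pair_integrable[OF f g] pre_H_pair_integrable[OF g f] pre_H_pair_integrable[OF g g]
  have eq: "(\<lambda>(z, y). (f (y + z) + c * g (y + z)) * (f y + c * g y)) =
    (\<lambda>p. (case p of (z, y) \<Rightarrow> f (y + z) * f y) + c * (case p of (z, y) \<Rightarrow> f (y + z) * g y)
      + c * (case p of (z, y) \<Rightarrow> g (y + z) * f y) + c\<^sup>2 * (case p of (z, y) \<Rightarrow> g (y + z) * g y))"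
    by (auto simp: algebra_simps power2_eq_square)
  show "(\<lambda>x. f x + c * g x) \<in> pre_H \<Gamma>"
    unfolding pre_H_def using i by (intro CollectI conjI) (measurable, simp only: eq, intro Bochner_Integration.integrable_add integrable_mult_right)
  have "cov_form \<Gamma> (\<lambda>x. f x + c * g x) (\<lambda>x. f x + c * g x) = cov_form \<Gamma> f f + c * cov_form \<Gamma> f g + c * cov_form \<Gamma> g f + c\<^sup>2 * cov_form \<Gamma> g g"
    unfolding cov_form_def eq using i by (simp only: Bochner_Integration.integral_add Bochner_Integration.integrable_add integrable_mult_right integral_mult_right_zero)
  then show "cov_form \<Gamma> (\<lambda>x. f x + c * g x) (\<lambda>x. f x + c * g x) = cov_form \<Gamma> f f + 2 * c * cov_form \<Gamma> f g + c\<^sup>2 * cov_form \<Gamma> g g"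
    using cov_form_commute[OF f g] by simp
qed

lemma pre_H_diff: "f \<in> pre_H \<Gamma> \<Longrightarrow> g \<in> pre_H \<Gamma> \<Longrightarrow> (\<lambda>x. f x - g x) \<in> pre_H \<Gamma>"
  using pre_H_lincomb(1)[of f g "-1"] by simp

lemma pre_H_norm_triangle:
  assumes f: "f \<in> pre_H \<Gamma>" and g: "g \<in> pre_H \<Gamma>"
  shows "pre_H_norm \<Gamma> (\<lambda>x. f x + g x) \<le> pre_H_norm \<Gamma> f + pre_H_norm \<Gamma> g"
proof (rule power2_le_imp_le)
  have fg: "(\<lambda>x. f x + g x) \<in> pre_H \<Gamma>" using pre_H_lincomb(1)[OF f g, of 1] by simp
  have "(pre_H_norm \<Gamma> (\<lambda>x. f x + g x))\<^sup>2 = cov_form \<Gamma> f f + 2 * cov_form \<Gamma> f g + cov_form \<Gamma> g g"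
    using pre_H_lincomb(2)[OF f g, of 1] by (simp add: pre_H_norm_square[OF fg])
  also have "\<dots> \<le> (pre_H_norm \<Gamma> f)\<^sup>2 + 2 * (pre_H_norm \<Gamma> f * pre_H_norm \<Gamma> g) + (pre_H_norm \<Gamma> g)\<^sup>2"
    using cov_form_abs_le[OF f g] by (simp add: pre_H_norm_square f g)
  also have "\<dots> = (pre_H_norm \<Gamma> f + pre_H_norm \<Gamma> g)\<^sup>2" by (simp add: power2_sum)
  finally show "(pre_H_norm \<Gamma> (\<lambda>x. f x + g x))\<^sup>2 \<le> (pre_H_norm \<Gamma> f + pre_H_norm \<Gamma> g)\<^sup>2" .
qed (use f g in \<open>auto intro: add_nonneg_nonneg pre_H_norm_nonneg\<close>)

lemma pre_H_norm_minus_commute: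
  "pre_H_norm \<Gamma> (\<lambda>x. f x - g x) = pre_H_norm \<Gamma> (\<lambda>x. g x - f x)"
proof -
  have "(f (y + z) - g (y + z)) * (f y - g y) = (g (y + z) - f (y + z)) * (g y - f y)" for y z
    by (simp add: algebra_simps)
  then show ?thesis by (simp add: pre_H_norm_def cov_form_def)
qed

lemma pre_H_norm_diff_le:
  assumes f: "f \<in> pre_H \<Gamma>" and g: "g \<in> pre_H \<Gamma>"
  shows "\<bar>pre_H_norm \<Gamma> f - pre_H_norm \<Gamma> g\<bar> \<le> pre_H_norm \<Gamma> (\<lambda>x. f x - g x)"
  using pre_H_norm_triangle[OF pre_H_diff[OF f g] g] pre_H_norm_triangle[OF pre_H_diff[OF g f] f]
    pre_H_norm_minus_commute[of f g] by simp

text \<open>Maurey's sampling argument: the points \<open>w\<close> are chosen greedily so that the error of the sum of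
  \<open>n\<close> samples grows in mean square only like \<open>n\<close>.\<close>

lemma fld_sample_step:
  assumes \<delta>: "\<delta> > 0" and g: "integrable lborel g" "\<And>w. 0 \<le> g w" and I: "0 < (LINT w|lborel. g w)"
    and X: "square_integrable M X"
  shows "\<exists>w. expectation (\<lambda>\<omega>. (X \<omega> + (LINT w|lborel. g w) * mol \<delta> w \<omega> - fld \<delta> g \<omega>)\<^sup>2) \<le>
     expectation (\<lambda>\<omega>. (X \<omega>)\<^sup>2) + (LINT w|lborel. g w)\<^sup>2 * molvar \<delta>"
proof (rule ccontr)
  define J where "J = (LINT w|lborel. g w)"
  define Y where "Y = fld \<delta> g"
  define b where "b = expectation (\<lambda>\<omega>. (X \<omega>)\<^sup>2) + J\<^sup>2 * molvar \<delta>"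
  define F where "F w = expectation (\<lambda>\<omega>. (X \<omega> + J * mol \<delta> w \<omega> - Y \<omega>)\<^sup>2)" for w
  assume "\<not> ?thesis"
  then have F: "F w > b" for w by (simp add: F_def b_def J_def Y_def not_le)
  have Y: "square_integrable M Y" unfolding Y_def by (rule square_integrable_fld[OF \<delta> g(1)])
  have Z: "square_integrable M (\<lambda>\<omega>. X \<omega> - Y \<omega>)" by (rule square_integrable_diff[OF X Y])
  note mo = square_integrable_mol[OF \<delta>]
  define c where "c w = expectation (\<lambda>\<omega>. mol \<delta> w \<omega> * (X \<omega> - Y \<omega>))" for w
  have Feq: "F w = expectation (\<lambda>\<omega>. (X \<omega> - Y \<omega>)\<^sup>2) + 2 * J * c w + J\<^sup>2 * molvar \<delta>" for w
  proof -
    have "F w = expectation (\<lambda>\<omega>. (X \<omega> - Y \<omega>)\<^sup>2 + 2 * J * (mol \<delta> w \<omega> * (X \<omega> - Y \<omega>)) + J\<^sup>2 * (mol \<delta> w \<omega>)\<^sup>2)"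
      unfolding F_def by (intro Bochner_Integration.integral_cong) (auto simp: power2_eq_square algebra_simps)
    also have "\<dots> = expectation (\<lambda>\<omega>. (X \<omega> - Y \<omega>)\<^sup>2) + 2 * J * c w + J\<^sup>2 * expectation (\<lambda>\<omega>. (mol \<delta> w \<omega>)\<^sup>2)"
      using Z mo[of w] square_integrable_mult[OF mo Z] by (simp add: c_def square_integrable_def)
    finally show ?thesis by (simp add: expectation_mol_square[OF \<delta>])
  qed
  have ic: "integrable lborel (\<lambda>w. g w * c w)"
    using LM.integrable_fst'[OF integrable_fld_mult[OF \<delta> g(1) Z]] by (simp add: c_def)
  have gc: "(LINT w|lborel. g w * c w) = expectation (\<lambda>\<omega>. Y \<omega> * (X \<omega> - Y \<omega>))"
    unfolding c_def Y_def by (rule expectation_fld_mult[symmetric, OF \<delta> g(1) Z[unfolded Y_def]])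
  \<comment> \<open>Integrated against g, the excess F - b gives - J E [Y^2], so it cannot be
    positive at every point.\<close>
  have exp: "g w * (F w - b) = (expectation (\<lambda>\<omega>. (X \<omega> - Y \<omega>)\<^sup>2) - expectation (\<lambda>\<omega>. (X \<omega>)\<^sup>2)) * g w + 2 * J * (g w * c w)" for w
    by (simp add: Feq b_def algebra_simps)
  have int: "integrable lborel (\<lambda>w. g w * (F w - b))"
    unfolding exp using g(1) ic by (intro Bochner_Integration.integrable_add integrable_mult_right) auto
  have "(LINT w|lborel. g w * (F w - b)) = (expectation (\<lambda>\<omega>. (X \<omega> - Y \<omega>)\<^sup>2) - expectation (\<lambda>\<omega>. (X \<omega>)\<^sup>2)) * J + 2 * J * expectation (\<lambda>\<omega>. Y \<omega> * (X \<omega> - Y \<omega>))"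
    unfolding exp gc[symmetric] J_def[symmetric] using g(1) ic by (simp add: J_def)
  also have "\<dots> = J * (expectation (\<lambda>\<omega>. (X \<omega> - Y \<omega>)\<^sup>2) + 2 * expectation (\<lambda>\<omega>. Y \<omega> * (X \<omega> - Y \<omega>)) - expectation (\<lambda>\<omega>. (X \<omega>)\<^sup>2))"
    by (simp add: algebra_simps)
  also have "expectation (\<lambda>\<omega>. (X \<omega> - Y \<omega>)\<^sup>2) + 2 * expectation (\<lambda>\<omega>. Y \<omega> * (X \<omega> - Y \<omega>)) - expectation (\<lambda>\<omega>. (X \<omega>)\<^sup>2)
     = expectation (\<lambda>\<omega>. (X \<omega> - Y \<omega>)\<^sup>2 + 2 * (Y \<omega> * (X \<omega> - Y \<omega>)) - (X \<omega>)\<^sup>2)"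
    using Z X square_integrable_mult[OF Y Z] by (simp add: square_integrable_def)
  also have "\<dots> = expectation (\<lambda>\<omega>. - ((Y \<omega>)\<^sup>2))"
    by (intro Bochner_Integration.integral_cong) (auto simp: power2_eq_square algebra_simps)
  also have "J * \<dots> \<le> 0"
    using I by (simp add: J_def mult_nonneg_nonneg)
  finally have "(LINT w|lborel. g w * (F w - b)) \<le> 0" .
  moreover have nn: "0 \<le> g w * (F w - b)" for w using g(2)[of w] F[of w] by simp
  moreover have "0 \<le> (LINT w|lborel. g w * (F w - b))"
    by (rule Bochner_Integration.integral_nonneg) (rule nn)
  ultimately have "(LINT w|lborel. g w * (F w - b)) = 0" by linarith
  then have "AE w in lborel. g w * (F w - b) = 0"
    using integral_nonneg_eq_0_iff_AE[OF int] nn by simp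
  then have "AE w in lborel. g w = 0" by eventually_elim (use F in \<open>auto simp: less_le\<close>)
  then have "J = 0" unfolding J_def by (rule integral_eq_zero_AE)
  then show False using I by (simp add: J_def)
qed

text \<open>After n samples the sum differs from n times the field by at most n c in mean square, so
  their average differs from the field by at most c / n. This is what makes the pathwise integral
  Gaussian.\<close>

lemma fld_in_L2_closure:
  assumes \<delta>: "\<delta> > 0" and g: "integrable lborel g" "\<And>w. 0 \<le> g w"
  shows "fld \<delta> g \<in> L2_closure M gspan"
proof -
  interpret V: gaussian_space M gspan by (rule gaussian_space_gspan)
  define J where "J = (LINT w|lborel. g w)"
  have J: "0 \<le> J" unfolding J_def using g(2) by simp
  note Y = square_integrable_fld[OF \<delta> g(1)]
  show ?thesis
    unfolding L2_closure_def
  proof (intro CollectI conjI allI impI Y)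
    fix e :: real assume e: "e > 0"
    show "\<exists>T\<in>gspan. expectation (\<lambda>\<omega>. (fld \<delta> g \<omega> - T \<omega>)\<^sup>2) < e"
    \<comment> \<open>Sampling requires positive mass; a density of mass zero gives a field that
      vanishes in L^2.\<close>
    proof (cases "J = 0")
      case True
      then have "AE w in lborel. g w = 0"
        using integral_nonneg_eq_0_iff_AE[OF g(1)] g(2) by (simp add: J_def)
      then have "expectation (\<lambda>\<omega>. fld \<delta> g \<omega> * fld \<delta> g \<omega>) = 0"
        unfolding expectation_fld_mult[OF \<delta> g(1) Y] by (intro integral_eq_zero_AE) auto
      then show ?thesis using e V.scale_V[OF mol_in_gspan[OF \<delta>, of 0], of 0]
        by (intro bexI[of _ "\<lambda>_. 0"]) (auto simp: power2_eq_square)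
    next
      case False
      then have Jpos: "0 < (LINT w|lborel. g w)" using J by (simp add: J_def)
      define c where "c = J\<^sup>2 * molvar \<delta>"
      have c: "c \<ge> 0" by (simp add: c_def molvar_nonneg)
      have "\<exists>T\<in>gspan. expectation (\<lambda>\<omega>. (T \<omega> - real n * fld \<delta> g \<omega>)\<^sup>2) \<le> real n * c" for n
      proof (induction n)
        case 0
        show ?case using V.scale_V[OF mol_in_gspan[OF \<delta>, of 0], of 0] by (intro bexI[of _ "\<lambda>_. 0"]) auto
      next
        case (Suc n)
        then obtain T where T: "T \<in> gspan" "expectation (\<lambda>\<omega>. (T \<omega> - real n * fld \<delta> g \<omega>)\<^sup>2) \<le> real n * c" by blast
        have "square_integrable M (\<lambda>\<omega>. T \<omega> - real n * fld \<delta> g \<omega>)"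
          by (intro square_integrable_diff square_integrable_scale Y V.square_integrable_V T)
        from fld_sample_step[OF \<delta> g Jpos this]
        obtain w where w: "expectation (\<lambda>\<omega>. (T \<omega> - real n * fld \<delta> g \<omega> + J * mol \<delta> w \<omega> - fld \<delta> g \<omega>)\<^sup>2) \<le>
          expectation (\<lambda>\<omega>. (T \<omega> - real n * fld \<delta> g \<omega>)\<^sup>2) + c"
          unfolding J_def c_def by blast
        have "expectation (\<lambda>\<omega>. ((T \<omega> + J * mol \<delta> w \<omega>) - real (Suc n) * fld \<delta> g \<omega>)\<^sup>2) =
          expectation (\<lambda>\<omega>. (T \<omega> - real n * fld \<delta> g \<omega> + J * mol \<delta> w \<omega> - fld \<delta> g \<omega>)\<^sup>2)"
          by (simp add: algebra_simps)
        also have "\<dots> \<le> real (Suc n) * c" using w T(2) by (simp add: algebra_simps)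
        finally show ?case
          by (intro bexI[of _ "\<lambda>\<omega>. T \<omega> + J * mol \<delta> w \<omega>"] V.add_V V.scale_V T(1) mol_in_gspan[OF \<delta>])
      qed
      moreover obtain n :: nat where n: "c / e < real n" using reals_Archimedean2 by blast
      ultimately obtain T where T: "T \<in> gspan" "expectation (\<lambda>\<omega>. (T \<omega> - real n * fld \<delta> g \<omega>)\<^sup>2) \<le> real n * c" by blast
      have n0: "real n > 0" using n c e by (meson divide_nonneg_pos le_less_trans)
      have "expectation (\<lambda>\<omega>. (fld \<delta> g \<omega> - (1 / real n) * T \<omega>)\<^sup>2) = expectation (\<lambda>\<omega>. (1 / (real n)\<^sup>2) * (T \<omega> - real n * fld \<delta> g \<omega>)\<^sup>2)"
        using n0 by (intro Bochner_Integration.integral_cong) (auto simp: power2_eq_square field_simps)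
      also have "\<dots> = (1 / (real n)\<^sup>2) * expectation (\<lambda>\<omega>. (T \<omega> - real n * fld \<delta> g \<omega>)\<^sup>2)"
        by (rule integral_mult_right_zero)
      also have "\<dots> \<le> (1 / (real n)\<^sup>2) * (real n * c)" by (intro mult_left_mono T(2)) simp
      also have "\<dots> = c / real n" using n0 by (simp add: power2_eq_square)
      also have "\<dots> < e" using n n0 e by (simp add: field_simps)
      finally show ?thesis by (intro bexI[OF _ V.scale_V[OF T(1), of "1 / real n"]])
    qed
  qed
qed

end

section \<open>Integrals of products of the noise\<close>

text \<open>Jensen and Fubini for averages of random variables with uniformly bounded second
  moments. It is applied to products of the noise on the original space and on a product of copies
  of it.\<close>

lemma square_integrable_mixture:
  fixes f :: "'x \<times> 'w \<Rightarrow> real"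
  assumes \<nu>: "finite_measure \<nu>" and M: "sigma_finite_measure M"
    and f [measurable]: "f \<in> borel_measurable (\<nu> \<Otimes>\<^sub>M M)"
    and sq: "\<And>x. x \<in> space \<nu> \<Longrightarrow> square_integrable M (\<lambda>\<omega>. f (x, \<omega>))"
    and c: "\<And>x. x \<in> space \<nu> \<Longrightarrow> (LINT \<omega>|M. (f (x, \<omega>))\<^sup>2) \<le> c"
  shows "square_integrable M (\<lambda>\<omega>. LINT x|\<nu>. f (x, \<omega>))"
    and "square_integrable M U \<Longrightarrow> integrable \<nu> (\<lambda>x. LINT \<omega>|M. f (x, \<omega>) * U \<omega>)"
    and "square_integrable M U \<Longrightarrow>
      (LINT \<omega>|M. (LINT x|\<nu>. f (x, \<omega>)) * U \<omega>) = (LINT x|\<nu>. LINT \<omega>|M. f (x, \<omega>) * U \<omega>)"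
proof -
  interpret \<nu>: finite_measure \<nu> by fact
  interpret M: sigma_finite_measure M by fact
  interpret P: pair_sigma_finite \<nu> M ..
  interpret Q: pair_sigma_finite M \<nu> ..
  have i: "integrable (\<nu> \<Otimes>\<^sub>M M) (\<lambda>p. (f p)\<^sup>2)"
  proof (rule P.integrable_pair_bound[where b = "\<lambda>_. c"])
    fix x assume x: "x \<in> space \<nu>"
    have "(\<integral>\<^sup>+\<omega>. ennreal \<bar>(f (x, \<omega>))\<^sup>2\<bar> \<partial>M) = ennreal (LINT \<omega>|M. \<bar>(f (x, \<omega>))\<^sup>2\<bar>)"
      using sq[OF x] by (intro nn_integral_eq_integral) (auto simp: square_integrable_def)
    then show "(\<integral>\<^sup>+\<omega>. ennreal \<bar>(f (x, \<omega>))\<^sup>2\<bar> \<partial>M) \<le> ennreal c" using c[OF x] by (simp add: ennreal_leI)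
  qed auto
  have i': "integrable (M \<Otimes>\<^sub>M \<nu>) (\<lambda>(\<omega>, x). (f (x, \<omega>))\<^sup>2)" using P.integrable_product_swap[OF i] by simp
  define m where "m = measure \<nu> (space \<nu>)"
  have bound: "AE \<omega> in M. (LINT x|\<nu>. f (x, \<omega>))\<^sup>2 \<le> m * (LINT x|\<nu>. (f (x, \<omega>))\<^sup>2)"
    using Q.AE_integrable_fst'[OF i'] AE_space
  proof eventually_elim
    fix \<omega> assume \<omega>: "\<omega> \<in> space M" and "integrable \<nu> (\<lambda>x. case (\<omega>, x) of (\<omega>, x) \<Rightarrow> (f (x, \<omega>))\<^sup>2)"
    then have int: "integrable \<nu> (\<lambda>x. (f (x, \<omega>))\<^sup>2)" by simp
    have [measurable]: "(\<lambda>x. f (x, \<omega>)) \<in> borel_measurable \<nu>" using \<omega> by measurable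
    have "\<bar>LINT x|\<nu>. f (x, \<omega>) * 1\<bar> \<le> sqrt (LINT x|\<nu>. (f (x, \<omega>))\<^sup>2) * sqrt (LINT x|\<nu>. 1\<^sup>2)"
      by (rule Cauchy_Schwarz_integral) (use int in auto)
    then have "\<bar>LINT x|\<nu>. f (x, \<omega>)\<bar> \<le> sqrt (m * (LINT x|\<nu>. (f (x, \<omega>))\<^sup>2))"
      by (simp add: m_def real_sqrt_mult mult.commute)
    then have "\<bar>LINT x|\<nu>. f (x, \<omega>)\<bar>\<^sup>2 \<le> (sqrt (m * (LINT x|\<nu>. (f (x, \<omega>))\<^sup>2)))\<^sup>2" by (intro power_mono) auto
    also have "\<dots> = m * (LINT x|\<nu>. (f (x, \<omega>))\<^sup>2)"
      by (intro real_sqrt_pow2 mult_nonneg_nonneg) (auto simp: m_def)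
    finally show "(LINT x|\<nu>. f (x, \<omega>))\<^sup>2 \<le> m * (LINT x|\<nu>. (f (x, \<omega>))\<^sup>2)" by simp
  qed
  have "integrable M (\<lambda>\<omega>. (LINT x|\<nu>. f (x, \<omega>))\<^sup>2)"
  proof (rule Bochner_Integration.integrable_bound)
    show "integrable M (\<lambda>\<omega>. m * (LINT x|\<nu>. (f (x, \<omega>))\<^sup>2))"
      using Q.integrable_fst'[OF i'] by simp
    show "AE \<omega> in M. norm ((LINT x|\<nu>. f (x, \<omega>))\<^sup>2) \<le> norm (m * (LINT x|\<nu>. (f (x, \<omega>))\<^sup>2))"
      using bound by eventually_elim (auto intro: order.trans[OF _ abs_ge_self])
  qed measurable
  then show "square_integrable M (\<lambda>\<omega>. LINT x|\<nu>. f (x, \<omega>))" by (simp add: square_integrable_def)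
  assume U: "square_integrable M U"
  have [measurable]: "U \<in> borel_measurable M" using U by (simp add: square_integrable_def)
  have iU: "integrable (\<nu> \<Otimes>\<^sub>M M) (\<lambda>(x, \<omega>). f (x, \<omega>) * U \<omega>)"
  proof (rule P.integrable_pair_bound[where b = "\<lambda>_. sqrt c * sqrt (LINT \<omega>|M. (U \<omega>)\<^sup>2)"])
    show "(\<lambda>(x, \<omega>). f (x, \<omega>) * U \<omega>) \<in> borel_measurable (\<nu> \<Otimes>\<^sub>M M)" by measurable
    fix x assume x: "x \<in> space \<nu>"
    have sqa: "square_integrable M (\<lambda>\<omega>. \<bar>f (x, \<omega>)\<bar>)" "square_integrable M (\<lambda>\<omega>. \<bar>U \<omega>\<bar>)"
      using sq[OF x] U by (auto simp: square_integrable_def)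
    have "(\<integral>\<^sup>+\<omega>. ennreal \<bar>f (x, \<omega>) * U \<omega>\<bar> \<partial>M) = ennreal (LINT \<omega>|M. \<bar>f (x, \<omega>)\<bar> * \<bar>U \<omega>\<bar>)"
      using square_integrable_mult[OF sqa] by (subst nn_integral_eq_integral[symmetric]) (auto simp: abs_mult)
    also have "\<dots> \<le> ennreal (sqrt c * sqrt (LINT \<omega>|M. (U \<omega>)\<^sup>2))"
    proof (rule ennreal_leI)
      have "(LINT \<omega>|M. \<bar>f (x, \<omega>)\<bar> * \<bar>U \<omega>\<bar>) \<le> sqrt (LINT \<omega>|M. (f (x, \<omega>))\<^sup>2) * sqrt (LINT \<omega>|M. (U \<omega>)\<^sup>2)"
        using Cauchy_Schwarz_square_integrable[OF sqa] by simp
      also have "\<dots> \<le> sqrt c * sqrt (LINT \<omega>|M. (U \<omega>)\<^sup>2)" using c[OF x] by (intro mult_right_mono) auto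
      finally show "(LINT \<omega>|M. \<bar>f (x, \<omega>)\<bar> * \<bar>U \<omega>\<bar>) \<le> sqrt c * sqrt (LINT \<omega>|M. (U \<omega>)\<^sup>2)" .
    qed
    finally show "(\<integral>\<^sup>+\<omega>. ennreal \<bar>case (x, \<omega>) of (x, \<omega>) \<Rightarrow> f (x, \<omega>) * U \<omega>\<bar> \<partial>M) \<le> ennreal (sqrt c * sqrt (LINT \<omega>|M. (U \<omega>)\<^sup>2))"
      by simp
  qed auto
  show "integrable \<nu> (\<lambda>x. LINT \<omega>|M. f (x, \<omega>) * U \<omega>)" using P.integrable_fst'[OF iU] by simp
  have "(LINT \<omega>|M. (LINT x|\<nu>. f (x, \<omega>)) * U \<omega>) = (LINT \<omega>|M. LINT x|\<nu>. f (x, \<omega>) * U \<omega>)" by simp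
  also have "\<dots> = (LINT x|\<nu>. LINT \<omega>|M. f (x, \<omega>) * U \<omega>)" by (rule P.Fubini_integral[OF iU])
  finally show "(LINT \<omega>|M. (LINT x|\<nu>. f (x, \<omega>)) * U \<omega>) = (LINT x|\<nu>. LINT \<omega>|M. f (x, \<omega>) * U \<omega>)" .
qed

text \<open>Every factor is bounded by the largest one; the summand 1 serves the empty
  product.\<close>

lemma prod_square_le_sum_power:
  fixes z :: "'i \<Rightarrow> real"
  assumes "finite I"
  shows "(\<Prod>k\<in>I. z k)\<^sup>2 \<le> 1 + (\<Sum>k\<in>I. \<bar>z k\<bar> ^ (2 * card I))"
proof (cases "I = {}")
  case False
  have "Max ((\<lambda>k. \<bar>z k\<bar>) ` I) \<in> (\<lambda>k. \<bar>z k\<bar>) ` I" using False assms by (intro Max_in) auto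
  then obtain j where j: "j \<in> I" "Max ((\<lambda>k. \<bar>z k\<bar>) ` I) = \<bar>z j\<bar>" by (rule imageE) auto
  have le: "\<bar>z k\<bar> \<le> \<bar>z j\<bar>" if "k \<in> I" for k
    unfolding j(2)[symmetric] using assms that by (intro Max_ge) auto
  have "\<bar>\<Prod>k\<in>I. z k\<bar> = (\<Prod>k\<in>I. \<bar>z k\<bar>)" by (rule abs_prod)
  also have "\<dots> \<le> (\<Prod>k\<in>I. \<bar>z j\<bar>)" using le by (intro prod_mono) auto
  finally have "\<bar>\<Prod>k\<in>I. z k\<bar>\<^sup>2 \<le> (\<bar>z j\<bar> ^ card I)\<^sup>2" by (intro power_mono) auto
  also have "\<dots> = \<bar>z j\<bar> ^ (2 * card I)" by (simp add: power_mult[symmetric] mult.commute)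
  also have "\<dots> \<le> (\<Sum>k\<in>I. \<bar>z k\<bar> ^ (2 * card I))" using j assms by (intro member_le_sum) auto
  finally show ?thesis by simp
qed simp

lemma real_sqrt_prod: "sqrt (\<Prod>k\<in>I. f k) = (\<Prod>k\<in>I. sqrt (f k))"
  by (induction I rule: infinite_finite_induct) (auto simp: real_sqrt_mult)

context noise
begin

lemma gspan_subset_closure: "gspan \<subseteq> L2_closure M gspan"
proof
  fix X assume X: "X \<in> gspan"
  then have "square_integrable M X" by (rule gaussian_space.square_integrable_V[OF gaussian_space_gspan])
  moreover have "\<exists>Y\<in>gspan. expectation (\<lambda>\<omega>. (X \<omega> - Y \<omega>)\<^sup>2) < e" if "e > 0" for e
    using X that by (intro bexI[of _ X]) simp_all
  ultimately show "X \<in> L2_closure M gspan" by (simp add: L2_closure_def)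
qed

lemma all_moments_prod_mol: "\<delta> > 0 \<Longrightarrow> finite I \<Longrightarrow> all_moments M (\<lambda>\<omega>. \<Prod>k\<in>I. mol \<delta> (x k) \<omega>)"
  by (intro gaussian_space.all_moments_prod_V[OF gaussian_space_gspan] mol_in_gspan)

lemma square_integrable_prod_mol: "\<delta> > 0 \<Longrightarrow> finite I \<Longrightarrow> square_integrable M (\<lambda>\<omega>. \<Prod>k\<in>I. mol \<delta> (x k) \<omega>)"
  using all_moments_prod_mol all_moments_measurable all_moments_square unfolding square_integrable_def by blast

text \<open>A crude bound, but by stationarity uniform in the points x k, as
  \<open>square_integrable_mixture\<close> requires.\<close>

lemma expectation_prod_mol_square_le:
  assumes \<delta>: "\<delta> > 0" and I: "finite I"
  shows "expectation (\<lambda>\<omega>. (\<Prod>k\<in>I. mol \<delta> (x k) \<omega>)\<^sup>2) \<le>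
    1 + real (card I) * (real (2 * card I) ^ (2 * card I) * (2 * exp (molvar \<delta> / 2)))"
proof -
  interpret V: gaussian_space M gspan by (rule gaussian_space_gspan)
  define N where "N = 2 * card I"
  have e: "integrable M (\<lambda>\<omega>. exp (mol \<delta> y \<omega>))" "expectation (\<lambda>\<omega>. exp (mol \<delta> y \<omega>)) = exp (molvar \<delta> / 2)"
    "integrable M (\<lambda>\<omega>. exp (- mol \<delta> y \<omega>))" "expectation (\<lambda>\<omega>. exp (- mol \<delta> y \<omega>)) = exp (molvar \<delta> / 2)" for y
    using V.integrable_exp_V[OF mol_in_gspan[OF \<delta>]] V.expectation_exp_V[OF mol_in_gspan[OF \<delta>, of y]]
      V.integrable_exp_V[OF V.scale_V[OF mol_in_gspan[OF \<delta>, of y], of "-1"]] V.expectation_exp_scale[OF mol_in_gspan[OF \<delta>, of y], of "-1"]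
    by (simp_all add: expectation_mol_square[OF \<delta>])
  have "expectation (\<lambda>\<omega>. (\<Prod>k\<in>I. mol \<delta> (x k) \<omega>)\<^sup>2) \<le>
    expectation (\<lambda>\<omega>. 1 + (\<Sum>k\<in>I. real N ^ N * (exp (mol \<delta> (x k) \<omega>) + exp (- mol \<delta> (x k) \<omega>))))"
  proof (rule integral_mono)
    show "integrable M (\<lambda>\<omega>. (\<Prod>k\<in>I. mol \<delta> (x k) \<omega>)\<^sup>2)"
      using square_integrable_prod_mol[OF \<delta> I] by (simp add: square_integrable_def)
    show "integrable M (\<lambda>\<omega>. 1 + (\<Sum>k\<in>I. real N ^ N * (exp (mol \<delta> (x k) \<omega>) + exp (- mol \<delta> (x k) \<omega>))))"
      using e by (intro Bochner_Integration.integrable_add Bochner_Integration.integrable_sum integrable_mult_right) auto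
    fix \<omega>
    have "(\<Prod>k\<in>I. mol \<delta> (x k) \<omega>)\<^sup>2 \<le> 1 + (\<Sum>k\<in>I. \<bar>mol \<delta> (x k) \<omega>\<bar> ^ N)"
      unfolding N_def by (rule prod_square_le_sum_power[OF I])
    also have "\<dots> \<le> 1 + (\<Sum>k\<in>I. real N ^ N * (exp (mol \<delta> (x k) \<omega>) + exp (- mol \<delta> (x k) \<omega>)))"
    proof (intro add_left_mono sum_mono)
      fix k
      have "\<bar>mol \<delta> (x k) \<omega>\<bar> ^ N \<le> real N ^ N * exp \<bar>mol \<delta> (x k) \<omega>\<bar>" by (rule power_le_exp) simp
      also have "\<dots> \<le> real N ^ N * (exp (mol \<delta> (x k) \<omega>) + exp (- mol \<delta> (x k) \<omega>))"
        by (intro mult_left_mono) (auto simp: abs_if)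
      finally show "\<bar>mol \<delta> (x k) \<omega>\<bar> ^ N \<le> real N ^ N * (exp (mol \<delta> (x k) \<omega>) + exp (- mol \<delta> (x k) \<omega>))" .
    qed
    finally show "(\<Prod>k\<in>I. mol \<delta> (x k) \<omega>)\<^sup>2 \<le> 1 + (\<Sum>k\<in>I. real N ^ N * (exp (mol \<delta> (x k) \<omega>) + exp (- mol \<delta> (x k) \<omega>)))" .
  qed
  also have "\<dots> = 1 + (\<Sum>k\<in>I. real N ^ N * (exp (molvar \<delta> / 2) + exp (molvar \<delta> / 2)))"
    using e by (simp add: prob_space)
  also have "\<dots> = 1 + real (card I) * (real N ^ N * (2 * exp (molvar \<delta> / 2)))" by simp
  finally show ?thesis by (simp add: N_def)
qed

end

locale noise_tuples = noise M \<Gamma> W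
  for M :: "'w measure" and \<Gamma> :: "'a::euclidean_space measure" and W +
  fixes n :: nat and \<nu> :: "(nat \<Rightarrow> 'a) measure"
  assumes sets_nu [measurable_cong]: "sets \<nu> = sets (tuples n)"
    and finite_nu: "finite_measure \<nu>"
begin

sublocale nu: finite_measure \<nu> by (rule finite_nu)

lemma measurable_nu_component: "k \<in> {1..n} \<Longrightarrow> (\<lambda>y. y k) \<in> measurable \<nu> borel"
  using measurable_component_singleton[of k "{1..n}" "\<lambda>_. borel :: 'a measure"] measurable_cong_sets[OF sets_nu refl, of borel]
  by auto

definition strat :: "real \<Rightarrow> 'w \<Rightarrow> real" where
  "strat \<epsilon> \<omega> = (LINT y|\<nu>. (\<Prod>k\<in>{1..n}. mol \<epsilon> (y k) \<omega>))"

lemma measurable_prod_mol: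
  assumes "\<epsilon> > 0"
  shows "(\<lambda>p. \<Prod>k\<in>{1..n}. mol \<epsilon> (fst p k) (snd p)) \<in> borel_measurable (\<nu> \<Otimes>\<^sub>M M)"
  by (intro borel_measurable_prod measurable_mol assms measurable_compose[OF measurable_fst measurable_nu_component] measurable_snd)

lemma measurable_expectation_mol:
  assumes \<epsilon>: "\<epsilon> > 0" and Y[measurable]: "Y \<in> borel_measurable M" and k: "k \<in> {1..n}"
  shows "(\<lambda>y. expectation (\<lambda>\<omega>. Y \<omega> * mol \<epsilon> (y k) \<omega>)) \<in> borel_measurable \<nu>"
proof -
  have [measurable]: "(\<lambda>y. y k) \<in> measurable \<nu> borel" by (rule measurable_nu_component[OF k])
  note \<epsilon>[measurable]
  show ?thesis by measurable
qed

lemma expectation_mult_mol_abs_le: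
  assumes \<epsilon>: "\<epsilon> > 0" and Y: "square_integrable M Y"
  shows "\<bar>expectation (\<lambda>\<omega>. Y \<omega> * mol \<epsilon> x \<omega>)\<bar> \<le> sqrt (expectation (\<lambda>\<omega>. (Y \<omega>)\<^sup>2)) * sqrt (molvar \<epsilon>)"
  using Cauchy_Schwarz_square_integrable[OF Y square_integrable_mol[OF \<epsilon>, of x]] by (simp add: expectation_mol_square[OF \<epsilon>])

lemma integrable_prod_expectation_mol:
  assumes \<epsilon>: "\<epsilon> > 0" and Y: "\<And>k. k \<in> {1..n} \<Longrightarrow> square_integrable M (Y k)"
  shows "integrable \<nu> (\<lambda>y. \<Prod>k\<in>{1..n}. expectation (\<lambda>\<omega>. Y k \<omega> * mol \<epsilon> (y k) \<omega>))"
proof (rule nu.integrable_const_bound)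
  show "AE y in \<nu>. norm (\<Prod>k\<in>{1..n}. expectation (\<lambda>\<omega>. Y k \<omega> * mol \<epsilon> (y k) \<omega>)) \<le>
    (\<Prod>k\<in>{1..n}. sqrt (expectation (\<lambda>\<omega>. (Y k \<omega>)\<^sup>2)) * sqrt (molvar \<epsilon>))"
    using Y by (intro always_eventually allI) (auto simp: abs_prod intro!: prod_mono expectation_mult_mol_abs_le[OF \<epsilon>])
  show "(\<lambda>y. \<Prod>k\<in>{1..n}. expectation (\<lambda>\<omega>. Y k \<omega> * mol \<epsilon> (y k) \<omega>)) \<in> borel_measurable \<nu>"
    using Y by (intro borel_measurable_prod measurable_expectation_mol \<epsilon>) (auto simp: square_integrable_def)
qed

lemma strat_mixture:
  assumes \<epsilon>: "\<epsilon> > 0"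
  shows "square_integrable M (strat \<epsilon>)"
    and "square_integrable M U \<Longrightarrow> integrable \<nu> (\<lambda>y. expectation (\<lambda>\<omega>. (\<Prod>k\<in>{1..n}. mol \<epsilon> (y k) \<omega>) * U \<omega>))"
    and "square_integrable M U \<Longrightarrow> expectation (\<lambda>\<omega>. strat \<epsilon> \<omega> * U \<omega>) = (LINT y|\<nu>. expectation (\<lambda>\<omega>. (\<Prod>k\<in>{1..n}. mol \<epsilon> (y k) \<omega>) * U \<omega>))"
proof -
  note mix = square_integrable_mixture[OF finite_nu sigma_finite_measure_axioms measurable_prod_mol[OF \<epsilon>],
    unfolded fst_conv snd_conv, OF square_integrable_prod_mol[OF \<epsilon> finite_atLeastAtMost]
      expectation_prod_mol_square_le[OF \<epsilon> finite_atLeastAtMost]]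
  show "square_integrable M (strat \<epsilon>)" using mix(1) by (simp add: strat_def[abs_def])
  show "square_integrable M U \<Longrightarrow> integrable \<nu> (\<lambda>y. expectation (\<lambda>\<omega>. (\<Prod>k\<in>{1..n}. mol \<epsilon> (y k) \<omega>) * U \<omega>))"
    using mix(2) by simp
  show "square_integrable M U \<Longrightarrow> expectation (\<lambda>\<omega>. strat \<epsilon> \<omega> * U \<omega>) = (LINT y|\<nu>. expectation (\<lambda>\<omega>. (\<Prod>k\<in>{1..n}. mol \<epsilon> (y k) \<omega>) * U \<omega>))"
    using mix(3) by (simp add: strat_def)
qed

text \<open>Wick's lower bound holds for each fixed tuple; Fubini integrates it against
  \<nu>.\<close>

lemma expectation_exp_strat_ge:
  assumes \<epsilon>: "\<epsilon> > 0" and Y: "Y \<in> L2_closure M gspan" and nn: "\<And>x. 0 \<le> expectation (\<lambda>\<omega>. Y \<omega> * mol \<epsilon> x \<omega>)"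
  shows "exp (expectation (\<lambda>\<omega>. (Y \<omega>)\<^sup>2) / 2) * (LINT y|\<nu>. (\<Prod>k\<in>{1..n}. expectation (\<lambda>\<omega>. Y \<omega> * mol \<epsilon> (y k) \<omega>))) \<le>
    expectation (\<lambda>\<omega>. exp (Y \<omega>) * strat \<epsilon> \<omega>)"
proof -
  interpret V: gaussian_space M "L2_closure M gspan"
    by (rule gaussian_space.gaussian_space_L2_closure[OF gaussian_space_gspan])
  have mol: "mol \<epsilon> x \<in> L2_closure M gspan" for x using mol_in_gspan[OF \<epsilon>] gspan_subset_closure by blast
  note sqY = V.square_integrable_V[OF Y] V.square_integrable_exp_V[OF Y]
  have "exp (expectation (\<lambda>\<omega>. (Y \<omega>)\<^sup>2) / 2) * (LINT y|\<nu>. (\<Prod>k\<in>{1..n}. expectation (\<lambda>\<omega>. Y \<omega> * mol \<epsilon> (y k) \<omega>))) =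
    (LINT y|\<nu>. exp (expectation (\<lambda>\<omega>. (Y \<omega>)\<^sup>2) / 2) * (\<Prod>k\<in>{1..n}. expectation (\<lambda>\<omega>. Y \<omega> * mol \<epsilon> (y k) \<omega>)))"
    by simp
  also have "\<dots> \<le> (LINT y|\<nu>. expectation (\<lambda>\<omega>. (\<Prod>k\<in>{1..n}. mol \<epsilon> (y k) \<omega>) * exp (Y \<omega>)))"
  proof (rule integral_mono)
    show "integrable \<nu> (\<lambda>y. exp (expectation (\<lambda>\<omega>. (Y \<omega>)\<^sup>2) / 2) * (\<Prod>k\<in>{1..n}. expectation (\<lambda>\<omega>. Y \<omega> * mol \<epsilon> (y k) \<omega>)))"
      by (intro integrable_mult_right integrable_prod_expectation_mol \<epsilon> sqY)
    show "integrable \<nu> (\<lambda>y. expectation (\<lambda>\<omega>. (\<Prod>k\<in>{1..n}. mol \<epsilon> (y k) \<omega>) * exp (Y \<omega>)))"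
      by (rule strat_mixture(2)[OF \<epsilon> sqY(2)])
    show "exp (expectation (\<lambda>\<omega>. (Y \<omega>)\<^sup>2) / 2) * (\<Prod>k\<in>{1..n}. expectation (\<lambda>\<omega>. Y \<omega> * mol \<epsilon> (y k) \<omega>)) \<le>
      expectation (\<lambda>\<omega>. (\<Prod>k\<in>{1..n}. mol \<epsilon> (y k) \<omega>) * exp (Y \<omega>))" for y
      using V.expectation_exp_prod_ge[of "{1..n}" "\<lambda>k. mol \<epsilon> (y k)" Y] mol Y nn expectation_mol_mol_nonneg[OF \<epsilon> \<epsilon>]
      by (simp add: power2_eq_square mult.commute)
  qed
  also have "\<dots> = expectation (\<lambda>\<omega>. strat \<epsilon> \<omega> * exp (Y \<omega>))"
    by (rule strat_mixture(3)[OF \<epsilon> sqY(2), symmetric])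
  finally show ?thesis by (simp add: mult.commute)
qed

text \<open>The squared norm of \<nu> in the n-th tensor power, for the covariance of the noise
  mollified at scale \<epsilon>.\<close>

definition energy :: "real \<Rightarrow> real" where
  "energy \<epsilon> = (LINT x|\<nu>. LINT y|\<nu>. (\<Prod>k\<in>{1..n}. expectation (\<lambda>\<omega>. mol \<epsilon> (x k) \<omega> * mol \<epsilon> (y k) \<omega>)))"

text \<open>The second moment of \<open>strat\<close> is a double integral of expectations of 2 n
  factors; Wick's formula bounds each of these below by the pairing of x k with y k.\<close>

lemma energy_le:
  assumes \<epsilon>: "\<epsilon> > 0"
  shows "energy \<epsilon> \<le> expectation (\<lambda>\<omega>. (strat \<epsilon> \<omega>)\<^sup>2)"
proof -
  interpret V: gaussian_space M gspan by (rule gaussian_space_gspan)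
  interpret NN: pair_sigma_finite \<nu> \<nu> ..
  note S = strat_mixture(1)[OF \<epsilon>] and prod_sq = square_integrable_prod_mol[OF \<epsilon> finite_atLeastAtMost]
  note \<epsilon>[measurable]
  have "expectation (\<lambda>\<omega>. (strat \<epsilon> \<omega>)\<^sup>2) = expectation (\<lambda>\<omega>. strat \<epsilon> \<omega> * strat \<epsilon> \<omega>)" by (simp add: power2_eq_square)
  also have "\<dots> = (LINT x|\<nu>. expectation (\<lambda>\<omega>. (\<Prod>k\<in>{1..n}. mol \<epsilon> (x k) \<omega>) * strat \<epsilon> \<omega>))"
    by (rule strat_mixture(3)[OF \<epsilon> S])
  finally have eq: "expectation (\<lambda>\<omega>. (strat \<epsilon> \<omega>)\<^sup>2) = (LINT x|\<nu>. expectation (\<lambda>\<omega>. (\<Prod>k\<in>{1..n}. mol \<epsilon> (x k) \<omega>) * strat \<epsilon> \<omega>))" .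
  have bnd: "(\<Prod>k\<in>{1..n}. expectation (\<lambda>\<omega>. mol \<epsilon> (x k) \<omega> * mol \<epsilon> (y k) \<omega>)) \<le> (\<Prod>k\<in>{1..n}. molvar \<epsilon>)" for x y :: "nat \<Rightarrow> 'a"
    using expectation_mult_mol_abs_le[OF \<epsilon> square_integrable_mol[OF \<epsilon>]] expectation_mol_mol_nonneg[OF \<epsilon> \<epsilon>] molvar_nonneg[of \<epsilon>]
    by (intro prod_mono) (auto simp: expectation_mol_square[OF \<epsilon>] abs_le_iff)
  have nn: "0 \<le> (\<Prod>k\<in>{1..n}. expectation (\<lambda>\<omega>. mol \<epsilon> (x k) \<omega> * mol \<epsilon> (y k) \<omega>))" for x y :: "nat \<Rightarrow> 'a"
    by (intro prod_nonneg expectation_mol_mol_nonneg \<epsilon>)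
  have meas: "(\<lambda>p. \<Prod>k\<in>{1..n}. expectation (\<lambda>\<omega>. mol \<epsilon> (fst p k) \<omega> * mol \<epsilon> (snd p k) \<omega>)) \<in> borel_measurable (\<nu> \<Otimes>\<^sub>M \<nu>)"
  proof (rule borel_measurable_prod)
    fix k assume k: "k \<in> {1..n}"
    have [measurable]: "(\<lambda>y. y k) \<in> measurable \<nu> borel" by (rule measurable_nu_component[OF k])
    show "(\<lambda>p. expectation (\<lambda>\<omega>. mol \<epsilon> (fst p k) \<omega> * mol \<epsilon> (snd p k) \<omega>)) \<in> borel_measurable (\<nu> \<Otimes>\<^sub>M \<nu>)" by measurable
  qed
  interpret PN: finite_measure "\<nu> \<Otimes>\<^sub>M \<nu>" by (rule finite_measure_pair_measure[OF finite_nu finite_nu])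
  have i: "integrable (\<nu> \<Otimes>\<^sub>M \<nu>) (\<lambda>p. \<Prod>k\<in>{1..n}. expectation (\<lambda>\<omega>. mol \<epsilon> (fst p k) \<omega> * mol \<epsilon> (snd p k) \<omega>))"
    using bnd nn by (intro PN.integrable_const_bound[OF _ meas, where B = "\<Prod>k\<in>{1..n}. molvar \<epsilon>"]) auto
  show ?thesis
    unfolding eq energy_def
  proof (rule integral_mono)
    show "integrable \<nu> (\<lambda>x. LINT y|\<nu>. (\<Prod>k\<in>{1..n}. expectation (\<lambda>\<omega>. mol \<epsilon> (x k) \<omega> * mol \<epsilon> (y k) \<omega>)))"
      using NN.integrable_fst'[OF i] by simp
    show "integrable \<nu> (\<lambda>x. expectation (\<lambda>\<omega>. (\<Prod>k\<in>{1..n}. mol \<epsilon> (x k) \<omega>) * strat \<epsilon> \<omega>))"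
      by (rule strat_mixture(2)[OF \<epsilon> S])
    fix x
    have "(LINT y|\<nu>. (\<Prod>k\<in>{1..n}. expectation (\<lambda>\<omega>. mol \<epsilon> (x k) \<omega> * mol \<epsilon> (y k) \<omega>))) \<le>
      (LINT y|\<nu>. expectation (\<lambda>\<omega>. (\<Prod>k\<in>{1..n}. mol \<epsilon> (y k) \<omega>) * (\<Prod>k\<in>{1..n}. mol \<epsilon> (x k) \<omega>)))"
    proof (rule integral_mono)
      show "integrable \<nu> (\<lambda>y. \<Prod>k\<in>{1..n}. expectation (\<lambda>\<omega>. mol \<epsilon> (x k) \<omega> * mol \<epsilon> (y k) \<omega>))"
        by (intro integrable_prod_expectation_mol \<epsilon> square_integrable_mol)
      show "integrable \<nu> (\<lambda>y. expectation (\<lambda>\<omega>. (\<Prod>k\<in>{1..n}. mol \<epsilon> (y k) \<omega>) * (\<Prod>k\<in>{1..n}. mol \<epsilon> (x k) \<omega>)))"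
        by (rule strat_mixture(2)[OF \<epsilon> prod_sq])
      show "(\<Prod>k\<in>{1..n}. expectation (\<lambda>\<omega>. mol \<epsilon> (x k) \<omega> * mol \<epsilon> (y k) \<omega>)) \<le>
         expectation (\<lambda>\<omega>. (\<Prod>k\<in>{1..n}. mol \<epsilon> (y k) \<omega>) * (\<Prod>k\<in>{1..n}. mol \<epsilon> (x k) \<omega>))" for y
        using V.expectation_prod_pairs_ge[of "{1..n}" "\<lambda>k. mol \<epsilon> (x k)" "\<lambda>k. mol \<epsilon> (y k)"] mol_in_gspan[OF \<epsilon>] expectation_mol_mol_nonneg[OF \<epsilon> \<epsilon>]
        by (simp add: mult.commute)
    qed
    also have "\<dots> = expectation (\<lambda>\<omega>. strat \<epsilon> \<omega> * (\<Prod>k\<in>{1..n}. mol \<epsilon> (x k) \<omega>))"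
      by (rule strat_mixture(3)[OF \<epsilon> prod_sq, symmetric])
    finally show "(LINT y|\<nu>. (\<Prod>k\<in>{1..n}. expectation (\<lambda>\<omega>. mol \<epsilon> (x k) \<omega> * mol \<epsilon> (y k) \<omega>))) \<le>
      expectation (\<lambda>\<omega>. (\<Prod>k\<in>{1..n}. mol \<epsilon> (x k) \<omega>) * strat \<epsilon> \<omega>)" by (simp add: mult.commute)
  qed
qed

text \<open>The factors are decoupled by evaluating the \<open>n\<close> copies of the noise on a product space; this
  turns the bound into the Cauchy--Schwarz inequality in \<open>L\<^sup>2\<close> of that space.\<close>

lemma prod_expectation_mol_le_energy:
  assumes \<epsilon>: "\<epsilon> > 0" and Y: "\<And>k. k \<in> {1..n} \<Longrightarrow> square_integrable M (Y k)"
  shows "\<bar>LINT y|\<nu>. (\<Prod>k\<in>{1..n}. expectation (\<lambda>\<omega>. Y k \<omega> * mol \<epsilon> (y k) \<omega>))\<bar> \<le>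
    sqrt (energy \<epsilon>) * (\<Prod>k\<in>{1..n}. sqrt (expectation (\<lambda>\<omega>. (Y k \<omega>)\<^sup>2)))"
proof -
  define P where "P = (\<Pi>\<^sub>M k\<in>{1..n}. M)"
  interpret P: prob_space P unfolding P_def by (intro prob_space_PiM) unfold_locales
  interpret PM: product_sigma_finite "\<lambda>_::nat. M" ..
  define f where "f p = (\<Prod>k\<in>{1..n}. mol \<epsilon> (fst p k) (snd p k))" for p :: "(nat \<Rightarrow> 'a) \<times> (nat \<Rightarrow> 'w)"
  define A where "A \<omega> = (\<Prod>k\<in>{1..n}. Y k (\<omega> k))" for \<omega>
  \<comment> \<open>The vector that represents \<nu> in L^2 of the product space: its squared norm
    is the energy, and its inner product with the elementary tensor \<open>A\<close> is the integral
    to be bounded.\<close>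
  define B where "B \<omega> = (LINT y|\<nu>. f (y, \<omega>))" for \<omega>
  have comp: "(\<lambda>\<omega>. \<omega> k) \<in> measurable P M" if "k \<in> {1..n}" for k
    unfolding P_def using that by (rule measurable_component_singleton)
  have f: "f \<in> borel_measurable (\<nu> \<Otimes>\<^sub>M P)"
    unfolding f_def[abs_def]
    by (intro borel_measurable_prod measurable_mol \<epsilon> measurable_compose[OF measurable_fst measurable_nu_component] measurable_compose[OF measurable_snd comp])
  have prod_int: "integrable P (\<lambda>\<omega>. \<Prod>k\<in>{1..n}. g k (\<omega> k))" "P.expectation (\<lambda>\<omega>. \<Prod>k\<in>{1..n}. g k (\<omega> k)) = (\<Prod>k\<in>{1..n}. expectation (g k))"
    if "\<And>k. k \<in> {1..n} \<Longrightarrow> integrable M (g k)" for g :: "nat \<Rightarrow> 'w \<Rightarrow> real"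
    unfolding P_def using that by (intro PM.product_integrable_prod PM.product_integral_prod; simp)+
  have sq_prod: "square_integrable P (\<lambda>\<omega>. \<Prod>k\<in>{1..n}. g k (\<omega> k))" "P.expectation (\<lambda>\<omega>. (\<Prod>k\<in>{1..n}. g k (\<omega> k))\<^sup>2) = (\<Prod>k\<in>{1..n}. expectation (\<lambda>\<omega>. (g k \<omega>)\<^sup>2))"
    if g: "\<And>k. k \<in> {1..n} \<Longrightarrow> square_integrable M (g k)" for g :: "nat \<Rightarrow> 'w \<Rightarrow> real"
  proof -
    have "(\<lambda>\<omega>. \<Prod>k\<in>{1..n}. g k (\<omega> k)) \<in> borel_measurable P"
      using g by (intro borel_measurable_prod measurable_compose[OF comp]) (auto simp: square_integrable_def)
    then show "square_integrable P (\<lambda>\<omega>. \<Prod>k\<in>{1..n}. g k (\<omega> k))"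
      using prod_int(1)[of "\<lambda>k \<omega>. (g k \<omega>)\<^sup>2"] g by (simp add: square_integrable_def prod_power_distrib)
    show "P.expectation (\<lambda>\<omega>. (\<Prod>k\<in>{1..n}. g k (\<omega> k))\<^sup>2) = (\<Prod>k\<in>{1..n}. expectation (\<lambda>\<omega>. (g k \<omega>)\<^sup>2))"
      using prod_int(2)[of "\<lambda>k \<omega>. (g k \<omega>)\<^sup>2"] g by (simp add: square_integrable_def prod_power_distrib)
  qed
  have mo: "square_integrable M (mol \<epsilon> x)" for x by (rule square_integrable_mol[OF \<epsilon>])
  have f_sq: "square_integrable P (\<lambda>\<omega>. f (y, \<omega>))" "P.expectation (\<lambda>\<omega>. (f (y, \<omega>))\<^sup>2) \<le> molvar \<epsilon> ^ n" for y
    using sq_prod[of "\<lambda>k. mol \<epsilon> (y k)", OF mo] by (simp_all add: f_def expectation_mol_square[OF \<epsilon>])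
  note mix = square_integrable_mixture[OF finite_nu P.sigma_finite_measure_axioms f f_sq]
  have A: "square_integrable P A" "P.expectation (\<lambda>\<omega>. (A \<omega>)\<^sup>2) = (\<Prod>k\<in>{1..n}. expectation (\<lambda>\<omega>. (Y k \<omega>)\<^sup>2))"
    unfolding A_def[abs_def] using sq_prod[of Y] Y by auto
  have B: "square_integrable P B" unfolding B_def[abs_def] by (rule mix(1))
  have "P.expectation (\<lambda>\<omega>. B \<omega> * A \<omega>) = (LINT y|\<nu>. P.expectation (\<lambda>\<omega>. f (y, \<omega>) * A \<omega>))"
    unfolding B_def by (rule mix(3)[OF A(1)])
  also have "\<dots> = (LINT y|\<nu>. (\<Prod>k\<in>{1..n}. expectation (\<lambda>\<omega>. Y k \<omega> * mol \<epsilon> (y k) \<omega>)))"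
  proof (intro Bochner_Integration.integral_cong refl)
    fix y
    show "P.expectation (\<lambda>\<omega>. f (y, \<omega>) * A \<omega>) = (\<Prod>k\<in>{1..n}. expectation (\<lambda>\<omega>. Y k \<omega> * mol \<epsilon> (y k) \<omega>))"
      using prod_int(2)[of "\<lambda>k \<omega>. Y k \<omega> * mol \<epsilon> (y k) \<omega>", OF square_integrable_mult[OF Y mo]]
      by (simp add: f_def A_def prod.distrib mult.commute)
  qed
  finally have BA: "P.expectation (\<lambda>\<omega>. B \<omega> * A \<omega>) = (LINT y|\<nu>. (\<Prod>k\<in>{1..n}. expectation (\<lambda>\<omega>. Y k \<omega> * mol \<epsilon> (y k) \<omega>)))" .
  have "P.expectation (\<lambda>\<omega>. (B \<omega>)\<^sup>2) = P.expectation (\<lambda>\<omega>. B \<omega> * B \<omega>)" by (simp add: power2_eq_square)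
  also have "\<dots> = (LINT x|\<nu>. P.expectation (\<lambda>\<omega>. f (x, \<omega>) * B \<omega>))"
    using mix(3)[OF B] by (simp add: B_def)
  also have "\<dots> = (LINT x|\<nu>. P.expectation (\<lambda>\<omega>. B \<omega> * f (x, \<omega>)))" by (simp add: mult.commute)
  also have "\<dots> = (LINT x|\<nu>. LINT y|\<nu>. P.expectation (\<lambda>\<omega>. f (y, \<omega>) * f (x, \<omega>)))"
    using mix(3)[OF f_sq(1)] by (simp add: B_def)
  also have "\<dots> = energy \<epsilon>"
    unfolding energy_def
  proof (intro Bochner_Integration.integral_cong refl)
    fix x y :: "nat \<Rightarrow> 'a"
    show "P.expectation (\<lambda>\<omega>. f (y, \<omega>) * f (x, \<omega>)) = (\<Prod>k\<in>{1..n}. expectation (\<lambda>\<omega>. mol \<epsilon> (x k) \<omega> * mol \<epsilon> (y k) \<omega>))"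
      using prod_int(2)[of "\<lambda>k \<omega>. mol \<epsilon> (x k) \<omega> * mol \<epsilon> (y k) \<omega>", OF square_integrable_mult[OF mo mo]]
      by (simp add: f_def prod.distrib mult.commute)
  qed
  finally have BB: "P.expectation (\<lambda>\<omega>. (B \<omega>)\<^sup>2) = energy \<epsilon>" .
  show ?thesis
    using Cauchy_Schwarz_square_integrable[OF B A(1)] unfolding BA BB A(2) by (simp add: real_sqrt_prod)
qed

lemma energy_nonneg: "\<epsilon> > 0 \<Longrightarrow> 0 \<le> energy \<epsilon>"
  unfolding energy_def by (intro Bochner_Integration.integral_nonneg prod_nonneg expectation_mol_mol_nonneg)

end

section \<open>The tensor pairing\<close>

text \<open>Bounded support gives integrable dominating functions, marginals without mass on null
  sets let almost everywhere limits be inserted, and the energy bound gives continuity of the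
  pairing in the norm of \<open>pre_H\<close>.\<close>

locale regular_tuples = noise_tuples M \<Gamma> W n \<nu>
  for M :: "'w measure" and \<Gamma> :: "'a::euclidean_space measure" and W and n :: nat and \<nu> :: "(nat \<Rightarrow> 'a) measure" +
  fixes R C :: real
  assumes bounded_nu: "AE y in \<nu>. \<forall>k\<in>{1..n}. norm (y k) \<le> R"
    and null_nu: "\<And>k N. k \<in> {1..n} \<Longrightarrow> N \<in> null_sets lborel \<Longrightarrow> AE y in \<nu>. y k \<notin> N"
    and energy_bound: "\<forall>\<^sub>F m in sequentially. energy (eps m) \<le> C"
begin

abbreviation GP :: "(nat \<Rightarrow> 'a) measure" where "GP \<equiv> (\<Pi>\<^sub>M k\<in>{1..n}. \<Gamma>)"

sublocale PG: product_sigma_finite "\<lambda>_::nat. \<Gamma>" ..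

sublocale GP: sigma_finite_measure GP by (rule PG.sigma_finite) simp

sublocale GN: pair_sigma_finite GP \<nu> ..

text \<open>The pairing is polarised, with a separate function in each slot, so that slots can be
  exchanged one at a time in \<open>TF_diff_le\<close>.\<close>

definition TF :: "(nat \<Rightarrow> 'a \<Rightarrow> real) \<Rightarrow> real" where
  "TF h = (LINT p|(GP \<Otimes>\<^sub>M \<nu>). (\<Prod>k\<in>{1..n}. h k (snd p k + fst p k)))"

lemma tensor_form_eq_TF: "tensor_form \<Gamma> n (tensor_power n f) \<nu> = TF (\<lambda>_. f)"
  unfolding tensor_form_def tensor_power_def TF_def by (simp add: case_prod_unfold)

lemma measurable_shift: "k \<in> {1..n} \<Longrightarrow> (\<lambda>p. snd p k + fst p k) \<in> measurable (GP \<Otimes>\<^sub>M \<nu>) borel"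
  by (intro borel_measurable_add measurable_compose[OF measurable_snd measurable_nu_component]
      measurable_compose[OF measurable_fst measurable_component_singleton[of k "{1..n}" "\<lambda>_. \<Gamma>", unfolded measurable_cong_sets[OF refl sets_G]]])

lemma measurable_TF_integrand:
  fixes h :: "nat \<Rightarrow> 'a \<Rightarrow> real"
  assumes "\<And>k. k \<in> {1..n} \<Longrightarrow> h k \<in> borel_measurable borel"
  shows "(\<lambda>p. \<Prod>k\<in>{1..n}. h k (snd p k + fst p k)) \<in> borel_measurable (GP \<Otimes>\<^sub>M \<nu>)"
  by (rule borel_measurable_prod, rule measurable_compose[OF measurable_shift]) (auto intro: assms)

text \<open>For fixed z the exceptional set is shifted to another null set, which the k-th marginal
  of \<nu> does not charge.\<close>

lemma AE_tuple_shift: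
  assumes P: "AE x in (lborel :: 'a measure). P x" and k: "k \<in> {1..n}"
  shows "AE p in GP \<Otimes>\<^sub>M \<nu>. P (snd p k + fst p k)"
proof -
  obtain N where N: "{x \<in> space lborel. \<not> P x} \<subseteq> N" "emeasure lborel N = 0" "N \<in> sets (lborel :: 'a measure)"
    using AE_E[OF P] by blast
  have [measurable]: "N \<in> sets borel" using N(3) by simp
  have "AE p in GP \<Otimes>\<^sub>M \<nu>. snd p k + fst p k \<notin> N"
  proof (rule GN.AE_pair_measure)
    show "{p \<in> space (GP \<Otimes>\<^sub>M \<nu>). snd p k + fst p k \<notin> N} \<in> sets (GP \<Otimes>\<^sub>M \<nu>)"
    proof -
      note measurable_shift[OF k, measurable]
      show ?thesis by measurable
    qed
    have "AE y in \<nu>. y k + z \<notin> N" for z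
    proof -
      have "(\<lambda>x. x + z) -` N \<in> null_sets lborel"
      proof (rule null_setsI)
        have m: "(\<lambda>x. x + z) -` N \<in> sets borel"
          using measurable_sets_borel[of "\<lambda>x. x + z" borel N] by simp
        then show "(\<lambda>x. x + z) -` N \<in> sets lborel" by simp
        have "emeasure lborel ((\<lambda>x. x + z) -` N) = (\<integral>\<^sup>+x. indicator ((\<lambda>x. x + z) -` N) x \<partial>lborel)"
          using m by simp
        also have "\<dots> = (\<integral>\<^sup>+x. indicator N (x + z) \<partial>lborel)" by (simp add: indicator_def)
        also have "\<dots> = (\<integral>\<^sup>+x. indicator N x \<partial>lborel)" by (rule nn_integral_lborel_shift) measurable
        finally show "emeasure lborel ((\<lambda>x. x + z) -` N) = 0" using N(2,3) by simp
      qed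
      from null_nu[OF k this] show ?thesis by simp
    qed
    then show "AE z in GP. AE y in \<nu>. snd (z, y) k + fst (z, y) k \<notin> N" by simp
  qed
  then show ?thesis by eventually_elim (use N(1) in auto)
qed

lemma AE_pair_bounded: "AE p in GP \<Otimes>\<^sub>M \<nu>. \<forall>k\<in>{1..n}. norm (snd p k) \<le> R"
proof (rule GN.AE_pair_measure)
  have "(\<lambda>p. norm (snd p k)) \<in> borel_measurable (GP \<Otimes>\<^sub>M \<nu>)" if "k \<in> {1..n}" for k
  proof -
    note measurable_nu_component[OF that, measurable]
    show ?thesis by measurable
  qed
  then have "{p \<in> space (GP \<Otimes>\<^sub>M \<nu>). norm (snd p k) \<le> R} \<in> sets (GP \<Otimes>\<^sub>M \<nu>)" if "k \<in> {1..n}" for k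
    using that by simp
  then show "{p \<in> space (GP \<Otimes>\<^sub>M \<nu>). \<forall>k\<in>{1..n}. norm (snd p k) \<le> R} \<in> sets (GP \<Otimes>\<^sub>M \<nu>)"
    by (intro sets.sets_Collect_finite_All) auto
  show "AE x in GP. AE y in \<nu>. \<forall>k\<in>{1..n}. norm (snd (x, y) k) \<le> R" using bounded_nu by simp
qed

lemma integrable_dominating_tuple: "integrable (GP \<Otimes>\<^sub>M \<nu>) (\<lambda>p. \<Prod>k\<in>{1..n}. D k * exp R * exp (- norm (fst p k)))"
proof -
  have "integrable GP (\<lambda>z. \<Prod>k\<in>{1..n}. D k * exp R * exp (- norm (z k)))"
    using tempered_measure_exp_integrable[OF tempered, of 1] by (intro PG.product_integrable_prod) auto
  from GN.integrable_mult_pair[OF this, of "\<lambda>_. 1"] show ?thesis by (simp add: case_prod_unfold)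
qed

text \<open>Since y k lies in a ball of radius R, decay in y k + z k becomes decay in z k at the
  price of the factor exp R.\<close>

lemma prod_decay_bound:
  fixes g :: "nat \<Rightarrow> 'a \<Rightarrow> real" and y z :: "nat \<Rightarrow> 'a"
  assumes g: "\<And>k x. k \<in> {1..n} \<Longrightarrow> \<bar>g k x\<bar> \<le> D k * exp (- norm x)"
    and y: "\<forall>k\<in>{1..n}. norm (y k) \<le> R"
  shows "\<bar>\<Prod>k\<in>{1..n}. g k (y k + z k)\<bar> \<le> (\<Prod>k\<in>{1..n}. D k * exp R * exp (- norm (z k)))"
  unfolding abs_prod
proof (intro prod_mono conjI)
  fix k assume k: "k \<in> {1..n}"
  have D: "0 \<le> D k" using order.trans[OF abs_ge_zero g[OF k, of 0]] by simp
  have "norm (z k) \<le> norm (y k + z k) + norm (y k)" using norm_triangle_ineq4[of "y k + z k" "y k"] by simp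
  then have "- norm (y k + z k) \<le> R - norm (z k)" using y k by force
  then have "D k * exp (- norm (y k + z k)) \<le> D k * exp (R - norm (z k))" using D by (intro mult_left_mono) auto
  then show "\<bar>g k (y k + z k)\<bar> \<le> D k * exp R * exp (- norm (z k))"
    using g[OF k, of "y k + z k"] by (simp add: exp_diff exp_minus divide_inverse mult.assoc)
qed simp

lemma TF_integrable_decay:
  assumes h: "\<And>k. k \<in> {1..n} \<Longrightarrow> exp_decay (h k)"
  shows "integrable (GP \<Otimes>\<^sub>M \<nu>) (\<lambda>p. \<Prod>k\<in>{1..n}. h k (snd p k + fst p k))"
proof -
  have "\<forall>k\<in>{1..n}. \<exists>D. \<forall>x. \<bar>h k x\<bar> \<le> D * exp (- norm x)" using h by (simp add: exp_decay_def)
  then obtain D where D: "\<And>k x. k \<in> {1..n} \<Longrightarrow> \<bar>h k x\<bar> \<le> D k * exp (- norm x)" by metis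
  show ?thesis
  proof (rule Bochner_Integration.integrable_bound[OF integrable_dominating_tuple[of D]])
    show "(\<lambda>p. \<Prod>k\<in>{1..n}. h k (snd p k + fst p k)) \<in> borel_measurable (GP \<Otimes>\<^sub>M \<nu>)"
      by (rule measurable_TF_integrand) (rule exp_decay_measurable[OF h])
    show "AE p in GP \<Otimes>\<^sub>M \<nu>. norm (\<Prod>k\<in>{1..n}. h k (snd p k + fst p k)) \<le> norm (\<Prod>k\<in>{1..n}. D k * exp R * exp (- norm (fst p k)))"
      using AE_pair_bounded
    proof eventually_elim
      case (elim p)
      from prod_decay_bound[of h D "snd p" "fst p", OF D elim] show ?case by simp
    qed
  qed
qed

lemma TF_tendsto:
  assumes g: "\<And>k m. k \<in> {1..n} \<Longrightarrow> g m k \<in> borel_measurable borel" "\<And>k. k \<in> {1..n} \<Longrightarrow> g' k \<in> borel_measurable borel"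
    and D: "\<And>k m x. k \<in> {1..n} \<Longrightarrow> \<bar>g m k x\<bar> \<le> D k * exp (- norm x)"
    and lim: "\<And>k. k \<in> {1..n} \<Longrightarrow> AE x in lborel. (\<lambda>m. g m k x) \<longlonglongrightarrow> g' k x"
  shows "(\<lambda>m. TF (g m)) \<longlonglongrightarrow> TF g'"
  unfolding TF_def
proof (rule integral_dominated_convergence[OF _ _ integrable_dominating_tuple[of D]])
  show "(\<lambda>p. \<Prod>k\<in>{1..n}. g' k (snd p k + fst p k)) \<in> borel_measurable (GP \<Otimes>\<^sub>M \<nu>)"
    by (rule measurable_TF_integrand) (rule g)
  show "(\<lambda>p. \<Prod>k\<in>{1..n}. g m k (snd p k + fst p k)) \<in> borel_measurable (GP \<Otimes>\<^sub>M \<nu>)" for m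
    by (rule measurable_TF_integrand) (rule g)
  show "AE p in GP \<Otimes>\<^sub>M \<nu>. norm (\<Prod>k\<in>{1..n}. g m k (snd p k + fst p k)) \<le> (\<Prod>k\<in>{1..n}. D k * exp R * exp (- norm (fst p k)))" for m
    using AE_pair_bounded
  proof eventually_elim
    case (elim p)
    from prod_decay_bound[of "g m" D "snd p" "fst p", OF D elim] show ?case by simp
  qed
  have "AE p in GP \<Otimes>\<^sub>M \<nu>. \<forall>k\<in>{1..n}. (\<lambda>m. g m k (snd p k + fst p k)) \<longlonglongrightarrow> g' k (snd p k + fst p k)"
    using AE_tuple_shift[OF lim] by (intro AE_finite_allI) auto
  then show "AE p in GP \<Otimes>\<^sub>M \<nu>. (\<lambda>m. \<Prod>k\<in>{1..n}. g m k (snd p k + fst p k)) \<longlonglongrightarrow> (\<Prod>k\<in>{1..n}. g' k (snd p k + fst p k))"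
    by eventually_elim (intro tendsto_prod, auto)
qed

text \<open>The bridge from probability to the pairing: a product of n integrals over
  \<open>\<Gamma>\<close> is one integral over the product measure, and Fubini exchanges it with
  \<nu>.\<close>

lemma TF_fld:
  assumes \<delta>: "0 < \<delta>" "\<delta> \<le> 1" and \<epsilon>: "0 < \<epsilon>" "\<epsilon> \<le> 1" and h: "\<And>k. k \<in> {1..n} \<Longrightarrow> exp_decay (h k)"
  shows "(LINT y|\<nu>. (\<Prod>k\<in>{1..n}. expectation (\<lambda>\<omega>. fld \<delta> (h k) \<omega> * mol \<epsilon> (y k) \<omega>))) = TF (\<lambda>k. smooth \<epsilon> (smooth \<delta> (h k)))"
proof -
  define H where "H k = smooth \<epsilon> (smooth \<delta> (h k))" for k
  have H: "exp_decay (H k)" if "k \<in> {1..n}" for k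
    unfolding H_def by (intro exp_decay_smooth h \<delta> \<epsilon> that)
  have i: "integrable (GP \<Otimes>\<^sub>M \<nu>) (\<lambda>(z, y). \<Prod>k\<in>{1..n}. H k (y k + z k))"
    using TF_integrable_decay[of H] H by (simp add: case_prod_unfold)
  have int: "integrable \<Gamma> (\<lambda>z. H k (x + z))" if k: "k \<in> {1..n}" for k x
  proof -
    obtain D where D: "D \<ge> 0" "\<And>x. \<bar>H k x\<bar> \<le> D * exp (- norm x)" using exp_decay_bound[OF H[OF k]] by blast
    have [measurable]: "H k \<in> borel_measurable borel" by (rule exp_decay_measurable[OF H[OF k]])
    show ?thesis
    proof (rule Bochner_Integration.integrable_bound)
      show "integrable \<Gamma> (\<lambda>z. D * exp (norm x) * exp (- norm z))"
        using tempered_measure_exp_integrable[OF tempered, of 1] by simp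
      have "\<bar>H k (x + z)\<bar> \<le> D * exp (norm x) * exp (- norm z)" for z
      proof -
        have "- norm (x + z) \<le> norm x - norm z" using norm_triangle_ineq4[of "x + z" x] by simp
        then have "D * exp (- norm (x + z)) \<le> D * exp (norm x - norm z)" using D(1) by (intro mult_left_mono) auto
        then show ?thesis using D(2)[of "x + z"] by (simp add: exp_diff exp_minus divide_inverse mult.assoc)
      qed
      then show "AE z in \<Gamma>. norm (H k (x + z)) \<le> norm (D * exp (norm x) * exp (- norm z))"
        by (intro always_eventually allI) (auto intro: order.trans[OF _ abs_ge_self])
    qed measurable
  qed
  have "(LINT y|\<nu>. (\<Prod>k\<in>{1..n}. expectation (\<lambda>\<omega>. fld \<delta> (h k) \<omega> * mol \<epsilon> (y k) \<omega>))) = (LINT y|\<nu>. (\<Prod>k\<in>{1..n}. LINT z|\<Gamma>. H k (y k + z)))"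
    unfolding H_def using expectation_fld_mol[OF \<delta> \<epsilon> h] by (intro Bochner_Integration.integral_cong prod.cong refl) auto
  also have "\<dots> = (LINT y|\<nu>. LINT z|GP. (\<Prod>k\<in>{1..n}. H k (y k + z k)))"
    using int by (subst PG.product_integral_prod) auto
  also have "\<dots> = (LINT z|GP. LINT y|\<nu>. (\<Prod>k\<in>{1..n}. H k (y k + z k)))"
    by (rule GN.Fubini_integral[OF i])
  also have "\<dots> = TF H"
    unfolding TF_def using GN.integral_fst'[OF i] by (simp add: case_prod_unfold)
  finally show ?thesis by (simp add: H_def[abs_def])
qed

text \<open>At positive mollification this is the energy estimate for the fields built from h k;
  along the common subsequence the fields' variances tend to the squared norms and the doubly
  smoothed functions to h k.\<close>

lemma TF_abs_le_decay:
  assumes h: "\<And>k. k \<in> {1..n} \<Longrightarrow> exp_decay (h k)"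
  shows "\<bar>TF h\<bar> \<le> sqrt C * (\<Prod>k\<in>{1..n}. pre_H_norm \<Gamma> (h k))"
proof -
  obtain r where r: "strict_mono r"
    "\<And>k. k \<in> {1..n} \<Longrightarrow> (\<lambda>m. expectation (\<lambda>\<omega>. fld (eps (r m)) (h k) \<omega> * fld (eps (r m)) (h k) \<omega>)) \<longlonglongrightarrow> cov_form \<Gamma> (h k) (h k)"
    "\<And>k. k \<in> {1..n} \<Longrightarrow> AE x in lborel. (\<lambda>m. smooth (eps (r m)) (smooth (eps (r m)) (h k)) x) \<longlonglongrightarrow> h k x"
    using cov_form_smooth_limits[of "{1..n}" h] h by auto
  have "\<forall>k\<in>{1..n}. \<exists>D. \<forall>x. \<bar>h k x\<bar> \<le> D * exp (- norm x)" using h by (simp add: exp_decay_def)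
  then obtain D where D: "\<And>k x. k \<in> {1..n} \<Longrightarrow> \<bar>h k x\<bar> \<le> D k * exp (- norm x)" by metis
  define T where "T m = TF (\<lambda>k. smooth (eps (r m)) (smooth (eps (r m)) (h k)))" for m
  have T: "T \<longlonglongrightarrow> TF h"
    unfolding T_def
  proof (rule TF_tendsto[where D = "\<lambda>k. D k * 6 ^ DIM('a) * 6 ^ DIM('a)"])
    fix k m x assume k: "k \<in> {1..n}"
    show "\<bar>smooth (eps (r m)) (smooth (eps (r m)) (h k)) x\<bar> \<le> D k * 6 ^ DIM('a) * 6 ^ DIM('a) * exp (- norm x)"
      by (intro smooth_le_exp_norm eps D k borel_measurable_smooth exp_decay_measurable[OF h])
    show "smooth (eps (r m)) (smooth (eps (r m)) (h k)) \<in> borel_measurable borel"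
      by (intro borel_measurable_smooth exp_decay_measurable[OF h] k)
  next
    fix k assume k: "k \<in> {1..n}"
    show "h k \<in> borel_measurable borel" by (rule exp_decay_measurable[OF h[OF k]])
    show "AE x in lborel. (\<lambda>m. smooth (eps (r m)) (smooth (eps (r m)) (h k)) x) \<longlonglongrightarrow> h k x" by (rule r(3)[OF k])
  qed
  have le: "\<bar>T m\<bar> \<le> sqrt (energy (eps (r m))) * (\<Prod>k\<in>{1..n}. sqrt (expectation (\<lambda>\<omega>. fld (eps (r m)) (h k) \<omega> * fld (eps (r m)) (h k) \<omega>)))" for m
  proof -
    have "T m = (LINT y|\<nu>. (\<Prod>k\<in>{1..n}. expectation (\<lambda>\<omega>. fld (eps (r m)) (h k) \<omega> * mol (eps (r m)) (y k) \<omega>)))"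
      unfolding T_def by (rule TF_fld[symmetric]) (auto intro: eps h)
    then show ?thesis
      using prod_expectation_mol_le_energy[OF eps(1)[of "r m"], of "\<lambda>k. fld (eps (r m)) (h k)"] square_integrable_fld[OF eps(1) exp_decay_integrable[OF h]]
      by (simp add: power2_eq_square)
  qed
  show ?thesis
  proof (rule tendsto_le[OF sequentially_bot])
    show "(\<lambda>m. sqrt C * (\<Prod>k\<in>{1..n}. sqrt (expectation (\<lambda>\<omega>. fld (eps (r m)) (h k) \<omega> * fld (eps (r m)) (h k) \<omega>)))) \<longlonglongrightarrow> sqrt C * (\<Prod>k\<in>{1..n}. pre_H_norm \<Gamma> (h k))"
      unfolding pre_H_norm_def by (intro tendsto_intros r(2))
    show "(\<lambda>m. \<bar>T m\<bar>) \<longlonglongrightarrow> \<bar>TF h\<bar>" by (intro tendsto_intros T)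
    show "\<forall>\<^sub>F m in sequentially. \<bar>T m\<bar> \<le> sqrt C * (\<Prod>k\<in>{1..n}. sqrt (expectation (\<lambda>\<omega>. fld (eps (r m)) (h k) \<omega> * fld (eps (r m)) (h k) \<omega>)))"
      using eventually_subseq[OF r(1) energy_bound]
    proof eventually_elim
      case (elim m)
      show ?case
        by (rule order.trans[OF le]) (intro mult_right_mono prod_nonneg real_sqrt_le_mono elim; simp)
    qed
  qed
qed

text \<open>The bound for functions of exponential decay is uniform over the truncations of \<bar>h
  k\<bar>, so Fatou's lemma extends it to \<open>pre_H\<close>.\<close>

lemma TF_integrable:
  assumes h: "\<And>k. k \<in> {1..n} \<Longrightarrow> h k \<in> pre_H \<Gamma>"
  shows "integrable (GP \<Otimes>\<^sub>M \<nu>) (\<lambda>p. \<Prod>k\<in>{1..n}. h k (snd p k + fst p k))"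
proof (rule integrableI_bounded)
  show "(\<lambda>p. \<Prod>k\<in>{1..n}. h k (snd p k + fst p k)) \<in> borel_measurable (GP \<Otimes>\<^sub>M \<nu>)"
    by (rule measurable_TF_integrand) (rule pre_H_measurable[OF h])
  define F where "F m k = trunc m (\<lambda>x. \<bar>h k x\<bar>)" for m k
  have F: "exp_decay (F m k)" "0 \<le> F m k x" if "k \<in> {1..n}" for m k x
    unfolding F_def using pre_H_measurable[OF pre_H_abs[OF h[OF that]]] by (auto intro: exp_decay_trunc trunc_nonneg)
  define K where "K = sqrt C * (\<Prod>k\<in>{1..n}. pre_H_norm \<Gamma> (\<lambda>x. \<bar>h k x\<bar>))"
  have lim: "(\<lambda>m. ennreal (\<Prod>k\<in>{1..n}. F m k (snd p k + fst p k))) \<longlonglongrightarrow> ennreal (\<Prod>k\<in>{1..n}. \<bar>h k (snd p k + fst p k)\<bar>)" for p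
    unfolding F_def by (intro tendsto_intros tendsto_prod trunc_tendsto)
  have C0: "0 \<le> C"
  proof -
    obtain m where "energy (eps m) \<le> C" using eventually_happens'[OF sequentially_bot energy_bound] by blast
    then show ?thesis using energy_nonneg[OF eps(1), of m] by linarith
  qed
  have "(\<integral>\<^sup>+p. ennreal (norm (\<Prod>k\<in>{1..n}. h k (snd p k + fst p k))) \<partial>(GP \<Otimes>\<^sub>M \<nu>)) =
     (\<integral>\<^sup>+p. liminf (\<lambda>m. ennreal (\<Prod>k\<in>{1..n}. F m k (snd p k + fst p k))) \<partial>(GP \<Otimes>\<^sub>M \<nu>))"
  proof (intro nn_integral_cong)
    fix p
    show "ennreal (norm (\<Prod>k\<in>{1..n}. h k (snd p k + fst p k))) = liminf (\<lambda>m. ennreal (\<Prod>k\<in>{1..n}. F m k (snd p k + fst p k)))"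
      using lim_imp_Liminf[OF sequentially_bot lim[of p]] by (simp add: abs_prod)
  qed
  also have "\<dots> \<le> liminf (\<lambda>m. \<integral>\<^sup>+p. ennreal (\<Prod>k\<in>{1..n}. F m k (snd p k + fst p k)) \<partial>(GP \<Otimes>\<^sub>M \<nu>))"
    by (intro nn_integral_liminf measurable_compose[OF measurable_TF_integrand measurable_ennreal]) (auto intro: exp_decay_measurable[OF F(1)])
  also have "\<dots> \<le> ennreal K"
  proof (rule Liminf_le)
    have "(\<integral>\<^sup>+p. ennreal (\<Prod>k\<in>{1..n}. F m k (snd p k + fst p k)) \<partial>(GP \<Otimes>\<^sub>M \<nu>)) \<le> ennreal K" for m
    proof -
      have "(\<integral>\<^sup>+p. ennreal (\<Prod>k\<in>{1..n}. F m k (snd p k + fst p k)) \<partial>(GP \<Otimes>\<^sub>M \<nu>)) = ennreal (TF (F m))"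
        unfolding TF_def using F by (intro nn_integral_eq_integral TF_integrable_decay always_eventually allI prod_nonneg) auto
      also have "TF (F m) \<le> sqrt C * (\<Prod>k\<in>{1..n}. pre_H_norm \<Gamma> (F m k))"
        using TF_abs_le_decay[of "F m"] F(1) by (meson abs_le_D1)
      also have "\<dots> \<le> K"
        unfolding K_def
      proof (intro mult_left_mono prod_mono conjI)
        fix k assume k: "k \<in> {1..n}"
        show "0 \<le> pre_H_norm \<Gamma> (F m k)" by (intro pre_H_norm_nonneg exp_decay_pre_H F k)
        show "pre_H_norm \<Gamma> (F m k) \<le> pre_H_norm \<Gamma> (\<lambda>x. \<bar>h k x\<bar>)"
          unfolding pre_H_norm_def F_def by (intro real_sqrt_le_mono cov_form_mono_trunc pre_H_abs h k) simp
      qed (use C0 in simp)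
      finally show ?thesis by (simp add: ennreal_leI)
    qed
    then show "\<forall>\<^sub>F m in sequentially. (\<integral>\<^sup>+p. ennreal (\<Prod>k\<in>{1..n}. F m k (snd p k + fst p k)) \<partial>(GP \<Otimes>\<^sub>M \<nu>)) \<le> ennreal K" by simp
  qed simp
  also have "\<dots> < \<infinity>" by simp
  finally show "(\<integral>\<^sup>+p. ennreal (norm (\<Prod>k\<in>{1..n}. h k (snd p k + fst p k))) \<partial>(GP \<Otimes>\<^sub>M \<nu>)) < \<infinity>" .
qed

lemma TF_trunc_tendsto:
  assumes h: "\<And>k. k \<in> {1..n} \<Longrightarrow> h k \<in> pre_H \<Gamma>"
  shows "(\<lambda>m. TF (\<lambda>k. trunc m (h k))) \<longlonglongrightarrow> TF h"
  unfolding TF_def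
proof (rule integral_dominated_convergence)
  show "integrable (GP \<Otimes>\<^sub>M \<nu>) (\<lambda>p. \<bar>\<Prod>k\<in>{1..n}. h k (snd p k + fst p k)\<bar>)"
    by (intro integrable_abs TF_integrable h)
  show "(\<lambda>p. \<Prod>k\<in>{1..n}. h k (snd p k + fst p k)) \<in> borel_measurable (GP \<Otimes>\<^sub>M \<nu>)"
    by (rule measurable_TF_integrand) (rule pre_H_measurable[OF h])
  show "(\<lambda>p. \<Prod>k\<in>{1..n}. trunc m (h k) (snd p k + fst p k)) \<in> borel_measurable (GP \<Otimes>\<^sub>M \<nu>)" for m
    by (rule measurable_TF_integrand) (rule borel_measurable_trunc[OF pre_H_measurable[OF h]])
  show "AE p in GP \<Otimes>\<^sub>M \<nu>. norm (\<Prod>k\<in>{1..n}. trunc m (h k) (snd p k + fst p k)) \<le> \<bar>\<Prod>k\<in>{1..n}. h k (snd p k + fst p k)\<bar>" for m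
    by (intro always_eventually allI) (auto simp: abs_prod intro!: prod_mono trunc_abs_le)
  show "AE p in GP \<Otimes>\<^sub>M \<nu>. (\<lambda>m. \<Prod>k\<in>{1..n}. trunc m (h k) (snd p k + fst p k)) \<longlonglongrightarrow> (\<Prod>k\<in>{1..n}. h k (snd p k + fst p k))"
    by (intro always_eventually allI tendsto_prod trunc_tendsto)
qed

lemma TF_abs_le:
  assumes h: "\<And>k. k \<in> {1..n} \<Longrightarrow> h k \<in> pre_H \<Gamma>"
  shows "\<bar>TF h\<bar> \<le> sqrt C * (\<Prod>k\<in>{1..n}. pre_H_norm \<Gamma> (h k))"
proof (rule LIMSEQ_le)
  show "(\<lambda>m. \<bar>TF (\<lambda>k. trunc m (h k))\<bar>) \<longlonglongrightarrow> \<bar>TF h\<bar>" by (intro tendsto_intros TF_trunc_tendsto h)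
  show "(\<lambda>m. sqrt C * (\<Prod>k\<in>{1..n}. pre_H_norm \<Gamma> (trunc m (h k)))) \<longlonglongrightarrow> sqrt C * (\<Prod>k\<in>{1..n}. pre_H_norm \<Gamma> (h k))"
    by (intro tendsto_intros tendsto_prod pre_H_norm_trunc_tendsto h)
  show "\<exists>N. \<forall>m\<ge>N. \<bar>TF (\<lambda>k. trunc m (h k))\<bar> \<le> sqrt C * (\<Prod>k\<in>{1..n}. pre_H_norm \<Gamma> (trunc m (h k)))"
    by (intro exI[of _ 0] allI impI TF_abs_le_decay exp_decay_trunc pre_H_measurable h)
qed

text \<open>Telescoping over the slots: each exchange of g for f costs one difference and n - 1
  factors bounded by the sum of the norms. For n = 0 there is no exchange and the right side is
  0.\<close>

lemma TF_diff_le: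
  assumes f: "f \<in> pre_H \<Gamma>" and g: "g \<in> pre_H \<Gamma>"
  shows "\<bar>TF (\<lambda>_. f) - TF (\<lambda>_. g)\<bar> \<le> real n * (sqrt C * (pre_H_norm \<Gamma> (\<lambda>x. f x - g x) * (pre_H_norm \<Gamma> f + pre_H_norm \<Gamma> g) ^ (n - 1)))"
proof -
  define B where "B = pre_H_norm \<Gamma> f + pre_H_norm \<Gamma> g"
  define d where "d = pre_H_norm \<Gamma> (\<lambda>x. f x - g x)"
  note fg = pre_H_diff[OF f g]
  have B: "pre_H_norm \<Gamma> f \<le> B" "pre_H_norm \<Gamma> g \<le> B" "0 \<le> B" and d: "0 \<le> d"
    using pre_H_norm_nonneg[OF f] pre_H_norm_nonneg[OF g] pre_H_norm_nonneg[OF fg] by (auto simp: B_def d_def)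
  \<comment> \<open>The interpolating tuples: f occupies the first \<open>i\<close> slots, as these
    are numbered from 1.\<close>
  define h where "h i = (\<lambda>k. if k \<le> i then f else g)" for i :: nat
  have h: "h i k \<in> pre_H \<Gamma>" for i k using f g by (simp add: h_def)
  have C0: "0 \<le> sqrt C"
  proof -
    obtain m where "energy (eps m) \<le> C" using eventually_happens'[OF sequentially_bot energy_bound] by blast
    then show ?thesis using energy_nonneg[OF eps(1), of m] by simp
  qed
  have step: "\<bar>TF (h (Suc i)) - TF (h i)\<bar> \<le> sqrt C * (d * B ^ (n - 1))" if i: "i < n" for i
  proof -
    define q where "q = (h i)(Suc i := (\<lambda>x. f x - g x))"
    have q: "q k \<in> pre_H \<Gamma>" for k using h fg by (simp add: q_def)
    have Si: "Suc i \<in> {1..n}" using i by simp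
    have split: "(\<Prod>k\<in>{1..n}. G k) = G (Suc i) * (\<Prod>k\<in>{1..n}-{Suc i}. G k)" for G :: "nat \<Rightarrow> real"
      by (rule prod.remove[OF _ Si]) simp
    have eq: "(\<Prod>k\<in>{1..n}. h (Suc i) k (v k)) - (\<Prod>k\<in>{1..n}. h i k (v k)) = (\<Prod>k\<in>{1..n}. q k (v k))" for v :: "nat \<Rightarrow> 'a"
    proof -
      have "(\<Prod>k\<in>{1..n}-{Suc i}. h (Suc i) k (v k)) = (\<Prod>k\<in>{1..n}-{Suc i}. h i k (v k))"
        "(\<Prod>k\<in>{1..n}-{Suc i}. q k (v k)) = (\<Prod>k\<in>{1..n}-{Suc i}. h i k (v k))"
        by (intro prod.cong; auto simp: h_def q_def)+
      then show ?thesis unfolding split by (simp add: h_def q_def left_diff_distrib)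
    qed
    have "TF (h (Suc i)) - TF (h i) = TF q"
      unfolding TF_def eq[symmetric] by (rule Bochner_Integration.integral_diff[symmetric]) (intro TF_integrable h)+
    also have "\<bar>TF q\<bar> \<le> sqrt C * (\<Prod>k\<in>{1..n}. pre_H_norm \<Gamma> (q k))" by (rule TF_abs_le[OF q])
    also have "(\<Prod>k\<in>{1..n}. pre_H_norm \<Gamma> (q k)) = d * (\<Prod>k\<in>{1..n}-{Suc i}. pre_H_norm \<Gamma> (q k))"
      unfolding split by (simp add: q_def d_def)
    also have "(\<Prod>k\<in>{1..n}-{Suc i}. pre_H_norm \<Gamma> (q k)) \<le> (\<Prod>k\<in>{1..n}-{Suc i}. B)"
      using B pre_H_norm_nonneg[OF f] pre_H_norm_nonneg[OF g] by (intro prod_mono) (auto simp: q_def h_def)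
    also have "\<dots> = B ^ (n - 1)" using Si by simp
    finally show ?thesis using C0 d by (simp add: mult_left_mono)
  qed
  have "TF (h n) - TF (h 0) = (\<Sum>i<n. TF (h (Suc i)) - TF (h i))" by (rule sum_lessThan_telescope[symmetric])
  also have "\<bar>\<dots>\<bar> \<le> (\<Sum>i<n. \<bar>TF (h (Suc i)) - TF (h i)\<bar>)" by (rule sum_abs)
  also have "\<dots> \<le> (\<Sum>i<n. sqrt C * (d * B ^ (n - 1)))" by (intro sum_mono step) auto
  finally have "\<bar>TF (h n) - TF (h 0)\<bar> \<le> real n * (sqrt C * (d * B ^ (n - 1)))" by simp
  moreover have "TF (h n) = TF (\<lambda>_. f)" "TF (h 0) = TF (\<lambda>_. g)"
    unfolding TF_def h_def by (intro Bochner_Integration.integral_cong prod.cong; simp)+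
  ultimately show ?thesis by (simp add: d_def B_def)
qed

lemma TF_nonneg: "(\<And>k x. k \<in> {1..n} \<Longrightarrow> 0 \<le> h k x) \<Longrightarrow> 0 \<le> TF h"
  unfolding TF_def by (intro Bochner_Integration.integral_nonneg prod_nonneg) auto

text \<open>The limit \<epsilon> to 0 at fixed Y. The pairings converge by domination along a
  subsequence, the expectations because exp Y is in L^2 and \<open>strat\<close> converges there to
  S.\<close>

lemma expectation_exp_limit_ge:
  assumes h: "exp_decay h" "\<And>x. 0 \<le> h x" and \<delta>: "0 < \<delta>" "\<delta> \<le> 1"
    and S: "L2_limit M strat S (at_right 0)"
  shows "exp (expectation (\<lambda>\<omega>. (fld \<delta> h \<omega>)\<^sup>2) / 2) * TF (\<lambda>_. smooth \<delta> h) \<le> expectation (\<lambda>\<omega>. exp (fld \<delta> h \<omega>) * S \<omega>)"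
proof -
  interpret V: gaussian_space M "L2_closure M gspan"
    by (rule gaussian_space.gaussian_space_L2_closure[OF gaussian_space_gspan])
  define Y where "Y = fld \<delta> h"
  have Y: "Y \<in> L2_closure M gspan" unfolding Y_def by (intro fld_in_L2_closure \<delta> exp_decay_integrable h)
  note eY = V.square_integrable_exp_V[OF Y]
  have sm: "exp_decay (smooth \<delta> h)" by (rule exp_decay_smooth[OF h(1) \<delta>])
  obtain r where r: "strict_mono r" "AE x in lborel. (\<lambda>m. smooth (eps (r m)) (smooth \<delta> h) x) \<longlonglongrightarrow> smooth \<delta> h x"
    using smooth_AE_subseq[OF exp_decay_integrable[OF sm], of eps] eps by blast
  have eps0: "filterlim (\<lambda>m. eps (r m)) (at_right 0) sequentially"
    by (rule filterlim_compose[OF filterlim_eps filterlim_subseq[OF r(1)]])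
  obtain D where D: "\<And>x. \<bar>smooth \<delta> h x\<bar> \<le> D * exp (- norm x)" using exp_decay_bound[OF sm] by blast
  have "(\<lambda>m. TF (\<lambda>_. smooth (eps (r m)) (smooth \<delta> h))) \<longlonglongrightarrow> TF (\<lambda>_. smooth \<delta> h)"
  proof (rule TF_tendsto[where D = "\<lambda>_. D * 6 ^ DIM('a)"])
    show "smooth (eps (r m)) (smooth \<delta> h) \<in> borel_measurable borel" "smooth \<delta> h \<in> borel_measurable borel" for m
      by (intro borel_measurable_smooth exp_decay_measurable[OF h(1)])+
    show "\<bar>smooth (eps (r m)) (smooth \<delta> h) x\<bar> \<le> D * 6 ^ DIM('a) * exp (- norm x)" for m x
      by (intro smooth_le_exp_norm eps D exp_decay_measurable[OF sm])
  qed (rule r(2))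
  then have 1: "(\<lambda>m. exp (expectation (\<lambda>\<omega>. (Y \<omega>)\<^sup>2) / 2) * TF (\<lambda>_. smooth (eps (r m)) (smooth \<delta> h))) \<longlonglongrightarrow>
     exp (expectation (\<lambda>\<omega>. (Y \<omega>)\<^sup>2) / 2) * TF (\<lambda>_. smooth \<delta> h)" by (intro tendsto_intros)
  have 2: "(\<lambda>m. expectation (\<lambda>\<omega>. exp (Y \<omega>) * strat (eps (r m)) \<omega>)) \<longlonglongrightarrow> expectation (\<lambda>\<omega>. exp (Y \<omega>) * S \<omega>)"
    by (rule filterlim_compose[OF expectation_mult_tendsto[OF eY S] eps0])
  have "exp (expectation (\<lambda>\<omega>. (Y \<omega>)\<^sup>2) / 2) * TF (\<lambda>_. smooth \<delta> h) \<le> expectation (\<lambda>\<omega>. exp (Y \<omega>) * S \<omega>)"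
  proof (rule LIMSEQ_le[OF 1 2], intro exI[of _ 0] allI impI)
    fix m
    have nn: "0 \<le> expectation (\<lambda>\<omega>. Y \<omega> * mol (eps (r m)) x \<omega>)" for x
      unfolding Y_def expectation_fld_mol[OF \<delta> eps(1,2) h(1)]
      by (intro Bochner_Integration.integral_nonneg smooth_nonneg h)
    show "exp (expectation (\<lambda>\<omega>. (Y \<omega>)\<^sup>2) / 2) * TF (\<lambda>_. smooth (eps (r m)) (smooth \<delta> h)) \<le> expectation (\<lambda>\<omega>. exp (Y \<omega>) * strat (eps (r m)) \<omega>)"
      using expectation_exp_strat_ge[OF eps(1) Y nn] TF_fld[OF \<delta> eps(1,2), of "\<lambda>_. h" "r m"] h(1) by (simp add: Y_def)
  qed
  then show ?thesis by (simp add: Y_def)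
qed

end

section \<open>The wave kernel\<close>

lemma sets_wave_kernel [measurable_cong, simp]: "sets (wave_kernel r) = sets borel"
  by (simp add: wave_kernel_def sphere_measure_def)

lemma space_wave_kernel [simp]: "space (wave_kernel r) = UNIV"
  using sets_eq_imp_space_eq[OF sets_wave_kernel[of r]] by simp

lemma emeasure_wave_kernel_1:
  assumes "DIM('a::euclidean_space) = 1" "E \<in> sets borel"
  shows "emeasure (wave_kernel r :: 'a measure) E = (\<integral>\<^sup>+x. ennreal (1 / 2 * indicator {x. norm x \<le> r} x) * indicator E x \<partial>lborel)"
  using assms unfolding wave_kernel_def by (simp add: emeasure_density)

lemma emeasure_wave_kernel_2:
  assumes "DIM('a::euclidean_space) = 2" "E \<in> sets borel"
  shows "emeasure (wave_kernel r :: 'a measure) E =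
    (\<integral>\<^sup>+x. ennreal (1 / (2 * pi) * (indicator {x. norm x \<le> r} x / sqrt (r\<^sup>2 - (norm x)\<^sup>2))) * indicator E x \<partial>lborel)"
  using assms unfolding wave_kernel_def by (subst if_not_P, simp, subst if_P, simp, subst emeasure_density) auto

lemma emeasure_wave_kernel_3:
  assumes "DIM('a::euclidean_space) = 3" and [measurable]: "E \<in> sets borel"
  shows "emeasure (wave_kernel r :: 'a measure) E =
    ennreal (1 / (4 * pi * r)) * (\<integral>\<^sup>+x. ennreal (3 / r * indicator (cball 0 r) x) * indicator E ((r / norm x) *\<^sub>R x) \<partial>lborel)"
proof -
  have [measurable]: "(\<lambda>x. (r / norm x) *\<^sub>R (x::'a)) \<in> measurable borel borel" by measurable
  have "emeasure (sphere_measure r :: 'a measure) E =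
    (\<integral>\<^sup>+x. ennreal (3 / r * indicator (cball 0 r) x) * indicator ((\<lambda>x. (r / norm x) *\<^sub>R x) -` E) x \<partial>lborel)"
  proof -
    have "(\<lambda>x. (r / norm x) *\<^sub>R x) -` E \<in> sets borel"
      using measurable_sets_borel[OF _ assms(2), of "\<lambda>x. (r / norm x) *\<^sub>R x"] by simp
    moreover have "(\<lambda>x. ennreal (3 / r * indicator (cball 0 r) x)) \<in> borel_measurable (borel :: 'a measure)"
      by (intro measurable_compose[OF _ measurable_ennreal] borel_measurable_times borel_measurable_const borel_measurable_indicator) simp
    ultimately show ?thesis
      unfolding sphere_measure_def assms(1) by (subst emeasure_distr; (subst emeasure_density)?) (auto simp del: times_divide_eq_left)
  qed
  moreover have "indicator ((\<lambda>x. (r / norm x) *\<^sub>R x) -` E) x = (indicator E ((r / norm x) *\<^sub>R x) :: ennreal)" for x :: 'a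
    by (simp add: indicator_def)
  ultimately show ?thesis unfolding wave_kernel_def using assms(1) by simp
qed

lemma le_suminf_ennreal: "f j \<le> (\<Sum>i. f i)" for f :: "nat \<Rightarrow> ennreal"
proof -
  have "sum f {j} \<le> (\<Sum>i. f i)" by (rule sum_le_suminf) auto
  then show ?thesis by simp
qed

lemma UNIV_borel: "UNIV \<in> sets borel"
  by simp

text \<open>A dyadic decomposition by the distance to the circle. The shell A j has area V r^2 / 4^j
  and the integrand is at most (2 / r) 2^j where that shell is used, so the sum is geometric with
  value 4 r V.\<close>

lemma nn_integral_inverse_sqrt_disc:
  fixes r :: real
  assumes d: "DIM('a::euclidean_space) = 2" and r: "r > 0"
  shows "(\<integral>\<^sup>+x. ennreal (indicator {x. norm x \<le> r} (x::'a) / sqrt (r\<^sup>2 - (norm x)\<^sup>2)) \<partial>lborel) \<le> ennreal (4 * r * unit_ball_vol 2)"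
proof -
  define V where "V = unit_ball_vol 2"
  have V: "V \<ge> 0" by (simp add: V_def)
  define \<rho> where "\<rho> j = r * sqrt (1 - (1 / 4) ^ j)" for j :: nat
  have \<rho>: "0 \<le> \<rho> j" "\<rho> j \<le> r" "(\<rho> j)\<^sup>2 = r\<^sup>2 * (1 - (1 / 4) ^ j)" for j
  proof -
    have *: "0 \<le> (1 / 4 :: real) ^ j" "(1 / 4 :: real) ^ j \<le> 1" by (auto intro: power_le_one)
    then show "0 \<le> \<rho> j" using r by (simp add: \<rho>_def)
    show "\<rho> j \<le> r" using r * by (simp add: \<rho>_def mult_left_le)
    show "(\<rho> j)\<^sup>2 = r\<^sup>2 * (1 - (1 / 4) ^ j)" using * by (simp add: \<rho>_def power_mult_distrib)
  qed
  define A where "A j = cball (0::'a) r - ball 0 (\<rho> j)" for j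
  have [measurable]: "A j \<in> sets borel" for j by (simp add: A_def)
  have emA: "emeasure lborel (A j) = ennreal (V * r\<^sup>2 * (1 / 4) ^ j)" for j
  proof -
    have "emeasure lborel (A j) = emeasure lborel (cball (0::'a) r) - emeasure lborel (ball (0::'a) (\<rho> j))"
      unfolding A_def using \<rho>[of j] emeasure_lborel_ball_finite[of "0::'a" "\<rho> j"] by (intro emeasure_Diff) auto
    also have "\<dots> = ennreal (V * r\<^sup>2) - ennreal (V * (\<rho> j)\<^sup>2)"
      using r \<rho>[of j] d by (simp add: emeasure_cball emeasure_ball V_def)
    also have "\<dots> = ennreal (V * r\<^sup>2 * (1 / 4) ^ j)"
      using V by (subst ennreal_minus) (auto simp: \<rho>(3) algebra_simps mult_left_le power_le_one intro!: mult_left_mono)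
    finally show ?thesis .
  qed
  have pointwise: "ennreal (indicator {x. norm x \<le> r} (x::'a) / sqrt (r\<^sup>2 - (norm x)\<^sup>2)) \<le> (\<Sum>j. ennreal (2 / r * 2 ^ j) * indicator (A j) x)" for x
  proof (cases "norm x < r")
    case True
    define q where "q = 1 - (norm x)\<^sup>2 / r\<^sup>2"
    have nx: "(norm x)\<^sup>2 < r\<^sup>2" using True by (intro power_strict_mono) auto
    have q: "0 < q" "q \<le> 1" using nx r by (auto simp: q_def)
    have qr: "r\<^sup>2 - (norm x)\<^sup>2 = r\<^sup>2 * q" using r by (simp add: q_def field_simps)
    have "(\<lambda>j. (1 / 4 :: real) ^ Suc j) \<longlonglongrightarrow> 0"
      by (rule LIMSEQ_Suc) (rule LIMSEQ_power_zero, simp)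
    then have "\<forall>\<^sub>F j in sequentially. (1 / 4 :: real) ^ Suc j < q" using q(1) by (rule order_tendstoD)
    then have ex: "\<exists>j. (1 / 4 :: real) ^ Suc j < q" by (auto dest: eventually_happens'[OF sequentially_bot])
    \<comment> \<open>Locates q between 4^(- j - 1) and 4^(- j): the upper bound puts x into A j,
      the lower one bounds the integrand.\<close>
    define j where "j = (LEAST j. (1 / 4 :: real) ^ Suc j < q)"
    have j1: "(1 / 4) ^ Suc j < q" unfolding j_def by (rule LeastI_ex[OF ex])
    have j2: "q \<le> (1 / 4) ^ j"
    proof (cases j)
      case (Suc i)
      then have "\<not> (1 / 4 :: real) ^ Suc i < q" using not_less_Least[of i "\<lambda>j. (1 / 4 :: real) ^ Suc j < q"] unfolding j_def[symmetric] by simp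
      then show ?thesis by (simp add: Suc)
    qed (use q in simp)
    have "(\<rho> j)\<^sup>2 \<le> (norm x)\<^sup>2"
      using qr mult_left_mono[OF j2, of "r\<^sup>2"] unfolding \<rho>(3) by (simp add: algebra_simps)
    then have "\<rho> j \<le> norm x" using \<rho>(1) by (simp add: power2_le_iff_abs_le)
    then have xA: "x \<in> A j" using True by (auto simp: A_def)
    have "sqrt ((1 / 4) ^ Suc j) \<le> sqrt q" using j1 by simp
    moreover have "sqrt ((1 / 4) ^ Suc j) = (1 / 2) ^ Suc j"
      by (simp add: real_sqrt_power real_sqrt_divide)
    ultimately have sq: "(1 / 2) ^ Suc j \<le> sqrt q" by (simp only:)
    have "1 / sqrt (r\<^sup>2 - (norm x)\<^sup>2) = 1 / (r * sqrt q)" using r by (simp add: qr real_sqrt_mult)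
    also have "\<dots> \<le> 1 / (r * (1 / 2) ^ Suc j)"
      using r sq q(1) by (intro divide_left_mono mult_left_mono mult_pos_pos) auto
    also have "\<dots> = 2 / r * 2 ^ j" using r by (simp add: field_simps power_divide)
    finally have "ennreal (indicator {x. norm x \<le> r} x / sqrt (r\<^sup>2 - (norm x)\<^sup>2)) \<le> ennreal (2 / r * 2 ^ j) * indicator (A j) x"
      using True xA by (simp add: ennreal_leI)
    also have "\<dots> \<le> (\<Sum>j. ennreal (2 / r * 2 ^ j) * indicator (A j) x)"
      by (rule le_suminf_ennreal)
    finally show ?thesis .
  next
    case False
    \<comment> \<open>On the circle itself the quotient is 1 / 0 = 0.\<close>
    then have "indicator {x. norm x \<le> r} x / sqrt (r\<^sup>2 - (norm x)\<^sup>2) = (0::real)" by (cases "norm x = r") (auto simp: indicator_def)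
    then show ?thesis by (simp only: ennreal_0 zero_le)
  qed
  have "(\<integral>\<^sup>+x. ennreal (indicator {x. norm x \<le> r} (x::'a) / sqrt (r\<^sup>2 - (norm x)\<^sup>2)) \<partial>lborel) \<le> (\<integral>\<^sup>+x. (\<Sum>j. ennreal (2 / r * 2 ^ j) * indicator (A j) (x::'a)) \<partial>lborel)"
    by (intro nn_integral_mono pointwise)
  also have "\<dots> = (\<Sum>j. \<integral>\<^sup>+x. ennreal (2 / r * 2 ^ j) * indicator (A j) (x::'a) \<partial>lborel)"
    by (rule nn_integral_suminf) measurable
  also have "\<dots> = (\<Sum>j. ennreal (2 * r * V * (1 / 2) ^ j))"
  proof (intro suminf_cong)
    fix j
    have "(\<integral>\<^sup>+x. ennreal (2 / r * 2 ^ j) * indicator (A j) (x::'a) \<partial>lborel) = ennreal (2 / r * 2 ^ j) * ennreal (V * r\<^sup>2 * (1 / 4) ^ j)"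
      by (simp add: nn_integral_cmult_indicator emA)
    also have "\<dots> = ennreal (2 / r * 2 ^ j * (V * r\<^sup>2 * (1 / 4) ^ j))"
      using r V by (subst ennreal_mult) auto
    also have "2 / r * 2 ^ j * (V * r\<^sup>2 * (1 / 4) ^ j) = 2 * r * V * (2 ^ j * (1 / 4) ^ j)"
      using r by (simp add: power2_eq_square)
    also have "(2::real) ^ j * (1 / 4) ^ j = (1 / 2) ^ j" by (subst power_mult_distrib[symmetric]) simp
    finally show "(\<integral>\<^sup>+x. ennreal (2 / r * 2 ^ j) * indicator (A j) (x::'a) \<partial>lborel) = ennreal (2 * r * V * (1 / 2) ^ j)" .
  qed
  also have "\<dots> = ennreal (\<Sum>j. 2 * r * V * (1 / 2) ^ j)"
    using r V by (intro suminf_ennreal2 summable_mult summable_geometric) auto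
  also have "(\<Sum>j. 2 * r * V * (1 / 2) ^ j) = 4 * r * V"
    by (subst suminf_mult) (auto simp: suminf_geometric intro: summable_geometric)
  finally show ?thesis by (simp add: V_def)
qed

text \<open>Stated for every real r, because products of kernels are formed for arbitrary time
  vectors, also outside the simplex. In dimension three the true mass is r; a linear bound
  suffices.\<close>

lemma wave_kernel_mass:
  assumes d: "DIM('a::euclidean_space) \<in> {1, 2, 3}"
  shows "\<exists>c. \<forall>r. emeasure (wave_kernel r :: 'a measure) UNIV \<le> ennreal (c * \<bar>r\<bar>)"
proof -
  consider (1) "DIM('a) = 1" | (2) "DIM('a) = 2" | (3) "DIM('a) = 3" using d by auto
  then show ?thesis
  proof cases
    case 1
    have "emeasure (wave_kernel r :: 'a measure) UNIV \<le> ennreal (unit_ball_vol 1 * \<bar>r\<bar>)" for r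
    proof -
      have "emeasure (wave_kernel r :: 'a measure) UNIV \<le> (\<integral>\<^sup>+x. indicator (cball (0::'a) \<bar>r\<bar>) x \<partial>lborel)"
        unfolding emeasure_wave_kernel_1[OF 1 UNIV_borel]
        by (intro nn_integral_mono) (auto simp: indicator_def)
      also have "\<dots> = ennreal (unit_ball_vol 1 * \<bar>r\<bar>)" using 1 by (simp add: emeasure_cball)
      finally show ?thesis .
    qed
    then show ?thesis by blast
  next
    case 2
    have "emeasure (wave_kernel r :: 'a measure) UNIV \<le> ennreal (4 * unit_ball_vol 2 * \<bar>r\<bar>)" for r
    proof (cases "r > 0")
      case True
      have "emeasure (wave_kernel r :: 'a measure) UNIV \<le> (\<integral>\<^sup>+x. ennreal (indicator {x. norm x \<le> r} (x::'a) / sqrt (r\<^sup>2 - (norm x)\<^sup>2)) \<partial>lborel)"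
        unfolding emeasure_wave_kernel_2[OF 2 UNIV_borel]
      proof (intro nn_integral_mono)
        fix x :: 'a
        define u where "u = indicator {x. norm x \<le> r} x / sqrt (r\<^sup>2 - (norm x)\<^sup>2)"
        have "0 \<le> u"
        proof (cases "norm x \<le> r")
          case True
          then have "(norm x)\<^sup>2 \<le> r\<^sup>2" by (intro power_mono) auto
          then show ?thesis by (simp add: u_def)
        qed (simp add: u_def)
        moreover have "1 / (2 * pi) \<le> 1" using pi_gt3 by simp
        ultimately have "1 / (2 * pi) * u \<le> 1 * u" by (intro mult_right_mono)
        then show "ennreal (1 / (2 * pi) * (indicator {x. norm x \<le> r} x / sqrt (r\<^sup>2 - (norm x)\<^sup>2))) * indicator UNIV x \<le> ennreal (indicator {x. norm x \<le> r} x / sqrt (r\<^sup>2 - (norm x)\<^sup>2))"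
          unfolding u_def[symmetric] by (simp add: ennreal_leI)
      qed
      also have "\<dots> \<le> ennreal (4 * r * unit_ball_vol 2)" by (rule nn_integral_inverse_sqrt_disc[OF 2 True])
      finally show ?thesis using True by (simp add: mult_ac)
    next
      case False
      have "emeasure (wave_kernel r :: 'a measure) UNIV = (\<integral>\<^sup>+x. 0 \<partial>(lborel :: 'a measure))"
        unfolding emeasure_wave_kernel_2[OF 2 UNIV_borel]
      proof (intro nn_integral_cong)
        fix x :: 'a
        \<comment> \<open>For r \<le> 0 only x = 0 with r = 0 survives the indicator, and there the
          quotient is 1 / 0 = 0.\<close>
        have "indicator {x. norm x \<le> r} x / sqrt (r\<^sup>2 - (norm x)\<^sup>2) = 0"
        proof (cases "norm x \<le> r")
          case True
          then have "norm x = 0" "r = 0" using False norm_ge_zero[of x] by linarith+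
          then show ?thesis by simp
        qed simp
        then show "ennreal (1 / (2 * pi) * (indicator {x. norm x \<le> r} x / sqrt (r\<^sup>2 - (norm x)\<^sup>2))) * indicator UNIV x = 0"
          by (simp only: mult_zero_right ennreal_0 mult_zero_left)
      qed
      then show ?thesis by simp
    qed
    then show ?thesis by blast
  next
    case 3
    have "emeasure (wave_kernel r :: 'a measure) UNIV \<le> ennreal (unit_ball_vol 3 * \<bar>r\<bar>)" for r
    proof (cases "r > 0")
      case True
      have "emeasure (wave_kernel r :: 'a measure) UNIV = ennreal (1 / (4 * pi * r)) * (\<integral>\<^sup>+x. ennreal (3 / r) * indicator (cball 0 r) (x::'a) \<partial>lborel)"
      proof -
        have "(\<integral>\<^sup>+x. ennreal (3 / r * indicator (cball 0 r) x) * indicator UNIV ((r / norm x) *\<^sub>R (x::'a)) \<partial>lborel) = (\<integral>\<^sup>+x. ennreal (3 / r) * indicator (cball 0 r) (x::'a) \<partial>lborel)"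
          by (intro nn_integral_cong) (auto simp: indicator_def)
        then show ?thesis unfolding emeasure_wave_kernel_3[OF 3 UNIV_borel] by simp
      qed
      also have "\<dots> = ennreal (1 / (4 * pi * r)) * (ennreal (3 / r) * ennreal (unit_ball_vol 3 * r ^ 3))"
        using 3 True by (simp add: nn_integral_cmult_indicator emeasure_cball)
      also have "\<dots> = ennreal (1 / (4 * pi * r) * (3 / r * (unit_ball_vol 3 * r ^ 3)))"
      proof -
        have "0 \<le> 1 / (4 * pi * r)" "0 \<le> 3 / r" using True by auto
        then show ?thesis by (simp only: ennreal_mult'[of "1 / (4 * pi * r)"] ennreal_mult'[of "3 / r"])
      qed
      also have "1 / (4 * pi * r) * (3 / r * (unit_ball_vol 3 * r ^ 3)) = 3 / (4 * pi) * (unit_ball_vol 3 * r)"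
        using True by (simp add: power3_eq_cube)
      also have "ennreal \<dots> \<le> ennreal (1 * (unit_ball_vol 3 * r))"
        using True pi_gt3 by (intro ennreal_leI mult_right_mono) auto
      finally show ?thesis using True by simp
    next
      case False
      \<comment> \<open>At r = 0 the quotient is 0 by convention, and \<open>ennreal\<close> maps
        negative factors to 0, so the kernel vanishes.\<close>
      then have "1 / (4 * pi * r) \<le> 0" by (simp add: divide_nonneg_nonpos mult_nonneg_nonpos)
      then show ?thesis unfolding emeasure_wave_kernel_3[OF 3 UNIV_borel] by (simp add: ennreal_neg)
    qed
    then show ?thesis by blast
  qed
qed

lemma wave_kernel_support:
  assumes d: "DIM('a::euclidean_space) \<in> {1, 2, 3}" and r: "r \<le> t"
  shows "emeasure (wave_kernel r :: 'a measure) (- cball 0 t) = 0"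
proof -
  have E [measurable]: "- cball (0::'a) t \<in> sets borel" by measurable
  consider (1) "DIM('a) = 1" | (2) "DIM('a) = 2" | (3) "DIM('a) = 3" using d by auto
  then show ?thesis
  proof cases
    case 1
    show ?thesis unfolding emeasure_wave_kernel_1[OF 1 E] using r
      by (subst nn_integral_0_iff_AE) (auto simp: indicator_def)
  next
    case 2
    show ?thesis unfolding emeasure_wave_kernel_2[OF 2 E] using r
      by (subst nn_integral_0_iff_AE) (auto simp: indicator_def)
  next
    case 3
    have "ennreal (3 / r * indicator (cball 0 r) x) * indicator (- cball 0 t) ((r / norm x) *\<^sub>R x) = 0" for x :: 'a
    proof (cases "r > 0")
      case True
      \<comment> \<open>The projection fixes x = 0, which lies in the ball; all other points land on
        the sphere of radius r \<le> t.\<close>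
      then show ?thesis using r by (cases "x = 0") (auto simp: indicator_def)
    next
      case False
      then have "3 / r \<le> 0" by (simp add: divide_nonneg_nonpos)
      then show ?thesis by (auto simp: indicator_def ennreal_neg)
    qed
    then have "(\<integral>\<^sup>+x. ennreal (3 / r * indicator (cball 0 r) x) * indicator (- cball 0 t) ((r / norm x) *\<^sub>R x) \<partial>(lborel :: 'a measure)) = 0"
      by (simp only: nn_integral_0_iff_AE[OF borel_measurable_const] nn_integral_const) simp
    then show ?thesis unfolding emeasure_wave_kernel_3[OF 3 E] by simp
  qed
qed

section \<open>Null sets under the wave kernel\<close>

lemma null_sets_affine:
  fixes N :: "'a::euclidean_space set" and c :: 'a
  assumes N: "N \<in> null_sets lborel" and l: "l \<noteq> 0"
  shows "(\<integral>\<^sup>+x. indicator N (c + l *\<^sub>R x) \<partial>lborel) = 0"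
proof -
  have [measurable]: "N \<in> sets borel" using N by auto
  have "0 = (\<integral>\<^sup>+x. indicator N x \<partial>lborel)" using N by auto
  also have "\<dots> = (\<integral>\<^sup>+x. ennreal (\<bar>l\<bar> ^ DIM('a)) * indicator N (c + l *\<^sub>R x) \<partial>lborel)"
    by (subst lborel_affine[OF l, of c]) (simp add: nn_integral_density nn_integral_distr del: nn_integral_indicator)
  also have "\<dots> = ennreal (\<bar>l\<bar> ^ DIM('a)) * (\<integral>\<^sup>+x. indicator N (c + l *\<^sub>R x) \<partial>lborel)"
    by (rule nn_integral_cmult) measurable
  finally show ?thesis using l by (auto simp: ennreal_zero_less_mult_iff)
qed

text \<open>In dimension three each kernel lives on a sphere and charges Lebesgue null sets; only the
  integral over the radius is absolutely continuous.\<close>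

lemma nn_integral_radial_null:
  fixes N :: "'a::euclidean_space set" and c :: 'a
  assumes N: "N \<in> null_sets lborel"
  shows "(\<integral>\<^sup>+r. indicator {0<..} r * (\<integral>\<^sup>+x. indicator N (c + (r / norm x) *\<^sub>R x) \<partial>lborel) \<partial>lborel) = 0"
proof -
  have [measurable]: "N \<in> sets borel" using N by auto
  have "(\<integral>\<^sup>+l. indicator {0<..} l * (\<integral>\<^sup>+x. indicator N (c + l *\<^sub>R x) \<partial>lborel) \<partial>(lborel :: real measure)) = (\<integral>\<^sup>+l. 0 \<partial>(lborel :: real measure))"
    using null_sets_affine[OF N, of _ c] by (intro nn_integral_cong) (auto simp: indicator_def)
  then have "(\<integral>\<^sup>+l. \<integral>\<^sup>+x. indicator {0<..} l * indicator N (c + l *\<^sub>R x) \<partial>lborel \<partial>(lborel :: real measure)) = 0"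
    by (simp add: nn_integral_cmult)
  then have "(\<integral>\<^sup>+x. \<integral>\<^sup>+l. indicator {0<..} l * indicator N (c + l *\<^sub>R x) \<partial>(lborel :: real measure) \<partial>lborel) = 0"
    by (subst (asm) lborel_pair.Fubini'[symmetric]) auto
  then have AE0: "AE x in lborel. (\<integral>\<^sup>+l. indicator {0<..} l * indicator N (c + l *\<^sub>R x) \<partial>(lborel :: real measure)) = 0"
    by (subst (asm) nn_integral_0_iff_AE) auto
  have "AE x in (lborel :: 'a measure). x \<noteq> 0" by (rule AE_lborel_singleton)
  with AE0 have "AE x in lborel. (\<integral>\<^sup>+r. indicator {0<..} r * indicator N (c + (r / norm x) *\<^sub>R x) \<partial>(lborel :: real measure)) = 0"
  proof eventually_elim
    case (elim x)
    \<comment> \<open>The substitution r = norm x l turns the projection onto the sphere of radius r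
      into the dilation by l, under which null sets stay null.\<close>
    have "(\<integral>\<^sup>+r. indicator {0<..} r * indicator N (c + (r / norm x) *\<^sub>R x) \<partial>(lborel :: real measure)) =
      ennreal \<bar>norm x\<bar> * (\<integral>\<^sup>+l. indicator {0<..} (0 + norm x * l) * indicator N (c + ((0 + norm x * l) / norm x) *\<^sub>R x) \<partial>lborel)"
      using elim by (intro nn_integral_real_affine) auto
    also have "(\<integral>\<^sup>+l. indicator {0<..} (0 + norm x * l) * indicator N (c + ((0 + norm x * l) / norm x) *\<^sub>R x) \<partial>lborel) =
       (\<integral>\<^sup>+l. indicator {0<..} l * indicator N (c + l *\<^sub>R x) \<partial>(lborel :: real measure))"
      using elim by (intro nn_integral_cong) (auto simp: indicator_def zero_less_mult_iff)
    finally show ?case using elim by simp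
  qed
  then have "(\<integral>\<^sup>+x. \<integral>\<^sup>+r. indicator {0<..} r * indicator N (c + (r / norm x) *\<^sub>R x) \<partial>(lborel :: real measure) \<partial>(lborel :: 'a measure)) = 0"
    by (subst nn_integral_0_iff_AE) auto
  then have "(\<integral>\<^sup>+r. \<integral>\<^sup>+x. indicator {0<..} r * indicator N (c + (r / norm x) *\<^sub>R x) \<partial>(lborel :: 'a measure) \<partial>(lborel :: real measure)) = 0"
    by (subst lborel_pair.Fubini'[symmetric]) auto
  then show ?thesis by (simp add: nn_integral_cmult)
qed

text \<open>Here \<open>a\<close> stands for the preceding time and \<open>c\<close> for the
  preceding position of a path; the joint measurability allows the integral over the time to be
  taken before that over the earlier positions.\<close>

lemma wave_kernel_null:
  fixes N :: "'a::euclidean_space set"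
  assumes d: "DIM('a) \<in> {1, 2, 3}" and N: "N \<in> null_sets lborel"
  shows "(\<lambda>p. emeasure (wave_kernel (fst p)) {v. snd p + v \<in> N}) \<in> borel_measurable (borel \<Otimes>\<^sub>M borel)"
    "(\<integral>\<^sup>+r. emeasure (wave_kernel (r - a)) {v. c + v \<in> N} \<partial>lborel) = 0"
proof -
  have [measurable]: "N \<in> sets borel" using N by auto
  have E [measurable]: "{v. c + v \<in> N} \<in> sets borel" for c by measurable
  have nullE: "{v. c + v \<in> N} \<in> null_sets lborel" for c
  proof (rule null_setsI)
    have "emeasure lborel {v. c + v \<in> N} = (\<integral>\<^sup>+v. indicator {v. c + v \<in> N} v \<partial>lborel)" by simp
    also have "\<dots> = (\<integral>\<^sup>+v. indicator N (c + 1 *\<^sub>R v) \<partial>lborel)" by (intro nn_integral_cong) (simp add: indicator_def)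
    finally show "emeasure lborel {v. c + v \<in> N} = 0" using null_sets_affine[OF N, of 1 c] by simp
  qed simp
  have AE_E: "AE x in lborel. indicator {v. c + v \<in> N} x = (0 :: ennreal)" for c
    using AE_not_in[OF nullE[of c]] by eventually_elim simp
  consider (12) "DIM('a) = 1 \<or> DIM('a) = 2" | (3) "DIM('a) = 3" using d by auto
  then have "(\<lambda>p. emeasure (wave_kernel (fst p)) {v. snd p + v \<in> N}) \<in> borel_measurable (borel \<Otimes>\<^sub>M borel) \<and>
    (\<integral>\<^sup>+r. emeasure (wave_kernel (r - a)) {v. c + v \<in> N} \<partial>lborel) = 0"
  proof cases
    case 12
    have "emeasure (wave_kernel r) {v. c + v \<in> N} = 0" for r c
      using 12
    proof
      assume "DIM('a) = 1"
      have "(\<integral>\<^sup>+x. ennreal (1 / 2 * indicator {x. norm x \<le> r} x) * indicator {v. c + v \<in> N} x \<partial>lborel) = (\<integral>\<^sup>+x. 0 \<partial>(lborel :: 'a measure))"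
        by (rule nn_integral_cong_AE) (use AE_E[of c] in \<open>eventually_elim, simp\<close>)
      then show ?thesis using emeasure_wave_kernel_1[OF \<open>DIM('a) = 1\<close> E] by simp
    next
      assume "DIM('a) = 2"
      have "(\<integral>\<^sup>+x. ennreal (1 / (2 * pi) * (indicator {x. norm x \<le> r} x / sqrt (r\<^sup>2 - (norm x)\<^sup>2))) * indicator {v. c + v \<in> N} x \<partial>lborel) = (\<integral>\<^sup>+x. 0 \<partial>(lborel :: 'a measure))"
        by (rule nn_integral_cong_AE) (use AE_E[of c] in \<open>eventually_elim, simp\<close>)
      then show ?thesis using emeasure_wave_kernel_2[OF \<open>DIM('a) = 2\<close> E] by simp
    qed
    then show ?thesis by simp
  next
    case 3
    have eq: "emeasure (wave_kernel r) {v. c + v \<in> N} = ennreal (1 / (4 * pi * r)) *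
      (\<integral>\<^sup>+x. ennreal (3 / r * (if norm x \<le> r then 1 else 0)) * indicator N (c + (r / norm x) *\<^sub>R x) \<partial>lborel)" for r c
      unfolding emeasure_wave_kernel_3[OF 3 E]
      by (intro arg_cong2[where f = "(*)"] refl nn_integral_cong) (auto simp: indicator_def)
    have "(\<lambda>p. emeasure (wave_kernel (fst p)) {v. snd p + v \<in> N}) \<in> borel_measurable (borel \<Otimes>\<^sub>M borel)"
      unfolding eq by measurable
    moreover have "(\<integral>\<^sup>+r. emeasure (wave_kernel (r - a)) {v. c + v \<in> N} \<partial>lborel) = 0"
    proof -
      have meas [measurable]: "(\<lambda>r. emeasure (wave_kernel r) {v. c + v \<in> N}) \<in> borel_measurable borel"
        unfolding eq by measurable
      have "(\<integral>\<^sup>+r. emeasure (wave_kernel (r + (- a))) {v. c + v \<in> N} \<partial>lborel) = (\<integral>\<^sup>+r. emeasure (wave_kernel r) {v. c + v \<in> N} \<partial>lborel)"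
        by (rule nn_integral_lborel_shift) measurable
      also have "\<dots> = 0"
      proof -
        have "AE r in lborel. indicator {0<..} r * (\<integral>\<^sup>+x. indicator N (c + (r / norm x) *\<^sub>R x) \<partial>lborel) = 0"
          using nn_integral_radial_null[OF N, of c] by (subst (asm) nn_integral_0_iff_AE) auto
        then have "AE r in lborel. emeasure (wave_kernel r) {v. c + v \<in> N} = 0"
        proof eventually_elim
          case (elim r)
          show ?case
          proof (cases "r > 0")
            case True
            then have "(\<integral>\<^sup>+x. indicator N (c + (r / norm x) *\<^sub>R x) \<partial>lborel) = 0" using elim by simp
            then have "AE x in lborel. indicator N (c + (r / norm x) *\<^sub>R x) = (0 :: ennreal)"
              by (subst (asm) nn_integral_0_iff_AE) auto
            then have "(\<integral>\<^sup>+x. ennreal (3 / r * (if norm x \<le> r then 1 else 0)) * indicator N (c + (r / norm x) *\<^sub>R x) \<partial>lborel) = 0"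
            proof -
              have "(\<integral>\<^sup>+x. ennreal (3 / r * (if norm x \<le> r then 1 else 0)) * indicator N (c + (r / norm x) *\<^sub>R x) \<partial>lborel) = (\<integral>\<^sup>+x. 0 \<partial>(lborel :: 'a measure))"
                by (rule nn_integral_cong_AE) (use \<open>AE x in lborel. indicator N (c + (r / norm x) *\<^sub>R x) = (0 :: ennreal)\<close> in \<open>eventually_elim, simp\<close>)
              then show ?thesis by simp
            qed
            then show ?thesis unfolding eq by simp
          next
            case False
            then have "1 / (4 * pi * r) \<le> 0" by (simp add: divide_nonneg_nonpos mult_nonneg_nonpos)
            then show ?thesis unfolding eq by (simp add: ennreal_neg)
          qed
        qed
        then show ?thesis by (subst nn_integral_0_iff_AE) auto
      qed
      finally show ?thesis by simp
    qed
    ultimately show ?thesis by blast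
  qed
  then show "(\<lambda>p. emeasure (wave_kernel (fst p)) {v. snd p + v \<in> N}) \<in> borel_measurable (borel \<Otimes>\<^sub>M borel)"
    "(\<integral>\<^sup>+r. emeasure (wave_kernel (r - a)) {v. c + v \<in> N} \<partial>lborel) = 0" by auto
qed

text \<open>No measurability of \<open>f\<close> is required: \<open>nn_integral\<close> is a lower integral, and Tonelli's theorem is
  applied to the simple functions below \<open>f\<close>.\<close>

lemma nn_integral_PiM_zeroI:
  fixes f :: "(nat \<Rightarrow> real) \<Rightarrow> ennreal"
  assumes I: "finite I" "k \<in> I" and f: "\<And>s. (\<integral>\<^sup>+r. f (s(k := r)) \<partial>lborel) = 0"
  shows "(\<integral>\<^sup>+s. f s \<partial>(\<Pi>\<^sub>M i\<in>I. lborel)) = 0"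
proof -
  interpret product_sigma_finite "\<lambda>_::nat. lborel :: real measure" ..
  have "integral\<^sup>S (\<Pi>\<^sub>M i\<in>I. lborel) g \<le> 0" if g: "simple_function (\<Pi>\<^sub>M i\<in>I. lborel) g" "g \<le> f" for g
  proof -
    have I': "insert k (I - {k}) = I" using I by auto
    have gm: "g \<in> borel_measurable (\<Pi>\<^sub>M i\<in>insert k (I - {k}). lborel)"
      unfolding I' by (rule borel_measurable_simple_function[OF g(1)])
    have "integral\<^sup>S (\<Pi>\<^sub>M i\<in>I. lborel) g = (\<integral>\<^sup>+s. g s \<partial>(\<Pi>\<^sub>M i\<in>insert k (I - {k}). lborel))"
      unfolding I' by (rule nn_integral_eq_simple_integral[OF g(1), symmetric])
    also have "\<dots> = (\<integral>\<^sup>+s. \<integral>\<^sup>+r. g (s(k := r)) \<partial>lborel \<partial>(\<Pi>\<^sub>M i\<in>I - {k}. lborel))"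
      using I by (intro product_nn_integral_insert gm) auto
    also have "\<dots> \<le> (\<integral>\<^sup>+s. \<integral>\<^sup>+r. f (s(k := r)) \<partial>lborel \<partial>(\<Pi>\<^sub>M i\<in>I - {k}. lborel))"
      using g(2) by (intro nn_integral_mono) (auto simp: le_fun_def)
    also have "\<dots> = 0" by (simp add: f)
    finally show ?thesis .
  qed
  then show ?thesis unfolding nn_integral_def by (intro antisym SUP_least) auto
qed

section \<open>The measure g_n on tuples\<close>

definition step_measure :: "nat \<Rightarrow> (nat \<Rightarrow> real) \<Rightarrow> (nat \<Rightarrow> 'a::euclidean_space) measure" where
  "step_measure n s = (\<Pi>\<^sub>M k\<in>{1..n}. wave_kernel (time_step s k))"

lemma measurable_path_from:
  "path_from (x::'a::euclidean_space) n \<in> measurable (step_measure n s) (tuples n)"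
  unfolding path_from_def[abs_def] step_measure_def
proof (rule measurable_restrict)
  fix k assume "k \<in> {1..n}"
  then have "(\<lambda>z. z i) \<in> measurable (\<Pi>\<^sub>M k\<in>{1..n}. wave_kernel (time_step s k) :: 'a measure) borel" if "i \<in> {1..k}" for i
    using measurable_component_singleton[of i "{1..n}" "\<lambda>k. wave_kernel (time_step s k) :: 'a measure"] that
    by (simp add: measurable_cong_sets[OF refl sets_wave_kernel])
  then show "(\<lambda>z. x + (\<Sum>i = 1..k. z i)) \<in> measurable (\<Pi>\<^sub>M k\<in>{1..n}. wave_kernel (time_step s k) :: 'a measure) borel"
    by (intro borel_measurable_add borel_measurable_sum borel_measurable_const) auto
qed

lemma sets_wave_g: "sets (wave_g n t (x::'a::euclidean_space)) = sets (tuples n)"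
  unfolding wave_g_def by (rule sets.sets_measure_of_eq)

lemma space_wave_g: "space (wave_g n t (x::'a::euclidean_space)) = space (tuples n)"
  by (rule sets_eq_imp_space_eq[OF sets_wave_g])

text \<open>Only an upper bound is claimed, so that the countable additivity of the set function
  defining \<open>wave_g\<close> need not be checked: \<open>measure_of\<close> returns the zero measure otherwise.\<close>

lemma emeasure_wave_g_le:
  fixes x :: "'a::euclidean_space"
  assumes A: "A \<in> sets (tuples n :: (nat \<Rightarrow> 'a) measure)"
  shows "emeasure (wave_g n t x) A \<le>
    (\<integral>\<^sup>+s. indicator (time_simplex n t) s * emeasure (step_measure n s) (path_from x n -` A \<inter> space (step_measure n s))
      \<partial>(\<Pi>\<^sub>M k\<in>{1..n}. lborel))"
proof -
  have "emeasure (distr (step_measure n s) (tuples n) (path_from x n)) A =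
    emeasure (step_measure n s) (path_from x n -` A \<inter> space (step_measure n s))" for s
    by (rule emeasure_distr[OF measurable_path_from A])
  then show ?thesis
    unfolding wave_g_def step_measure_def[symmetric] emeasure_measure_of_conv by simp
qed

lemma time_simplex_bounds:
  assumes s: "s \<in> time_simplex n t" and k: "k \<in> {1..n}"
  shows "0 < s k" "s k < t" "0 < time_step s k" "time_step s k < t"
proof -
  have step: "(s(0 := 0)) (k - 1) < s k \<and> s k < t" if "k \<in> {1..n}" for k
    using s that by (simp add: time_simplex_def)
  have nn: "0 \<le> (s(0 := 0)) j" if "j \<le> n" for j
    using that
  proof (induction j)
    case (Suc j)
    then have "Suc j \<in> {1..n}" by auto
    from step[OF this] Suc show ?case by simp
  qed simp
  have km: "k - 1 \<le> n" "k \<noteq> 0" using k by auto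
  show "0 < s k" "s k < t" "0 < time_step s k" "time_step s k < t"
    using step[OF k] nn[OF km(1)] km(2) unfolding time_step_def by auto
qed

lemma sigma_finite_wave_kernel:
  assumes d: "DIM('a::euclidean_space) \<in> {1, 2, 3}"
  shows "sigma_finite_measure (wave_kernel r :: 'a measure)"
proof -
  obtain c where c: "emeasure (wave_kernel r :: 'a measure) UNIV \<le> ennreal (c * \<bar>r\<bar>)" using wave_kernel_mass[OF d] by blast
  have "finite_measure (wave_kernel r :: 'a measure)"
    by (rule finite_measureI) (use c in \<open>auto simp: top_unique\<close>)
  then show ?thesis by (simp add: finite_measure_def)
qed

context
  fixes n :: nat and t :: real and x :: "'a::euclidean_space"
  assumes d: "DIM('a) \<in> {1, 2, 3}"
begin

lemma product_sigma_finite_step: "product_sigma_finite (\<lambda>k. wave_kernel (time_step s k) :: 'a measure)"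
  by (rule product_sigma_finite.intro) (rule sigma_finite_wave_kernel[OF d])

text \<open>The lower bound 1 on B makes B^n a bound for products over any subset of the
  steps.\<close>

lemma wave_kernel_mass_simplex:
  "\<exists>B\<ge>1. \<forall>s\<in>time_simplex n t. \<forall>k\<in>{1..n}. emeasure (wave_kernel (time_step s k) :: 'a measure) UNIV \<le> ennreal B"
proof -
  obtain c where c: "\<And>r. emeasure (wave_kernel r :: 'a measure) UNIV \<le> ennreal (c * \<bar>r\<bar>)" using wave_kernel_mass[OF d] by blast
  have "emeasure (wave_kernel (time_step s k) :: 'a measure) UNIV \<le> ennreal (max 1 (\<bar>c\<bar> * \<bar>t\<bar>))"
    if "s \<in> time_simplex n t" "k \<in> {1..n}" for s k
  proof (rule order.trans[OF c ennreal_leI])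
    have "c * \<bar>time_step s k\<bar> \<le> \<bar>c\<bar> * \<bar>t\<bar>"
      using time_simplex_bounds(3,4)[OF that] by (intro mult_mono) auto
    then show "c * \<bar>time_step s k\<bar> \<le> max 1 (\<bar>c\<bar> * \<bar>t\<bar>)" by simp
  qed
  then show ?thesis by (intro exI[of _ "max 1 (\<bar>c\<bar> * \<bar>t\<bar>)"]) auto
qed

text \<open>Each of the n kernels has mass at most B, and the simplex lies in the cube over
  [0, t].\<close>

lemma finite_measure_wave_g: "finite_measure (wave_g n t x)"
proof (rule finite_measureI)
  obtain B where B: "B \<ge> 1" "\<And>s k. s \<in> time_simplex n t \<Longrightarrow> k \<in> {1..n} \<Longrightarrow> emeasure (wave_kernel (time_step s k) :: 'a measure) UNIV \<le> ennreal B"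
    using wave_kernel_mass_simplex by blast
  interpret L: product_sigma_finite "\<lambda>_::nat. lborel :: real measure" ..
  have top: "space (tuples n) \<in> sets (tuples n :: (nat \<Rightarrow> 'a) measure)" by (rule sets.top)
  have "emeasure (wave_g n t x) (space (wave_g n t x)) \<le>
    (\<integral>\<^sup>+s. indicator (time_simplex n t) s * emeasure (step_measure n s) (path_from x n -` space (tuples n) \<inter> space (step_measure n s)) \<partial>(\<Pi>\<^sub>M k\<in>{1..n}. lborel))"
    unfolding space_wave_g by (rule emeasure_wave_g_le[OF top])
  also have "\<dots> \<le> (\<integral>\<^sup>+s. ennreal (B ^ n) * indicator (\<Pi>\<^sub>E k\<in>{1..n}. {0..t}) s \<partial>(\<Pi>\<^sub>M k\<in>{1..n}. lborel))"
  proof (rule nn_integral_mono)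
    fix s :: "nat \<Rightarrow> real" assume sp: "s \<in> space (\<Pi>\<^sub>M k\<in>{1..n}. lborel)"
    interpret P: product_sigma_finite "\<lambda>k. wave_kernel (time_step s k) :: 'a measure" by (rule product_sigma_finite_step)
    show "indicator (time_simplex n t) s * emeasure (step_measure n s) (path_from x n -` space (tuples n) \<inter> space (step_measure n s)) \<le>
      ennreal (B ^ n) * indicator (\<Pi>\<^sub>E k\<in>{1..n}. {0..t}) s"
    proof (cases "s \<in> time_simplex n t")
      case True
      have "emeasure (step_measure n s) (path_from x n -` space (tuples n) \<inter> space (step_measure n s)) \<le> emeasure (step_measure n s) (space (step_measure n s) :: (nat \<Rightarrow> 'a) set)"
        by (intro emeasure_mono) auto
      also have "\<dots> = (\<Prod>k\<in>{1..n}. emeasure (wave_kernel (time_step s k) :: 'a measure) UNIV)"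
        unfolding step_measure_def using P.emeasure_PiM[of "{1..n}" "\<lambda>_. UNIV"] by (simp add: space_PiM)
      also have "\<dots> \<le> (\<Prod>k\<in>{1..n}. ennreal B)" using B(2)[OF True] by (intro prod_mono_ennreal) auto
      also have "\<dots> = ennreal (B ^ n)" using B(1) by (simp add: ennreal_power)
      finally have "emeasure (step_measure n s) (path_from x n -` space (tuples n) \<inter> space (step_measure n s)) \<le> ennreal (B ^ n)" .
      moreover have "s \<in> (\<Pi>\<^sub>E k\<in>{1..n}. {0..t})"
        using sp time_simplex_bounds(1,2)[OF True] by (auto simp: space_PiM PiE_iff less_imp_le)
      ultimately show ?thesis using True by simp
    qed simp
  qed
  also have "\<dots> = ennreal (B ^ n) * emeasure (\<Pi>\<^sub>M k\<in>{1..n}. lborel :: real measure) (\<Pi>\<^sub>E k\<in>{1..n}. {0..t})"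
    by (rule nn_integral_cmult_indicator) (auto intro!: sets_PiM_I_finite)
  also have "\<dots> = ennreal (B ^ n) * (\<Prod>k\<in>{1..n}. emeasure lborel {0..t})"
    by (subst L.emeasure_PiM) auto
  also have "\<dots> < \<infinity>"
    by (auto simp: ennreal_mult_less_top emeasure_lborel_Icc_eq power_less_top_ennreal)
  finally show "emeasure (wave_g n t x) (space (wave_g n t x)) \<noteq> \<infinity>" by simp
qed

lemma measurable_tuple_component: "k \<in> {1..n} \<Longrightarrow> (\<lambda>y. y k) \<in> measurable (tuples n :: (nat \<Rightarrow> 'a) measure) borel"
  by (rule measurable_component_singleton)

text \<open>Finite speed of propagation, in the crude form that each of at most n increments has
  length at most \<bar>t\<bar>.\<close>

lemma wave_g_bounded: "AE y in wave_g n t x. \<forall>k\<in>{1..n}. norm (y k) \<le> norm x + real n * \<bar>t\<bar>"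
proof -
  define R where "R = norm x + real n * \<bar>t\<bar>"
  define A where "A = {y \<in> space (tuples n :: (nat \<Rightarrow> 'a) measure). \<not> (\<forall>k\<in>{1..n}. norm (y k) \<le> R)}"
  have A: "A \<in> sets (tuples n)"
  proof -
    have "{y \<in> space (tuples n :: (nat \<Rightarrow> 'a) measure). norm (y k) \<le> R} \<in> sets (tuples n)" if "k \<in> {1..n}" for k
    proof -
      note measurable_tuple_component[OF that, measurable]
      show ?thesis by measurable
    qed
    then have "{y \<in> space (tuples n :: (nat \<Rightarrow> 'a) measure). \<forall>k\<in>{1..n}. norm (y k) \<le> R} \<in> sets (tuples n)"
      by (intro sets.sets_Collect_finite_All) auto
    then show ?thesis unfolding A_def by (rule sets.sets_Collect_neg)
  qed
  have "emeasure (wave_g n t x) A \<le> (\<integral>\<^sup>+s. 0 \<partial>(\<Pi>\<^sub>M k\<in>{1..n}. lborel :: real measure))"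
  proof (rule order.trans[OF emeasure_wave_g_le[OF A] nn_integral_mono])
    fix s :: "nat \<Rightarrow> real"
    interpret P: product_sigma_finite "\<lambda>k. wave_kernel (time_step s k) :: 'a measure" by (rule product_sigma_finite_step)
    show "indicator (time_simplex n t) s * emeasure (step_measure n s) (path_from x n -` A \<inter> space (step_measure n s)) \<le> 0"
    proof (cases "s \<in> time_simplex n t")
      case True
      define E where "E i = (\<Pi>\<^sub>E k\<in>{1..n}. if k = i then - cball (0::'a) \<bar>t\<bar> else UNIV)" for i
      have E: "E i \<in> null_sets (step_measure n s)" if i: "i \<in> {1..n}" for i
      proof (rule null_setsI)
        show "E i \<in> sets (step_measure n s)"
          unfolding E_def step_measure_def by (intro sets_PiM_I_finite) auto
        have "emeasure (step_measure n s) (E i) = (\<Prod>k\<in>{1..n}. emeasure (wave_kernel (time_step s k)) (if k = i then - cball (0::'a) \<bar>t\<bar> else UNIV))"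
          unfolding E_def step_measure_def by (rule P.emeasure_PiM) auto
        also have "\<dots> = 0"
          using i wave_kernel_support[OF d, of "time_step s i" "\<bar>t\<bar>"] time_simplex_bounds(4)[OF True i]
          by (intro prod_zero) auto
        finally show "emeasure (step_measure n s) (E i) = 0" .
      qed
      have "path_from x n -` A \<inter> space (step_measure n s) \<subseteq> (\<Union>i\<in>{1..n}. E i)"
      proof
        fix z assume z: "z \<in> path_from x n -` A \<inter> space (step_measure n s)"
        then obtain k where k: "k \<in> {1..n}" "R < norm (path_from x n z k)" by (auto simp: A_def not_le)
        show "z \<in> (\<Union>i\<in>{1..n}. E i)"
        proof (rule ccontr)
          assume "z \<notin> (\<Union>i\<in>{1..n}. E i)"
          then have zi: "norm (z i) \<le> \<bar>t\<bar>" if "i \<in> {1..n}" for i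
            using z that by (fastforce simp: E_def step_measure_def space_PiM PiE_iff split: if_splits)
          have "norm (path_from x n z k) = norm (x + (\<Sum>i = 1..k. z i))" using k(1) by (simp add: path_from_def)
          also have "\<dots> \<le> norm x + norm (\<Sum>i = 1..k. z i)" by (rule norm_triangle_ineq)
          also have "norm (\<Sum>i = 1..k. z i) \<le> (\<Sum>i = 1..k. \<bar>t\<bar>)"
            using k(1) by (intro sum_norm_le zi) auto
          also have "(\<Sum>i = 1..k. \<bar>t\<bar>) \<le> real n * \<bar>t\<bar>" using k(1) by (simp add: mult_right_mono)
          finally show False using k(2) by (simp add: R_def)
        qed
      qed
      moreover have "(\<Union>i\<in>{1..n}. E i) \<in> null_sets (step_measure n s)"
        using E by (intro null_sets_UN') auto
      ultimately have "emeasure (step_measure n s) (path_from x n -` A \<inter> space (step_measure n s)) = 0"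
        using emeasure_mono[of _ "\<Union>i\<in>{1..n}. E i" "step_measure n s"] by (auto simp: null_sets_def)
      then show ?thesis by simp
    qed simp
  qed
  then have "emeasure (wave_g n t x) A = 0" by simp
  then have "A \<in> null_sets (wave_g n t x)" using A by (simp add: null_sets_def sets_wave_g)
  then have "AE y in wave_g n t x. y \<notin> A" by (rule AE_not_in)
  with AE_space show ?thesis by eventually_elim (auto simp: A_def R_def space_wave_g)
qed

text \<open>Let the k-th time vary and fix all others. The increments before the k-th determine the
  point c from which the k-th step starts, those after it contribute only mass, and the integral of
  the k-th kernel over its time charges no null set.\<close>

lemma wave_g_null:
  assumes k: "k \<in> {1..n}" and N: "N \<in> null_sets lborel"
  shows "AE y in wave_g n t x. y k \<notin> N"
proof -
  have [measurable]: "N \<in> sets borel" using N by auto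
  define A where "A = {y \<in> space (tuples n :: (nat \<Rightarrow> 'a) measure). y k \<in> N}"
  have A: "A \<in> sets (tuples n)"
  proof -
    note measurable_tuple_component[OF k, measurable]
    show ?thesis unfolding A_def by measurable
  qed
  obtain B where B: "B \<ge> 1" "\<And>s k. s \<in> time_simplex n t \<Longrightarrow> k \<in> {1..n} \<Longrightarrow> emeasure (wave_kernel (time_step s k) :: 'a measure) UNIV \<le> ennreal B"
    using wave_kernel_mass_simplex by blast
  \<comment> \<open>Splits off the increments that precede the k-th; \<open>k\<close> itself belongs
    to \<open>J\<close>.\<close>
  define I J where "I = {1..<k}" and "J = {k..n}"
  have IJ: "I \<union> J = {1..n}" "I \<inter> J = {}" "finite I" "finite J" "k \<in> J" using k by (auto simp: I_def J_def)
  note W = wave_kernel_null[OF d N]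
  define c where "c z = x + (\<Sum>i\<in>I. z i)" for z :: "nat \<Rightarrow> 'a"
  define b where "b s = (s(0 := 0)) (k - 1)" for s :: "nat \<Rightarrow> real"
  have bound: "emeasure (step_measure n s) (path_from x n -` A \<inter> space (step_measure n s)) \<le>
     ennreal (B ^ n) * (\<integral>\<^sup>+z. emeasure (wave_kernel (time_step s k)) {v. c z + v \<in> N} \<partial>(\<Pi>\<^sub>M i\<in>I. wave_kernel (time_step s i)))"
    if s: "s \<in> time_simplex n t" for s
  proof -
    interpret P: product_sigma_finite "\<lambda>k. wave_kernel (time_step s k) :: 'a measure" by (rule product_sigma_finite_step)
    define E where "E = path_from x n -` A \<inter> space (step_measure n s)"
    have E: "E \<in> sets (step_measure n s)" unfolding E_def by (rule measurable_sets[OF measurable_path_from A])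
    have Em: "indicator E \<in> borel_measurable (\<Pi>\<^sub>M i\<in>I \<union> J. wave_kernel (time_step s i) :: 'a measure)"
      using E unfolding IJ(1) step_measure_def by (rule borel_measurable_indicator)
    have "emeasure (step_measure n s) E = (\<integral>\<^sup>+z. indicator E z \<partial>(\<Pi>\<^sub>M i\<in>I \<union> J. wave_kernel (time_step s i)))"
      using E unfolding IJ(1) step_measure_def by simp
    also have "\<dots> = (\<integral>\<^sup>+z. \<integral>\<^sup>+w. indicator E (merge I J (z, w)) \<partial>(\<Pi>\<^sub>M i\<in>J. wave_kernel (time_step s i)) \<partial>(\<Pi>\<^sub>M i\<in>I. wave_kernel (time_step s i)))"
      by (rule P.product_nn_integral_fold[OF IJ(2-4) Em])
    also have "\<dots> \<le> (\<integral>\<^sup>+z. ennreal (B ^ n) * emeasure (wave_kernel (time_step s k)) {v. c z + v \<in> N} \<partial>(\<Pi>\<^sub>M i\<in>I. wave_kernel (time_step s i)))"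
    proof (rule nn_integral_mono)
      fix z :: "nat \<Rightarrow> 'a" assume z: "z \<in> space (\<Pi>\<^sub>M i\<in>I. wave_kernel (time_step s i))"
      define F where "F = (\<Pi>\<^sub>E i\<in>J. if i = k then {v. c z + v \<in> N} else UNIV)"
      have "(\<integral>\<^sup>+w. indicator E (merge I J (z, w)) \<partial>(\<Pi>\<^sub>M i\<in>J. wave_kernel (time_step s i))) \<le> (\<integral>\<^sup>+w. indicator F w \<partial>(\<Pi>\<^sub>M i\<in>J. wave_kernel (time_step s i)))"
      proof (rule nn_integral_mono)
        fix w :: "nat \<Rightarrow> 'a" assume w: "w \<in> space (\<Pi>\<^sub>M i\<in>J. wave_kernel (time_step s i))"
        have "w \<in> F" if "merge I J (z, w) \<in> E"
        proof -
          have "path_from x n (merge I J (z, w)) k \<in> N" using that by (simp add: E_def A_def)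
          moreover have "path_from x n (merge I J (z, w)) k = c z + w k"
          proof -
            have "(\<Sum>i = 1..k. merge I J (z, w) i) = (\<Sum>i\<in>insert k I. merge I J (z, w) i)"
              using k by (intro sum.cong) (auto simp: I_def)
            also have "\<dots> = w k + (\<Sum>i\<in>I. z i)"
              using IJ by (subst sum.insert) (auto simp: merge_def I_def J_def intro!: sum.cong)
            finally show ?thesis using k by (simp add: path_from_def c_def)
          qed
          ultimately show ?thesis using w by (auto simp: F_def space_PiM PiE_iff)
        qed
        then show "(indicator E (merge I J (z, w)) :: ennreal) \<le> indicator F w" by (auto simp: indicator_def)
      qed
      also have "\<dots> = emeasure (\<Pi>\<^sub>M i\<in>J. wave_kernel (time_step s i)) F"
        unfolding F_def using IJ by (intro nn_integral_indicator sets_PiM_I_finite) auto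
      also have "\<dots> = (\<Prod>i\<in>J. emeasure (wave_kernel (time_step s i)) (if i = k then {v. c z + v \<in> N} else UNIV))"
        unfolding F_def using IJ by (intro P.emeasure_PiM) auto
      also have "\<dots> = emeasure (wave_kernel (time_step s k)) {v. c z + v \<in> N} * (\<Prod>i\<in>J-{k}. emeasure (wave_kernel (time_step s i) :: 'a measure) UNIV)"
        using IJ by (subst prod.remove[of J k]) (auto intro!: arg_cong2[where f = "(*)"] prod.cong)
      also have "\<dots> \<le> emeasure (wave_kernel (time_step s k)) {v. c z + v \<in> N} * ennreal (B ^ n)"
      proof (intro mult_left_mono)
        have "(\<Prod>i\<in>J-{k}. emeasure (wave_kernel (time_step s i) :: 'a measure) UNIV) \<le> (\<Prod>i\<in>J-{k}. ennreal B)"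
          using IJ(1) by (intro prod_mono_ennreal B(2)[OF s]) blast
        also have "\<dots> = ennreal (B ^ card (J - {k}))" using B(1) by (simp add: ennreal_power)
        also have "\<dots> \<le> ennreal (B ^ n)"
          using B(1) k by (intro ennreal_leI power_increasing) (auto simp: J_def)
        finally show "(\<Prod>i\<in>J-{k}. emeasure (wave_kernel (time_step s i) :: 'a measure) UNIV) \<le> ennreal (B ^ n)" .
      qed simp
      finally show "(\<integral>\<^sup>+w. indicator E (merge I J (z, w)) \<partial>(\<Pi>\<^sub>M i\<in>J. wave_kernel (time_step s i))) \<le> ennreal (B ^ n) * emeasure (wave_kernel (time_step s k)) {v. c z + v \<in> N}"
        by (simp add: mult.commute)
    qed
    also have "\<dots> = ennreal (B ^ n) * (\<integral>\<^sup>+z. emeasure (wave_kernel (time_step s k)) {v. c z + v \<in> N} \<partial>(\<Pi>\<^sub>M i\<in>I. wave_kernel (time_step s i)))"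
    proof (rule nn_integral_cmult)
      have "c \<in> measurable (\<Pi>\<^sub>M i\<in>I. wave_kernel (time_step s i)) borel"
        unfolding c_def[abs_def]
        by (intro borel_measurable_add borel_measurable_const borel_measurable_sum)
          (use measurable_component_singleton[of _ I "\<lambda>i. wave_kernel (time_step s i) :: 'a measure"] in \<open>simp add: measurable_cong_sets[OF refl sets_wave_kernel]\<close>)
      from measurable_compose[OF measurable_Pair[OF measurable_const[of "time_step s k"] this] W(1)]
      show "(\<lambda>z. emeasure (wave_kernel (time_step s k)) {v. c z + v \<in> N}) \<in> borel_measurable (\<Pi>\<^sub>M i\<in>I. wave_kernel (time_step s i))" by simp
    qed
    finally show ?thesis by (simp add: E_def)
  qed
  have "emeasure (wave_g n t x) A \<le> (\<integral>\<^sup>+s. indicator (time_simplex n t) s * emeasure (step_measure n s) (path_from x n -` A \<inter> space (step_measure n s)) \<partial>(\<Pi>\<^sub>M k\<in>{1..n}. lborel))"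
    by (rule emeasure_wave_g_le[OF A])
  also have "\<dots> = 0"
  proof (rule nn_integral_PiM_zeroI[OF finite_atLeastAtMost k])
    fix s :: "nat \<Rightarrow> real"
    define Q where "Q = (\<Pi>\<^sub>M i\<in>I. wave_kernel (time_step s i) :: 'a measure)"
    interpret P: product_sigma_finite "\<lambda>k. wave_kernel (time_step s k) :: 'a measure" by (rule product_sigma_finite_step)
    interpret Q: sigma_finite_measure Q unfolding Q_def by (rule P.sigma_finite[OF IJ(3)])
    interpret LQ: pair_sigma_finite "lborel :: real measure" Q ..
    \<comment> \<open>The earlier steps do not involve the k-th time, so their product measure stays
      fixed while that time varies.\<close>
    have Qeq: "(\<Pi>\<^sub>M i\<in>I. wave_kernel (time_step (s(k := r)) i) :: 'a measure) = Q" for r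
      unfolding Q_def by (intro PiM_cong refl) (auto simp: I_def time_step_def)
    have tk: "time_step (s(k := r)) k = r - b s" for r
      using k by (auto simp: time_step_def b_def)
    have cm: "c \<in> measurable Q borel"
      unfolding c_def[abs_def] Q_def
      by (intro borel_measurable_add borel_measurable_const borel_measurable_sum)
        (use measurable_component_singleton[of _ I "\<lambda>i. wave_kernel (time_step s i) :: 'a measure"] in \<open>simp add: measurable_cong_sets[OF refl sets_wave_kernel]\<close>)
    have m: "(\<lambda>(r, z). emeasure (wave_kernel (r - b s)) {v. c z + v \<in> N}) \<in> borel_measurable (lborel \<Otimes>\<^sub>M Q)"
    proof -
      have "(\<lambda>p. (fst p - b s, c (snd p))) \<in> measurable (lborel \<Otimes>\<^sub>M Q) (borel \<Otimes>\<^sub>M borel)"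
        by (intro measurable_Pair borel_measurable_diff borel_measurable_const measurable_compose[OF measurable_snd cm]) simp
      from measurable_compose[OF this W(1)] show ?thesis by (simp add: case_prod_unfold)
    qed
    \<comment> \<open>Varying the k-th time also changes the next step, but the later steps enter
      \<open>bound\<close> only through the uniform mass B^n.\<close>
    have "(\<integral>\<^sup>+r. indicator (time_simplex n t) (s(k := r)) * emeasure (step_measure n (s(k := r))) (path_from x n -` A \<inter> space (step_measure n (s(k := r)))) \<partial>lborel) \<le>
      (\<integral>\<^sup>+r. ennreal (B ^ n) * (\<integral>\<^sup>+z. emeasure (wave_kernel (r - b s)) {v. c z + v \<in> N} \<partial>Q) \<partial>lborel)"
      using bound[of "s(k := _)", unfolded Qeq tk] by (intro nn_integral_mono) (auto simp: indicator_def)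
    also have "\<dots> = ennreal (B ^ n) * (\<integral>\<^sup>+r. \<integral>\<^sup>+z. emeasure (wave_kernel (r - b s)) {v. c z + v \<in> N} \<partial>Q \<partial>lborel)"
      by (rule nn_integral_cmult) (rule Q.borel_measurable_nn_integral[OF m])
    also have "(\<integral>\<^sup>+r. \<integral>\<^sup>+z. emeasure (wave_kernel (r - b s)) {v. c z + v \<in> N} \<partial>Q \<partial>lborel) = (\<integral>\<^sup>+z. \<integral>\<^sup>+r. emeasure (wave_kernel (r - b s)) {v. c z + v \<in> N} \<partial>lborel \<partial>Q)"
      by (rule LQ.Fubini'[OF m, symmetric])
    also have "\<dots> = 0" by (simp add: W(2))
    finally show "(\<integral>\<^sup>+r. indicator (time_simplex n t) (s(k := r)) * emeasure (step_measure n (s(k := r))) (path_from x n -` A \<inter> space (step_measure n (s(k := r)))) \<partial>lborel) = 0"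
      by (simp only: mult_zero_right le_zero_eq)
  qed
  finally have "A \<in> null_sets (wave_g n t x)" using A by (simp add: null_sets_def sets_wave_g)
  then have "AE y in wave_g n t x. y \<notin> A" by (rule AE_not_in)
  with AE_space show ?thesis by eventually_elim (auto simp: A_def space_wave_g)
qed

end

section \<open>Passage to the completion\<close>

context noise_tuples
begin

text \<open>The energy is at most the second moment of \<open>strat\<close>, and eventually
  \<open>strat\<close> is within mean square distance 1 of S; the constant is 2 times 1 plus 2 E
  [S^2].\<close>

lemma eventually_energy_le:
  assumes S: "L2_limit M strat S (at_right 0)"
  shows "\<forall>\<^sub>F m in sequentially. energy (eps m) \<le> 2 + 2 * expectation (\<lambda>\<omega>. (S \<omega>)\<^sup>2)"
proof -
  have sqS: "square_integrable M S" using S by (simp add: L2_limit_def)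
  have "((\<lambda>\<epsilon>. expectation (\<lambda>\<omega>. (strat \<epsilon> \<omega> - S \<omega>)\<^sup>2)) \<longlongrightarrow> 0) (at_right 0)" using S by (simp add: L2_limit_def)
  from filterlim_compose[OF this filterlim_eps]
  have "\<forall>\<^sub>F m in sequentially. expectation (\<lambda>\<omega>. (strat (eps m) \<omega> - S \<omega>)\<^sup>2) < 1" by (rule order_tendstoD) simp
  then show ?thesis
  proof eventually_elim
    case (elim m)
    have "energy (eps m) \<le> expectation (\<lambda>\<omega>. (strat (eps m) \<omega> - S \<omega> + S \<omega>)\<^sup>2)"
      using energy_le[OF eps(1)] by simp
    also have "\<dots> \<le> 2 * expectation (\<lambda>\<omega>. (strat (eps m) \<omega> - S \<omega>)\<^sup>2) + 2 * expectation (\<lambda>\<omega>. (S \<omega>)\<^sup>2)"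
      by (rule integral_square_add_le[OF square_integrable_diff[OF strat_mixture(1)[OF eps(1)] sqS] sqS])
    finally show ?case using elim by simp
  qed
qed

end

context noise
begin

lemma H_cauchy_bounded:
  assumes F: "F \<in> H_cauchy \<Gamma>"
  shows "\<exists>B. \<forall>j. pre_H_norm \<Gamma> (F j) \<le> B"
proof -
  have mem: "F j \<in> pre_H \<Gamma>" for j using F by (simp add: H_cauchy_def)
  obtain N where N: "\<And>i j. i \<ge> N \<Longrightarrow> j \<ge> N \<Longrightarrow> pre_H_norm \<Gamma> (\<lambda>x. F i x - F j x) < 1"
    using F zero_less_one unfolding H_cauchy_def by blast
  have tail: "pre_H_norm \<Gamma> (F j) \<le> pre_H_norm \<Gamma> (F N) + 1" if "j \<ge> N" for j
    using pre_H_norm_diff_le[OF mem[of j] mem[of N]] N[OF that order_refl] by linarith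
  define B where "B = Max (insert (pre_H_norm \<Gamma> (F N) + 1) ((\<lambda>j. pre_H_norm \<Gamma> (F j)) ` {..N}))"
  have "pre_H_norm \<Gamma> (F j) \<le> B" for j
  proof (cases "j \<ge> N")
    case True
    then show ?thesis using tail[OF True] unfolding B_def by (intro order.trans[OF tail[OF True]] Max_ge) auto
  next
    case False
    then show ?thesis unfolding B_def by (intro Max_ge) auto
  qed
  then show ?thesis by blast
qed

text \<open>A function that is Lipschitz on bounded sets maps Cauchy sequences, which are bounded,
  to Cauchy sequences and equivalent ones to the same limit. So the description in
  \<open>H_extend\<close> denotes a unique number.\<close>

lemma H_extend_tendsto:
  assumes f: "f \<in> H_space \<Gamma>" and F: "F \<in> f"
    and q: "\<And>B. \<exists>K. \<forall>g\<in>pre_H \<Gamma>. \<forall>h\<in>pre_H \<Gamma>. pre_H_norm \<Gamma> g \<le> B \<longrightarrow> pre_H_norm \<Gamma> h \<le> B \<longrightarrow>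
      \<bar>q g - q h\<bar> \<le> K * pre_H_norm \<Gamma> (\<lambda>x. g x - h x)"
  shows "(\<lambda>j. q (F j)) \<longlonglongrightarrow> H_extend q f"
proof -
  obtain F0 where F0: "F0 \<in> H_cauchy \<Gamma>" "f = H_rel \<Gamma> `` {F0}" using f by (auto simp: H_space_def elim: quotientE)
  have mem: "G j \<in> pre_H \<Gamma>" if "G \<in> H_cauchy \<Gamma>" for G j using that by (simp add: H_cauchy_def)
  obtain B0 where B0: "\<And>j. pre_H_norm \<Gamma> (F0 j) \<le> B0" using H_cauchy_bounded[OF F0(1)] by blast
  have "Cauchy (\<lambda>j. q (F0 j))"
  proof (rule metric_CauchyI)
    fix e :: real assume e: "e > 0"
    obtain K where K: "\<And>i j. \<bar>q (F0 i) - q (F0 j)\<bar> \<le> K * pre_H_norm \<Gamma> (\<lambda>x. F0 i x - F0 j x)"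
      using q[of B0] B0 mem[OF F0(1)] by blast
    \<comment> \<open>\<open>K\<close> may be zero or negative, hence \<bar>K\<bar> + 1.\<close>
    have e': "0 < e / (\<bar>K\<bar> + 1)" using e by simp
    obtain N where N: "\<And>i j. i \<ge> N \<Longrightarrow> j \<ge> N \<Longrightarrow> pre_H_norm \<Gamma> (\<lambda>x. F0 i x - F0 j x) < e / (\<bar>K\<bar> + 1)"
      using F0(1) e' unfolding H_cauchy_def by blast
    have "dist (q (F0 i)) (q (F0 j)) < e" if "i \<ge> N" "j \<ge> N" for i j
    proof -
      define a where "a = pre_H_norm \<Gamma> (\<lambda>x. F0 i x - F0 j x)"
      have a: "0 \<le> a" unfolding a_def by (rule pre_H_norm_nonneg[OF pre_H_diff[OF mem[OF F0(1)] mem[OF F0(1)]]])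
      have "\<bar>q (F0 i) - q (F0 j)\<bar> \<le> K * a" using K by (simp add: a_def)
      also have "\<dots> \<le> (\<bar>K\<bar> + 1) * a" using a by (intro mult_right_mono) auto
      also have "\<dots> < e" using N[OF that] by (simp add: a_def field_simps)
      finally show ?thesis by (simp add: dist_real_def)
    qed
    then show "\<exists>N. \<forall>i\<ge>N. \<forall>j\<ge>N. dist (q (F0 i)) (q (F0 j)) < e" by blast
  qed
  then obtain r where r: "(\<lambda>j. q (F0 j)) \<longlonglongrightarrow> r" using Cauchy_convergent_iff convergent_def by blast
  have lim: "(\<lambda>j. q (G j)) \<longlonglongrightarrow> r" if G: "G \<in> f" for G
  proof -
    have GH: "G \<in> H_cauchy \<Gamma>" and d: "(\<lambda>j. pre_H_norm \<Gamma> (\<lambda>x. F0 j x - G j x)) \<longlonglongrightarrow> 0"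
      using G F0(2) by (auto simp: H_rel_def)
    obtain B1 where B1: "\<And>j. pre_H_norm \<Gamma> (G j) \<le> B1" using H_cauchy_bounded[OF GH] by blast
    obtain K where K: "\<And>j. \<bar>q (F0 j) - q (G j)\<bar> \<le> K * pre_H_norm \<Gamma> (\<lambda>x. F0 j x - G j x)"
      using q[of "max B0 B1"] B0 B1 mem[OF F0(1)] mem[OF GH] by (meson max.coboundedI1 max.coboundedI2)
    have "(\<lambda>j. q (F0 j) - q (G j)) \<longlonglongrightarrow> 0"
    proof (rule Lim_null_comparison)
      show "(\<lambda>j. K * pre_H_norm \<Gamma> (\<lambda>x. F0 j x - G j x)) \<longlonglongrightarrow> 0" using tendsto_mult_left[OF d, of K] by simp
    qed (use K in simp)
    from tendsto_diff[OF r this] show ?thesis by simp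
  qed
  have "H_extend q f = r"
    unfolding H_extend_def
  proof (rule the_equality)
    show "\<forall>G\<in>f. (\<lambda>j. q (G j)) \<longlonglongrightarrow> r" using lim by blast
    show "r' = r" if "\<forall>G\<in>f. (\<lambda>j. q (G j)) \<longlonglongrightarrow> r'" for r'
      using that F lim[OF F] LIMSEQ_unique by blast
  qed
  then show ?thesis using lim[OF F] by simp
qed

lemma H_norm_tendsto:
  assumes "f \<in> H_space \<Gamma>" "F \<in> f"
  shows "(\<lambda>j. pre_H_norm \<Gamma> (F j)) \<longlonglongrightarrow> H_norm \<Gamma> f"
  unfolding H_norm_def
  by (rule H_extend_tendsto[OF assms]) (auto intro!: exI[of _ 1] pre_H_norm_diff_le)

end

context regular_tuples
begin

lemma H_tensor_inner_tendsto:
  assumes "f \<in> H_space \<Gamma>" "F \<in> f"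
  shows "(\<lambda>j. TF (\<lambda>_. F j)) \<longlonglongrightarrow> H_tensor_inner \<Gamma> n f \<nu>"
  unfolding H_tensor_inner_def tensor_form_eq_TF
proof (rule H_extend_tendsto[OF assms])
  fix B
  have C0: "0 \<le> C"
  proof -
    obtain m where "energy (eps m) \<le> C" using eventually_happens[OF energy_bound] by auto
    then show ?thesis using energy_nonneg[OF eps(1)] by (rule order.trans[rotated])
  qed
  show "\<exists>K. \<forall>g\<in>pre_H \<Gamma>. \<forall>h\<in>pre_H \<Gamma>. pre_H_norm \<Gamma> g \<le> B \<longrightarrow> pre_H_norm \<Gamma> h \<le> B \<longrightarrow>
      \<bar>TF (\<lambda>_. g) - TF (\<lambda>_. h)\<bar> \<le> K * pre_H_norm \<Gamma> (\<lambda>x. g x - h x)"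
  proof (intro exI ballI impI)
    fix g h assume g: "g \<in> pre_H \<Gamma>" "pre_H_norm \<Gamma> g \<le> B" and h: "h \<in> pre_H \<Gamma>" "pre_H_norm \<Gamma> h \<le> B"
    have d: "0 \<le> pre_H_norm \<Gamma> (\<lambda>x. g x - h x)" by (rule pre_H_norm_nonneg[OF pre_H_diff[OF g(1) h(1)]])
    have "(pre_H_norm \<Gamma> g + pre_H_norm \<Gamma> h) ^ (n - 1) \<le> (2 * B) ^ (n - 1)"
      using g h pre_H_norm_nonneg[OF g(1)] pre_H_norm_nonneg[OF h(1)] by (intro power_mono) auto
    then have "real n * (sqrt C * (pre_H_norm \<Gamma> (\<lambda>x. g x - h x) * (pre_H_norm \<Gamma> g + pre_H_norm \<Gamma> h) ^ (n - 1))) \<le>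
      real n * (sqrt C * (pre_H_norm \<Gamma> (\<lambda>x. g x - h x) * (2 * B) ^ (n - 1)))"
      using C0 d by (intro mult_left_mono) auto
    then show "\<bar>TF (\<lambda>_. g) - TF (\<lambda>_. h)\<bar> \<le> (real n * sqrt C * (2 * B) ^ (n - 1)) * pre_H_norm \<Gamma> (\<lambda>x. g x - h x)"
      using TF_diff_le[OF g(1) h(1)] by (simp add: mult_ac)
  qed
qed

end

text \<open>The measures g_n enter the final estimate only through \<open>regular_tuples\<close>;
  the radius and the energy bound may depend on n.\<close>

locale chaos_series = noise M \<Gamma> W
  for M :: "'w measure" and \<Gamma> :: "'a::euclidean_space measure" and W +
  fixes \<nu> :: "nat \<Rightarrow> (nat \<Rightarrow> 'a) measure" and R C :: "nat \<Rightarrow> real" and S :: "nat \<Rightarrow> 'w \<Rightarrow> real" and U :: "'w \<Rightarrow> real"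
  assumes tuples: "regular_tuples M \<Gamma> W n (\<nu> n) (R n) (C n)"
    and S_limit: "L2_limit M (noise_tuples.strat W n (\<nu> n)) (S n) (at_right 0)"
    and U_limit: "L2_limit M (\<lambda>N \<omega>. \<Sum>n<N. S n \<omega>) U sequentially"
begin

sublocale T: regular_tuples M \<Gamma> W n "\<nu> n" "R n" "C n" for n by (rule tuples)

lemma square_integrable_S: "square_integrable M (S n)"
  using S_limit[of n] by (simp add: L2_limit_def)

text \<open>The tilted lower bounds of the single terms are added and then compared with the norm of
  U by \<open>expectation_tilt_le_Lp_norm\<close>. The factor exp (v / 2) from Wick's formula
  cancels against the normalisation of the tilt.\<close>

lemma sum_TF_smooth_le:
  assumes h: "exp_decay h" "\<And>x. 0 \<le> h x" and \<delta>: "0 < \<delta>" "\<delta> \<le> 1" and p: "p > 1"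
    and L: "Lp_norm M p U \<le> ennreal L" "0 \<le> L"
  shows "(\<Sum>n<N. T.TF n (\<lambda>_. smooth \<delta> h)) \<le> exp (cov_form \<Gamma> (smooth \<delta> h) (smooth \<delta> h) / (2 * (p - 1))) * L"
proof -
  interpret V: gaussian_space M "L2_closure M gspan"
    by (rule gaussian_space.gaussian_space_L2_closure[OF gaussian_space_gspan])
  define Y where "Y = fld \<delta> h"
  define v where "v = expectation (\<lambda>\<omega>. (Y \<omega>)\<^sup>2)"
  have Y: "Y \<in> L2_closure M gspan" unfolding Y_def by (intro fld_in_L2_closure \<delta> exp_decay_integrable h)
  note eY = V.square_integrable_exp_V[OF Y]
  have U: "square_integrable M U" using U_limit by (simp add: L2_limit_def)
  define a where "a n = T.TF n (\<lambda>_. smooth \<delta> h)" for n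
  have a0: "0 \<le> a n" for n unfolding a_def by (rule T.TF_nonneg) (rule smooth_nonneg[OF h(2)])
  have "exp (v / 2) * (\<Sum>n<N. a n) \<le> expectation (\<lambda>\<omega>. exp (Y \<omega>) * U \<omega>)"
  \<comment> \<open>As the pairings are non-negative, the first \<open>N\<close> of them bound every
    longer partial sum from below, and hence the limit.\<close>
  proof (rule LIMSEQ_le_const[OF expectation_mult_tendsto[OF eY U_limit]], intro exI[of _ N] allI impI)
    fix N' assume "N \<le> N'"
    then have "exp (v / 2) * (\<Sum>n<N. a n) \<le> exp (v / 2) * (\<Sum>n<N'. a n)"
      using a0 by (intro mult_left_mono sum_mono2) auto
    also have "\<dots> \<le> (\<Sum>n<N'. expectation (\<lambda>\<omega>. exp (Y \<omega>) * S n \<omega>))"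
      unfolding sum_distrib_left a_def v_def Y_def
      by (intro sum_mono T.expectation_exp_limit_ge h \<delta> S_limit)
    also have "\<dots> = expectation (\<lambda>\<omega>. exp (Y \<omega>) * (\<Sum>n<N'. S n \<omega>))"
      using square_integrable_mult[OF eY square_integrable_S] by (simp add: sum_distrib_left)
    finally show "exp (v / 2) * (\<Sum>n<N. a n) \<le> expectation (\<lambda>\<omega>. exp (Y \<omega>) * (\<Sum>n<N'. S n \<omega>))" .
  qed
  then have "exp (- v / 2) * (exp (v / 2) * (\<Sum>n<N. a n)) \<le> exp (- v / 2) * expectation (\<lambda>\<omega>. exp (Y \<omega>) * U \<omega>)"
    by (intro mult_left_mono) auto
  then have "(\<Sum>n<N. a n) \<le> exp (- v / 2) * expectation (\<lambda>\<omega>. exp (Y \<omega>) * U \<omega>)"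
    by (simp add: mult.assoc[symmetric] exp_add[symmetric])
  then have "ennreal (\<Sum>n<N. a n) \<le> ennreal (exp (v / (2 * (p - 1)))) * Lp_norm M p U"
    using V.expectation_tilt_le_Lp_norm[OF Y U p] unfolding v_def by (meson ennreal_leI order.trans)
  also have "\<dots> \<le> ennreal (exp (v / (2 * (p - 1)))) * ennreal L" by (intro mult_left_mono L) simp
  also have "\<dots> = ennreal (exp (v / (2 * (p - 1))) * L)" using L(2) by (simp add: ennreal_mult)
  finally have "(\<Sum>n<N. a n) \<le> exp (v / (2 * (p - 1))) * L" using L(2) by (simp add: ennreal_le_iff)
  moreover have "v = cov_form \<Gamma> (smooth \<delta> h) (smooth \<delta> h)"
    unfolding v_def Y_def using expectation_fld_fld[OF \<delta> \<delta> h(1) h(1)] by (simp add: power2_eq_square)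
  ultimately show ?thesis by (simp add: a_def)
qed

text \<open>The smoothing is removed at a fixed number of terms, where both sides converge; the same
  scheme then removes the truncation and passes to the completion.\<close>

lemma sum_TF_decay_le:
  assumes h: "exp_decay h" "\<And>x. 0 \<le> h x" and p: "p > 1" and L: "Lp_norm M p U \<le> ennreal L" "0 \<le> L"
  shows "(\<Sum>n<N. T.TF n (\<lambda>_. h)) \<le> exp (cov_form \<Gamma> h h / (2 * (p - 1))) * L"
proof -
  obtain r where r: "strict_mono r" "AE x in lborel. (\<lambda>m. smooth (eps (r m)) h x) \<longlonglongrightarrow> h x"
    using smooth_AE_subseq[OF exp_decay_integrable[OF h(1)], of eps] eps by blast
  note hm = exp_decay_measurable[OF h(1)]
  obtain D where D: "\<And>x. \<bar>h x\<bar> \<le> D * exp (- norm x)" using exp_decay_bound[OF h(1)] by blast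
  have sm: "\<bar>smooth (eps (r m)) h x\<bar> \<le> D * 6 ^ DIM('a) * exp (- norm x)" for m x
    by (intro smooth_le_exp_norm eps D hm)
  have TF: "(\<lambda>m. T.TF n (\<lambda>_. smooth (eps (r m)) h)) \<longlonglongrightarrow> T.TF n (\<lambda>_. h)" for n
    by (rule T.TF_tendsto[where D = "\<lambda>_. D * 6 ^ DIM('a)"]) (intro borel_measurable_smooth hm sm r(2))+
  have cov: "(\<lambda>m. cov_form \<Gamma> (smooth (eps (r m)) h) (smooth (eps (r m)) h)) \<longlonglongrightarrow> cov_form \<Gamma> h h"
    by (rule cov_form_tendsto[where C = "D * 6 ^ DIM('a)" and D = "D * 6 ^ DIM('a)"]) (intro borel_measurable_smooth hm sm r(2))+
  show ?thesis
  proof (rule LIMSEQ_le)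
    show "(\<lambda>m. \<Sum>n<N. T.TF n (\<lambda>_. smooth (eps (r m)) h)) \<longlonglongrightarrow> (\<Sum>n<N. T.TF n (\<lambda>_. h))" by (intro tendsto_sum TF)
    show "(\<lambda>m. exp (cov_form \<Gamma> (smooth (eps (r m)) h) (smooth (eps (r m)) h) / (2 * (p - 1))) * L) \<longlonglongrightarrow> exp (cov_form \<Gamma> h h / (2 * (p - 1))) * L"
      using p by (intro tendsto_intros cov) auto
    show "\<exists>k. \<forall>m\<ge>k. (\<Sum>n<N. T.TF n (\<lambda>_. smooth (eps (r m)) h)) \<le> exp (cov_form \<Gamma> (smooth (eps (r m)) h) (smooth (eps (r m)) h) / (2 * (p - 1))) * L"
      by (intro exI[of _ 0] allI impI sum_TF_smooth_le h eps p L)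
  qed
qed

lemma sum_TF_le:
  assumes h: "h \<in> pre_H \<Gamma>" "\<And>x. 0 \<le> h x" and p: "p > 1" and L: "Lp_norm M p U \<le> ennreal L" "0 \<le> L"
  shows "(\<Sum>n<N. T.TF n (\<lambda>_. h)) \<le> exp ((pre_H_norm \<Gamma> h)\<^sup>2 / (2 * (p - 1))) * L"
  unfolding pre_H_norm_square[OF h(1)]
proof (rule LIMSEQ_le)
  show "(\<lambda>m. \<Sum>n<N. T.TF n (\<lambda>_. trunc m h)) \<longlonglongrightarrow> (\<Sum>n<N. T.TF n (\<lambda>_. h))" by (intro tendsto_sum T.TF_trunc_tendsto h)
  show "(\<lambda>m. exp (cov_form \<Gamma> (trunc m h) (trunc m h) / (2 * (p - 1))) * L) \<longlonglongrightarrow> exp (cov_form \<Gamma> h h / (2 * (p - 1))) * L"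
    using p by (intro tendsto_intros cov_form_trunc_tendsto h) auto
  show "\<exists>k. \<forall>m\<ge>k. (\<Sum>n<N. T.TF n (\<lambda>_. trunc m h)) \<le> exp (cov_form \<Gamma> (trunc m h) (trunc m h) / (2 * (p - 1))) * L"
    by (intro exI[of _ 0] allI impI sum_TF_decay_le exp_decay_trunc pre_H_measurable h trunc_nonneg p L)
qed

context
  fixes f :: "(nat \<Rightarrow> 'a \<Rightarrow> real) set"
  assumes f: "f \<in> H_space \<Gamma>" "H_nonneg f"
begin

lemma H_tensor_inner_nonneg: "0 \<le> H_tensor_inner \<Gamma> n f (\<nu> n)"
proof -
  obtain F where F: "F \<in> f" "\<And>j x. 0 \<le> F j x" using f(2) by (auto simp: H_nonneg_def)
  show ?thesis
    by (rule LIMSEQ_le_const[OF T.H_tensor_inner_tendsto[OF f(1) F(1)]]) (auto intro: T.TF_nonneg F(2))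
qed

lemma sum_H_tensor_inner_le:
  assumes p: "p > 1" and L: "Lp_norm M p U \<le> ennreal L" "0 \<le> L"
  shows "(\<Sum>n<N. H_tensor_inner \<Gamma> n f (\<nu> n)) \<le> exp ((H_norm \<Gamma> f)\<^sup>2 / (2 * (p - 1))) * L"
proof -
  obtain F where F: "F \<in> f" "\<And>j x. 0 \<le> F j x" using f(2) by (auto simp: H_nonneg_def)
  have mem: "F j \<in> pre_H \<Gamma>" for j
    using f(1) F(1) by (auto simp: H_space_def H_rel_def H_cauchy_def elim!: quotientE)
  show ?thesis
  proof (rule LIMSEQ_le)
    show "(\<lambda>j. \<Sum>n<N. T.TF n (\<lambda>_. F j)) \<longlonglongrightarrow> (\<Sum>n<N. H_tensor_inner \<Gamma> n f (\<nu> n))"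
      by (intro tendsto_sum T.H_tensor_inner_tendsto f F)
    show "(\<lambda>j. exp ((pre_H_norm \<Gamma> (F j))\<^sup>2 / (2 * (p - 1))) * L) \<longlonglongrightarrow> exp ((H_norm \<Gamma> f)\<^sup>2 / (2 * (p - 1))) * L"
      using p by (intro tendsto_intros H_norm_tendsto f F) auto
    show "\<exists>k. \<forall>j\<ge>k. (\<Sum>n<N. T.TF n (\<lambda>_. F j)) \<le> exp ((pre_H_norm \<Gamma> (F j))\<^sup>2 / (2 * (p - 1))) * L"
      by (intro exI[of _ 0] allI impI sum_TF_le mem F p L)
  qed
qed

text \<open>The bound on partial sums is used at the exponent 2, for which the norm of U is finite;
  at the exponent of the theorem it may be infinite.\<close>

lemma summable_H_tensor_inner: "summable (\<lambda>n. H_tensor_inner \<Gamma> n f (\<nu> n))"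
proof -
  have "square_integrable M U" using U_limit by (simp add: L2_limit_def)
  then have "(\<integral>\<^sup>+\<omega>. ennreal (\<bar>U \<omega>\<bar> powr 2) \<partial>M) \<noteq> \<infinity>"
    by (simp add: square_integrable_def nn_integral_eq_integral)
  then obtain L where L: "Lp_norm M 2 U \<le> ennreal L" "0 \<le> L"
    using that[of "enn2real (\<integral>\<^sup>+\<omega>. ennreal (\<bar>U \<omega>\<bar> powr 2) \<partial>M) powr (1 / 2)"] by (simp add: Lp_norm_def)
  show ?thesis
    by (rule summableI_nonneg_bounded[OF H_tensor_inner_nonneg sum_H_tensor_inner_le[OF _ L]]) simp
qed

lemma suminf_H_tensor_inner_le:
  assumes p: "p > 1"
  shows "ennreal (exp (- (1 / (2 * (p - 1))) * (H_norm \<Gamma> f)\<^sup>2) * (\<Sum>n. H_tensor_inner \<Gamma> n f (\<nu> n))) \<le> Lp_norm M p U"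
proof (cases "Lp_norm M p U")
  case (real L)
  have "(\<Sum>n. H_tensor_inner \<Gamma> n f (\<nu> n)) \<le> exp ((H_norm \<Gamma> f)\<^sup>2 / (2 * (p - 1))) * L"
    using real by (intro suminf_le_const summable_H_tensor_inner sum_H_tensor_inner_le p) auto
  then have "exp (- (1 / (2 * (p - 1))) * (H_norm \<Gamma> f)\<^sup>2) * (\<Sum>n. H_tensor_inner \<Gamma> n f (\<nu> n)) \<le>
    exp (- (1 / (2 * (p - 1))) * (H_norm \<Gamma> f)\<^sup>2) * (exp ((H_norm \<Gamma> f)\<^sup>2 / (2 * (p - 1))) * L)"
    by (intro mult_left_mono) auto
  also have "\<dots> = L" by (simp add: mult.assoc[symmetric] exp_add[symmetric])
  finally show ?thesis using real by (simp add: ennreal_leI)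
qed simp

end

end

theorem lemma5p4:
  fixes M :: "'w measure"
    and \<Gamma> \<mu> :: "'a::euclidean_space measure"
    and W :: "('a \<Rightarrow> real) \<Rightarrow> 'w \<Rightarrow> real"
    and u :: "real \<Rightarrow> 'a \<Rightarrow> 'w \<Rightarrow> real"
    and f :: "(nat \<Rightarrow> 'a \<Rightarrow> real) set"
    and \<alpha> t p :: real
  assumes "DIM('a) \<in> {1, 2, 3}"
    and "covariance_measure \<Gamma> \<mu>"
    and "homogeneous_covariance \<alpha> \<Gamma>"
    and "(0 < \<alpha> \<and> \<alpha> < min 2 (real DIM('a))) \<or> (\<alpha> = 1 \<and> DIM('a) = 1)"
    and "gaussian_noise M \<Gamma> W"
    and "stratonovich_solution M W u"
    and "p > 1" and "t > 0"
    and "f \<in> H_space \<Gamma>" and "H_nonneg f"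
  shows "summable (\<lambda>n. H_tensor_inner \<Gamma> n f (wave_g n t 0)) \<and>
    ennreal (exp (- (1 / (2 * (p - 1))) * (H_norm \<Gamma> f)\<^sup>2) *
        (\<Sum>n. H_tensor_inner \<Gamma> n f (wave_g n t 0)))
      \<le> Lp_norm M p (u t 0)"
proof -
  note d = assms(1)
  interpret noise M \<Gamma> W
    using assms(2,5) by (simp add: noise_def covariance_measure_def)
  obtain S' where S': "\<forall>t\<ge>0. \<forall>x. (\<forall>n. L2_limit M (strat_approx W n t x) (S' n t x) (at_right 0)) \<and>
      L2_limit M (\<lambda>N \<omega>. \<Sum>n<N. S' n t x \<omega>) (u t x) sequentially"
    using assms(6) unfolding stratonovich_solution_def by (rule exE)
  define S where "S n = S' n t 0" for n
  have S: "\<And>n. L2_limit M (strat_approx W n t 0) (S n) (at_right 0)"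
    "L2_limit M (\<lambda>N \<omega>. \<Sum>n<N. S n \<omega>) (u t 0) sequentially"
    using S'[rule_format, OF less_imp_le[OF assms(8)], of 0] unfolding S_def by simp_all
  have nt: "noise_tuples M \<Gamma> W n (wave_g n t 0)" for n
    by (rule noise_tuples.intro[OF noise_axioms noise_tuples_axioms.intro[OF sets_wave_g finite_measure_wave_g[OF d]]])
  have strat: "noise_tuples.strat W n (wave_g n t 0) = strat_approx W n t 0" for n
    by (intro ext) (simp add: noise_tuples.strat_def[OF nt] strat_approx_def)
  have rt: "regular_tuples M \<Gamma> W n (wave_g n t 0) (norm (0::'a) + real n * \<bar>t\<bar>) (2 + 2 * expectation (\<lambda>\<omega>. (S n \<omega>)\<^sup>2))" for n
  proof (rule regular_tuples.intro[OF nt regular_tuples_axioms.intro])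
    show "AE y in wave_g n t (0::'a). \<forall>k\<in>{1..n}. norm (y k) \<le> norm (0::'a) + real n * \<bar>t\<bar>" by (rule wave_g_bounded[OF d])
    show "\<And>k N. k \<in> {1..n} \<Longrightarrow> N \<in> null_sets lborel \<Longrightarrow> AE y in wave_g n t (0::'a). y k \<notin> N" by (rule wave_g_null[OF d])
    show "\<forall>\<^sub>F m in sequentially. noise_tuples.energy M W n (wave_g n t 0) (eps m) \<le> 2 + 2 * expectation (\<lambda>\<omega>. (S n \<omega>)\<^sup>2)"
      by (rule noise_tuples.eventually_energy_le[OF nt]) (simp add: strat S)
  qed
  have "chaos_series M \<Gamma> W (\<lambda>n. wave_g n t 0) (\<lambda>n. norm (0::'a) + real n * \<bar>t\<bar>) (\<lambda>n. 2 + 2 * expectation (\<lambda>\<omega>. (S n \<omega>)\<^sup>2)) S (u t 0)"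
    by (rule chaos_series.intro[OF noise_axioms chaos_series_axioms.intro]) (simp_all only: rt strat S)
  then interpret chaos_series M \<Gamma> W "\<lambda>n. wave_g n t 0" "\<lambda>n. norm (0::'a) + real n * \<bar>t\<bar>" "\<lambda>n. 2 + 2 * expectation (\<lambda>\<omega>. (S n \<omega>)\<^sup>2)" S "u t 0" .
  show ?thesis
    using summable_H_tensor_inner[OF assms(9,10)] suminf_H_tensor_inner_le[OF assms(9,10,7)] by blast
qed

end
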